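(* Fix $c_1,c_2\in\mathbb{R}$, let $W(x)=c_1\tanh(x)+c_2$, and fix an integer $s\ge 3$. The Korteweg--de Vries equation $\frac{d}{dt}u=-u'''+6uu'$ on $\mathbb{R}$ with initial data $u(0)\in W+H^s(\mathbb{R})$ is globally well-posed in the following sense: $u(t)=W+q(t)$, where $q(t)$ is the global solution to $$\frac{d}{dt}q=-(q+W)'''+6(q+W)(q+W)'$$ with initial data $q(0)=u(0)-W$ in $H^s(\mathbb{R})$. Moreover, for every $T>0$: $q\in C([-T,T];H^s(\mathbb{R}))$, $q$ is the unique solution in this class, and $q$ depends continuously on the initial data, i.e. the map $q(0)\mapsto q$ is continuous from $H^s(\mathbb{R})$ to $C([-T,T];H^s(\mathbb{R}))$.
   Context: All functions are real-valued; primes denote spatial derivatives $\partial_x$. $H^s(\mathbb{R})$ is the usual $L^2$-based Sobolev space, and $C([-T,T];H^s)$ carries the norm $\sup_{|t|\le T}\|q(t)\|_{H^s}$. For $q\in C([-T,T];H^s)$ with $s\ge3$, the right-hand side of the equation for $q$ lies in $C([-T,T];H^{s-3})$ and the equation is understood as an identity in $H^{s-3}(\mathbb{R})$. *)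

theory Defs
  imports "HOL-Analysis.Analysis"
begin

text \<open>
  Elements of \<open>L\<^sup>2\<close> and of the Sobolev spaces \<open>H\<^sup>s\<close> are represented by Borel measurable functions
  on the real line; two functions represent the same element iff they agree almost everywhere.
\<close>

definition square_int :: "(real \<Rightarrow> real) \<Rightarrow> bool" where
  "square_int f \<longleftrightarrow> f \<in> borel_measurable lborel \<and> integrable lborel (\<lambda>x. (f x)\<^sup>2)"

definition locally_int :: "(real \<Rightarrow> real) \<Rightarrow> bool" where
  "locally_int f \<longleftrightarrow> (\<forall>K. compact K \<longrightarrow> set_integrable lborel K f)"

definition test_fun :: "(real \<Rightarrow> real) \<Rightarrow> bool" where
  "test_fun \<phi> \<longleftrightarrow> (\<forall>k. (deriv ^^ k) \<phi> differentiable_on UNIV) \<and> compact (closure {x. \<phi> x \<noteq> 0})"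

definition weak_deriv :: "nat \<Rightarrow> (real \<Rightarrow> real) \<Rightarrow> (real \<Rightarrow> real) \<Rightarrow> bool" where
  "weak_deriv k f g \<longleftrightarrow> locally_int f \<and> locally_int g \<and>
     (\<forall>\<phi>. test_fun \<phi> \<longrightarrow>
        (LINT x|lborel. f x * (deriv ^^ k) \<phi> x) = (-1) ^ k * (LINT x|lborel. g x * \<phi> x))"

text \<open>
  A choice of the weak derivative (unique up to null sets); it is meaningful only if the
  \<open>k\<close>-th weak derivative exists.
\<close>

definition wderiv :: "nat \<Rightarrow> (real \<Rightarrow> real) \<Rightarrow> real \<Rightarrow> real" where
  "wderiv k f = (SOME g. weak_deriv k f g)"

definition sobolev :: "nat \<Rightarrow> (real \<Rightarrow> real) set" where
  "sobolev s = {f. square_int f \<and> (\<forall>k\<le>s. \<exists>g. weak_deriv k f g \<and> square_int g)}"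

definition sobolev_norm :: "nat \<Rightarrow> (real \<Rightarrow> real) \<Rightarrow> real" where
  "sobolev_norm s f = sqrt (\<Sum>k\<le>s. LINT x|lborel. (wderiv k f x)\<^sup>2)"

text \<open>
  Curves are functions of time \<open>t\<close> first and space \<open>x\<close> second. The space \<open>C([-T,T]; H\<^sup>s)\<close> consists
  of those curves whose restriction to \<open>[-T,T]\<close> is continuous into \<open>H\<^sup>s\<close>; values at other times
  are irrelevant.
\<close>

definition C_sobolev :: "real \<Rightarrow> nat \<Rightarrow> (real \<Rightarrow> real \<Rightarrow> real) set" where
  "C_sobolev T s = {q. (\<forall>t\<in>{-T..T}. q t \<in> sobolev s) \<and>
     (\<forall>t\<in>{-T..T}.
        ((\<lambda>\<tau>. sobolev_norm s (\<lambda>x. q \<tau> x - q t x)) \<longlongrightarrow> 0) (at t within {-T..T}))}"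

definition C_sobolev_norm :: "real \<Rightarrow> nat \<Rightarrow> (real \<Rightarrow> real \<Rightarrow> real) \<Rightarrow> real" where
  "C_sobolev_norm T s q = (SUP t\<in>{-T..T}. sobolev_norm s (q t))"

text \<open>
  The time derivative of \<open>u\<close> at \<open>t\<close>, relative to the time set \<open>J\<close>, as a limit of difference
  quotients in \<open>H\<^sup>r\<close>. Only increments of \<open>u\<close> need to lie in \<open>H\<^sup>r\<close>, so the notion also applies to
  curves in an affine space \<open>W + H\<^sup>r\<close>.
\<close>

definition has_time_deriv ::
    "nat \<Rightarrow> (real \<Rightarrow> real \<Rightarrow> real) \<Rightarrow> (real \<Rightarrow> real) \<Rightarrow> real \<Rightarrow> real set \<Rightarrow> bool" where
  "has_time_deriv r u v t J \<longleftrightarrow>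
     v \<in> sobolev r \<and> (\<forall>\<tau>\<in>J. (\<lambda>x. u \<tau> x - u t x) \<in> sobolev r) \<and>
     ((\<lambda>\<tau>. sobolev_norm r (\<lambda>x. (u \<tau> x - u t x) / (\<tau> - t) - v x)) \<longlongrightarrow> 0) (at t within J)"

definition kdv_rhs :: "(real \<Rightarrow> real) \<Rightarrow> real \<Rightarrow> real" where
  "kdv_rhs u = (\<lambda>x. - wderiv 3 u x + 6 * u x * wderiv 1 u x)"

definition solves_kdv :: "nat \<Rightarrow> real set \<Rightarrow> (real \<Rightarrow> real \<Rightarrow> real) \<Rightarrow> bool" where
  "solves_kdv s J u \<longleftrightarrow> (\<forall>t\<in>J. has_time_deriv (s - 3) u (kdv_rhs (u t)) t J)"

definition solves_perturbed_kdv ::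
    "(real \<Rightarrow> real) \<Rightarrow> nat \<Rightarrow> real set \<Rightarrow> (real \<Rightarrow> real \<Rightarrow> real) \<Rightarrow> bool" where
  "solves_perturbed_kdv W s J q \<longleftrightarrow>
     (\<forall>t\<in>J. has_time_deriv (s - 3) q (kdv_rhs (\<lambda>x. q t x + W x)) t J)"

end

theory Submission
  imports Defs "HOL-Computational_Algebra.Polynomial"
begin

text \<open>
  The equation for \<open>q\<close> reads \<open>q' = F q\<close> with \<open>F q = D (- D\<^sup>2 q + 6 W q + 3 q\<^sup>2) + h\<close>, and only the skewness of \<open>D\<close>, the
  Leibniz rule, \<open>\<parallel>q\<parallel>\<^sub>\<infinity>\<^sup>2 \<le> 2 \<parallel>q\<parallel> \<parallel>D q\<parallel>\<close> and the smooth bounded multipliers \<open>W\<^sup>(\<^sup>k\<^sup>)\<close> matter; so the analysis takes place in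
  an abstract Hilbert space, where the resolvent \<open>(1 - r\<^sup>2 D\<^sup>2)\<^sup>-\<^sup>1\<close> serves as a smoothing operator \<open>K\<close>. The regularised
  equation \<open>u' = J F (J u)\<close>, \<open>J = K\<^sup>n\<close>, is an ordinary differential equation. The perturbed conservation laws for mass,
  energy and the third KdV invariant give bounds in \<open>L\<^sup>2\<close>, \<open>H\<^sup>1\<close> and \<open>H\<^sup>2\<close> on any time interval, uniformly in the
  regularisation; in \<open>H\<^sup>k\<close>, \<open>k \<ge> 3\<close>, the energy estimate is then linear. Passing to the limit solves the equation for
  smooth data, and the Bona--Smith argument extends the flow continuously to \<open>H\<^sup>s\<close>. Finally \<open>L\<^sup>2(\<real>)\<close> with the weak
  derivative is an instance, by the calculus of absolutely continuous functions and the lemma of du Bois-Reymond.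
\<close>

text \<open>\<open>F\<close> loses three derivatives, so a direct Picard iteration in
  \<open>H k\<close> fails and every bound must come from a cancellation that survives the
  regularisation. Hence the form J F(J u) with J self-adjoint and commuting with D: one J moves to
  the other factor, and each energy identity becomes that of the original equation at J u. For
  \<open>E1\<close> the drift from D X even vanishes exactly, since J X is orthogonal to D (J X).
  \<open>E2\<close> is not compatible with J; there J J F is F plus an error that is small for fine
  smoothing. That error depends on the cutoff level A while the a priori constant must not, so the
  constant is chosen before A and the smoothing scale after it. Finally A is taken to be the a
  priori bound itself, and the cutoff equals 1 along the solution. The \<open>H 2\<close> bound
  starts the induction: the estimate of order k is linear once order k - 1 is bounded, and the
  commutator estimates begin at k = 3. Smooth data lie in \<open>H (s + 4)\<close>: three orders go
  to \<open>F\<close>, one more buys strong convergence by interpolation.\<close>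

lemma gronwall_two_sided:
  fixes y :: "real => real"
  assumes der: "\<And>t. t \<in> {-T..T} ==> (y has_real_derivative y' t) (at t within {-T..T})"
    and bd: "\<And>t. t \<in> {-T..T} ==> \<bar>y' t\<bar> \<le> a * y t"
    and t: "t \<in> {-T..T}"
  shows "y t \<le> y 0 * exp (a * \<bar>t\<bar>)"
proof -
  have cont: "continuous_on {-T..T} y"
    using der by (meson DERIV_continuous_on)
  have int: "(y has_real_derivative y' x) (at x)" if "-T < x" "x < T" for x
    using der[of x] that by (simp add: at_within_Icc_at)
  show ?thesis
  proof (cases "t \<ge> 0")
    case True
    have "y t * exp (- a * t) \<le> y 0 * exp (- a * 0)"
    proof (rule DERIV_nonpos_imp_decreasing_open[OF True, where f = "\<lambda>s. y s * exp (- a * s)"])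
      show "continuous_on {0..t} (\<lambda>s. y s * exp (- a * s))"
        using t by (intro continuous_intros continuous_on_subset[OF cont]) auto
      fix x assume x: "0 < x" "x < t"
      have "((\<lambda>s. y s * exp (- a * s)) has_real_derivative (y' x - a * y x) * exp (- a * x)) (at x)"
        using x t by (auto intro!: derivative_eq_intros int simp: algebra_simps)
      moreover have "(y' x - a * y x) * exp (- a * x) \<le> 0"
        using bd[of x] x t by (intro mult_nonpos_nonneg) auto
      ultimately show "\<exists>z. ((\<lambda>s. y s * exp (- a * s)) has_real_derivative z) (at x) \<and> z \<le> 0" by blast
    qed
    then show ?thesis using True by (simp add: exp_minus field_simps)
  next
    case False
    then have F: "t \<le> 0" by simp
    have "y t * exp (a * t) \<le> y 0 * exp (a * 0)"
    proof (rule DERIV_nonneg_imp_increasing_open[OF F, where f = "\<lambda>s. y s * exp (a * s)"])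
      show "continuous_on {t..0} (\<lambda>s. y s * exp (a * s))"
        using t by (intro continuous_intros continuous_on_subset[OF cont]) auto
      fix x assume x: "t < x" "x < 0"
      have "((\<lambda>s. y s * exp (a * s)) has_real_derivative (y' x + a * y x) * exp (a * x)) (at x)"
        using x t by (auto intro!: derivative_eq_intros int simp: algebra_simps)
      moreover have "(y' x + a * y x) * exp (a * x) \<ge> 0"
        using bd[of x] x t by (intro mult_nonneg_nonneg) auto
      ultimately show "\<exists>z. ((\<lambda>s. y s * exp (a * s)) has_real_derivative z) (at x) \<and> z \<ge> 0" by blast
    qed
    then show ?thesis using False by (simp add: exp_minus field_simps)
  qed
qed

text \<open>The point of S nearest to x exists because a minimising sequence is Cauchy by the
  parallelogram identity; x minus that point is orthogonal to S, hence 0. Applied later to the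
  density of the domain and to the range of the resolvent equation.\<close>

lemma closed_subspace_eq_UNIV:
  fixes S :: "'a::{real_inner, complete_space} set"
  assumes sub: "subspace S" and cl: "closed S"
    and orth: "\<And>g. (\<And>f. f \<in> S ==> inner f g = 0) ==> g = 0"
  shows "S = UNIV"
proof -
  have "x \<in> S" for x
  proof -
    define A where "A = (\<lambda>s. (norm (x - s))\<^sup>2) ` S"
    define d where "d = Inf A"
    have ne: "A \<noteq> {}" using subspace_0[OF sub] by (auto simp: A_def)
    have dle: "d \<le> (norm (x - s))\<^sup>2" if "s \<in> S" for s
      unfolding d_def by (rule cInf_lower) (use that in \<open>auto simp: A_def intro!: bdd_belowI[of _ 0]\<close>)
    have "\<exists>s. s \<in> S \<and> (norm (x - s))\<^sup>2 < d + inverse (Suc n)" for n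
      using cInf_lessD[OF ne, of "d + inverse (Suc n)"] by (auto simp: d_def A_def)
    then obtain s where s: "\<And>n. s n \<in> S" "\<And>n. (norm (x - s n))\<^sup>2 < d + inverse (Suc n)" by metis
    \<comment> \<open>Parallelogram identity: the midpoint of \<open>s m\<close> and
      \<open>s n\<close> lies in S, so its squared distance to x is at least d.\<close>
    have half: "(norm (s m - s n))\<^sup>2 \<le> 4 * inverse (Suc k)" if "k \<le> m" "k \<le> n" for k m n
    proof -
      have "(norm (s m - s n))\<^sup>2 = 2 * (norm (x - s m))\<^sup>2 + 2 * (norm (x - s n))\<^sup>2
          - 4 * (norm (x - (1/2) *\<^sub>R (s m + s n)))\<^sup>2"
        by (simp add: power2_norm_eq_inner algebra_simps inner_commute)
      moreover have "d \<le> (norm (x - (1/2) *\<^sub>R (s m + s n)))\<^sup>2"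
        by (rule dle) (simp add: sub s subspace_add subspace_scale)
      moreover have "(norm (x - s i))\<^sup>2 < d + inverse (Suc k)" if "k \<le> i" for i
      proof -
        have "inverse (real (Suc i)) \<le> inverse (real (Suc k))" using that by (intro le_imp_inverse_le) auto
        then show ?thesis using s(2)[of i] by linarith
      qed
      note this[OF that(1)] this[OF that(2)]
      ultimately show ?thesis by linarith
    qed
    have "Cauchy s"
      unfolding Cauchy_def
    proof (intro allI impI)
      fix e :: real assume e: "e > 0"
      then have "0 < (e / 2)\<^sup>2" by simp
      then obtain k where k: "inverse (Suc k) < (e / 2)\<^sup>2" using reals_Archimedean by blast
      have "dist (s m) (s n) < e" if "m \<ge> k" "n \<ge> k" for m n
      proof (rule power2_less_imp_less)
        show "(dist (s m) (s n))\<^sup>2 < e\<^sup>2" using half[OF that] k by (simp add: dist_norm power_divide)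
      qed (use e in simp)
      then show "\<exists>M. \<forall>m\<ge>M. \<forall>n\<ge>M. dist (s m) (s n) < e" by blast
    qed
    then obtain p where p: "s \<longlonglongrightarrow> p" using Cauchy_convergent convergent_def by blast
    have pS: "p \<in> S" using closed_sequentially[OF cl] s(1) p by blast
    have "(norm (x - p))\<^sup>2 \<le> d"
    proof (rule tendsto_le)
      show "(\<lambda>n. d + inverse (Suc n)) \<longlonglongrightarrow> d"
        using tendsto_add[OF tendsto_const LIMSEQ_inverse_real_of_nat, of d] by simp
      show "(\<lambda>n. (norm (x - s n))\<^sup>2) \<longlonglongrightarrow> (norm (x - p))\<^sup>2" by (intro tendsto_intros p)
    qed (use s(2) in \<open>auto intro!: always_eventually less_imp_le\<close>)
    then have min: "(norm (x - p))\<^sup>2 \<le> (norm (x - f))\<^sup>2" if "f \<in> S" for f using dle[OF that] by linarith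
    have "inner f (x - p) = 0" if f: "f \<in> S" for f
    proof (cases "f = 0")
      case False
      \<comment> \<open>c minimises the distance from x to p + c f along the line; minimality of p
        forces the resulting gain to vanish.\<close>
      define c where "c = inner f (x - p) / (norm f)^2"
      have "p + c *\<^sub>R f \<in> S" using sub f pS by (simp add: subspace_add subspace_scale)
      then have "(norm (x - p))\<^sup>2 \<le> norm (x - p - c *\<^sub>R f)^2"
        using min by (simp add: diff_diff_eq)
      also have "\<dots> = norm (x - p)^2 - 2 * c * inner f (x - p) + c^2 * (norm f)^2"
        unfolding power2_norm_eq_inner by (simp add: algebra_simps inner_commute power2_eq_square)
      also have "\<dots> = norm (x - p)^2 - (inner f (x - p))^2 / (norm f)^2"
        using False by (simp add: c_def field_simps power2_eq_square)
      finally have "(inner f (x - p))^2 / (norm f)^2 \<le> 0" by simp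
      then show ?thesis using False by (simp add: divide_le_0_iff)
    qed auto
    then have "x - p = 0" by (rule orth)
    then show ?thesis using pS by simp
  qed
  then show ?thesis by auto
qed

text \<open>Serves both limit passages, from regularised to smooth solutions and from smooth to
  general data. The pointwise limits are known beforehand and identify the limit that the derivative
  theorem produces.\<close>

lemma has_vector_derivative_uniform_limit:
  fixes y :: "nat => real => 'b::banach"
  assumes S: "convex S" "x \<in> S"
    and d: "\<And>i x. x \<in> S ==> (y i has_vector_derivative y' i x) (at x within S)"
    and y': "uniform_limit S y' z sequentially"
    and y: "\<And>x. x \<in> S ==> (\<lambda>i. y i x) \<longlonglongrightarrow> q x"
  shows "(q has_vector_derivative z x) (at x within S)"
proof -
  have "\<exists>G. \<forall>x\<in>S. (\<lambda>i. y i x) \<longlonglongrightarrow> G x \<and> (G has_derivative (\<lambda>h. h *\<^sub>R z x)) (at x within S)"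
  proof (rule has_derivative_sequence)
    show "convex S" "x \<in> S" by (rule S)+
    show "(\<lambda>i. y i x) \<longlonglongrightarrow> q x" by (rule y[OF S(2)])
    show "(y i has_derivative (\<lambda>h. h *\<^sub>R y' i x)) (at x within S)" if "x \<in> S" for i x
      using d[OF that] unfolding has_vector_derivative_def .
    show "\<forall>\<^sub>F i in sequentially. \<forall>x\<in>S. \<forall>h. norm (h *\<^sub>R y' i x - h *\<^sub>R z x) \<le> e * norm h" if "e > 0" for e
      using uniform_limitD[OF y' that]
    proof eventually_elim
      case (elim i)
      then show ?case
        by (auto simp: scaleR_diff_right[symmetric] dist_norm mult.commute[of e] intro!: mult_left_mono intro: less_imp_le)
    qed
  qed
  then obtain G where G: "\<And>x. x \<in> S ==> (\<lambda>i. y i x) \<longlonglongrightarrow> G x"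
    "\<And>x. x \<in> S ==> (G has_derivative (\<lambda>h. h *\<^sub>R z x)) (at x within S)" by blast
  have "G x = q x" if "x \<in> S" for x using LIMSEQ_unique[OF G(1)[OF that] y[OF that]] .
  then show ?thesis
    unfolding has_vector_derivative_def using has_derivative_transform[OF S(2) _ G(2)[OF S(2)], of q] by simp
qed

text \<open>Picard iteration in the unknown z(t) = exp(- 2 l |t|) y(t), that is, in an exponentially
  weighted sup norm. The weight makes the integral operator a contraction with constant 1/2 whatever
  T is, so the whole interval is treated at once.\<close>

lemma ode_lipschitz_solution:
  fixes G :: "'a::banach => 'a"
  assumes lip: "\<And>x y. norm (G x - G y) \<le> L * norm (x - y)" and T: "T > 0"
  shows "\<exists>y. y 0 = y0 \<and> (\<forall>t\<in>{-T..T}. (y has_vector_derivative G (y t)) (at t within {-T..T}))"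
proof -
  define l where "l = \<bar>L\<bar> + 1"
  have l0: "l > 0" by (simp add: l_def add_nonneg_pos)
  have lipl: "norm (G x - G y) \<le> l * norm (x - y)" for x y
    using lip[of x y] by (rule order_trans) (intro mult_right_mono, auto simp: l_def)
  have contG: "continuous_on UNIV G"
  proof (rule lipschitz_on_continuous_on[of l])
    show "l-lipschitz_on UNIV G" using lipl l0 by (auto simp: lipschitz_on_def dist_norm)
  qed
  \<comment> \<open>Clamping time to [-T, T] lets the iteration run in the complete space of bounded
    continuous functions on the whole line.\<close>
  define c :: "real => real" where "c t = max (-T) (min T t)" for t
  have cT: "c t \<in> {-T..T}" for t using T by (auto simp: c_def)
  have cid: "c t = t" if "t \<in> {-T..T}" for t using that by (auto simp: c_def)
  have contc: "continuous_on UNIV c" unfolding c_def by (intro continuous_intros)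
  define f where "f z s = G (exp (2 * l * \<bar>s\<bar>) *\<^sub>R z s)" for z :: "real => 'a" and s
  define I where "I z t = integral {-T..t} (f z) - integral {-T..0} (f z)" for z t
  define P where "P z t = exp (- 2 * l * \<bar>c t\<bar>) *\<^sub>R (y0 + I z (c t))" for z t
  have contf: "continuous_on A (f z)" if "continuous_on UNIV z" for A z
    unfolding f_def
    by (intro continuous_on_compose2[OF contG] continuous_intros continuous_on_subset[OF that]) auto
  have derI: "(I z has_vector_derivative f z t) (at t within {-T..T})"
    if "continuous_on UNIV z" "t \<in> {-T..T}" for z t
    unfolding I_def
    using integral_has_vector_derivative[OF contf[OF that(1)] that(2)]
    by (auto intro!: derivative_eq_intros)
  have contI: "continuous_on {-T..T} (I z)" if "continuous_on UNIV z" for z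
    using derI[OF that] by (meson continuous_on_vector_derivative)
  have contP: "continuous_on UNIV (P z)" if "continuous_on UNIV z" for z
    unfolding P_def
    by (intro continuous_intros contc continuous_on_compose2[OF contI[OF that] contc]) (use cT in auto)
  have P_bcont: "P (apply_bcontfun z) \<in> bcontfun" for z
  proof -
    have "P z t = P z (c t)" for t using cid[OF cT, of t] by (simp add: P_def)
    then have "range (P z) \<subseteq> P z ` {-T..T}" using cT by (metis image_eqI image_subsetI)
    moreover have "bounded (P z ` {-T..T})"
      by (intro compact_imp_bounded compact_continuous_image continuous_on_subset[OF contP]) auto
    ultimately show ?thesis
      using contP[of z] by (auto simp: bcontfun_def intro: bounded_subset)
  qed
  \<comment> \<open>l times the integral of exp(2 l |s|) between 0 and t is at most exp(2 l |t|) /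
    2; the 1/2 is the contraction constant.\<close>
  have Ibd: "norm (I z t - I w t) \<le> exp (2 * l * \<bar>t\<bar>) / 2 * d"
    if z: "continuous_on UNIV z" and w: "continuous_on UNIV w" and d: "\<And>s. norm (z s - w s) \<le> d"
      and t: "t \<in> {-T..T}" for z w d t
  proof -
    have d0: "d \<ge> 0" using d[of 0] norm_ge_zero order_trans by blast
    have fb: "norm (f z s - f w s) \<le> l * d * exp (2 * l * \<bar>s\<bar>)" for s
    proof -
      have "norm (f z s - f w s) \<le> l * norm (exp (2 * l * \<bar>s\<bar>) *\<^sub>R (z s - w s))"
        unfolding f_def by (rule order_trans[OF lipl]) (simp add: scaleR_diff_right)
      also have "\<dots> \<le> l * (exp (2 * l * \<bar>s\<bar>) * d)" using d[of s] l0 by (simp add: mult_left_mono)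
      finally show ?thesis by (simp add: ac_simps)
    qed
    have int: "f u integrable_on {a..b}" if "continuous_on UNIV u" for u a b
      by (rule integrable_continuous_interval[OF contf[OF that]])
    show ?thesis
    proof (cases "t \<ge> 0")
      case True
      have e: "I u t = integral {0..t} (f u)" if "continuous_on UNIV u" for u
        using Henstock_Kurzweil_Integration.integral_combine[of "-T" 0 t "f u"] True T int[OF that] by (simp add: I_def algebra_simps)
      have h: "((\<lambda>s. l * d * exp (2 * l * \<bar>s\<bar>)) has_integral (d / 2 * exp (2 * l * t) - d/2 * exp (2*l*0))) {0..t}"
      proof (rule has_integral_eq[rotated])
        show "((\<lambda>s. l * d * exp (2 * l * s)) has_integral (d / 2 * exp (2 * l * t) - d/2 * exp (2*l*0))) {0..t}"
          by (rule fundamental_theorem_of_calculus[OF True])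
            (auto intro!: derivative_eq_intros simp flip: has_real_derivative_iff_has_vector_derivative)
      qed auto
      have "I z t - I w t = integral {0..t} (\<lambda>s. f z s - f w s)"
        unfolding e[OF z] e[OF w] by (rule Henstock_Kurzweil_Integration.integral_diff[symmetric]) (auto intro: int z w)
      also have "norm \<dots> \<le> d / 2 * exp (2 * l * t) - d/2 * exp (2*l*0)"
        unfolding integral_unique[OF h, symmetric]
        by (intro integral_norm_bound_integral fb Henstock_Kurzweil_Integration.integrable_diff int z w has_integral_integrable[OF h])
      finally show ?thesis using True d0 by (simp add: field_simps)
    next
      case False
      have e: "I u t = - integral {t..0} (f u)" if "continuous_on UNIV u" for u
        using Henstock_Kurzweil_Integration.integral_combine[of "-T" t 0 "f u"] False t int[OF that] by (simp add: I_def algebra_simps)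
      have h: "((\<lambda>s. l * d * exp (2 * l * \<bar>s\<bar>)) has_integral (- d / 2 * exp (- 2 * l * 0) - (- d/2 * exp (-2*l*t)))) {t..0}"
      proof (rule has_integral_eq[rotated])
        show "((\<lambda>s. l * d * exp (- 2 * l * s)) has_integral (- d / 2 * exp (- 2 * l * 0) - (- d/2 * exp (-2*l*t)))) {t..0}"
          by (rule fundamental_theorem_of_calculus)
            (use False in \<open>auto intro!: derivative_eq_intros simp flip: has_real_derivative_iff_has_vector_derivative\<close>)
      qed auto
      have "norm (I z t - I w t) = norm (integral {t..0} (\<lambda>s. f z s - f w s))"
        unfolding e[OF z] e[OF w]
        by (subst Henstock_Kurzweil_Integration.integral_diff) (auto intro: int z w simp: norm_minus_commute)
      also have "\<dots> \<le> - d / 2 * exp (- 2 * l * 0) - (- d/2 * exp (-2*l*t))"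
        unfolding integral_unique[OF h, symmetric]
        by (intro integral_norm_bound_integral fb Henstock_Kurzweil_Integration.integrable_diff int z w has_integral_integrable[OF h])
      finally show ?thesis using False d0 by (simp add: field_simps)
    qed
  qed
  define Q where "Q z = Bcontfun (P (apply_bcontfun z))" for z
  have Q: "apply_bcontfun (Q z) = P z" for z
    by (simp add: Q_def Bcontfun_inverse[OF P_bcont])
  have "\<exists>!z. Q z = z"
  proof (rule banach_fix_type[of "1/2"])
    show "\<forall>x y. dist (Q x) (Q y) \<le> 1/2 * dist x y"
    proof (intro allI dist_bound)
      fix z w :: "real \<Rightarrow>\<^sub>C 'a" and t
      have "dist (Q z t) (Q w t) = exp (- 2 * l * \<bar>c t\<bar>) * norm (I z (c t) - I w (c t))"
        by (simp add: Q P_def dist_norm scaleR_diff_right[symmetric])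
      also have "\<dots> \<le> exp (- 2 * l * \<bar>c t\<bar>) * (exp (2 * l * \<bar>c t\<bar>) / 2 * dist z w)"
        by (intro mult_left_mono Ibd cT) (auto simp: dist_bounded simp flip: dist_norm)
      also have "\<dots> = 1/2 * dist z w" by (simp add: exp_minus)
      finally show "dist (Q z t) (Q w t) \<le> 1/2 * dist z w" .
    qed
  qed auto
  then obtain z where z: "Q z = z" by blast
  have zP: "z t = P z t" for t using Q[of z] z by simp
  define y where "y t = y0 + I z t" for t
  have yz: "exp (2 * l * \<bar>t\<bar>) *\<^sub>R z t = y t" if "t \<in> {-T..T}" for t
    using that by (subst zP) (simp add: P_def y_def cid exp_minus)
  have "(y has_vector_derivative G (y t)) (at t within {-T..T})" if "t \<in> {-T..T}" for t
  proof -
    have "(I z has_vector_derivative G (y t)) (at t within {-T..T})"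
      using derI[OF _ that, of z] yz[OF that] by (simp add: f_def)
    then show ?thesis unfolding y_def by (auto intro!: derivative_eq_intros)
  qed
  moreover have "y 0 = y0" by (simp add: y_def I_def)
  ultimately show ?thesis by blast
qed

section \<open>The abstract KdV equation\<close>

text \<open>\<open>m k\<close> models multiplication by the k-th derivative of the background W, so
  \<open>D_m\<close> is a Leibniz rule, and \<open>h\<close> models the forcing - W''' + 6 W W', the
  right-hand side at q = 0. The product is total but controlled only when one factor lies in
  \<open>dom\<close>. \<open>D_range\<close> adds to skewness the solvability that yields
  resolvents.\<close>

locale kdv_structure =
  fixes dom :: "'a::{real_inner, banach} set"
    and D :: "'a => 'a"
    and mul :: "'a => 'a => 'a" (infixl "\<odot>" 70)
    and m :: "nat => 'a => 'a"
    and h :: 'a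
  assumes dom_sub: "subspace dom"
    and D_add: "f \<in> dom ==> g \<in> dom ==> D (f + g) = D f + D g"
    and D_scale: "f \<in> dom ==> D (c *\<^sub>R f) = c *\<^sub>R D f"
    and D_closed: "(\<And>n. u n \<in> dom) ==> u \<longlonglongrightarrow> f ==> (\<lambda>n. D (u n)) \<longlonglongrightarrow> g ==> f \<in> dom \<and> D f = g"
    and D_skew: "f \<in> dom ==> g \<in> dom ==> inner (D f) g = - inner f (D g)"
    and D_range: "d \<noteq> 0 ==> \<exists>u\<in>dom. u - d *\<^sub>R D u = f"
    and dom_dense: "closure dom = UNIV"
    and mul_commute: "f \<odot> g = g \<odot> f"
    and mul_add: "f \<in> dom ==> f \<odot> (g + g') = f \<odot> g + f \<odot> g'"
    and mul_scale: "f \<in> dom ==> f \<odot> (c *\<^sub>R g) = c *\<^sub>R (f \<odot> g)"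
    and mul_add_dom: "f \<in> dom ==> f' \<in> dom ==> (f + f') \<odot> g = f \<odot> g + f' \<odot> g"
    and mul_scale_dom: "f \<in> dom ==> (c *\<^sub>R f) \<odot> g = c *\<^sub>R (f \<odot> g)"
    and mul_bound: "f \<in> dom ==> (norm (f \<odot> g))\<^sup>2 \<le> 2 * norm f * norm (D f) * (norm g)\<^sup>2"
    and mul_adj: "f \<in> dom ==> inner (f \<odot> g) g' = inner g (f \<odot> g')"
    and mul_dom: "f \<in> dom ==> g \<in> dom ==> f \<odot> g \<in> dom"
    and D_mul: "f \<in> dom ==> g \<in> dom ==> D (f \<odot> g) = D f \<odot> g + f \<odot> D g"
    and m_lin: "bounded_linear (m k)"
    and m_adj: "inner (m k f) g = inner f (m k g)"
    and m_dom: "f \<in> dom ==> m k f \<in> dom"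
    and D_m: "f \<in> dom ==> D (m k f) = m (Suc k) f + m k (D f)"
    and h_dom: "(D ^^ k) h \<in> dom"
begin

fun H :: "nat => 'a set" where
  "H 0 = UNIV"
| "H (Suc k) = {f \<in> dom. D f \<in> H k}"

lemma D_0 [simp]: "D 0 = 0"
  using D_scale[of 0 0] subspace_0[OF dom_sub] by simp

lemma dom_add: "f \<in> dom ==> g \<in> dom ==> f + g \<in> dom"
  and dom_scale: "f \<in> dom ==> c *\<^sub>R f \<in> dom"
  and dom_0 [simp]: "0 \<in> dom"
  using dom_sub by (auto simp: subspace_def)

lemma D_minus: "f \<in> dom ==> D (- f) = - D f"
  using D_scale[of f "-1"] by simp

lemma D_diff: "f \<in> dom ==> g \<in> dom ==> D (f - g) = D f - D g"
  using D_add[of f "-1 *\<^sub>R g"] D_scale[of g "-1"] dom_scale[of g "-1"] by simp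

lemma H_add: "f \<in> H k ==> g \<in> H k ==> f + g \<in> H k"
  by (induction k arbitrary: f g) (auto simp: dom_add D_add)

lemma H_scale: "f \<in> H k ==> c *\<^sub>R f \<in> H k"
  by (induction k arbitrary: f) (auto simp: dom_scale D_scale)

lemma H_0 [simp]: "0 \<in> H k"
  by (induction k) auto

lemma H_minus: "f \<in> H k ==> - f \<in> H k"
  using H_scale[of f k "-1"] by simp

lemma H_diff: "f \<in> H k ==> g \<in> H k ==> f - g \<in> H k"
  using H_add[of f k "- g"] H_minus[of g k] by simp

lemma H_SucD: "f \<in> H (Suc k) ==> f \<in> H k"
  by (induction k arbitrary: f) auto

lemma H_mono: "f \<in> H k ==> j \<le> k ==> f \<in> H j"
  using lift_Suc_antimono_le[of H j k] H_SucD by blast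

lemma D_H: "f \<in> H (Suc k) ==> D f \<in> H k" by simp

lemma Dp_H: "f \<in> H (j + k) ==> (D ^^ j) f \<in> H k"
  by (induction j arbitrary: f) (simp_all add: funpow_swap1 del: funpow.simps add: funpow_Suc_right)

lemma Dp_H': "f \<in> H n ==> j + k \<le> n ==> (D ^^ j) f \<in> H k"
  using Dp_H H_mono by blast

lemma H_1 [simp]: "H (Suc 0) = dom" by auto

lemma Dp_dom: "f \<in> H n ==> j < n ==> (D ^^ j) f \<in> dom"
  using Dp_H'[of f n j 1] by simp

lemma H_dom: "f \<in> H n ==> 0 < n ==> f \<in> dom"
  using Dp_dom[of f n 0] by simp

lemma H_iff: "f \<in> H n \<longleftrightarrow> (\<forall>j<n. (D ^^ j) f \<in> dom)"
proof
  show "f \<in> H n ==> \<forall>j<n. (D ^^ j) f \<in> dom" using Dp_dom by blast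
  show "\<forall>j<n. (D ^^ j) f \<in> dom ==> f \<in> H n"
  proof (induction n arbitrary: f)
    case (Suc n)
    have "(D ^^ j) (D f) \<in> dom" if "j < n" for j
      using Suc.prems that by (metis Suc_less_eq funpow_Suc_right comp_apply)
    then have "D f \<in> H n" by (intro Suc.IH) blast
    moreover have "f \<in> dom" using Suc.prems[rule_format, of 0] by simp
    ultimately show ?case by simp
  qed simp
qed

lemma h_H [simp]: "h \<in> H n" using h_dom H_iff by blast

lemma Dp_add: "f \<in> H n ==> g \<in> H n ==> j \<le> n ==> (D ^^ j) (f + g) = (D ^^ j) f + (D ^^ j) g"
  by (induction j) (auto simp: D_add Dp_dom)

lemma Dp_scale: "f \<in> H n ==> j \<le> n ==> (D ^^ j) (c *\<^sub>R f) = c *\<^sub>R (D ^^ j) f"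
  by (induction j) (auto simp: D_scale Dp_dom)

lemma Dp_minus: "f \<in> H n ==> j \<le> n ==> (D ^^ j) (- f) = - (D ^^ j) f"
  using Dp_scale[of f n j "-1"] by simp

lemma Dp_diff: "f \<in> H n ==> g \<in> H n ==> j \<le> n ==> (D ^^ j) (f - g) = (D ^^ j) f - (D ^^ j) g"
  using Dp_add[of f n "-g" j] Dp_minus[of g n j] H_minus[of g n] by simp

lemma Dp_0 [simp]: "(D ^^ j) 0 = 0" by (induction j) auto

lemma inner_D_self: "f \<in> dom ==> inner f (D f) = 0"
  using D_skew[of f f] by (simp add: inner_commute)

text \<open>\<open>D_closed\<close> is applied order by order; since D is unbounded, every
  intermediate derivative has to converge.\<close>

lemma H_closed:
  assumes "\<And>n. u n \<in> H k" "\<And>j. j \<le> k ==> (\<lambda>n. (D ^^ j) (u n)) \<longlonglongrightarrow> g j"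
  shows "g 0 \<in> H k \<and> (\<forall>j\<le>k. (D ^^ j) (g 0) = g j)"
proof -
  have *: "g j \<in> dom \<and> D (g j) = g (Suc j)" if "j < k" for j
  proof (rule D_closed)
    show "(D ^^ j) (u n) \<in> dom" for n using Dp_dom[OF assms(1) that] .
    show "(\<lambda>n. (D ^^ j) (u n)) \<longlonglongrightarrow> g j" using assms(2) that by simp
    show "(\<lambda>n. D ((D ^^ j) (u n))) \<longlonglongrightarrow> g (Suc j)" using assms(2)[of "Suc j"] that by simp
  qed
  have "(D ^^ j) (g 0) = g j" if "j \<le> k" for j
    using that by (induction j) (auto simp: *)
  then show ?thesis using * by (auto simp: H_iff)
qed

text \<open>Only the two end orders are kept, so an energy estimate has to treat orders 0 and k
  alone; \<open>interpolation\<close> recovers the intermediate ones.\<close>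

definition hn :: "nat => 'a => real" where
  "hn k f = norm f + norm ((D ^^ k) f)"

lemma hn_nonneg [simp]: "0 \<le> hn k f" by (simp add: hn_def)

lemma norm_le_hn: "norm f \<le> hn k f" by (simp add: hn_def)

lemma hn_add: "f \<in> H k ==> g \<in> H k ==> hn k (f + g) \<le> hn k f + hn k g"
  unfolding hn_def by (smt (verit) Dp_add norm_triangle_ineq order_refl)

lemma hn_scale: "f \<in> H k ==> hn k (c *\<^sub>R f) = \<bar>c\<bar> * hn k f"
  by (simp add: hn_def Dp_scale algebra_simps)

lemma hn_minus: "f \<in> H k ==> hn k (- f) = hn k f"
  using hn_scale[of f k "-1"] by simp

lemma hn_diff: "f \<in> H k ==> g \<in> H k ==> hn k (f - g) \<le> hn k f + hn k g"
  using hn_add[of f k "-g"] hn_minus[of g k] H_minus[of g k] by simp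

lemma hn_diff_commute: "f \<in> H k ==> g \<in> H k ==> hn k (f - g) = hn k (g - f)"
  using hn_minus[of "f - g" k] H_diff[of f k g] by simp

lemma hn_0 [simp]: "hn k 0 = 0" by (simp add: hn_def)

lemma norm_D_sq: "f \<in> H 2 ==> (norm (D f))\<^sup>2 \<le> norm f * norm (D (D f))"
proof -
  assume f: "f \<in> H 2"
  then have d: "f \<in> dom" "D f \<in> dom" by (auto simp: numeral_2_eq_2)
  have "(norm (D f))\<^sup>2 = - inner f (D (D f))"
    using D_skew[OF d] by (simp add: power2_norm_eq_inner)
  also have "\<dots> \<le> norm f * norm (D (D f))"
    by (metis inner_minus_left norm_cauchy_schwarz norm_minus_cancel)
  finally show ?thesis .
qed

text \<open>The sequence of squared norms is convex, so it is dominated by its end points.\<close>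

lemma interpolation:
  assumes "f \<in> H k" "j \<le> k"
  shows "norm ((D ^^ j) f) \<le> hn k f"
proof -
  define b where "b j = (norm ((D ^^ j) f))\<^sup>2" for j
  have conv: "2 * b (Suc i) \<le> b i + b (Suc (Suc i))" if "Suc (Suc i) \<le> k" for i
  proof -
    have "(D ^^ i) f \<in> H 2" using Dp_H'[OF assms(1), of i 2] that by simp
    from norm_D_sq[OF this]
    have "b (Suc i) \<le> norm ((D ^^ i) f) * norm ((D ^^ Suc (Suc i)) f)" by (simp add: b_def)
    moreover have "2 * (norm ((D ^^ i) f) * norm ((D ^^ Suc (Suc i)) f)) \<le> b i + b (Suc (Suc i))"
      unfolding b_def by (metis mult.assoc sum_squares_bound)
    ultimately show ?thesis by linarith
  qed
  have step: "b i \<le> max (b 0) (b (Suc i))" if "Suc i \<le> k" for i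
    using that
  proof (induction i)
    case (Suc i)
    then show ?case using conv[of i] by (auto simp: max_def split: if_splits)
  qed auto
  have "b j \<le> max (b 0) (b k)"
    using assms(2)
  proof (induction "k - j" arbitrary: j)
    case (Suc n)
    then have "b (Suc j) \<le> max (b 0) (b k)" by (metis Suc_diff_Suc Suc_inject Suc_leI zero_less_Suc zero_less_diff)
    moreover have "b j \<le> max (b 0) (b (Suc j))" using Suc.hyps(2) by (intro step) simp
    ultimately show ?case by (simp add: le_max_iff_disj) linarith
  qed auto
  also have "\<dots> \<le> (hn k f)\<^sup>2"
    by (auto simp: b_def hn_def intro!: power_mono)
  finally show ?thesis unfolding b_def by (rule power2_le_imp_le) simp
qed

lemma hn_mono: "f \<in> H k ==> j \<le> k ==> hn j f \<le> 2 * hn k f"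
  using interpolation[of f k j] norm_le_hn[of f k] unfolding hn_def[of j] by linarith

lemma hn_D: "f \<in> H (Suc k) ==> hn k (D f) \<le> 2 * hn (Suc k) f"
  using interpolation[of f "Suc k" 1] interpolation[of f "Suc k" "Suc k"]
  unfolding hn_def[of k] by (simp add: funpow_swap1)

lemma hn_Dp': "f \<in> H n ==> j + k \<le> n ==> hn k ((D ^^ j) f) \<le> 2 * hn n f"
  using interpolation[of f n j] interpolation[of f n "k + j"]
  unfolding hn_def[of k] by (simp add: funpow_add[of k j D] add.commute[of j k])

lemma hn_Suc_le: "f \<in> dom ==> hn (Suc k) f \<le> norm f + hn k (D f)"
  unfolding hn_def by (simp add: funpow_swap1)

section \<open>Resolvents and the smoothing operator\<close>

definition Rs :: "real => 'a => 'a" where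
  "Rs d f = (SOME u. u \<in> dom \<and> u - d *\<^sub>R D u = f)"

text \<open>(1 - d D)^-1 (1 + d D)^-1 is the factorisation of (1 - d^2 D^2)^-1. The two factors
  commute and are adjoint to each other, which makes \<open>K d\<close> self-adjoint, and only
  first-order equations have to be solved.\<close>

definition K :: "real => 'a => 'a" where
  "K d f = Rs d (Rs (- d) f)"

lemma Rs: "d \<noteq> 0 ==> Rs d f \<in> dom \<and> Rs d f - d *\<^sub>R D (Rs d f) = f"
  unfolding Rs_def by (rule someI_ex) (use D_range in blast)

text \<open>Pythagoras: by skewness u and D u are orthogonal. This gives uniqueness, contractivity,
  and one derivative at the price 1/d.\<close>

lemma norm_resolvent:
  assumes "u \<in> dom"
  shows "(norm (u - d *\<^sub>R D u))\<^sup>2 = (norm u)\<^sup>2 + d\<^sup>2 * (norm (D u))\<^sup>2"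
  using inner_D_self[OF assms] inner_commute[of u "D u"]
  unfolding power2_norm_eq_inner by (simp add: inner_diff power2_eq_square)

lemma Rs_unique: "u \<in> dom ==> r \<noteq> 0 ==> Rs r (u - r *\<^sub>R D u) = u"
proof -
  assume u: "u \<in> dom" and d: "r \<noteq> 0"
  define v where "v = Rs r (u - r *\<^sub>R D u)"
  have v: "v \<in> dom" "v - r *\<^sub>R D v = u - r *\<^sub>R D u" using Rs[OF d] by (auto simp: v_def)
  have "u - v \<in> dom" using u v H_diff[of u 1 v] by simp
  from norm_resolvent[OF this, of r]
  have "(norm (u - v))\<^sup>2 + r\<^sup>2 * (norm (D (u - v)))\<^sup>2 = 0"
    using v u by (simp add: D_diff scaleR_diff_right algebra_simps)
  then have "(norm (u - v))\<^sup>2 \<le> 0" using d zero_le_mult_iff by (smt (verit) zero_le_power2)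
  then show ?thesis by (simp add: v_def)
qed

lemma Rs_lin: assumes "d \<noteq> 0" shows "bounded_linear (Rs d)"
proof (rule bounded_linear_intro[where K = 1])
  fix x y r
  have *: "Rs d x \<in> dom" "Rs d y \<in> dom" "Rs d x - d *\<^sub>R D (Rs d x) = x" "Rs d y - d *\<^sub>R D (Rs d y) = y"
    using Rs[OF assms] by auto
  have "(Rs d x + Rs d y) - d *\<^sub>R D (Rs d x + Rs d y)
      = (Rs d x - d *\<^sub>R D (Rs d x)) + (Rs d y - d *\<^sub>R D (Rs d y))"
    using *(1,2) by (simp add: D_add scaleR_add_right)
  then have "x + y = (Rs d x + Rs d y) - d *\<^sub>R D (Rs d x + Rs d y)"
    using *(3,4) by simp
  then show "Rs d (x + y) = Rs d x + Rs d y"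
    using Rs_unique[OF dom_add[OF *(1,2)] assms] by simp
  have "r *\<^sub>R x = r *\<^sub>R (Rs d x - d *\<^sub>R D (Rs d x))" using * by simp
  also have "\<dots> = (r *\<^sub>R Rs d x) - d *\<^sub>R D (r *\<^sub>R Rs d x)"
    unfolding D_scale[OF *(1)] scaleR_diff_right by (simp add: mult.commute)
  finally show "Rs d (r *\<^sub>R x) = r *\<^sub>R Rs d x"
    using Rs_unique[OF dom_scale[OF *(1)] assms] by simp
  have "(norm x)\<^sup>2 = (norm (Rs d x))\<^sup>2 + d\<^sup>2 * (norm (D (Rs d x)))\<^sup>2"
    using norm_resolvent[OF *(1), of d] *(3) by simp
  then have "(norm (Rs d x))\<^sup>2 \<le> (norm x)\<^sup>2" by simp
  then have "norm (Rs d x) \<le> norm x" by (rule power2_le_imp_le) simp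
  then show "norm (Rs d x) \<le> norm x * 1" by simp
qed

lemma Rs_norm: assumes "d \<noteq> 0" shows "norm (Rs d f) \<le> norm f" "\<bar>d\<bar> * norm (D (Rs d f)) \<le> norm f"
proof -
  have *: "(norm f)\<^sup>2 = (norm (Rs d f))\<^sup>2 + (\<bar>d\<bar> * norm (D (Rs d f)))\<^sup>2"
    using norm_resolvent[of "Rs d f" d] Rs[OF assms, of f] by (simp add: power_mult_distrib)
  then have "(norm (Rs d f))\<^sup>2 \<le> (norm f)\<^sup>2" "(\<bar>d\<bar> * norm (D (Rs d f)))\<^sup>2 \<le> (norm f)\<^sup>2" by simp_all
  then show "norm (Rs d f) \<le> norm f" "\<bar>d\<bar> * norm (D (Rs d f)) \<le> norm f"
    by (auto intro: power2_le_imp_le)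
qed

lemma Rs_D: assumes "r \<noteq> 0" "f \<in> dom" shows "D (Rs r f) \<in> dom" "Rs r (D f) = D (Rs r f)"
proof -
  have R: "Rs r f \<in> dom" "Rs r f - r *\<^sub>R D (Rs r f) = f" using Rs[OF assms(1)] by auto
  have "D (Rs r f) = (1/r) *\<^sub>R (Rs r f - f)" 
    using assms(1) by (subst R(2)[symmetric]) (simp add: algebra_simps)
  then show d: "D (Rs r f) \<in> dom" using R assms H_diff[of _ 1] dom_scale by simp
  have "D f = D (Rs r f - r *\<^sub>R D (Rs r f))" using R by simp
  also have "\<dots> = D (Rs r f) - r *\<^sub>R D (D (Rs r f))"
    using R(1) d by (simp add: D_diff D_scale dom_scale)
  finally show "Rs r (D f) = D (Rs r f)" using Rs_unique[OF d assms(1)] by simp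
qed

lemma Rs_adj: assumes "d \<noteq> 0" shows "inner (Rs d f) g = inner f (Rs (- d) g)"
proof -
  define u v where "u = Rs d f" and "v = Rs (- d) g"
  have u: "u \<in> dom" "f = u - d *\<^sub>R D u" and v: "v \<in> dom" "g = v + d *\<^sub>R D v"
    using Rs[of d f] Rs[of "- d" g] assms by (auto simp: u_def v_def)
  show ?thesis
    unfolding u_def[symmetric] v_def[symmetric]
    using D_skew[OF u(1) v(1)] by (subst v(2), subst u(2)) (simp add: inner_add inner_diff)
qed

lemma Rs_comm: assumes "d \<noteq> 0" shows "Rs (- d) (Rs d f) = Rs d (Rs (- d) f)"
proof -
  define v where "v = Rs d (Rs (- d) f)"
  have r: "Rs (- d) f \<in> dom" "Rs (- d) f + d *\<^sub>R D (Rs (- d) f) = f" using Rs[of "-d" f] assms by auto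
  interpret b: bounded_linear "Rs d" by (rule Rs_lin[OF assms])
  have "Rs d f = v + d *\<^sub>R D v"
    by (subst r(2)[symmetric]) (simp add: b.add b.scale Rs_D[OF assms r(1)] v_def)
  then have "Rs (- d) (Rs d f) = Rs (- d) (v - (- d) *\<^sub>R D v)" by simp
  also have "\<dots> = v" using assms Rs[OF assms] by (intro Rs_unique) (auto simp: v_def)
  finally show ?thesis by (simp add: v_def)
qed

lemma K_lin: "d \<noteq> 0 ==> bounded_linear (K d)"
  unfolding K_def by (rule bounded_linear_compose) (auto intro: Rs_lin)

lemma K_norm: "d \<noteq> 0 ==> norm (K d f) \<le> norm f"
  unfolding K_def by (meson Rs_norm(1) neg_equal_0_iff_equal order_trans)

lemma K_adj: "d \<noteq> 0 ==> inner (K d f) g = inner f (K d g)"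
  unfolding K_def using Rs_adj[of d] Rs_adj[of "-d"] Rs_comm[of "d"] by simp

text \<open>Applying 1 - e D and then 1 + e D undoes the two resolvents, so (1 - e^2 D^2) K f = f;
  the last claim is this equation rearranged.\<close>

lemma K_eq: assumes "e \<noteq> 0" 
  shows "K e f \<in> dom" "D (K e f) \<in> dom" "K e f - f = e\<^sup>2 *\<^sub>R D (D (K e f))"
proof -
  define r where "r = Rs (- e) f"
  have r: "r \<in> dom" "r + e *\<^sub>R D r = f" using Rs[of "-e" f] assms by (auto simp: r_def)
  have k: "K e f \<in> dom" "K e f - e *\<^sub>R D (K e f) = r" using Rs[OF assms, of r] by (auto simp: K_def r_def)
  show "K e f \<in> dom" by (rule k)
  show d: "D (K e f) \<in> dom" using Rs_D(1)[OF assms r(1)] by (simp add: K_def r_def)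
  have "D r = D (K e f) - e *\<^sub>R D (D (K e f))"
    using k(1) d by (subst k(2)[symmetric]) (simp add: D_diff D_scale dom_scale)
  then have "f = (K e f - e *\<^sub>R D (K e f)) + e *\<^sub>R (D (K e f) - e *\<^sub>R D (D (K e f)))"
    using r(2) k(2) by simp
  then show "K e f - f = e\<^sup>2 *\<^sub>R D (D (K e f))"
    by (simp add: scaleR_diff_right power2_eq_square algebra_simps)
qed

lemma K_D: assumes "d \<noteq> 0" "f \<in> dom" shows "K d (D f) = D (K d f)"
  using Rs_D(2)[of "-d" f] Rs_D(2)[OF assms(1), of "Rs (- d) f"] Rs[of "-d" f] assms by (simp add: K_def)

lemma K_norm_D: assumes "d > 0" shows "norm (D (K d f)) \<le> (1 / d) * norm f"
  using Rs_norm(2)[of d "Rs (-d) f"] Rs_norm(1)[of "-d" f] assms by (simp add: K_def field_simps)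

lemma K_H: "d \<noteq> 0 ==> f \<in> H k ==> K d f \<in> H (k + 2)"
proof (induction k arbitrary: f)
  case 0 then show ?case using K_eq by (simp add: numeral_2_eq_2)
next
  case (Suc k) then show ?case using K_eq(1)[of d f] K_D[of d f] by (auto simp flip: K_D)
qed

lemma K_Dp: "d \<noteq> 0 ==> f \<in> H k ==> j \<le> k ==> (D ^^ j) (K d f) = K d ((D ^^ j) f)"
  by (induction j) (auto simp: K_D Dp_dom)

text \<open>K f - f = d^2 D (K (D f)), and D K costs only 1/d. One derivative of f thus gives the
  rate d, two derivatives (next lemma) the rate d^2; the second rate is what the Bona-Smith argument
  exploits.\<close>

lemma K_near1: assumes "d > 0" "f \<in> dom" shows "norm (K d f - f) \<le> d * norm (D f)"
proof -
  have "K d f - f = d\<^sup>2 *\<^sub>R D (K d (D f))" using K_eq(3)[of d f] assms by (simp add: K_D)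
  then have "norm (K d f - f) \<le> d\<^sup>2 * ((1/d) * norm (D f))"
    using mult_left_mono[OF K_norm_D[OF assms(1), of "D f"], of "d\<^sup>2"] by simp
  then show ?thesis using assms(1) by (simp add: power2_eq_square)
qed

lemma K_near2: assumes "d > 0" "f \<in> H 2" shows "norm (K d f - f) \<le> d\<^sup>2 * norm (D (D f))"
proof -
  have "f \<in> dom" "D f \<in> dom" using assms(2) by (auto simp: numeral_2_eq_2)
  then have "K d f - f = d\<^sup>2 *\<^sub>R K d (D (D f))" using K_eq(3)[of d f] assms(1) by (simp add: K_D)
  then show ?thesis using K_norm[of d "D (D f)"] assms(1) by (simp add: mult_left_mono)
qed

lemma Kn_lin: "d \<noteq> 0 ==> bounded_linear (K d ^^ n)"
proof (induction n)
  case (Suc n) then show ?case using bounded_linear_compose[OF K_lin Suc.IH] by (simp add: comp_def)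
qed (simp add: bounded_linear_ident id_def)

lemma Kn_norm: "d \<noteq> 0 ==> norm ((K d ^^ n) f) \<le> norm f"
  by (induction n) (auto intro: order_trans[OF K_norm])

lemma Kn_adj: "d \<noteq> 0 ==> inner ((K d ^^ n) f) g = inner f ((K d ^^ n) g)"
  by (induction n arbitrary: f g) (simp_all add: K_adj funpow_swap1)

lemma Kn_H: "d \<noteq> 0 ==> f \<in> H k ==> (K d ^^ n) f \<in> H (k + 2 * n)"
proof (induction n)
  case (Suc n) then show ?case using K_H[of d "(K d ^^ n) f" "k + 2 * n"] by simp
qed simp

lemma Kn_H': "d \<noteq> 0 ==> f \<in> H k ==> (K d ^^ n) f \<in> H k"
  using Kn_H[of d f k n] H_mono by (metis le_add1)

lemma Kn_H0: "d \<noteq> 0 ==> k \<le> 2 * n ==> (K d ^^ n) f \<in> H k"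
  using Kn_H[of d f 0 n] H_mono by simp

lemma Kn_Dp: "d \<noteq> 0 ==> f \<in> H k ==> j \<le> k ==> (D ^^ j) ((K d ^^ n) f) = (K d ^^ n) ((D ^^ j) f)"
  by (induction n) (auto simp: K_Dp[OF _ Kn_H'])

lemma Kn_hn: "d \<noteq> 0 ==> f \<in> H k ==> hn k ((K d ^^ n) f) \<le> hn k f"
  unfolding hn_def by (simp add: Kn_Dp add_mono Kn_norm)

lemma Kn_near1: assumes "d > 0" "f \<in> dom" shows "norm ((K d ^^ n) f - f) \<le> n * d * norm (D f)"
proof (induction n)
  case (Suc n)
  have "(K d ^^ n) f \<in> dom" using Kn_H'[of d f 1 n] assms by simp
  then have "norm (K d ((K d ^^ n) f) - (K d ^^ n) f) \<le> d * norm (D ((K d ^^ n) f))"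
    by (rule K_near1[OF assms(1)])
  also have "D ((K d ^^ n) f) = (K d ^^ n) (D f)" using Kn_Dp[of d f 1 1 n] assms by simp
  also have "d * norm ((K d ^^ n) (D f)) \<le> d * norm (D f)" using Kn_norm assms by (simp add: mult_left_mono)
  finally have "norm ((K d ^^ Suc n) f - f) \<le> d * norm (D f) + n * d * norm (D f)"
    using Suc norm_triangle_ineq[of "K d ((K d ^^ n) f) - (K d ^^ n) f" "(K d ^^ n) f - f"] by simp
  then show ?case by (simp add: algebra_simps)
qed simp

lemma Kn_near2: assumes "d > 0" "f \<in> H 2" shows "norm ((K d ^^ n) f - f) \<le> n * d\<^sup>2 * norm (D (D f))"
proof (induction n)
  case (Suc n)
  have "(K d ^^ n) f \<in> H 2" using Kn_H'[of d f 2 n] assms by simp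
  then have "norm (K d ((K d ^^ n) f) - (K d ^^ n) f) \<le> d\<^sup>2 * norm (D (D ((K d ^^ n) f)))"
    by (rule K_near2[OF assms(1)])
  also have "D (D ((K d ^^ n) f)) = (K d ^^ n) (D (D f))" using Kn_Dp[of d f 2 2 n] assms by (simp add: numeral_2_eq_2)
  also have "d\<^sup>2 * norm ((K d ^^ n) (D (D f))) \<le> d\<^sup>2 * norm (D (D f))" using Kn_norm assms by (simp add: mult_left_mono)
  finally have "norm ((K d ^^ Suc n) f - f) \<le> d\<^sup>2 * norm (D (D f)) + n * d\<^sup>2 * norm (D (D f))"
    using Suc norm_triangle_ineq[of "K d ((K d ^^ n) f) - (K d ^^ n) f" "(K d ^^ n) f - f"] by simp
  then show ?case by (simp add: algebra_simps)
qed simp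

text \<open>Each factor K gains two derivatives, with constants that blow up as d tends to 0. These
  bounds only make the regularised equation a Lipschitz ODE; the uniform estimates rest on
  contractivity instead.\<close>

lemma Kn_smoothing: assumes "d > 0" "k \<le> 2 * n"
  shows "\<exists>C\<ge>0. \<forall>f. norm ((D ^^ k) ((K d ^^ n) f)) \<le> C * norm f"
proof -
  have K: "\<exists>C\<ge>0. \<forall>f. norm ((D ^^ i) (K d f)) \<le> C * norm f" if i: "i \<le> 2" for i
  proof -
    consider "i = 0" | "i = 1" | "i = 2" using i by linarith
    then show ?thesis
    proof cases
      case 1 then show ?thesis using K_norm[of d] assms(1) by (intro exI[of _ 1]) auto
    next
      case 2 then show ?thesis using K_norm_D[OF assms(1)] assms(1) by (intro exI[of _ "1/d"]) auto
    next
      case 3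
      have "norm (D (D (K d f))) \<le> 2 / d\<^sup>2 * norm f" for f
      proof -
        have "d\<^sup>2 * norm (D (D (K d f))) = norm (K d f - f)" using K_eq(3)[of d f] assms(1) by simp
        also have "\<dots> \<le> 2 * norm f" using norm_triangle_ineq4[of "K d f" f] K_norm[of d f] assms(1) by simp
        finally show ?thesis using assms(1) by (simp add: field_simps)
      qed
      then show ?thesis using 3 by (intro exI[of _ "2/d\<^sup>2"]) (auto simp: numeral_2_eq_2)
    qed
  qed
  show ?thesis using assms(2)
  proof (induction n arbitrary: k)
    case 0 then show ?case by (intro exI[of _ 1]) auto
  next
    case (Suc n)
    \<comment> \<open>The innermost factor K takes at most two of the k derivatives, the other n
      factors take the rest.\<close>
    define i where "i = min k 2"
    have i: "i \<le> 2" "k - i \<le> 2 * n" "k = (k - i) + i" using Suc.prems by (auto simp: i_def)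
    obtain C where C: "C \<ge> 0" "\<And>f. norm ((D ^^ i) (K d f)) \<le> C * norm f" using K[OF i(1)] by blast
    obtain C' where C': "C' \<ge> 0" "\<And>f. norm ((D ^^ (k - i)) ((K d ^^ n) f)) \<le> C' * norm f" using Suc.IH[OF i(2)] by blast
    have "norm ((D ^^ k) ((K d ^^ Suc n) f)) \<le> C' * C * norm f" for f
    proof -
      have "(D ^^ i) ((K d ^^ n) (K d f)) = (K d ^^ n) ((D ^^ i) (K d f))"
        using K_H[of d f 0] assms(1) i(1) by (intro Kn_Dp[of _ _ 2]) (simp_all add: numeral_2_eq_2)
      then have "(D ^^ k) ((K d ^^ Suc n) f) = (D ^^ (k - i)) ((K d ^^ n) ((D ^^ i) (K d f)))"
        by (subst i(3), subst funpow_add) (simp add: funpow_swap1)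
      then have "norm ((D ^^ k) ((K d ^^ Suc n) f)) \<le> C' * norm ((D ^^ i) (K d f))" using C' by simp
      also have "\<dots> \<le> C' * (C * norm f)" using C C' by (intro mult_left_mono) auto
      finally show ?thesis by simp
    qed
    then show ?case using C C' by (intro exI[of _ "C' * C"]) auto
  qed
qed

text \<open>The rate of \<open>K_near1\<close> holds on the dense domain, and contractivity of K
  carries the convergence to every f.\<close>

lemma K_tendsto: "((\<lambda>n. K (1 / Suc n) f) \<longlonglongrightarrow> f)"
  unfolding LIMSEQ_iff
proof (intro allI impI)
  fix e :: real assume e: "e > 0"
  have "f \<in> closure dom" using dom_dense by simp
  then obtain g where g: "g \<in> dom" "dist g f < e / 4"
    using e by (meson closure_approachable zero_less_divide_iff zero_less_numeral)
  obtain N :: nat where N: "4 * norm (D g) / e < Suc N" 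
    using reals_Archimedean2 by (metis less_SucI of_nat_less_iff order.strict_trans lessI)
  have "norm (K (1 / Suc n) f - f) < e" if "n \<ge> N" for n
  proof -
    define \<delta> where "\<delta> = 1 / real (Suc n)"
    have d: "\<delta> > 0" by (simp add: \<delta>_def)
    interpret b: bounded_linear "K \<delta>" using d by (intro K_lin) simp
    have "norm (K \<delta> g - g) \<le> \<delta> * norm (D g)" by (rule K_near1[OF d g(1)])
    also have "\<dots> \<le> e / 4"
    proof -
      have "4 * norm (D g) / e \<le> Suc n" using N that by (smt (verit) Suc_le_mono of_nat_le_iff)
      then show ?thesis using e by (simp add: \<delta>_def field_simps)
    qed
    finally have "norm (K \<delta> g - g) \<le> e / 4" .
    moreover have "norm (K \<delta> (f - g)) < e / 4" "norm (g - f) < e / 4"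
      using K_norm[of \<delta> "f - g"] d g(2) by (auto simp: dist_norm norm_minus_commute)
    moreover have "norm (K \<delta> f - f) = norm (K \<delta> (f - g) + (K \<delta> g - g) + (g - f))" by (simp add: b.diff)
    ultimately have "norm (K \<delta> f - f) < e" using e norm_triangle_ineq[of "K \<delta> (f - g) + (K \<delta> g - g)" "g - f"]
      norm_triangle_ineq[of "K \<delta> (f - g)" "K \<delta> g - g"] by linarith
    then show ?thesis by (simp add: \<delta>_def)
  qed
  then show "\<exists>no. \<forall>n\<ge>no. norm (K (1 / Suc n) f - f) < e" by blast
qed

lemma Kn_tendsto: "(\<lambda>n. (K (1 / Suc n) ^^ i) f) \<longlonglongrightarrow> f"
proof (induction i)
  case (Suc i)
  have "(\<lambda>n. K (1 / Suc n) ((K (1 / Suc n) ^^ i) f - f)) \<longlonglongrightarrow> 0"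
  proof (rule Lim_null_comparison)
    show "\<forall>\<^sub>F n in sequentially. norm (K (1 / Suc n) ((K (1 / Suc n) ^^ i) f - f)) \<le> norm ((K (1 / Suc n) ^^ i) f - f)"
      by (intro always_eventually allI K_norm) simp
    show "(\<lambda>n. norm ((K (1 / Suc n) ^^ i) f - f)) \<longlonglongrightarrow> 0"
      using Suc.IH by (simp add: LIM_zero tendsto_norm_zero)
  qed
  moreover have "K (1 / Suc n) ((K (1 / Suc n) ^^ i) f - f) + K (1 / Suc n) f = (K (1 / Suc n) ^^ Suc i) f" for n
    using linear_diff[OF bounded_linear.linear[OF K_lin], of "1 / Suc n"] by simp
  ultimately show ?case using tendsto_add[OF _ K_tendsto[of f]] by fastforce
qed simp


lemma H_Suc: "f \<in> H (Suc k) \<longleftrightarrow> f \<in> dom \<and> D f \<in> H k" by simp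

lemma H_2: "f \<in> H 2 \<longleftrightarrow> f \<in> dom \<and> D f \<in> dom" by (simp add: numeral_2_eq_2)

declare H.simps(2) [simp del]

section \<open>Products and commutators in the scale \<open>H k\<close>\<close>

lemma mul_diff: "f \<in> dom ==> f \<odot> (g - k) = f \<odot> g - f \<odot> k"
  using mul_add[of f g "-1 *\<^sub>R k"] mul_scale[of f "-1" k] by simp

lemma mul_0 [simp]: "0 \<odot> f = 0" "f \<odot> 0 = 0"
  using mul_scale_dom[of 0 0 f] mul_commute by auto

lemma norm_mul_sqrt:
  assumes "f \<in> dom" shows "norm (f \<odot> g) \<le> sqrt (2 * norm f * norm (D f)) * norm g"
proof -
  have "norm (f \<odot> g) \<le> sqrt (2 * norm f * norm (D f) * (norm g)\<^sup>2)"
    using mul_bound[OF assms, of g] by (rule real_le_rsqrt)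
  then show ?thesis by (simp add: real_sqrt_mult)
qed

lemma norm_mul: 
  assumes "f \<in> dom" shows "norm (f \<odot> g) \<le> hn 1 f * norm g"
proof -
  have "2 * norm f * norm (D f) \<le> (norm f + norm (D f))\<^sup>2" by (simp add: power2_sum)
  then have "sqrt (2 * norm f * norm (D f)) \<le> hn 1 f"
    by (simp add: hn_def real_le_lsqrt)
  then show ?thesis using norm_mul_sqrt[OF assms, of g] by (meson mult_right_mono norm_ge_zero order_trans)
qed

lemma mul_diff_dom: "f \<in> dom ==> f' \<in> dom ==> (f - f') \<odot> g = f \<odot> g - f' \<odot> g"
  using mul_add_dom[of f "-1 *\<^sub>R f'" g] mul_scale_dom[of f' "-1" g] dom_scale[of f' "-1"] by simp

lemma mul_square_diff:
  assumes "v \<in> dom" "w \<in> dom" shows "v \<odot> v - w \<odot> w = (v + w) \<odot> (v - w)"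
  using assms by (simp add: mul_add_dom mul_diff mul_commute[of w v])

text \<open>\<open>max r 1\<close> provides a sup norm for one factor: for r = 0 this is the product
  bound in L^2, for r \<ge> 1 the algebra property. Induction on r, with the Leibniz rule
  distributing the new derivative.\<close>

lemma mul_hn:
  "\<exists>C\<ge>0. \<forall>a\<in>H (max r 1). \<forall>b\<in>H r. a \<odot> b \<in> H r \<and> hn r (a \<odot> b) \<le> C * hn (max r 1) a * hn r b"
proof (induction r)
  case 0
  have "hn 0 (a \<odot> b) \<le> 1 * hn 1 a * hn 0 b" if "a \<in> dom" for a b
    using norm_mul[OF that, of b] by (simp add: hn_def)
  then show ?case by (intro exI[of _ 1]) simp
next
  case (Suc r)
  then obtain C where C: "C \<ge> 0"
    "\<And>a b. a \<in> H (max r 1) ==> b \<in> H r ==> a \<odot> b \<in> H r \<and> hn r (a \<odot> b) \<le> C * hn (max r 1) a * hn r b"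
    by blast
  have 1: "max (Suc r) 1 = Suc r" by simp
  show ?case
  proof (intro exI[of _ "2 + 8 * C"] conjI ballI, unfold 1)
    fix a b assume a: "a \<in> H (Suc r)" and b: "b \<in> H (Suc r)"
    have ad: "a \<in> dom" "b \<in> dom" and Da: "D a \<in> H r" "D b \<in> H r" using a b by (auto simp: H_Suc)
    have a': "a \<in> H (max r 1)" "b \<in> H (max r 1)" using a b H_mono by auto
    have D: "D (a \<odot> b) = b \<odot> D a + a \<odot> D b" using D_mul[OF ad] by (simp add: mul_commute)
    have le: "hn (max r 1) a \<le> 2 * hn (Suc r) a" "hn (max r 1) b \<le> 2 * hn (Suc r) b"
      using hn_mono[OF a] hn_mono[OF b] by simp_all
    show "a \<odot> b \<in> H (Suc r)" using mul_dom[OF ad] D C(2)[OF a'(2) Da(1)] C(2)[OF a'(1) Da(2)] H_add by (simp add: H_Suc)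
    have 1: "hn r (b \<odot> D a) \<le> C * (2 * hn (Suc r) b) * (2 * hn (Suc r) a)"
      using C(2)[OF a'(2) Da(1)] by (rule conjunct2[THEN order_trans]) (intro mult_mono mult_nonneg_nonneg le hn_D a C(1) hn_nonneg order_refl; simp)
    have 2: "hn r (a \<odot> D b) \<le> C * (2 * hn (Suc r) a) * (2 * hn (Suc r) b)"
      using C(2)[OF a'(1) Da(2)] by (rule conjunct2[THEN order_trans]) (intro mult_mono mult_nonneg_nonneg le hn_D b C(1) hn_nonneg order_refl; simp)
    have 3: "norm (a \<odot> b) \<le> (2 * hn (Suc r) a) * hn (Suc r) b"
      using norm_mul[OF ad(1), of b] by (rule order_trans) (intro mult_mono norm_le_hn hn_mono[OF a]; simp)
    have "hn (Suc r) (a \<odot> b) \<le> norm (a \<odot> b) + hn r (D (a \<odot> b))" by (rule hn_Suc_le[OF mul_dom[OF ad]])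
    also have "hn r (D (a \<odot> b)) \<le> hn r (b \<odot> D a) + hn r (a \<odot> D b)"
      unfolding D using C(2)[OF a'(2) Da(1)] C(2)[OF a'(1) Da(2)] by (intro hn_add) auto
    finally show "hn (Suc r) (a \<odot> b) \<le> (2 + 8 * C) * hn (Suc r) a * hn (Suc r) b"
      using 1 2 3 by (simp add: algebra_simps)
  qed (use C in simp)
qed

lemma mul_H: "a \<in> H r ==> b \<in> H r ==> r \<ge> 1 ==> a \<odot> b \<in> H r"
  using mul_hn[of r] by (auto simp: max_def)

lemma mul_H': "a \<in> H (Suc r) ==> b \<in> H r ==> a \<odot> b \<in> H r"
  using mul_hn[of r] H_mono[of a "Suc r" "max r 1"] by auto

text \<open>The Leibniz rule puts the last derivative on one factor, and the algebra property of
  order r bounds both resulting products. Hence the top norm never occurs on both factors at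
  once.\<close>

lemma mul_tame:
  assumes "r \<ge> 1"
  shows "\<exists>C\<ge>0. \<forall>a\<in>H (Suc r). \<forall>b\<in>H (Suc r).
    hn (Suc r) (a \<odot> b) \<le> C * (hn (Suc r) a * hn r b + hn r a * hn (Suc r) b)"
proof -
  have mr: "max r 1 = r" using assms by simp
  obtain C where C: "C \<ge> 0"
    "\<And>a b. a \<in> H r ==> b \<in> H r ==> a \<odot> b \<in> H r \<and> hn r (a \<odot> b) \<le> C * hn r a * hn r b"
    using mul_hn[of r] unfolding mr by blast
  show ?thesis
  proof (intro exI[of _ "2 + 2 * C"] conjI ballI)
    fix a b assume a: "a \<in> H (Suc r)" and b: "b \<in> H (Suc r)"
    have ad: "a \<in> dom" "b \<in> dom" and Da: "D a \<in> H r" "D b \<in> H r" using a b by (auto simp: H_Suc)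
    have a': "a \<in> H r" "b \<in> H r" using a b H_mono by auto
    have D: "D (a \<odot> b) = b \<odot> D a + a \<odot> D b" using D_mul[OF ad] by (simp add: mul_commute)
    have 1: "hn r (b \<odot> D a) \<le> C * hn r b * (2 * hn (Suc r) a)"
      using C(2)[OF a'(2) Da(1)] by (rule conjunct2[THEN order_trans]) (intro mult_mono mult_nonneg_nonneg hn_D a C(1) hn_nonneg order_refl; simp)
    have 2: "hn r (a \<odot> D b) \<le> C * hn r a * (2 * hn (Suc r) b)"
      using C(2)[OF a'(1) Da(2)] by (rule conjunct2[THEN order_trans]) (intro mult_mono mult_nonneg_nonneg hn_D b C(1) hn_nonneg order_refl; simp)
    have 3: "norm (a \<odot> b) \<le> (2 * hn r a) * hn (Suc r) b"
      using norm_mul[OF ad(1), of b] by (rule order_trans) (intro mult_mono norm_le_hn hn_mono[OF a'(1)] assms; simp)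
    have "hn (Suc r) (a \<odot> b) \<le> norm (a \<odot> b) + hn r (D (a \<odot> b))" by (rule hn_Suc_le[OF mul_dom[OF ad]])
    also have "hn r (D (a \<odot> b)) \<le> hn r (b \<odot> D a) + hn r (a \<odot> D b)"
      unfolding D using C(2)[OF a'(2) Da(1)] C(2)[OF a'(1) Da(2)] by (intro hn_add) auto
    finally have "hn (Suc r) (a \<odot> b) \<le> 2 * (hn r a * hn (Suc r) b) + 2 * C * (hn (Suc r) a * hn r b + hn r a * hn (Suc r) b)"
      using 1 2 3 by (simp add: algebra_simps)
    also have "\<dots> \<le> 2 * (hn (Suc r) a * hn r b + hn r a * hn (Suc r) b) + 2 * C * (hn (Suc r) a * hn r b + hn r a * hn (Suc r) b)"
      by (simp add: mult_nonneg_nonneg)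
    finally show "hn (Suc r) (a \<odot> b) \<le> (2 + 2 * C) * (hn (Suc r) a * hn r b + hn r a * hn (Suc r) b)"
      by (simp add: algebra_simps)
  qed (use C in simp)
qed

lemma m_bound: "\<exists>C\<ge>0. \<forall>f. norm (m i f) \<le> C * norm f"
  using bounded_linear.nonneg_bounded[OF m_lin[of i]] by (metis mult.commute)

lemma m_add: "m i (f + g) = m i f + m i g" and m_scale: "m i (c *\<^sub>R f) = c *\<^sub>R m i f"
  and m_diff: "m i (f - g) = m i f - m i g" and m_0 [simp]: "m i 0 = 0"
  using bounded_linear.linear[OF m_lin[of i]] by (auto simp: linear_add linear_scale linear_diff linear_0)

text \<open>The induction runs over all i simultaneously, because D (m i f) contains
  \<open>m (Suc i) f\<close>.\<close>

lemma m_hn: "\<exists>C\<ge>0. \<forall>f\<in>H r. m i f \<in> H r \<and> hn r (m i f) \<le> C * hn r f"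
proof (induction r arbitrary: i)
  case 0
  obtain C where "C \<ge> 0" "\<And>f. norm (m i f) \<le> C * norm f" using m_bound by blast
  then show ?case by (intro exI[of _ C]) (simp add: hn_def)
next
  case (Suc r)
  obtain C where C: "C \<ge> 0" "\<And>f. f \<in> H r ==> m i f \<in> H r \<and> hn r (m i f) \<le> C * hn r f"
    using Suc[of i] by blast
  obtain C' where C': "C' \<ge> 0" "\<And>f. f \<in> H r ==> m (Suc i) f \<in> H r \<and> hn r (m (Suc i) f) \<le> C' * hn r f"
    using Suc[of "Suc i"] by blast
  obtain C0 where C0: "C0 \<ge> 0" "\<And>f. norm (m i f) \<le> C0 * norm f" using m_bound by blast
  show ?case
  proof (intro exI[of _ "C0 + 2 * C + 2 * C'"] conjI ballI)
    fix f assume f: "f \<in> H (Suc r)"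
    then have f': "f \<in> dom" "D f \<in> H r" "f \<in> H r" using f H_mono[OF f, of r] by (auto simp: H_Suc)
    have d: "D (m i f) = m (Suc i) f + m i (D f)" by (rule D_m[OF f'(1)])
    show "m i f \<in> H (Suc r)" using m_dom[OF f'(1)] d C(2)[OF f'(2)] C'(2)[OF f'(3)] H_add by (simp add: H_Suc)
    have "hn (Suc r) (m i f) \<le> norm (m i f) + hn r (D (m i f))" by (rule hn_Suc_le[OF m_dom[OF f'(1)]])
    also have "hn r (D (m i f)) \<le> hn r (m (Suc i) f) + hn r (m i (D f))"
      unfolding d using C(2)[OF f'(2)] C'(2)[OF f'(3)] by (intro hn_add) auto
    also have "hn r (m (Suc i) f) \<le> C' * (2 * hn (Suc r) f)"
      using C'(2)[OF f'(3)] hn_mono[OF f, of r] C'(1) by (meson mult_left_mono order_trans le_SucI order_refl)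
    also have "hn r (m i (D f)) \<le> C * (2 * hn (Suc r) f)"
      using C(2)[OF f'(2)] hn_D[OF f] C(1) by (meson mult_left_mono order_trans)
    also have "norm (m i f) \<le> C0 * hn (Suc r) f" using C0 norm_le_hn by (meson mult_left_mono order_trans)
    finally show "hn (Suc r) (m i f) \<le> (C0 + 2 * C + 2 * C') * hn (Suc r) f" by (simp add: algebra_simps)
  qed (use C C' C0 in simp)
qed

lemma m_H: "f \<in> H r ==> m i f \<in> H r" using m_hn[of r i] by blast

lemma D_sum: "(\<And>i. i \<in> A ==> x i \<in> dom) ==> (\<Sum>i\<in>A. x i) \<in> dom \<and> D (\<Sum>i\<in>A. x i) = (\<Sum>i\<in>A. D (x i))"
  by (induction A rule: infinite_finite_induct) (auto simp: D_add dom_add)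

text \<open>A telescoped Leibniz rule without binomial coefficients: whenever D passes f it leaves D
  f times a lower derivative of g, and the later derivatives stay outside, so that product bounds
  apply to each summand as a whole.\<close>

lemma Dp_mul_expand:
  assumes f: "f \<in> H N" and g: "g \<in> H N" and k: "k \<le> N"
  shows "(D ^^ k) (f \<odot> g) = f \<odot> (D ^^ k) g + (\<Sum>i<k. (D ^^ (k - 1 - i)) (D f \<odot> (D ^^ i) g))"
  using k
proof (induction k)
  case (Suc k)
  have fd: "f \<in> dom" using Suc.prems H_dom[OF f] by simp
  have gd: "(D ^^ k) g \<in> dom" using Dp_dom[OF g] Suc.prems by simp
  have mem: "D f \<odot> (D ^^ i) g \<in> H (N - 1 - i)" if "i < k" for i
  proof (rule mul_H)
    show "D f \<in> H (N - 1 - i)" using Dp_H'[OF f, of 1 "N - 1 - i"] that Suc.prems by simp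
    show "(D ^^ i) g \<in> H (N - 1 - i)" using Dp_H'[OF g, of i "N - 1 - i"] that Suc.prems by simp
    show "N - 1 - i \<ge> 1" using that Suc.prems by simp
  qed
  have dm: "(D ^^ (k - 1 - i)) (D f \<odot> (D ^^ i) g) \<in> dom" if "i < k" for i
    using Dp_dom[OF mem[OF that], of "k - 1 - i"] that Suc.prems by simp
  have "(D ^^ Suc k) (f \<odot> g) = D (f \<odot> (D ^^ k) g + (\<Sum>i<k. (D ^^ (k - 1 - i)) (D f \<odot> (D ^^ i) g)))"
    using Suc by simp
  also have "\<dots> = D f \<odot> (D ^^ k) g + f \<odot> (D ^^ Suc k) g + (\<Sum>i<k. D ((D ^^ (k - 1 - i)) (D f \<odot> (D ^^ i) g)))"
    using D_sum[of "{..<k}" "\<lambda>i. (D ^^ (k - 1 - i)) (D f \<odot> (D ^^ i) g)"] dm fd gd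
    by (simp add: D_add mul_dom D_mul)
  also have "(\<Sum>i<k. D ((D ^^ (k - 1 - i)) (D f \<odot> (D ^^ i) g))) = (\<Sum>i<k. (D ^^ (Suc k - 1 - i)) (D f \<odot> (D ^^ i) g))"
  proof (rule sum.cong)
    fix i assume "i \<in> {..<k}"
    then have "Suc k - 1 - i = Suc (k - 1 - i)" by auto
    then show "D ((D ^^ (k - 1 - i)) (D f \<odot> (D ^^ i) g)) = (D ^^ (Suc k - 1 - i)) (D f \<odot> (D ^^ i) g)" by simp
  qed simp
  finally show ?case by simp
qed simp

text \<open>In every summand of \<open>Dp_mul_expand\<close> at least one derivative sits on f, so
  at most N - 1 reach g. The pairing of order N on f with order N - 2 on g is what stays tame when g
  = D w is inserted.\<close>

lemma mul_commutator:
  assumes N: "N \<ge> 3"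
  shows "\<exists>C\<ge>0. \<forall>f\<in>H N. \<forall>g\<in>H N. norm ((D ^^ N) (f \<odot> g) - f \<odot> (D ^^ N) g)
      \<le> C * (hn N f * hn (N - 2) g + hn (N - 1) f * hn (N - 1) g)"
proof -
  have "\<exists>C. \<forall>r. C r \<ge> 0 \<and> (\<forall>a\<in>H (max r 1). \<forall>b\<in>H r. hn r (a \<odot> b) \<le> C r * hn (max r 1) a * hn r b)"
    using mul_hn by (intro choice) blast
  then obtain C where C0: "\<And>r. C r \<ge> 0"
    and C: "\<And>r a b. a \<in> H (max r 1) ==> b \<in> H r ==> hn r (a \<odot> b) \<le> C r * hn (max r 1) a * hn r b" by blast
  obtain C' where C': "C' \<ge> 0" "\<And>a b. a \<in> H (N - 1) ==> b \<in> H (N - 1) ==>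
    hn (N - 1) (a \<odot> b) \<le> C' * (hn (N - 1) a * hn (N - 2) b + hn (N - 2) a * hn (N - 1) b)"
  proof -
    have "1 \<le> N - 2" "Suc (N - 2) = N - 1" using N by auto
    then show ?thesis using mul_tame[of "N - 2"] that by auto
  qed
  define S where "S = (\<Sum>i<N. C (N - 1 - i))"
  have CS: "C (N - 1 - i) \<le> S" if "i < N" for i
    unfolding S_def using that C0 by (intro member_le_sum) auto
  have S0: "S \<ge> 0" unfolding S_def using C0 by (intro sum_nonneg) auto
  show ?thesis
  proof (intro exI[of _ "N * (8 * S + 2 * C')"] conjI ballI)
    fix f g assume f: "f \<in> H N" and g: "g \<in> H N"
    define B where "B = hn N f * hn (N - 2) g + hn (N - 1) f * hn (N - 1) g"
    have f1: "f \<in> H (N - 1)" using H_mono[OF f] by simp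
    have g1: "g \<in> H (N - 1)" using H_mono[OF g] by simp
    have Df: "D f \<in> H (N - 1)" using Dp_H'[OF f, of 1 "N - 1"] N by simp
    have B0: "hn (N - 1) f * hn (N - 1) g \<le> B" "B \<ge> 0" by (simp_all add: B_def)
    \<comment> \<open>Only i = 0 can put N derivatives on f, and it uses the tame product bound; for
      i > 0 order N - 1 suffices for both factors.\<close>
    have "norm ((D ^^ (N - 1 - i)) (D f \<odot> (D ^^ i) g)) \<le> (8 * S + 2 * C') * B" if i: "i < N" for i
    proof (cases "i = 0")
      case True
      have "norm ((D ^^ (N - 1)) (D f \<odot> g)) \<le> hn (N - 1) (D f \<odot> g)" by (simp add: hn_def)
      also have "\<dots> \<le> C' * (hn (N - 1) (D f) * hn (N - 2) g + hn (N - 2) (D f) * hn (N - 1) g)"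
        by (rule C'(2)[OF Df g1])
      also have "\<dots> \<le> C' * ((2 * hn N f) * hn (N - 2) g + (2 * hn (N - 1) f) * hn (N - 1) g)"
        using hn_Dp'[OF f, of 1 "N - 1"] hn_Dp'[OF f1, of 1 "N - 2"] N
        by (intro mult_left_mono add_mono mult_right_mono C'(1)) auto
      also have "\<dots> = 2 * C' * B" by (simp add: B_def algebra_simps)
      also have "\<dots> \<le> (8 * S + 2 * C') * B" using S0 B0(2) by (simp add: algebra_simps)
      finally show ?thesis using True by simp
    next
      case False
      define r where "r = N - 1 - i"
      have r: "i + r \<le> N - 1" "1 + max r 1 \<le> N - 1" using i False N by (auto simp: r_def)
      have a: "D f \<in> H (max r 1)" using H_mono[OF Df] r by simp
      have b: "(D ^^ i) g \<in> H r" using Dp_H'[OF g1 r(1)] .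
      have "norm ((D ^^ r) (D f \<odot> (D ^^ i) g)) \<le> hn r (D f \<odot> (D ^^ i) g)" by (simp add: hn_def)
      also have "\<dots> \<le> C r * hn (max r 1) (D f) * hn r ((D ^^ i) g)" by (rule C[OF a b])
      also have "\<dots> \<le> S * (2 * hn (N - 1) f) * (2 * hn (N - 1) g)"
        using hn_Dp'[OF f1 r(2)] hn_Dp'[OF g1 r(1)] CS[OF i] S0
        by (intro mult_mono mult_nonneg_nonneg) (auto simp: r_def)
      also have "\<dots> = 4 * S * (hn (N - 1) f * hn (N - 1) g)" by simp
      also have "\<dots> \<le> (8 * S + 2 * C') * B"
        using S0 B0 C'(1) by (intro mult_mono) auto
      finally show ?thesis by (simp add: r_def)
    qed
    then have "norm (\<Sum>i<N. (D ^^ (N - 1 - i)) (D f \<odot> (D ^^ i) g)) \<le> (\<Sum>i<N. (8 * S + 2 * C') * B)"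
      by (intro order_trans[OF norm_sum] sum_mono) auto
    then show "norm ((D ^^ N) (f \<odot> g) - f \<odot> (D ^^ N) g) \<le> N * (8 * S + 2 * C') * (hn N f * hn (N - 2) g + hn (N - 1) f * hn (N - 1) g)"
      using Dp_mul_expand[OF f g order_refl] by (simp add: B_def)
  qed (use S0 C'(1) in simp)
qed

text \<open>A derivative that falls on the coefficient turns m i into \<open>m (Suc i)\<close>,
  again a bounded operator, so the commutator of order N + 1 costs only N derivatives of g.\<close>

lemma m_commutator:
  "\<exists>C\<ge>0. \<forall>g\<in>H (Suc N). norm ((D ^^ Suc N) (m i g) - m i ((D ^^ Suc N) g)) \<le> C * hn N g"
proof (induction N)
  case 0
  obtain C where C: "C \<ge> 0" "\<And>f. norm (m (Suc i) f) \<le> C * norm f" using m_bound by blast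
  have "norm (m (Suc i) g) \<le> C * hn 0 g" for g
    using C norm_le_hn by (meson mult_left_mono order_trans)
  then show ?case using C(1) by (intro exI[of _ C]) (auto simp: D_m)
next
  case (Suc N)
  then obtain C where C: "C \<ge> 0"
    "\<And>g. g \<in> H (Suc N) ==> norm ((D ^^ Suc N) (m i g) - m i ((D ^^ Suc N) g)) \<le> C * hn N g" by blast
  obtain C' where C': "C' \<ge> 0" "\<And>f. f \<in> H (Suc N) ==> m (Suc i) f \<in> H (Suc N) \<and> hn (Suc N) (m (Suc i) f) \<le> C' * hn (Suc N) f"
    using m_hn[of "Suc N" "Suc i"] by blast
  show ?case
  proof (intro exI[of _ "2 * C + C'"] conjI ballI)
    fix g assume g: "g \<in> H (Suc (Suc N))"
    have g': "g \<in> dom" "D g \<in> H (Suc N)" "g \<in> H (Suc N)" using g H_mono[OF g, of "Suc N"] by (auto simp: H_Suc)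
    have "(D ^^ Suc (Suc N)) (m i g) = (D ^^ Suc N) (m (Suc i) g + m i (D g))"
      using D_m[OF g'(1)] by (metis funpow_Suc_right comp_apply)
    also have "\<dots> = (D ^^ Suc N) (m (Suc i) g) + (D ^^ Suc N) (m i (D g))"
      using g' by (intro Dp_add[of _ "Suc N"] m_H) auto
    finally have "(D ^^ Suc (Suc N)) (m i g) - m i ((D ^^ Suc (Suc N)) g)
      = (D ^^ Suc N) (m (Suc i) g) + ((D ^^ Suc N) (m i (D g)) - m i ((D ^^ Suc N) (D g)))"
      by (simp add: funpow_swap1)
    then have "norm ((D ^^ Suc (Suc N)) (m i g) - m i ((D ^^ Suc (Suc N)) g))
      \<le> norm ((D ^^ Suc N) (m (Suc i) g)) + norm ((D ^^ Suc N) (m i (D g)) - m i ((D ^^ Suc N) (D g)))"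
      by (metis norm_triangle_ineq)
    also have "\<dots> \<le> C' * hn (Suc N) g + C * hn N (D g)"
      using C(2)[OF g'(2)] C'(2)[OF g'(3)] norm_ge_zero[of "m (Suc i) g"] unfolding hn_def[of _ "m (Suc i) g"] by linarith
    also have "C * hn N (D g) \<le> C * (2 * hn (Suc N) g)" by (intro mult_left_mono hn_D g'(3) C(1))
    finally show "norm ((D ^^ Suc (Suc N)) (m i g) - m i ((D ^^ Suc (Suc N)) g)) \<le> (2 * C + C') * hn (Suc N) g"
      by (simp add: algebra_simps)
  qed (use C C' in simp)
qed

section \<open>The nonlinearity and its Lipschitz bounds\<close>

definition X :: "'a => 'a" where "X v = - D (D v) + 6 *\<^sub>R m 0 v + 3 *\<^sub>R (v \<odot> v)"
text \<open>\<open>X\<close> is the gradient of the energy \<open>E1\<close> below, so v' = F v is a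
  forced Hamiltonian equation with D as its skew operator. With the intended m and h,
  \<open>F v\<close> is - (v + W)''' + 6 (v + W)(v + W)'.\<close>

definition F :: "'a => 'a" where "F v = D (X v) + h"

lemma X_H: "v \<in> H (k + 2) ==> X v \<in> H k"
proof -
  assume v: "v \<in> H (k + 2)"
  have "D (D v) \<in> H k" using v by (simp add: H_Suc)
  moreover have "v \<in> H k" "v \<in> H (Suc k)" using H_mono[OF v] by auto
  ultimately show ?thesis
    unfolding X_def by (intro H_add H_minus H_scale m_H mul_H')
qed

lemma F_H: "v \<in> H (k + 3) ==> F v \<in> H k"
  using X_H[of v "Suc k"] unfolding F_def by (intro H_add) (auto simp: eval_nat_numeral H_Suc)

lemma X_diff:
  assumes "v \<in> H 2" "w \<in> H 2"
  shows "X v - X w = - D (D (v - w)) + 6 *\<^sub>R m 0 (v - w) + 3 *\<^sub>R ((v + w) \<odot> (v - w))"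
proof -
  have "v \<in> dom" "w \<in> dom" "D v \<in> dom" "D w \<in> dom" using assms by (auto simp: H_2)
  then show ?thesis
    unfolding X_def by (simp add: D_diff m_diff mul_square_diff[symmetric] scaleR_diff_right)
qed

lemma X_lipschitz:
  "\<exists>C\<ge>0. \<forall>v\<in>H (k + 2). \<forall>w\<in>H (k + 2). hn k (X v - X w) \<le> C * (1 + hn (k + 2) v + hn (k + 2) w) * hn (k + 2) (v - w)"
proof -
  obtain C where C: "C \<ge> 0" "\<And>f. f \<in> H k ==> m 0 f \<in> H k \<and> hn k (m 0 f) \<le> C * hn k f"
    using m_hn[of k 0] by blast
  obtain C' where C': "C' \<ge> 0" "\<And>a b. a \<in> H (max k 1) ==> b \<in> H k ==> a \<odot> b \<in> H k \<and> hn k (a \<odot> b) \<le> C' * hn (max k 1) a * hn k b"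
    using mul_hn[of k] by blast
  show ?thesis
  proof (intro exI[of _ "2 + 12 * C + 12 * C'"] conjI ballI)
    fix v w assume v: "v \<in> H (k + 2)" and w: "w \<in> H (k + 2)"
    define z where "z = v - w"
    have z: "z \<in> H (k + 2)" using H_diff[OF v w] by (simp add: z_def)
    have vw: "v + w \<in> H (k + 2)" using H_add[OF v w] .
    define Z where "Z = hn (k + 2) z"
    define P where "P = hn (k + 2) v + hn (k + 2) w"
    have zk: "z \<in> H k" "hn k z \<le> 2 * Z" and vwk: "v + w \<in> H (max k 1)" "hn (max k 1) (v + w) \<le> 2 * P"
      using H_mono[OF z] hn_mono[OF z] H_mono[OF vw] hn_mono[OF vw, of "max k 1"] hn_add[OF v w] by (auto simp: Z_def P_def)
    have Dz: "D (D z) \<in> H k" "hn k (D (D z)) \<le> 2 * Z"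
      using Dp_H'[OF z, of 2 k] hn_Dp'[OF z, of 2 k] by (auto simp: Z_def numeral_2_eq_2)
    have ZP: "Z \<ge> 0" "P \<ge> 0" by (auto simp: Z_def P_def)
    have e: "X v - X w = - D (D z) + 6 *\<^sub>R m 0 z + 3 *\<^sub>R ((v + w) \<odot> z)"
      using X_diff[of v w] H_mono[OF v, of 2] H_mono[OF w, of 2] by (simp add: z_def)
    have "hn k (X v - X w) \<le> hn k (- D (D z)) + hn k (6 *\<^sub>R m 0 z) + hn k (3 *\<^sub>R ((v + w) \<odot> z))"
      unfolding e using Dz(1) C(2)[OF zk(1)] C'(2)[OF vwk(1) zk(1)]
      by (intro order_trans[OF hn_add] add_mono order_refl hn_add H_add H_minus H_scale) auto
    also have "\<dots> = hn k (D (D z)) + 6 * hn k (m 0 z) + 3 * hn k ((v + w) \<odot> z)"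
      using Dz(1) C(2)[OF zk(1)] C'(2)[OF vwk(1) zk(1)] by (simp add: hn_minus hn_scale)
    also have "\<dots> \<le> 2 * Z + 6 * (C * (2 * Z)) + 3 * (C' * (2 * P) * (2 * Z))"
    proof (intro add_mono mult_left_mono)
      show "hn k (m 0 z) \<le> C * (2 * Z)" using C(2)[OF zk(1)] zk(2) C(1) by (meson mult_left_mono order_trans)
      have "hn k ((v + w) \<odot> z) \<le> C' * hn (max k 1) (v + w) * hn k z" using C'(2)[OF vwk(1) zk(1)] by blast
      also have "\<dots> \<le> C' * (2 * P) * (2 * Z)" using vwk zk C'(1) ZP by (intro mult_mono) auto
      finally show "hn k ((v + w) \<odot> z) \<le> C' * (2 * P) * (2 * Z)" .
    qed (use Dz in auto)
    also have "\<dots> \<le> (2 + 12 * C + 12 * C') * (1 + P) * Z"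
      using ZP C(1) C'(1) by (simp add: algebra_simps)
    finally show "hn k (X v - X w) \<le> (2 + 12 * C + 12 * C') * (1 + hn (k + 2) v + hn (k + 2) w) * hn (k + 2) (v - w)"
      by (simp add: Z_def P_def z_def add.assoc)
  qed (use C C' in simp)
qed

lemma F_lipschitz:
  "\<exists>C\<ge>0. \<forall>v\<in>H (k + 3). \<forall>w\<in>H (k + 3). hn k (F v - F w) \<le> C * (1 + hn (k + 3) v + hn (k + 3) w) * hn (k + 3) (v - w)"
proof -
  obtain C where C: "C \<ge> 0" "\<And>v w. v \<in> H (Suc k + 2) ==> w \<in> H (Suc k + 2) ==>
    hn (Suc k) (X v - X w) \<le> C * (1 + hn (Suc k + 2) v + hn (Suc k + 2) w) * hn (Suc k + 2) (v - w)"
    using X_lipschitz[of "Suc k"] by blast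
  show ?thesis
  proof (intro exI[of _ "2 * C"] conjI ballI)
    fix v w assume v: "v \<in> H (k + 3)" and w: "w \<in> H (k + 3)"
    have 3: "k + 3 = Suc k + 2" by simp
    have x: "X v \<in> H (Suc k)" "X w \<in> H (Suc k)" using X_H v w unfolding 3 by blast+
    have "hn k (F v - F w) = hn k (D (X v - X w))" using x by (simp add: F_def D_diff H_Suc)
    also have "\<dots> \<le> 2 * hn (Suc k) (X v - X w)" by (intro hn_D H_diff x)
    also have "\<dots> \<le> 2 * (C * (1 + hn (k + 3) v + hn (k + 3) w) * hn (k + 3) (v - w))"
      using C(2)[of v w] v w unfolding 3 by simp
    finally show "hn k (F v - F w) \<le> 2 * C * (1 + hn (k + 3) v + hn (k + 3) w) * hn (k + 3) (v - w)" by simp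
  qed (use C in simp)
qed

lemma F_0: "F 0 = h" by (simp add: F_def X_def)

lemma F_bound:
  "\<exists>C\<ge>0. \<forall>v\<in>H (k + 3). hn (k + 3) v \<le> A --> hn k (F v) \<le> C"
proof -
  obtain C where C: "C \<ge> 0" "\<And>v w. v \<in> H (k + 3) ==> w \<in> H (k + 3) ==>
    hn k (F v - F w) \<le> C * (1 + hn (k + 3) v + hn (k + 3) w) * hn (k + 3) (v - w)"
    using F_lipschitz[of k] by blast
  show ?thesis
  proof (intro exI[of _ "hn k h + C * (1 + \<bar>A\<bar>) * \<bar>A\<bar>"] conjI ballI impI)
    fix v assume v: "v \<in> H (k + 3)" and A: "hn (k + 3) v \<le> A"
    have "hn k (F v) = hn k (h + (F v - F 0))" by (simp add: F_0)
    also have "\<dots> \<le> hn k h + hn k (F v - F 0)" using F_H[OF v] F_H[OF H_0] by (intro hn_add H_diff) auto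
    also have "hn k (F v - F 0) \<le> C * (1 + hn (k + 3) v + hn (k + 3) 0) * hn (k + 3) (v - 0)" using v by (intro C) auto
    also have "\<dots> \<le> C * (1 + \<bar>A\<bar>) * \<bar>A\<bar>" using A C(1) by (auto intro!: mult_mono)
    finally show "hn k (F v) \<le> hn k h + C * (1 + \<bar>A\<bar>) * \<bar>A\<bar>" by simp
  qed (use C in simp)
qed


section \<open>Energy and difference estimates\<close>

lemma dom_diff: "f \<in> dom ==> g \<in> dom ==> f - g \<in> dom"
  using H_diff[of f 1 g] by simp

text \<open>Integration by parts against a self-adjoint multiplier moves the derivative from v to
  the coefficient. This and \<open>inner_mul_D\<close> are why transport terms lose no derivative in
  energy estimates.\<close>

lemma inner_m_D: assumes "v \<in> dom" shows "inner (m i v) (D v) = - inner (m (Suc i) v) v / 2"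
proof -
  have "inner (m i v) (D v) = - inner (D (m i v)) v"
    using D_skew[OF m_dom[OF assms] assms] by simp
  also have "\<dots> = - inner (m (Suc i) v) v - inner (m i v) (D v)"
    using assms m_adj[of i "D v" v] inner_commute[of "D v"] by (simp add: D_m inner_add_left)
  finally show ?thesis by simp
qed

lemma inner_mul_D: assumes "f \<in> dom" "g \<in> dom" shows "inner (f \<odot> g) (D g) = - inner (D f \<odot> g) g / 2"
proof -
  have "inner (f \<odot> g) (D g) = - inner (D (f \<odot> g)) g"
    using D_skew[OF mul_dom[OF assms] assms(2)] by simp
  also have "\<dots> = - inner (D f \<odot> g) g - inner (f \<odot> g) (D g)"
    using assms mul_adj[of f "D g" g] inner_commute[of "D g"] by (simp add: D_mul inner_add_left)
  finally show ?thesis by simp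
qed

lemma inner_cube: assumes "v \<in> dom" shows "inner (v \<odot> v) (D v) = 0"
  using inner_mul_D[OF assms assms] mul_adj[OF assms, of "D v" v] inner_commute[of "D v"]
  by (simp add: mul_commute[of "D v"])

lemma inner_DDD: assumes "w \<in> H 3" shows "inner (D (D (D w))) w = 0"
proof -
  have "w \<in> dom" "D w \<in> dom" "D (D w) \<in> dom" using assms by (auto simp: H_Suc numeral_3_eq_3)
  then show ?thesis using D_skew[of "D (D w)" w] inner_D_self[of "D w"] by (simp add: inner_commute)
qed

lemma DX:
  assumes "v \<in> H 3" shows "D (X v) = - D (D (D v)) + 6 *\<^sub>R D (m 0 v) + 6 *\<^sub>R (v \<odot> D v)"
proof -
  have v: "v \<in> dom" "D v \<in> dom" "D (D v) \<in> dom" using assms by (auto simp: H_Suc numeral_3_eq_3)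
  then have "D (v \<odot> v) = 2 *\<^sub>R (v \<odot> D v)" using D_mul[of v v] by (simp add: mul_commute scaleR_2)
  moreover have "- D (D v) \<in> dom" using dom_scale[OF v(3), of "-1"] by simp
  ultimately show ?thesis
    unfolding X_def using v by (simp add: D_add D_diff dom_add dom_diff dom_scale m_dom mul_dom D_minus D_scale)
qed

lemma X_dom: "v \<in> H 3 ==> X v \<in> dom" using X_H[of v 1] by (simp add: eval_nat_numeral)

lemma abs_inner_le: "norm f \<le> A ==> norm g \<le> B ==> \<bar>inner f g\<bar> \<le> A * B"
  by (meson Cauchy_Schwarz_ineq2 mult_mono norm_ge_zero order_trans)

text \<open>Dispersion and the nonlinear term drop out of the mass balance; there remain 3
  \<open>inner (m 1 v) v\<close>, the effect of W', and the forcing.\<close>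

lemma L2_estimate: "\<exists>C\<ge>0. \<forall>v\<in>H 3. \<bar>inner v (F v)\<bar> \<le> C * (1 + (norm v)\<^sup>2)"
proof -
  obtain C where C: "C \<ge> 0" "\<And>f. norm (m 1 f) \<le> C * norm f" using m_bound by blast
  show ?thesis
  proof (intro exI[of _ "3 * C + norm h"] conjI ballI)
    fix v assume v3: "v \<in> H 3"
    then have v: "v \<in> dom" "D v \<in> dom" "D (D v) \<in> dom" by (auto simp: H_Suc numeral_3_eq_3)
    have 1: "inner v (D (m 0 v)) = inner (m 1 v) v / 2"
      using D_skew[OF v(1) m_dom[OF v(1), of 0]] inner_m_D[OF v(1), of 0] by (simp add: inner_commute)
    have 2: "inner v (v \<odot> D v) = 0" using mul_adj[OF v(1), of v "D v"] inner_cube[OF v(1)] by simp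
    have "inner v (F v) = 3 * inner (m 1 v) v + inner v h"
      unfolding F_def DX[OF v3] using inner_DDD[OF v3] 1 2
      by (simp add: inner_add_right inner_diff_right inner_commute[of v "D (D (D v))"])
    then have "\<bar>inner v (F v)\<bar> \<le> 3 * \<bar>inner (m 1 v) v\<bar> + \<bar>inner v h\<bar>" by simp
    also have "\<dots> \<le> 3 * (C * norm v * norm v) + norm v * norm h"
      using C(2)[of v] by (intro add_mono mult_left_mono abs_inner_le) auto
    also have "norm v * norm h \<le> (1 + (norm v)\<^sup>2) * norm h"
    proof (rule mult_right_mono)
      have "2 * norm v \<le> 1 + (norm v)\<^sup>2" using zero_le_power2[of "norm v - 1"] unfolding power2_diff by simp
      then show "norm v \<le> 1 + (norm v)\<^sup>2" using norm_ge_zero[of v] by linarith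
    qed simp
    also have "3 * (C * norm v * norm v) \<le> 3 * C * (1 + (norm v)\<^sup>2)" using C(1) by (simp add: power2_eq_square algebra_simps)
    finally show "\<bar>inner v (F v)\<bar> \<le> (3 * C + norm h) * (1 + (norm v)\<^sup>2)" by (simp add: algebra_simps)
  qed (use C in simp)
qed

text \<open>The top-order part f D^(N+1) w is integrated by parts, the rest is
  \<open>mul_commutator\<close> with g = D w. Tameness matters: for f = w the bound is a multiple of
  hn (N - 1) w times (hn N w)^2, hence linear in the energy of order N.\<close>

lemma transport_estimate:
  assumes N: "N \<ge> 3"
  shows "\<exists>C\<ge>0. \<forall>f\<in>H N. \<forall>w\<in>H (Suc N). \<bar>inner ((D ^^ N) (f \<odot> D w)) ((D ^^ N) w)\<bar>
      \<le> C * (hn N f * hn (N - 1) w + hn (N - 1) f * hn N w) * hn N w"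
proof -
  obtain C where C: "C \<ge> 0" "\<And>f g. f \<in> H N ==> g \<in> H N ==> norm ((D ^^ N) (f \<odot> g) - f \<odot> (D ^^ N) g)
      \<le> C * (hn N f * hn (N - 2) g + hn (N - 1) f * hn (N - 1) g)"
    using mul_commutator[OF N] by blast
  show ?thesis
  proof (intro exI[of _ "2 + 2 * C"] conjI ballI)
    fix f w assume f: "f \<in> H N" and w: "w \<in> H (Suc N)"
    define z where "z = (D ^^ N) w"
    have z: "z \<in> dom" using Dp_dom[OF w] by (simp add: z_def)
    have fd: "f \<in> dom" using H_dom[OF f] N by simp
    have w': "w \<in> H N" "w \<in> H (N - 1)" "D w \<in> H N" using w H_mono[OF w] by (auto simp: H_Suc)
    have f': "f \<in> H (N - 1)" using H_mono[OF f] by simp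
    have Df: "D f \<in> dom" using Dp_dom[OF f, of 1] N by simp
    have zn: "norm z \<le> hn N w" by (simp add: z_def hn_def)
    have comm: "norm ((D ^^ N) (f \<odot> D w) - f \<odot> D z) \<le> 2 * C * (hn N f * hn (N - 1) w + hn (N - 1) f * hn N w)"
    proof -
      have "norm ((D ^^ N) (f \<odot> D w) - f \<odot> (D ^^ N) (D w)) \<le> C * (hn N f * hn (N - 2) (D w) + hn (N - 1) f * hn (N - 1) (D w))"
        by (rule C(2)[OF f w'(3)])
      also have "\<dots> \<le> C * (hn N f * (2 * hn (N - 1) w) + hn (N - 1) f * (2 * hn N w))"
        using hn_Dp'[OF w'(2), of 1 "N - 2"] hn_Dp'[OF w'(1), of 1 "N - 1"] N
        by (intro mult_left_mono add_mono C(1)) auto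
      finally show ?thesis by (simp add: z_def funpow_swap1 algebra_simps)
    qed
    have "inner (f \<odot> D z) z = - inner (D f \<odot> z) z / 2"
      using mul_adj[OF fd, of "D z" z] inner_mul_D[OF fd z] by (simp add: inner_commute)
    also have "\<bar>\<dots>\<bar> \<le> hn 1 (D f) * norm z * norm z / 2"
      using abs_inner_le[OF norm_mul[OF Df, of z] order_refl[of "norm z"]] by simp
    also have "hn 1 (D f) \<le> 4 * hn (N - 1) f"
    proof -
      have "2 \<le> N - 1" "f \<in> H 2" using H_mono[OF f, of 2] N by auto
      then have "hn 1 (D f) \<le> 2 * hn 2 f" "hn 2 f \<le> 2 * hn (N - 1) f"
        using hn_Dp'[of f 2 1 1] hn_mono[OF f', of 2] by simp_all
      then show ?thesis by linarith
    qed
    then have "hn 1 (D f) * norm z * norm z / 2 \<le> (4 * hn (N - 1) f) * hn N w * hn N w / 2"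
      by (intro divide_right_mono mult_mono zn) auto
    finally have 1: "\<bar>inner (f \<odot> D z) z\<bar> \<le> 2 * (hn (N - 1) f * hn N w) * hn N w" by (simp add: ac_simps)
    also have "\<dots> \<le> 2 * (hn N f * hn (N - 1) w + hn (N - 1) f * hn N w) * hn N w"
      by (intro mult_right_mono mult_left_mono) auto
    finally have 1: "\<bar>inner (f \<odot> D z) z\<bar> \<le> 2 * (hn N f * hn (N - 1) w + hn (N - 1) f * hn N w) * hn N w" .
    have 2: "\<bar>inner ((D ^^ N) (f \<odot> D w) - f \<odot> D z) z\<bar> \<le> 2 * C * (hn N f * hn (N - 1) w + hn (N - 1) f * hn N w) * hn N w"
      by (rule abs_inner_le[OF comm zn])
    have "inner ((D ^^ N) (f \<odot> D w)) z = inner ((D ^^ N) (f \<odot> D w) - f \<odot> D z) z + inner (f \<odot> D z) z"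
      by (simp add: inner_diff_left)
    then have "\<bar>inner ((D ^^ N) (f \<odot> D w)) z\<bar> \<le> \<bar>inner ((D ^^ N) (f \<odot> D w) - f \<odot> D z) z\<bar> + \<bar>inner (f \<odot> D z) z\<bar>"
      by simp
    then show "\<bar>inner ((D ^^ N) (f \<odot> D w)) ((D ^^ N) w)\<bar>
      \<le> (2 + 2 * C) * (hn N f * hn (N - 1) w + hn (N - 1) f * hn N w) * hn N w"
      using 1 2 by (simp add: z_def algebra_simps)
  qed (use C in simp)
qed

text \<open>D^N D (W w) is W D^(N+1) w plus terms with at most N derivatives of w; for the former,
  integration by parts leaves the coefficient W'.\<close>

lemma potential_estimate:
  assumes N: "N \<ge> 1"
  shows "\<exists>C\<ge>0. \<forall>w\<in>H (Suc N). \<bar>inner ((D ^^ N) (D (m 0 w))) ((D ^^ N) w)\<bar> \<le> C * (hn N w)\<^sup>2"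
proof -
  obtain C where C: "C \<ge> 0" "\<And>g. g \<in> H (Suc (N - 1)) ==>
      norm ((D ^^ Suc (N - 1)) (m 0 g) - m 0 ((D ^^ Suc (N - 1)) g)) \<le> C * hn (N - 1) g"
    using m_commutator[of "N - 1" 0] by blast
  have S: "Suc (N - 1) = N" using N by simp
  obtain C1 where C1: "C1 \<ge> 0" "\<And>f. f \<in> H N ==> m 1 f \<in> H N \<and> hn N (m 1 f) \<le> C1 * hn N f"
    using m_hn[of N 1] by blast
  obtain C2 where C2: "C2 \<ge> 0" "\<And>f. norm (m 1 f) \<le> C2 * norm f" using m_bound by blast
  show ?thesis
  proof (intro exI[of _ "2 * C + C1 + C2"] conjI ballI)
    fix w assume w: "w \<in> H (Suc N)"
    define z where "z = (D ^^ N) w"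
    have z: "z \<in> dom" using Dp_dom[OF w] by (simp add: z_def)
    have w': "w \<in> dom" "w \<in> H N" "D w \<in> H N" using w H_mono[OF w] by (auto simp: H_Suc)
    have zn: "norm z \<le> hn N w" by (simp add: z_def hn_def)
    have e: "(D ^^ N) (D (m 0 w)) = (D ^^ N) (m 1 w) + ((D ^^ N) (m 0 (D w)) - m 0 (D z)) + m 0 (D z)"
      using Dp_add[of "m 1 w" N "m 0 (D w)" N] C1(2)[OF w'(2)] m_H[OF w'(3), of 0] D_m[OF w'(1), of 0] by simp
    have 1: "\<bar>inner ((D ^^ N) (m 1 w)) z\<bar> \<le> C1 * hn N w * hn N w"
      using C1(2)[OF w'(2)] norm_ge_zero[of "m 1 w"] zn unfolding hn_def[of _ "m 1 w"] by (intro abs_inner_le) linarith+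
    have 2: "\<bar>inner ((D ^^ N) (m 0 (D w)) - m 0 (D z)) z\<bar> \<le> (2 * C * hn N w) * hn N w"
    proof (rule abs_inner_le[OF _ zn])
      have "norm ((D ^^ N) (m 0 (D w)) - m 0 (D z)) \<le> C * hn (N - 1) (D w)"
        using C(2)[unfolded S, OF w'(3)] by (simp add: z_def funpow_swap1)
      also have "\<dots> \<le> C * (2 * hn N w)" using hn_Dp'[OF w'(2), of 1 "N - 1"] N C(1) by (intro mult_left_mono) auto
      finally show "norm ((D ^^ N) (m 0 (D w)) - m 0 (D z)) \<le> 2 * C * hn N w" by simp
    qed
    have "inner (m 0 (D z)) z = - inner (m 1 z) z / 2" using inner_m_D[OF z, of 0] m_adj[of 0 "D z" z] by (simp add: inner_commute)
    also have "\<bar>\<dots>\<bar> \<le> C2 * hn N w * hn N w"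
    proof -
      have "norm (m 1 z) \<le> C2 * hn N w" using C2 zn by (meson mult_left_mono order_trans)
      then have "\<bar>inner (m 1 z) z\<bar> \<le> C2 * hn N w * hn N w" by (rule abs_inner_le[OF _ zn])
      then show ?thesis by simp
    qed
    finally have 3: "\<bar>inner (m 0 (D z)) z\<bar> \<le> C2 * hn N w * hn N w" .
    show "\<bar>inner ((D ^^ N) (D (m 0 w))) ((D ^^ N) w)\<bar> \<le> (2 * C + C1 + C2) * (hn N w)\<^sup>2"
      unfolding z_def[symmetric] e inner_add_left using 1 2 3 by (simp add: power2_eq_square algebra_simps)
  qed (use C C1 C2 in simp)
qed

lemma Dp_DDD: assumes "w \<in> H (N + 3)" shows "inner ((D ^^ N) (D (D (D w)))) ((D ^^ N) w) = 0"
proof -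
  have "(D ^^ N) w \<in> H 3" using Dp_H[OF assms] .
  from inner_DDD[OF this] show ?thesis by (simp add: funpow_swap1)
qed

text \<open>The transport estimate with f = w = v. The growth rate involves only order N - 1, so a
  bound there makes the inequality linear in the energy; the summands 1 absorb the forcing and the
  linear terms.\<close>

lemma energy_estimate:
  assumes N: "N \<ge> 3"
  shows "\<exists>C\<ge>0. \<forall>v\<in>H (N + 3). \<bar>inner ((D ^^ N) (F v)) ((D ^^ N) v)\<bar> \<le> C * (1 + hn (N - 1) v) * (1 + hn N v)\<^sup>2"
proof -
  obtain C where C: "C \<ge> 0" "\<And>f w. f \<in> H N ==> w \<in> H (Suc N) ==> \<bar>inner ((D ^^ N) (f \<odot> D w)) ((D ^^ N) w)\<bar>
      \<le> C * (hn N f * hn (N - 1) w + hn (N - 1) f * hn N w) * hn N w"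
    using transport_estimate[OF N] by blast
  obtain C1 where C1: "C1 \<ge> 0" "\<And>w. w \<in> H (Suc N) ==> \<bar>inner ((D ^^ N) (D (m 0 w))) ((D ^^ N) w)\<bar> \<le> C1 * (hn N w)\<^sup>2"
    using potential_estimate[of N] N by auto
  show ?thesis
  proof (intro exI[of _ "hn N h + 6 * C1 + 12 * C"] conjI ballI)
    fix v assume v: "v \<in> H (N + 3)"
    define z where "z = (D ^^ N) v"
    have zn: "norm z \<le> hn N v" by (simp add: z_def hn_def)
    have v': "v \<in> H 3" "v \<in> H (Suc N)" "v \<in> H N" "v \<in> dom" "D v \<in> H N" "D (D (D v)) \<in> H N" "D (m 0 v) \<in> H N" "v \<odot> D v \<in> H N"
    proof -
      show v1: "v \<in> H 3" "v \<in> H (Suc N)" "v \<in> H N" using H_mono[OF v] by auto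
      then show "v \<in> dom" "D v \<in> H N" by (auto simp: H_Suc)
      then show "v \<odot> D v \<in> H N" using v1 N by (intro mul_H) auto
      show "D (D (D v)) \<in> H N" using v by (simp add: numeral_3_eq_3 H_Suc)
      show "D (m 0 v) \<in> H N" using m_H[OF v1(2), of 0] by (simp add: H_Suc)
    qed
    have "(D ^^ N) (F v) = - (D ^^ N) (D (D (D v))) + 6 *\<^sub>R (D ^^ N) (D (m 0 v)) + 6 *\<^sub>R (D ^^ N) (v \<odot> D v) + (D ^^ N) h"
      unfolding F_def DX[OF v'(1)] using v'
      by (simp add: Dp_add[of _ N] Dp_scale[of _ N] Dp_minus[of _ N] Dp_diff[of _ N] H_add H_scale H_minus H_diff)
    then have "inner ((D ^^ N) (F v)) z = 6 * inner ((D ^^ N) (D (m 0 v))) z + 6 * inner ((D ^^ N) (v \<odot> D v)) z + inner ((D ^^ N) h) z"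
      using Dp_DDD[OF v] by (simp add: inner_add_left inner_diff_left z_def)
    then have "\<bar>inner ((D ^^ N) (F v)) z\<bar> \<le> 6 * \<bar>inner ((D ^^ N) (D (m 0 v))) z\<bar> + 6 * \<bar>inner ((D ^^ N) (v \<odot> D v)) z\<bar> + \<bar>inner ((D ^^ N) h) z\<bar>"
      by linarith
    also have "\<dots> \<le> 6 * (C1 * (hn N v)\<^sup>2) + 6 * (C * (hn N v * hn (N - 1) v + hn (N - 1) v * hn N v) * hn N v) + hn N h * hn N v"
      unfolding z_def by (intro add_mono mult_left_mono C1(2) C(2) v' abs_inner_le) (auto simp: hn_def)
    also have "\<dots> = 6 * C1 * (hn N v)\<^sup>2 + 12 * C * hn (N - 1) v * (hn N v)\<^sup>2 + hn N h * hn N v"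
      by (simp add: power2_eq_square algebra_simps)
    also have "\<dots> \<le> 6 * C1 * ((1 + hn (N - 1) v) * (1 + hn N v)\<^sup>2) + 12 * C * ((1 + hn (N - 1) v) * (1 + hn N v)\<^sup>2) + hn N h * ((1 + hn (N - 1) v) * (1 + hn N v)\<^sup>2)"
    proof -
      have a: "(hn N v)\<^sup>2 \<le> (1 + hn N v)\<^sup>2" "hn N v \<le> (1 + hn N v)\<^sup>2"
        by (auto simp: power2_sum)
      have b: "(hn N v)\<^sup>2 \<le> (1 + hn (N - 1) v) * (1 + hn N v)\<^sup>2" "hn N v \<le> (1 + hn (N - 1) v) * (1 + hn N v)\<^sup>2"
        using mult_mono[of 1 "1 + hn (N - 1) v" _ "(1 + hn N v)\<^sup>2"] a by auto
      have c: "hn (N - 1) v * (hn N v)\<^sup>2 \<le> (1 + hn (N - 1) v) * (1 + hn N v)\<^sup>2"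
        using a by (intro mult_mono) auto
      show ?thesis using b c C(1) C1(1) by (intro add_mono) (auto intro!: mult_left_mono simp: mult.assoc)
    qed
    finally show "\<bar>inner ((D ^^ N) (F v)) ((D ^^ N) v)\<bar> \<le> (hn N h + 6 * C1 + 12 * C) * (1 + hn (N - 1) v) * (1 + hn N v)\<^sup>2"
      by (simp add: z_def algebra_simps)
  qed (use C C1 in simp)
qed

text \<open>With w = p - q one has p p' - q q' = w w' + q w' + w q'. The first two products have the
  derivative on w and fall under the transport estimate; only w q' differentiates q.\<close>

lemma F_diff:
  assumes "p \<in> H 3" "q \<in> H 3"
  shows "F p - F q = - D (D (D (p - q))) + 6 *\<^sub>R D (m 0 (p - q))
     + 6 *\<^sub>R ((p - q) \<odot> D (p - q) + q \<odot> D (p - q) + (p - q) \<odot> D q)"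
proof -
  have p: "p \<in> dom" "D p \<in> dom" "D (D p) \<in> dom" using assms(1) by (auto simp: H_Suc numeral_3_eq_3)
  have q: "q \<in> dom" "D q \<in> dom" "D (D q) \<in> dom" using assms(2) by (auto simp: H_Suc numeral_3_eq_3)
  show ?thesis
    unfolding F_def DX[OF assms(1)] DX[OF assms(2)] using p q
    by (simp add: D_diff m_diff m_dom mul_diff_dom mul_diff scaleR_diff_right scaleR_add_right)
qed

text \<open>The quadratic term is kept in divergence form D ((p + q) w). Integration by parts leaves
  the derivative of p + q as a coefficient, so the L^2 distance obeys a closed estimate.\<close>

lemma difference_estimate0:
  "\<exists>C\<ge>0. \<forall>p\<in>H 3. \<forall>q\<in>H 3. \<bar>inner (F p - F q) (p - q)\<bar> \<le> C * (1 + hn 3 p + hn 3 q) * (norm (p - q))\<^sup>2"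
proof -
  obtain C where C: "C \<ge> 0" "\<And>f. norm (m 1 f) \<le> C * norm f" using m_bound by blast
  show ?thesis
  proof (intro exI[of _ "3 * C + 6"] conjI ballI)
    fix p q assume p: "p \<in> H 3" and q: "q \<in> H 3"
    define w where "w = p - q"
    define S where "S = p + q"
    have w: "w \<in> H 3" "S \<in> H 3" using H_diff[OF p q] H_add[OF p q] by (simp_all add: w_def S_def)
    have wd: "w \<in> dom" "D w \<in> dom" "S \<in> dom" "D S \<in> dom" "D (D w) \<in> dom" using w by (auto simp: H_Suc numeral_3_eq_3)
    have p2: "p \<in> H 2" "q \<in> H 2" using H_mono[OF p] H_mono[OF q] by auto
    have "F p - F q = D (X p - X q)" using X_dom[OF p] X_dom[OF q] by (simp add: F_def D_diff)
    also have "X p - X q = - D (D w) + 6 *\<^sub>R m 0 w + 3 *\<^sub>R (S \<odot> w)" using X_diff[OF p2] by (simp add: w_def S_def)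
    also have "D \<dots> = - D (D (D w)) + 6 *\<^sub>R D (m 0 w) + 3 *\<^sub>R D (S \<odot> w)"
      using wd dom_scale[OF wd(5), of "-1"] by (simp add: D_add D_diff dom_add dom_diff dom_scale m_dom mul_dom D_minus D_scale)
    finally have e: "F p - F q = - D (D (D w)) + 6 *\<^sub>R D (m 0 w) + 3 *\<^sub>R D (S \<odot> w)" .
    have 1: "inner (D (m 0 w)) w = inner (m 1 w) w / 2"
      using D_skew[OF m_dom[OF wd(1), of 0] wd(1)] inner_m_D[OF wd(1), of 0] by simp
    have 2: "inner (D (S \<odot> w)) w = inner (D S \<odot> w) w / 2"
      using D_skew[OF mul_dom[OF wd(3,1)] wd(1)] inner_mul_D[OF wd(3,1)] by simp
    have "inner (F p - F q) w = 3 * inner (m 1 w) w + (3/2) * inner (D S \<odot> w) w"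
      unfolding e using inner_DDD[OF w(1)] 1 2 by (simp add: inner_add_left inner_diff_left)
    then have "\<bar>inner (F p - F q) w\<bar> \<le> 3 * \<bar>inner (m 1 w) w\<bar> + (3/2) * \<bar>inner (D S \<odot> w) w\<bar>" by (simp add: abs_mult)
    also have "\<dots> \<le> 3 * (C * norm w * norm w) + (3/2) * (hn 1 (D S) * norm w * norm w)"
      using C(2) by (intro add_mono mult_left_mono abs_inner_le norm_mul wd) auto
    also have "\<dots> = (3 * C + (3/2) * hn 1 (D S)) * (norm w)\<^sup>2" by (simp add: power2_eq_square algebra_simps)
    also have "\<dots> \<le> ((3 * C + 6) * (1 + hn 3 p + hn 3 q)) * (norm w)\<^sup>2"
    proof (rule mult_right_mono)
      have "hn 1 (D S) \<le> 2 * (hn 3 p + hn 3 q)" using hn_Dp'[OF w(2), of 1 1] hn_add[OF p q] by (simp add: S_def)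
      moreover have "3 * C \<le> 3 * C * (1 + hn 3 p + hn 3 q)" using C(1) by (simp add: algebra_simps)
      ultimately show "3 * C + (3/2) * hn 1 (D S) \<le> (3 * C + 6) * (1 + hn 3 p + hn 3 q)"
        unfolding distrib_right[of "3 * C" 6] using hn_nonneg[of 3 p] hn_nonneg[of 3 q] by argo
    qed simp
    finally show "\<bar>inner (F p - F q) (p - q)\<bar> \<le> (3 * C + 6) * (1 + hn 3 p + hn 3 q) * (norm (p - q))\<^sup>2" by (simp add: w_def)
  qed (use C in simp)
qed

text \<open>Only the term \<open>w \<odot> D^(N+1) q\<close> loses a derivative; it is kept separate since it is small when
  \<open>w\<close> is small in a weaker norm.\<close>

lemma difference_estimate:
  assumes N: "N \<ge> 3"
  shows "\<exists>C\<ge>0. \<forall>p\<in>H (N + 3). \<forall>q\<in>H (N + 3). \<bar>inner ((D ^^ N) (F p - F q)) ((D ^^ N) (p - q))\<bar>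
      \<le> C * (1 + hn N p + hn N q) * (hn N (p - q))\<^sup>2 + 6 * norm ((p - q) \<odot> (D ^^ Suc N) q) * hn N (p - q)"
proof -
  obtain C where C: "C \<ge> 0" "\<And>f w. f \<in> H N ==> w \<in> H (Suc N) ==> \<bar>inner ((D ^^ N) (f \<odot> D w)) ((D ^^ N) w)\<bar>
      \<le> C * (hn N f * hn (N - 1) w + hn (N - 1) f * hn N w) * hn N w"
    using transport_estimate[OF N] by blast
  have C': "\<bar>inner ((D ^^ N) (f \<odot> D w)) ((D ^^ N) w)\<bar> \<le> 4 * C * hn N f * (hn N w)\<^sup>2" if "f \<in> H N" "w \<in> H (Suc N)" for f w
  proof -
    have w: "w \<in> H N" using H_mono[OF that(2)] by simp
    have "\<bar>inner ((D ^^ N) (f \<odot> D w)) ((D ^^ N) w)\<bar> \<le> C * (hn N f * hn (N - 1) w + hn (N - 1) f * hn N w) * hn N w" by (rule C(2)[OF that])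
    also have "\<dots> \<le> C * (hn N f * (2 * hn N w) + (2 * hn N f) * hn N w) * hn N w"
      using hn_mono[OF w, of "N - 1"] hn_mono[OF that(1), of "N - 1"] C(1)
      by (intro mult_mono mult_left_mono add_mono order_refl) auto
    finally show ?thesis by (simp add: power2_eq_square algebra_simps)
  qed
  obtain C1 where C1: "C1 \<ge> 0" "\<And>w. w \<in> H (Suc N) ==> \<bar>inner ((D ^^ N) (D (m 0 w))) ((D ^^ N) w)\<bar> \<le> C1 * (hn N w)\<^sup>2"
    using potential_estimate[of N] N by auto
  obtain C2 where C2: "C2 \<ge> 0" "\<And>f g. f \<in> H N ==> g \<in> H N ==> norm ((D ^^ N) (f \<odot> g) - f \<odot> (D ^^ N) g)
      \<le> C2 * (hn N f * hn (N - 2) g + hn (N - 1) f * hn (N - 1) g)"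
    using mul_commutator[OF N] by blast
  show ?thesis
  proof (intro exI[of _ "6 * C1 + 48 * C + 48 * C2"] conjI ballI)
    fix p q assume p: "p \<in> H (N + 3)" and q: "q \<in> H (N + 3)"
    define w where "w = p - q"
    define z where "z = (D ^^ N) w"
    define Y where "Y = hn N w"
    define P where "P = 1 + hn N p + hn N q"
    have Y0: "Y \<ge> 0" by (simp add: Y_def)
    have w: "w \<in> H (N + 3)" using H_diff[OF p q] by (simp add: w_def)
    have zn: "norm z \<le> Y" by (simp add: z_def hn_def Y_def)
    have w': "w \<in> H 3" "w \<in> H (Suc N)" "w \<in> H N" "w \<in> dom" "D w \<in> H N" "D (D (D w)) \<in> H N" "D (m 0 w) \<in> H N" "w \<odot> D w \<in> H N"
      and q': "q \<in> H N" "q \<in> H (Suc N)" "D q \<in> H N" "q \<odot> D w \<in> H N" "w \<odot> D q \<in> H N"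
    proof -
      show v1: "w \<in> H 3" "w \<in> H (Suc N)" "w \<in> H N" "q \<in> H N" "q \<in> H (Suc N)" using H_mono[OF w] H_mono[OF q] by auto
      then show d: "w \<in> dom" "D w \<in> H N" "D q \<in> H N" by (auto simp: H_Suc)
      then show "w \<odot> D w \<in> H N" "q \<odot> D w \<in> H N" "w \<odot> D q \<in> H N" using v1 N by (auto intro!: mul_H)
      show "D (D (D w)) \<in> H N" using w by (simp add: numeral_3_eq_3 H_Suc)
      show "D (m 0 w) \<in> H N" using m_H[OF v1(2), of 0] by (simp add: H_Suc)
    qed
    have pN: "p \<in> H N" using H_mono[OF p] by simp
    have Ywp: "Y \<le> P" using hn_diff[OF pN q'(1)] by (simp add: Y_def P_def w_def)
    have qP: "hn N q \<le> P" by (simp add: P_def)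
    have P1: "P \<ge> 1" by (simp add: P_def)
    have e: "(D ^^ N) (F p - F q) = - (D ^^ N) (D (D (D w))) + 6 *\<^sub>R (D ^^ N) (D (m 0 w))
        + 6 *\<^sub>R ((D ^^ N) (w \<odot> D w) + (D ^^ N) (q \<odot> D w) + (D ^^ N) (w \<odot> D q))"
      using F_diff[of p q] H_mono[OF p, of 3] H_mono[OF q, of 3] w' q' unfolding w_def[symmetric]
      by (simp add: Dp_add[of _ N] Dp_scale[of _ N] Dp_minus[of _ N] Dp_diff[of _ N] H_add H_scale H_minus H_diff)
    have i: "inner ((D ^^ N) (F p - F q)) z = 6 * inner ((D ^^ N) (D (m 0 w))) z
        + 6 * (inner ((D ^^ N) (w \<odot> D w)) z + inner ((D ^^ N) (q \<odot> D w)) z + inner ((D ^^ N) (w \<odot> D q)) z)"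
      unfolding e using Dp_DDD[OF w] by (simp add: inner_add_left inner_diff_left z_def)
    have 1: "\<bar>inner ((D ^^ N) (D (m 0 w))) z\<bar> \<le> C1 * P * Y\<^sup>2"
    proof -
      have "C1 * Y\<^sup>2 * 1 \<le> C1 * Y\<^sup>2 * P" using P1 C1(1) by (intro mult_left_mono) auto
      then show ?thesis using C1(2)[OF w'(2)] by (simp add: z_def Y_def algebra_simps)
    qed
    have 2: "\<bar>inner ((D ^^ N) (f \<odot> D w)) z\<bar> \<le> 4 * C * P * Y\<^sup>2" if "f \<in> H N" "hn N f \<le> P" for f
    proof -
      have "4 * C * hn N f * Y\<^sup>2 \<le> 4 * C * P * Y\<^sup>2" using that(2) C(1) by (intro mult_right_mono mult_left_mono) auto
      then show ?thesis using C'[OF that(1) w'(2)] by (simp add: z_def Y_def)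
    qed
    note 2 = this[OF w'(3)] this[OF q'(1) qP]
    \<comment> \<open>The commutator estimate splits off w times D^(N+1) q, the single term with
      more than N derivatives on q.\<close>
    have 3: "\<bar>inner ((D ^^ N) (w \<odot> D q)) z\<bar> \<le> 8 * C2 * P * Y\<^sup>2 + norm (w \<odot> (D ^^ Suc N) q) * Y"
    proof -
      have wN: "w \<in> H (N - 1)" and qN: "q \<in> H (N - 1)" using H_mono[OF w'(3)] H_mono[OF q'(1)] by auto
      have "norm ((D ^^ N) (w \<odot> D q) - w \<odot> (D ^^ N) (D q)) \<le> C2 * (hn N w * hn (N - 2) (D q) + hn (N - 1) w * hn (N - 1) (D q))"
        by (rule C2(2)[OF w'(3) q'(3)])
      also have "\<dots> \<le> C2 * (Y * (4 * P) + (2 * Y) * (2 * P))"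
      proof (intro mult_left_mono add_mono mult_mono C2(1))
        have 0: "hn (N - 1) (D q) \<le> 2 * hn N q" using hn_Dp'[OF q'(1), of 1 "N - 1"] N by simp
        have "hn (N - 2) (D q) \<le> 2 * hn N q" using hn_Dp'[OF q'(1), of 1 "N - 2"] N by simp
        then show "hn (N - 2) (D q) \<le> 4 * P" using qP P1 by linarith
        show "hn (N - 1) (D q) \<le> 2 * P" using 0 qP by linarith
        show "hn (N - 1) w \<le> 2 * Y" using hn_mono[OF w'(3), of "N - 1"] by (simp add: Y_def)
      qed (auto simp: Y_def)
      finally have a: "norm ((D ^^ N) (w \<odot> D q) - w \<odot> (D ^^ Suc N) q) \<le> 8 * C2 * P * Y"
        by (simp add: funpow_swap1 algebra_simps)
      have "\<bar>inner ((D ^^ N) (w \<odot> D q) - w \<odot> (D ^^ Suc N) q) z\<bar> \<le> 8 * C2 * P * Y * Y" by (rule abs_inner_le[OF a zn])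
      moreover have "\<bar>inner (w \<odot> (D ^^ Suc N) q) z\<bar> \<le> norm (w \<odot> (D ^^ Suc N) q) * Y" by (rule abs_inner_le[OF order_refl zn])
      ultimately show ?thesis by (simp add: inner_diff_left power2_eq_square)
    qed
    have "\<bar>inner ((D ^^ N) (F p - F q)) z\<bar> \<le> 6 * (C1 * P * Y\<^sup>2) + 6 * (4 * C * P * Y\<^sup>2 + 4 * C * P * Y\<^sup>2 + (8 * C2 * P * Y\<^sup>2 + norm (w \<odot> (D ^^ Suc N) q) * Y))"
    proof -
      have tri: "\<bar>6 * a + 6 * (b + c + d)\<bar> \<le> 6 * a' + 6 * (b' + c' + d')"
        if "\<bar>a\<bar> \<le> a'" "\<bar>b\<bar> \<le> b'" "\<bar>c\<bar> \<le> c'" "\<bar>d\<bar> \<le> d'" for a b c d a' b' c' d' :: real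
        using that unfolding abs_le_iff by (auto simp: algebra_simps)
      show ?thesis unfolding i by (rule tri[OF 1 2(1)[folded Y_def, OF Ywp] 2(2) 3])
    qed
    also have "\<dots> \<le> (6 * C1 + 48 * C + 48 * C2) * P * Y\<^sup>2 + 6 * norm (w \<odot> (D ^^ Suc N) q) * Y" by (simp add: algebra_simps)
    finally have "\<bar>inner ((D ^^ N) (F p - F q)) z\<bar> \<le> (6 * C1 + 48 * C + 48 * C2) * P * Y\<^sup>2 + 6 * norm (w \<odot> (D ^^ Suc N) q) * Y" .
    then show "\<bar>inner ((D ^^ N) (F p - F q)) ((D ^^ N) (p - q))\<bar>
      \<le> (6 * C1 + 48 * C + 48 * C2) * (1 + hn N p + hn N q) * (hn N (p - q))\<^sup>2 + 6 * norm ((p - q) \<odot> (D ^^ Suc N) q) * hn N (p - q)"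
      by (simp add: w_def z_def Y_def P_def)
  qed (use C C1 C2 in simp)
qed


lemma norm_Dp_le_hn: "norm ((D ^^ k) f) \<le> hn k f" by (simp add: hn_def)

lemma norm_D_le_hn: "norm (D f) \<le> hn 1 f" using norm_Dp_le_hn[of 1 f] by simp

lemma norm_DD_le_hn: "norm (D (D f)) \<le> hn 2 f" using norm_Dp_le_hn[of 2 f] by (simp add: numeral_2_eq_2)

text \<open>The product is not a bounded bilinear map on the whole space; with (1 - D)^-1 applied to
  one factor it is, and the product rule for time derivatives becomes available.\<close>

lemma mul_bilinear: "bounded_bilinear (\<lambda>w g. Rs 1 w \<odot> g)"
proof (rule bounded_bilinear.intro)
  have d: "Rs 1 w \<in> dom" for w using Rs[of 1 w] by simp
  have l: "linear (Rs 1)" using bounded_linear.linear[OF Rs_lin[of 1]] by simp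
  show "Rs 1 (a + a') \<odot> b = Rs 1 a \<odot> b + Rs 1 a' \<odot> b" for a a' b
    using linear_add[OF l] mul_add_dom[OF d d] by simp
  show "Rs 1 a \<odot> (b + b') = Rs 1 a \<odot> b + Rs 1 a \<odot> b'" for a b b' by (rule mul_add[OF d])
  show "Rs 1 (r *\<^sub>R a) \<odot> b = r *\<^sub>R (Rs 1 a \<odot> b)" for r a b using linear_scale[OF l] mul_scale_dom[OF d] by simp
  show "Rs 1 a \<odot> r *\<^sub>R b = r *\<^sub>R (Rs 1 a \<odot> b)" for r a b by (rule mul_scale[OF d])
  have "norm (Rs 1 a \<odot> b) \<le> norm a * norm b * 2" for a b
  proof -
    have "hn 1 (Rs 1 a) \<le> norm a * 2" using Rs_norm[of 1 a] by (simp add: hn_def)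
    then have "hn 1 (Rs 1 a) * norm b \<le> norm a * 2 * norm b" by (intro mult_right_mono) auto
    then show ?thesis using norm_mul[OF d, of a b] by simp
  qed
  then show "\<exists>K. \<forall>a b. norm (Rs 1 a \<odot> b) \<le> norm a * norm b * K" by blast
qed

text \<open>An element v of \<open>dom\<close> equals \<open>Rs 1 (v - D v)\<close>, so the bilinear
  map above is applied to v - D v. This is why D v is assumed to be differentiable in time as
  well.\<close>

lemma mul_has_vector_derivative:
  assumes "\<And>t. v t \<in> dom" "v' \<in> dom"
    and "(v has_vector_derivative v') (at t within S)" "((\<lambda>t. D (v t)) has_vector_derivative D v') (at t within S)"
    and "(g has_vector_derivative g') (at t within S)"
  shows "((\<lambda>t. v t \<odot> g t) has_vector_derivative (v t \<odot> g' + v' \<odot> g t)) (at t within S)"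
proof -
  have R: "Rs 1 (w - D w) = w" if "w \<in> dom" for w using Rs_unique[OF that, of 1] by simp
  have "((\<lambda>t. v t - D (v t)) has_vector_derivative (v' - D v')) (at t within S)"
    using assms by (intro has_vector_derivative_diff) auto
  from bounded_bilinear.has_vector_derivative[OF mul_bilinear this assms(5)]
  show ?thesis using assms(1,2) by (simp add: R)
qed

lemma inner_has_real_derivative:
  fixes f g :: "real => 'b::real_inner"
  assumes "(f has_vector_derivative f') (at t within S)" "(g has_vector_derivative g') (at t within S)"
  shows "((\<lambda>t. inner (f t) (g t)) has_real_derivative (inner (f t) g' + inner f' (g t))) (at t within S)"
  unfolding has_real_derivative_iff_has_vector_derivative
  by (rule bounded_bilinear.has_vector_derivative[OF bounded_bilinear_inner assms])

lemma norm_sq_has_real_derivative: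
  fixes f :: "real => 'b::real_inner"
  assumes "(f has_vector_derivative f') (at t within S)"
  shows "((\<lambda>t. (norm (f t))\<^sup>2) has_real_derivative (2 * inner (f t) f')) (at t within S)"
  using inner_has_real_derivative[OF assms assms] by (simp add: power2_norm_eq_inner inner_commute)

section \<open>Conserved quantities\<close>

text \<open>The Hamiltonian, the integral of v'^2 / 2 + 3 W v^2 + v^3.\<close>

definition E1 :: "'a => real" where
  "E1 v = (norm (D v))\<^sup>2 / 2 + 3 * inner (m 0 v) v + inner (v \<odot> v) v"

lemma E1_derivative:
  assumes v: "\<And>t. v t \<in> H 2" and v': "v' \<in> dom"
    and d: "(v has_vector_derivative v') (at t within S)" "((\<lambda>t. D (v t)) has_vector_derivative D v') (at t within S)"
  shows "((\<lambda>t. E1 (v t)) has_real_derivative inner (X (v t)) v') (at t within S)"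
proof -
  have vd: "v t \<in> dom" "D (v t) \<in> dom" for t using v H_2 by auto
  have 1: "((\<lambda>t. (norm (D (v t)))\<^sup>2) has_real_derivative (2 * inner (D (v t)) (D v'))) (at t within S)"
    by (rule norm_sq_has_real_derivative[OF d(2)])
  have md: "((\<lambda>t. m 0 (v t)) has_vector_derivative m 0 v') (at t within S)"
    by (rule bounded_linear.has_vector_derivative[OF m_lin d(1)])
  have 2: "((\<lambda>t. inner (m 0 (v t)) (v t)) has_real_derivative (inner (m 0 (v t)) v' + inner (m 0 v') (v t))) (at t within S)"
    by (rule inner_has_real_derivative[OF md d(1)])
  have 3: "((\<lambda>t. inner (v t \<odot> v t) (v t)) has_real_derivative (inner (v t \<odot> v t) v' + inner (v t \<odot> v' + v' \<odot> v t) (v t))) (at t within S)"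
    by (rule inner_has_real_derivative[OF mul_has_vector_derivative[OF vd(1) v' d d(1)] d(1)])
  have "inner (v t \<odot> v') (v t) = inner (v t \<odot> v t) v'"
    using mul_adj[OF vd(1), of t v' "v t"] by (simp add: inner_commute)
  moreover have "inner (m 0 v') (v t) = inner (m 0 (v t)) v'" by (metis m_adj inner_commute)
  moreover have "inner (D (v t)) (D v') = - inner (D (D (v t))) v'" using D_skew[OF vd(2) v'] by simp
  moreover have "((\<lambda>t. E1 (v t)) has_real_derivative 2 * inner (D (v t)) (D v') / 2
      + 3 * (inner (m 0 (v t)) v' + inner (m 0 v') (v t)) + (inner (v t \<odot> v t) v' + inner (v t \<odot> v' + v' \<odot> v t) (v t))) (at t within S)"
    unfolding E1_def by (intro DERIV_add DERIV_cdivide DERIV_cmult 1 2 3)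
  ultimately show ?thesis
    by (simp add: X_def inner_add_left inner_diff_left mul_commute[of v'])
qed

text \<open>The cubic term is at most the sup norm of v times the mass, and the sup norm costs only
  the square root of ||D v||. By Young's inequality a quarter of ||D v||^2 absorbs it; powers of M
  remain.\<close>

lemma E1_coercive:
  "\<exists>C\<ge>0. \<forall>v\<in>dom. norm v \<le> M --> \<bar>E1 v - (norm (D v))\<^sup>2 / 2\<bar> \<le> (norm (D v))\<^sup>2 / 4 + C"
proof -
  obtain C where C: "C \<ge> 0" "\<And>f. norm (m 0 f) \<le> C * norm f" using m_bound by blast
  show ?thesis
  proof (intro exI[of _ "3 * C * M\<^sup>2 + \<bar>M\<bar>^3 + M^4 / 4"] conjI ballI impI)
    fix v assume v: "v \<in> dom" and M: "norm v \<le> M"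
    define a d where "a = norm v" and "d = norm (D v)"
    have ad: "0 \<le> a" "0 \<le> d" "a \<le> M" using M by (auto simp: a_def d_def)
    have "sqrt (2 * a * d) \<le> a + d / 2"
    proof (rule real_le_lsqrt)
      have "0 \<le> (a - d/2)\<^sup>2" by simp
      then show "2 * a * d \<le> (a + d / 2)\<^sup>2" by (simp add: power2_eq_square algebra_simps)
    qed (use ad in auto)
    then have "norm (v \<odot> v) \<le> (a + d / 2) * a"
      using norm_mul_sqrt[OF v, of v] ad unfolding a_def d_def by (meson mult_right_mono norm_ge_zero order_trans)
    then have "\<bar>inner (v \<odot> v) v\<bar> \<le> (a + d / 2) * a * a" by (rule abs_inner_le) (simp add: a_def)
    also have "\<dots> = a^3 + d * a\<^sup>2 / 2" by (simp add: power2_eq_square power3_eq_cube algebra_simps)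
    also have "d * a\<^sup>2 / 2 \<le> d\<^sup>2 / 4 + a^4 / 4"
      using sum_squares_bound[of d "a\<^sup>2"] by simp
    also have "a^3 \<le> \<bar>M\<bar>^3" using ad by (intro power_mono) auto
    also have "a^4 \<le> M^4" using ad by (intro power_mono) auto
    finally have 1: "\<bar>inner (v \<odot> v) v\<bar> \<le> d\<^sup>2 / 4 + \<bar>M\<bar>^3 + M^4 / 4" by simp
    have "\<bar>inner (m 0 v) v\<bar> \<le> C * a * a" using C(2)[of v] by (intro abs_inner_le) (auto simp: a_def)
    also have "\<dots> = C * a\<^sup>2" by (simp add: power2_eq_square)
    also have "\<dots> \<le> C * M\<^sup>2" using ad C by (intro mult_left_mono power_mono) auto
    finally have 2: "\<bar>inner (m 0 v) v\<bar> \<le> C * M\<^sup>2" .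
    have "\<bar>E1 v - (norm (D v))\<^sup>2 / 2\<bar> = \<bar>3 * inner (m 0 v) v + inner (v \<odot> v) v\<bar>" by (simp add: E1_def)
    also have "\<dots> \<le> 3 * \<bar>inner (m 0 v) v\<bar> + \<bar>inner (v \<odot> v) v\<bar>" by linarith
    finally show "\<bar>E1 v - (norm (D v))\<^sup>2 / 2\<bar> \<le> (norm (D v))\<^sup>2 / 4 + (3 * C * M\<^sup>2 + \<bar>M\<bar>^3 + M^4 / 4)"
      using 1 2 unfolding d_def by linarith
  qed (use C in simp)
qed

text \<open>The Hamiltonian cancellation is exact for the regularised flow: J is self-adjoint and
  commutes with D, so X v is orthogonal to J J D (X v). In the remaining pairing with J J h all
  derivatives are moved onto h, and the L^2 size of v and \<open>m 0 v\<close> suffices.\<close>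

lemma E1_drift:
  assumes r: "r > 0" and that: "v \<in> H 2"
  shows "\<bar>inner (X v) ((K r ^^ n) ((K r ^^ n) h))\<bar> \<le> hn 2 h * norm v + 6 * norm (m 0 v) * norm h + 6 * hn 2 h * (norm v)\<^sup>2"
    and "v \<in> H 3 ==> inner (X v) ((K r ^^ n) ((K r ^^ n) (F v))) = inner (X v) ((K r ^^ n) ((K r ^^ n) h))"
proof -
  define k where "k = (K r ^^ n) ((K r ^^ n) h)"
  have d0: "r \<noteq> 0" using r by simp
  have k2: "k \<in> H 2" "hn 2 k \<le> hn 2 h" "norm k \<le> norm h"
    unfolding k_def using d0 by (auto intro!: Kn_H' order_trans[OF Kn_hn] order_trans[OF Kn_norm] Kn_hn Kn_norm)
  have kd: "k \<in> dom" "D k \<in> dom" using k2 by (auto simp: H_2)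
  have vd: "v \<in> dom" "D v \<in> dom" using that by (auto simp: H_2)
  have 1: "inner (D (D v)) k = inner v (D (D k))" using D_skew[OF vd(2) kd(1)] D_skew[OF vd(1) kd(2)] by simp
  have 2: "inner (v \<odot> v) k = inner v (k \<odot> v)" using mul_adj[OF vd(1), of v k] by (simp add: mul_commute)
  have e: "inner (X v) k = - inner v (D (D k)) + 6 * inner (m 0 v) k + 3 * inner v (k \<odot> v)"
    unfolding X_def using 1 2 by (simp add: inner_add_left inner_diff_left)
  have a1: "\<bar>inner v (D (D k))\<bar> \<le> norm v * hn 2 h"
  proof (rule abs_inner_le[OF order_refl])
    show "norm (D (D k)) \<le> hn 2 h" using k2(2) norm_DD_le_hn[of k] by linarith
  qed
  have a2: "\<bar>inner (m 0 v) k\<bar> \<le> norm (m 0 v) * norm h" by (rule abs_inner_le[OF order_refl k2(3)])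
  have a3: "\<bar>inner v (k \<odot> v)\<bar> \<le> norm v * (2 * hn 2 h * norm v)"
  proof (rule abs_inner_le[OF order_refl])
    have "hn 1 k \<le> 2 * hn 2 h" using hn_mono[OF k2(1), of 1] k2(2) by simp
    then show "norm (k \<odot> v) \<le> 2 * hn 2 h * norm v" using norm_mul[OF kd(1), of v] by (meson mult_right_mono norm_ge_zero order_trans)
  qed
  have "\<bar>inner (X v) k\<bar> \<le> \<bar>inner v (D (D k))\<bar> + 6 * \<bar>inner (m 0 v) k\<bar> + 3 * \<bar>inner v (k \<odot> v)\<bar>" unfolding e by linarith
  also have "\<dots> \<le> norm v * hn 2 h + 6 * (norm (m 0 v) * norm h) + 3 * (norm v * (2 * hn 2 h * norm v))"
    by (intro add_mono mult_left_mono a1 a2 a3) auto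
  finally show "\<bar>inner (X v) ((K r ^^ n) ((K r ^^ n) h))\<bar> \<le> hn 2 h * norm v + 6 * norm (m 0 v) * norm h + 6 * hn 2 h * (norm v)\<^sup>2"
    by (simp add: k_def power2_eq_square algebra_simps)
  assume v3: "v \<in> H 3"
  have x: "X v \<in> dom" by (rule X_dom[OF v3])
  have l: "linear (K r ^^ n)" using bounded_linear.linear[OF Kn_lin[OF d0]] .
  have "inner (X v) ((K r ^^ n) ((K r ^^ n) (D (X v)))) = inner ((K r ^^ n) (X v)) (D ((K r ^^ n) (X v)))"
    using Kn_adj[OF d0, of n "X v"] Kn_Dp[OF d0, of "X v" 1 1 n] x by simp
  also have "\<dots> = 0" using inner_D_self Kn_H'[OF d0, of "X v" 1 n] x by simp
  finally show "inner (X v) ((K r ^^ n) ((K r ^^ n) (F v))) = inner (X v) ((K r ^^ n) ((K r ^^ n) h))"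
    unfolding F_def by (simp add: linear_add[OF l] inner_add_right)
qed

text \<open>For W = 0 this is the integral of v''^2 / 2 + 5 v v'^2 + 9 v^4 / 2. It differs from the
  third KdV invariant only in the coefficient of v^4 (5/2 there), a term controlled in H^1.\<close>

definition E2 :: "'a => real" where
  "E2 v = (norm (X v))\<^sup>2 / 2 - inner (v \<odot> D v) (D v)"

text \<open>The differential of \<open>E2\<close> at v in the direction z, with one D moved off z by
  skewness.\<close>

definition G :: "'a => 'a => real" where
  "G v z = inner (X v) (- D (D z) + 6 *\<^sub>R m 0 z + 6 *\<^sub>R (v \<odot> z)) - inner z (D v \<odot> D v) + 2 * inner (D (v \<odot> D v)) z"

lemma E2_derivative:
  assumes v: "\<And>t. v t \<in> H 2" and v': "v' \<in> H 2"
    and d: "(v has_vector_derivative v') (at t within S)" "((\<lambda>t. D (v t)) has_vector_derivative D v') (at t within S)"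
      "((\<lambda>t. D (D (v t))) has_vector_derivative D (D v')) (at t within S)"
  shows "((\<lambda>t. E2 (v t)) has_real_derivative G (v t) v') (at t within S)"
proof -
  have vd: "v t \<in> dom" "D (v t) \<in> dom" for t using v H_2 by auto
  have v'd: "v' \<in> dom" "D v' \<in> dom" using v' by (auto simp: H_2)
  have md: "((\<lambda>t. m 0 (v t)) has_vector_derivative m 0 v') (at t within S)"
    by (rule bounded_linear.has_vector_derivative[OF m_lin d(1)])
  have X': "((\<lambda>t. X (v t)) has_vector_derivative (- D (D v') + 6 *\<^sub>R m 0 v' + 3 *\<^sub>R (v t \<odot> v' + v' \<odot> v t))) (at t within S)"
    unfolding X_def
    by (intro has_vector_derivative_add has_vector_derivative_minus d(3)
        bounded_linear.has_vector_derivative[OF bounded_linear_scaleR_right] md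
        mul_has_vector_derivative[OF vd(1) v'd(1) d(1,2) d(1)])
  have P: "((\<lambda>t. v t \<odot> D (v t)) has_vector_derivative (v t \<odot> D v' + v' \<odot> D (v t))) (at t within S)"
    by (rule mul_has_vector_derivative[OF vd(1) v'd(1) d(1,2) d(2)])
  have "((\<lambda>t. E2 (v t)) has_real_derivative 2 * inner (X (v t)) (- D (D v') + 6 *\<^sub>R m 0 v' + 3 *\<^sub>R (v t \<odot> v' + v' \<odot> v t)) / 2
      - (inner (v t \<odot> D (v t)) (D v') + inner (v t \<odot> D v' + v' \<odot> D (v t)) (D (v t)))) (at t within S)"
    unfolding E2_def
    by (intro DERIV_diff DERIV_cdivide norm_sq_has_real_derivative[OF X'] inner_has_real_derivative[OF P d(2)])
  moreover have "inner (v t \<odot> D v') (D (v t)) = inner (v t \<odot> D (v t)) (D v')"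
    using mul_adj[OF vd(1), of t "D v'" "D (v t)"] by (simp add: inner_commute)
  moreover have "inner (v' \<odot> D (v t)) (D (v t)) = inner v' (D (v t) \<odot> D (v t))"
    using mul_adj[OF vd(2), of t v' "D (v t)"] by (simp add: mul_commute)
  moreover have "inner (v t \<odot> D (v t)) (D v') = - inner (D (v t \<odot> D (v t))) v'"
    using D_skew[OF mul_dom[OF vd] v'd(1), of t] by simp
  moreover have "v t \<odot> v' + v' \<odot> v t = 2 *\<^sub>R (v t \<odot> v')" by (simp add: mul_commute scaleR_2)
  ultimately show ?thesis by (simp add: G_def inner_add_left diff_diff_eq2 add.commute add_diff_eq)
qed

lemma G_linear:
  assumes "v \<in> H 2" "z \<in> H 2" "z' \<in> H 2"
  shows "G v (z + z') = G v z + G v z'" "G v (c *\<^sub>R z) = c * G v z"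
proof -
  have d: "v \<in> dom" "z \<in> dom" "D z \<in> dom" "z' \<in> dom" "D z' \<in> dom" using assms by (auto simp: H_2)
  have "- D (D (z + z')) + 6 *\<^sub>R m 0 (z + z') + 6 *\<^sub>R (v \<odot> (z + z'))
     = (- D (D z) + 6 *\<^sub>R m 0 z + 6 *\<^sub>R (v \<odot> z)) + (- D (D z') + 6 *\<^sub>R m 0 z' + 6 *\<^sub>R (v \<odot> z'))"
    using d by (simp add: D_add m_add mul_add scaleR_add_right)
  then show "G v (z + z') = G v z + G v z'"
    unfolding G_def by (simp only: inner_add_right inner_add_left) (simp add: algebra_simps)
  have "- D (D (c *\<^sub>R z)) + 6 *\<^sub>R m 0 (c *\<^sub>R z) + 6 *\<^sub>R (v \<odot> (c *\<^sub>R z)) = c *\<^sub>R (- D (D z) + 6 *\<^sub>R m 0 z + 6 *\<^sub>R (v \<odot> z))"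
    using d by (simp add: D_scale m_scale mul_scale scaleR_add_right scaleR_diff_right mult.commute)
  then show "G v (c *\<^sub>R z) = c * G v z"
    unfolding G_def by (simp only: inner_scaleR_right inner_scaleR_left) (simp add: algebra_simps)
qed

text \<open>This is the part of X v without second derivatives. Its bound makes ||X v|| and ||D (D
  v)|| interchangeable once v is bounded in H^1, so that \<open>E2\<close> controls H^2.\<close>

lemma lower_part_bound:
  "\<exists>C\<ge>0. \<forall>v\<in>dom. hn 1 v \<le> M --> 6 *\<^sub>R m 0 v + 3 *\<^sub>R (v \<odot> v) \<in> dom \<and> hn 1 (6 *\<^sub>R m 0 v + 3 *\<^sub>R (v \<odot> v)) \<le> C"
proof -
  obtain C where C: "C \<ge> 0" "\<And>f. f \<in> H 1 ==> m 0 f \<in> H 1 \<and> hn 1 (m 0 f) \<le> C * hn 1 f"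
    using m_hn[of 1 0] by blast
  obtain C' where C': "C' \<ge> 0" "\<And>a b. a \<in> H 1 ==> b \<in> H 1 ==> a \<odot> b \<in> H 1 \<and> hn 1 (a \<odot> b) \<le> C' * hn 1 a * hn 1 b"
    using mul_hn[of 1] by (simp del: One_nat_def) blast
  show ?thesis
  proof (intro exI[of _ "6 * (C * \<bar>M\<bar>) + 3 * (C' * \<bar>M\<bar> * \<bar>M\<bar>)"] conjI ballI impI)
    fix v assume v: "v \<in> dom" and M: "hn 1 v \<le> M"
    have v1: "v \<in> H 1" using v by simp
    have a: "6 *\<^sub>R m 0 v \<in> H 1" "3 *\<^sub>R (v \<odot> v) \<in> H 1" using C(2)[OF v1] C'(2)[OF v1 v1] H_scale by blast+
    show "6 *\<^sub>R m 0 v + 3 *\<^sub>R (v \<odot> v) \<in> dom" using H_add[OF a] by simp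
    have "hn 1 (6 *\<^sub>R m 0 v + 3 *\<^sub>R (v \<odot> v)) \<le> hn 1 (6 *\<^sub>R m 0 v) + hn 1 (3 *\<^sub>R (v \<odot> v))" by (rule hn_add[OF a])
    also have "\<dots> = 6 * hn 1 (m 0 v) + 3 * hn 1 (v \<odot> v)"
      using C(2)[OF v1] C'(2)[OF v1 v1] by (simp add: hn_scale del: One_nat_def)
    also have "\<dots> \<le> 6 * (C * hn 1 v) + 3 * (C' * hn 1 v * hn 1 v)"
      using C(2)[OF v1] C'(2)[OF v1 v1] by (intro add_mono mult_left_mono) auto
    also have "\<dots> \<le> 6 * (C * \<bar>M\<bar>) + 3 * (C' * \<bar>M\<bar> * \<bar>M\<bar>)"
      using M C(1) C'(1) by (intro add_mono mult_left_mono mult_mono) auto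
    finally show "hn 1 (6 *\<^sub>R m 0 v + 3 *\<^sub>R (v \<odot> v)) \<le> 6 * (C * \<bar>M\<bar>) + 3 * (C' * \<bar>M\<bar> * \<bar>M\<bar>)" .
  qed (use C C' in simp)
qed

text \<open>The cubic correction in \<open>E2\<close> is chosen so that the terms \<open>\<integral> v' X\<^sup>2\<close> cancel.\<close>

lemma G_DX:
  assumes v: "v \<in> H 5" and y: "y = 6 *\<^sub>R m 0 v + 3 *\<^sub>R (v \<odot> v)"
  shows "G v (D (X v)) = - 3 * inner (m 1 (X v)) (X v) - 2 * inner (X v) (D v \<odot> y) - 2 * inner (X v) (D (v \<odot> y))"
proof -
  define x where "x = X v"
  have x3: "x \<in> H 3" using X_H[of v 3] v by (simp add: x_def)
  then have x: "x \<in> dom" "D x \<in> dom" "D (D x) \<in> dom" by (auto simp: H_Suc numeral_3_eq_3)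
  have vd: "v \<in> dom" "D v \<in> dom" "D (D v) \<in> dom" using H_mono[OF v, of 3] by (auto simp: H_Suc numeral_3_eq_3)
  have yd: "y \<in> dom" unfolding y using vd by (intro dom_add dom_scale m_dom mul_dom)
  \<comment> \<open>Second derivatives of v are traded for y - x, which makes the terms quadratic in
    x comparable with each other.\<close>
  have e: "D (D v) = y - x" by (simp add: x_def X_def y)
  have t1: "inner x (D (D (D x))) = 0" using inner_DDD[OF x3] by (simp add: inner_commute)
  have t2: "inner x (m 0 (D x)) = - inner (m 1 x) x / 2"
    using inner_m_D[OF x(1), of 0] m_adj[of 0 x "D x"] by simp
  have t3: "inner x (v \<odot> D x) = - inner (D v \<odot> x) x / 2"
    using inner_mul_D[OF vd(1) x(1)] mul_adj[OF vd(1), of x "D x"] by simp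
  have t4: "inner (D x) (D v \<odot> D v) = - 2 * inner x (D v \<odot> (y - x))"
  proof -
    have "inner (D x) (D v \<odot> D v) = - inner x (D (D v \<odot> D v))" using D_skew[OF x(1) mul_dom[OF vd(2,2)]] .
    also have "D (D v \<odot> D v) = 2 *\<^sub>R (D v \<odot> (y - x))" using D_mul[OF vd(2,2)] e by (simp add: mul_commute scaleR_2)
    finally show ?thesis by simp
  qed
  have t5: "inner (D (v \<odot> D v)) (D x) = inner (D x) (D v \<odot> D v) + inner (D x) (v \<odot> (y - x))"
    using D_mul[OF vd(1,2)] e by (simp add: inner_commute inner_add_right)
  have t6: "inner (D x) (v \<odot> y) = - inner x (D (v \<odot> y))" using D_skew[OF x(1) mul_dom[OF vd(1) yd]] .
  have t7: "inner (D x) (v \<odot> x) = inner x (v \<odot> D x)" using mul_adj[OF vd(1), of "D x" x] mul_adj[OF vd(1), of x "D x"] by (simp add: inner_commute)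
  have t8: "inner x (D v \<odot> x) = inner (D v \<odot> x) x" by (simp add: inner_commute)
  \<comment> \<open>The multiples of \<open>inner (D v \<odot> x) x\<close> are - 3 from the second
    summand by \<open>t3\<close>, + 2 from \<open>t4\<close>, and + 1 from \<open>t7\<close> with
    \<open>t3\<close>; they add up to 0.\<close>
  have "G v (D x) = 6 * inner x (m 0 (D x)) + 6 * inner x (v \<odot> D x) - inner (D x) (D v \<odot> D v) + 2 * inner (D (v \<odot> D v)) (D x)"
    unfolding G_def x_def[symmetric] using t1 by (simp add: inner_add_right inner_diff_right)
  also have "\<dots> = - 3 * inner (m 1 x) x - 2 * inner x (D v \<odot> y) - 2 * inner x (D (v \<odot> y))"
    unfolding t5 t4 using t2 t3 t6 t7 t8 by (simp add: mul_diff[OF vd(2)] mul_diff[OF vd(1)] inner_diff_right)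
  finally show ?thesis by (simp add: x_def)
qed

lemma G_DX_bound:
  "\<exists>C\<ge>0. \<forall>v\<in>H 5. hn 1 v \<le> M --> \<bar>G v (D (X v))\<bar> \<le> C * (1 + norm (X v))\<^sup>2"
proof -
  obtain Y where Y: "Y \<ge> 0" "\<And>v. v \<in> dom ==> hn 1 v \<le> M ==> 6 *\<^sub>R m 0 v + 3 *\<^sub>R (v \<odot> v) \<in> dom \<and> hn 1 (6 *\<^sub>R m 0 v + 3 *\<^sub>R (v \<odot> v)) \<le> Y"
    using lower_part_bound[of M] by blast
  obtain C where C: "C \<ge> 0" "\<And>f. norm (m 1 f) \<le> C * norm f" using m_bound by blast
  show ?thesis
  proof (intro exI[of _ "3 * C + 6 * (Y * \<bar>M\<bar>)"] conjI ballI impI)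
    fix v assume v: "v \<in> H 5" and M: "hn 1 v \<le> M"
    define y where "y = 6 *\<^sub>R m 0 v + 3 *\<^sub>R (v \<odot> v)"
    have vd: "v \<in> dom" "D v \<in> dom" using H_mono[OF v, of 2] by (auto simp: H_2)
    have y: "y \<in> dom" "hn 1 y \<le> Y" using Y(2)[OF vd(1) M] by (auto simp: y_def)
    have M0: "M \<ge> 0" using M hn_nonneg[of 1 v] by linarith
    have Dv: "norm (D v) \<le> M" using M norm_D_le_hn[of v] by linarith
    have Dy: "norm (D y) \<le> Y" using y norm_D_le_hn[of y] by linarith
    have a: "norm (D v \<odot> y) \<le> Y * M"
      using norm_mul[OF y(1), of "D v"] mult_mono[OF y(2) Dv] Y(1) by (simp add: mul_commute)
    have "norm (v \<odot> D y) \<le> M * Y"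
      using norm_mul[OF vd(1), of "D y"] mult_mono[OF M Dy] M0 by simp
    then have b: "norm (D (v \<odot> y)) \<le> 2 * (Y * M)"
      using a D_mul[OF vd(1) y(1)] norm_triangle_ineq[of "D v \<odot> y" "v \<odot> D y"] by (simp add: mult.commute)
    define x where "x = norm (X v)"
    have x0: "x \<ge> 0" by (simp add: x_def)
    have g: "G v (D (X v)) = - 3 * inner (m 1 (X v)) (X v) - 2 * inner (X v) (D v \<odot> y) - 2 * inner (X v) (D (v \<odot> y))"
      by (rule G_DX[OF v y_def])
    have 1: "\<bar>inner (m 1 (X v)) (X v)\<bar> \<le> C * x * x" using C(2) by (intro abs_inner_le) (auto simp: x_def)
    have 2: "\<bar>inner (X v) (D v \<odot> y)\<bar> \<le> x * (Y * M)" using a by (intro abs_inner_le) (auto simp: x_def)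
    have 3: "\<bar>inner (X v) (D (v \<odot> y))\<bar> \<le> x * (2 * (Y * M))" using b by (intro abs_inner_le) (auto simp: x_def)
    have "\<bar>G v (D (X v))\<bar> \<le> 3 * (C * x * x) + 2 * (x * (Y * M)) + 2 * (x * (2 * (Y * M)))" unfolding g using 1 2 3 by linarith
    also have "\<dots> = 3 * C * x\<^sup>2 + 6 * (Y * M) * x" by (simp add: power2_eq_square algebra_simps)
    also have "\<dots> \<le> 3 * C * (1 + x)\<^sup>2 + 6 * (Y * M) * (1 + x)\<^sup>2"
    proof (intro add_mono mult_left_mono)
      show "x \<le> (1 + x)\<^sup>2" "x\<^sup>2 \<le> (1 + x)\<^sup>2" using x0 by (auto simp: power2_sum)
    qed (use C(1) Y(1) M0 in auto)
    finally show "\<bar>G v (D (X v))\<bar> \<le> (3 * C + 6 * (Y * \<bar>M\<bar>)) * (1 + norm (X v))\<^sup>2" using M0 by (simp add: x_def algebra_simps)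
  qed (use C Y in simp)
qed

text \<open>Meant for directions z bounded in \<open>H 2\<close>, namely the forcing plus the
  regularisation error. Only one power of ||X v|| appears, which the Gronwall argument for
  \<open>E2\<close> tolerates.\<close>

lemma G_bound:
  "\<exists>C\<ge>0. \<forall>v\<in>H 3. \<forall>z\<in>H 2. hn 1 v \<le> M --> \<bar>G v z\<bar> \<le> C * hn 2 z * (1 + norm (X v))"
proof -
  obtain Y where Y: "Y \<ge> 0" "\<And>v. v \<in> dom ==> hn 1 v \<le> M ==> 6 *\<^sub>R m 0 v + 3 *\<^sub>R (v \<odot> v) \<in> dom \<and> hn 1 (6 *\<^sub>R m 0 v + 3 *\<^sub>R (v \<odot> v)) \<le> Y"
    using lower_part_bound[of M] by blast
  obtain C where C: "C \<ge> 0" "\<And>f. norm (m 0 f) \<le> C * norm f" using m_bound by blast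
  show ?thesis
  proof (intro exI[of _ "1 + 6 * C + 6 * \<bar>M\<bar> + 6 * M\<^sup>2 + 2 * \<bar>M\<bar> * (1 + Y)"] conjI ballI impI)
    fix v z assume v: "v \<in> H 3" and z: "z \<in> H 2" and M: "hn 1 v \<le> M"
    define y where "y = 6 *\<^sub>R m 0 v + 3 *\<^sub>R (v \<odot> v)"
    define x where "x = norm (X v)"
    define Z where "Z = hn 2 z"
    have vd: "v \<in> dom" "D v \<in> dom" using H_mono[OF v, of 2] by (auto simp: H_2)
    have zd: "z \<in> dom" "D z \<in> dom" using z by (auto simp: H_2)
    have y: "y \<in> dom" "hn 1 y \<le> Y" using Y(2)[OF vd(1) M] by (auto simp: y_def)
    have M0: "M \<ge> 0" using M hn_nonneg[of 1 v] by linarith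
    have Dv: "norm (D v) \<le> M" using M norm_D_le_hn[of v] by linarith
    have x0: "x \<ge> 0" "Z \<ge> 0" by (auto simp: x_def Z_def)
    have zn: "norm z \<le> Z" "norm (D (D z)) \<le> Z" "hn 1 z \<le> 2 * Z"
      using hn_mono[OF z, of 1] by (auto simp: Z_def hn_def numeral_2_eq_2)
    have "norm (D (D v)) \<le> norm y + x"
    proof -
      have "D (D v) = y - X v" by (simp add: X_def y_def)
      then show ?thesis using norm_triangle_ineq4[of y "X v"] by (simp add: x_def)
    qed
    then have DDv: "norm (D (D v)) \<le> Y + x" using norm_le_hn[of y 1] y(2) by linarith
    have L: "norm (- D (D z) + 6 *\<^sub>R m 0 z + 6 *\<^sub>R (v \<odot> z)) \<le> (1 + 6 * C + 6 * M) * Z"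
    proof -
      have "norm (- D (D z) + 6 *\<^sub>R m 0 z + 6 *\<^sub>R (v \<odot> z)) \<le> norm (D (D z)) + 6 * norm (m 0 z) + 6 * norm (v \<odot> z)"
        by (intro norm_triangle_le add_mono) auto
      also have "\<dots> \<le> Z + 6 * (C * Z) + 6 * (M * Z)"
      proof (intro add_mono mult_left_mono)
        show "norm (m 0 z) \<le> C * Z" using C zn by (meson mult_left_mono order_trans)
        show "norm (v \<odot> z) \<le> M * Z" using norm_mul[OF vd(1), of z] mult_mono[OF M zn(1)] M0 by simp
      qed (use zn in auto)
      finally show ?thesis by (simp add: algebra_simps)
    qed
    have 1: "\<bar>inner (X v) (- D (D z) + 6 *\<^sub>R m 0 z + 6 *\<^sub>R (v \<odot> z))\<bar> \<le> x * ((1 + 6 * C + 6 * M) * Z)"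
      by (rule abs_inner_le[OF _ L]) (simp add: x_def)
    have 2: "\<bar>inner z (D v \<odot> D v)\<bar> \<le> 2 * Z * M * M"
    proof -
      have "inner z (D v \<odot> D v) = inner (z \<odot> D v) (D v)" using mul_adj[OF vd(2), of z "D v"] by (simp add: mul_commute)
      moreover have "norm (z \<odot> D v) \<le> 2 * Z * M" using norm_mul[OF zd(1), of "D v"] mult_mono[OF zn(3) Dv] x0 by simp
      ultimately show ?thesis using abs_inner_le[OF _ Dv] by simp
    qed
    have 3: "\<bar>inner (v \<odot> D (D v)) z\<bar> \<le> (Y + x) * (M * Z)"
    proof -
      have "inner (v \<odot> D (D v)) z = inner (D (D v)) (v \<odot> z)" by (rule mul_adj[OF vd(1)])
      moreover have "norm (v \<odot> z) \<le> M * Z" using norm_mul[OF vd(1), of z] mult_mono[OF M zn(1)] M0 by simp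
      ultimately show ?thesis using abs_inner_le[OF DDv] by simp
    qed
    have "inner (D (v \<odot> D v)) z = inner z (D v \<odot> D v) + inner (v \<odot> D (D v)) z"
      using D_mul[OF vd] inner_commute[of z] by (simp add: inner_add_left)
    then have "G v z = inner (X v) (- D (D z) + 6 *\<^sub>R m 0 z + 6 *\<^sub>R (v \<odot> z)) + inner z (D v \<odot> D v) + 2 * inner (v \<odot> D (D v)) z"
      unfolding G_def by simp
    then have "\<bar>G v z\<bar> \<le> x * ((1 + 6 * C + 6 * M) * Z) + 2 * Z * M * M + 2 * ((Y + x) * (M * Z))"
      using 1 2 3 by linarith
    also have "\<dots> = ((1 + 6 * C + 6 * M) * x + 2 * M\<^sup>2 + 2 * M * (Y + x)) * Z" by (simp add: power2_eq_square algebra_simps)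
    also have "\<dots> \<le> ((1 + 6 * C + 6 * M) * (1 + x) + 6 * M\<^sup>2 * (1 + x) + 2 * M * ((1 + Y) * (1 + x))) * Z"
    proof (intro mult_right_mono add_mono mult_left_mono)
      show "2 * M\<^sup>2 \<le> 6 * M\<^sup>2 * (1 + x)" using x0 by (simp add: algebra_simps add_increasing2)
      show "Y + x \<le> (1 + Y) * (1 + x)" using x0 Y(1) by (simp add: algebra_simps)
    qed (use x0 M0 C(1) in auto)
    finally show "\<bar>G v z\<bar> \<le> (1 + 6 * C + 6 * \<bar>M\<bar> + 6 * M\<^sup>2 + 2 * \<bar>M\<bar> * (1 + Y)) * hn 2 z * (1 + norm (X v))"
      using M0 by (simp add: Z_def x_def algebra_simps)
  qed (use C Y in simp)
qed


definition cutoff :: "real => real => real" where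
  "cutoff A r = max 0 (min 1 (A + 1 - r))"

lemma cutoff_bounds: "0 \<le> cutoff A r" "cutoff A r \<le> 1" by (auto simp: cutoff_def)

lemma cutoff_lipschitz: "\<bar>cutoff A r - cutoff A s\<bar> \<le> \<bar>r - s\<bar>"
  by (auto simp: cutoff_def max_def min_def)

lemma cutoff_eq_1: "r \<le> A ==> cutoff A r = 1" and cutoff_eq_0: "r \<ge> A + 1 ==> cutoff A r = 0"
  by (auto simp: cutoff_def)

section \<open>The regularised equation\<close>

text \<open>A solution of the regularised equation \<open>u' = J F(J u)\<close>, \<open>J = K d ^^ n\<close>, slowed down where the
  \<open>H\<^sup>N\<close> size of \<open>u\<close> exceeds \<open>A\<close>.  The scalar factor does not affect energy estimates.\<close>

definition reg_sol :: "real => nat => nat => real => real => (real => 'a) => bool" where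
  "reg_sol d n N A T u \<longleftrightarrow> (\<forall>t. u t \<in> H N) \<and>
    (\<forall>k\<le>N. \<forall>t\<in>{-T..T}. ((\<lambda>t. (D ^^ k) (u t)) has_vector_derivative
       cutoff A (hn N (u t)) *\<^sub>R (K d ^^ n) ((D ^^ k) (F ((K d ^^ n) (u t))))) (at t within {-T..T}))"

text \<open>Boundedness and the Lipschitz property are assumed only on the support of the cutoff. If
  exactly one point lies outside, the difference is that of the two cutoff values times Fv at the
  inner point; by symmetry one inner point is enough.\<close>

lemma cutoff_product_lipschitz:
  fixes S :: "'b::real_normed_vector => real" and Fv :: "'b => 'c::real_normed_vector"
  assumes S: "\<And>x y. \<bar>S x - S y\<bar> \<le> a * norm (x - y)"
    and bd: "\<And>x. S x \<le> A + 1 ==> norm (Fv x) \<le> B"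
    and lip: "\<And>x y. S x \<le> A + 1 ==> S y \<le> A + 1 ==> norm (Fv x - Fv y) \<le> b * norm (x - y)"
    and nn: "0 \<le> a" "0 \<le> b" "0 \<le> B"
  shows "norm (cutoff A (S x) *\<^sub>R Fv x - cutoff A (S y) *\<^sub>R Fv y) \<le> (a * B + b) * norm (x - y)"
proof -
  have c: "\<bar>cutoff A (S x) - cutoff A (S y)\<bar> \<le> a * norm (x - y)" for x y
    using cutoff_lipschitz S order_trans by blast
  have one: "norm (cutoff A (S x) *\<^sub>R Fv x - cutoff A (S y) *\<^sub>R Fv y) \<le> (a * B + b) * norm (x - y)"
    if x: "S x \<le> A + 1" for x y
  proof (cases "S y \<le> A + 1")
    case True
    have "cutoff A (S x) *\<^sub>R Fv x - cutoff A (S y) *\<^sub>R Fv y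
      = (cutoff A (S x) - cutoff A (S y)) *\<^sub>R Fv x + cutoff A (S y) *\<^sub>R (Fv x - Fv y)"
      by (simp add: algebra_simps)
    then have "norm (cutoff A (S x) *\<^sub>R Fv x - cutoff A (S y) *\<^sub>R Fv y)
      \<le> \<bar>cutoff A (S x) - cutoff A (S y)\<bar> * norm (Fv x) + cutoff A (S y) * norm (Fv x - Fv y)"
      using norm_triangle_ineq[of "(cutoff A (S x) - cutoff A (S y)) *\<^sub>R Fv x" "cutoff A (S y) *\<^sub>R (Fv x - Fv y)"]
        cutoff_bounds by simp
    also have "\<dots> \<le> a * norm (x - y) * B + 1 * (b * norm (x - y))"
      using nn by (intro add_mono mult_mono c bd x lip True cutoff_bounds) auto
    finally show ?thesis by (simp add: algebra_simps)
  next
    case False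
    then have "cutoff A (S y) = 0" by (intro cutoff_eq_0) simp
    then have "norm (cutoff A (S x) *\<^sub>R Fv x - cutoff A (S y) *\<^sub>R Fv y) = \<bar>cutoff A (S x) - cutoff A (S y)\<bar> * norm (Fv x)" by simp
    also have "\<dots> \<le> a * norm (x - y) * B" using nn by (intro mult_mono c bd x) auto
    also have "\<dots> \<le> (a * B + b) * norm (x - y)" using nn by (simp add: algebra_simps)
    finally show ?thesis .
  qed
  consider "S x \<le> A + 1" | "S y \<le> A + 1" | "S x > A + 1" "S y > A + 1" by linarith
  then show ?thesis
  proof cases
    case 1 then show ?thesis by (rule one)
  next
    case 2 then show ?thesis using one[of y x] by (simp add: norm_minus_commute)
  next
    case 3
    then have "cutoff A (S x) = 0" "cutoff A (S y) = 0" by (auto intro: cutoff_eq_0)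
    then show ?thesis using nn by simp
  qed
qed

lemma hn_triangle_abs: "f \<in> H k ==> g \<in> H k ==> \<bar>hn k f - hn k g\<bar> \<le> hn k (f - g)"
  using hn_add[of "f - g" k g] hn_add[of "g - f" k f] H_diff hn_diff_commute[of f k g] by fastforce

lemma Kn_smoothing_hn: assumes "d > 0" "k \<le> 2 * n"
  shows "\<exists>C\<ge>0. \<forall>f. hn k ((K d ^^ n) f) \<le> C * norm f"
proof -
  obtain C where "C \<ge> 0" "\<And>f. norm ((D ^^ k) ((K d ^^ n) f)) \<le> C * norm f"
    using Kn_smoothing[OF assms] by blast
  then show ?thesis
    using Kn_norm[of d n] assms(1) by (intro exI[of _ "1 + C"]) (auto simp: hn_def algebra_simps add_mono)
qed

text \<open>The unknown is y with u = u0 + J y, where y' is the cut-off F(J u) and y(0) = 0, solved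
  in the base space. J maps into \<open>H N\<close> because 2 n \<ge> N, so u lies in
  \<open>H N\<close> by construction, and time derivatives of D^k u come from the bounded operator
  D^k J.\<close>

lemma reg_sol_exists:
  assumes r: "r > 0" and T: "T > 0" and A: "A \<ge> 0" and N: "N \<ge> 3" "2 * n \<ge> N" and u0: "u0 \<in> H N"
  shows "\<exists>u. u 0 = u0 \<and> reg_sol r n N A T u"
proof -
  define J where "J = K r ^^ n"
  have d0: "r \<noteq> 0" using r by simp
  have Jl: "bounded_linear J" unfolding J_def by (rule Kn_lin[OF d0])
  have Jlin: "J (f - g) = J f - J g" "J (f + g) = J f + J g" "J (c *\<^sub>R f) = c *\<^sub>R J f" for f g c
    using bounded_linear.linear[OF Jl] by (auto simp: linear_diff linear_add linear_scale)
  have JH: "J f \<in> H k" if "k \<le> 2 * n" for f k unfolding J_def by (rule Kn_H0[OF d0 that])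
  obtain a where a: "a \<ge> 0" "\<And>f. hn N (J f) \<le> a * norm f" unfolding J_def using Kn_smoothing_hn[OF r N(2)] by blast
  define uu where "uu y = u0 + J y" for y
  define S where "S y = hn N (uu y)" for y
  define Fv where "Fv y = F (J (uu y))" for y
  have uH: "uu y \<in> H N" for y unfolding uu_def by (intro H_add u0 JH N)
  have vH: "J (uu y) \<in> H N" for y unfolding J_def by (rule Kn_H'[OF d0 uH])
  have vH3: "J (uu y) \<in> H 3" for y using H_mono[OF vH N(1)] .
  have udiff: "uu x - uu y = J (x - y)" for x y by (simp add: uu_def Jlin)
  have Slip: "\<bar>S x - S y\<bar> \<le> a * norm (x - y)" for x y
  proof -
    have "\<bar>S x - S y\<bar> \<le> hn N (uu x - uu y)" unfolding S_def by (rule hn_triangle_abs[OF uH uH])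
    then show ?thesis using a(2)[of "x - y"] udiff by simp
  qed
  have v3: "hn 3 (J (uu y)) \<le> 2 * (A + 1)" if "S y \<le> A + 1" for y
  proof -
    have "hn 3 (J (uu y)) \<le> 2 * hn N (J (uu y))" by (rule hn_mono[OF vH N(1)])
    moreover have "hn N (J (uu y)) \<le> S y" unfolding J_def S_def by (rule Kn_hn[OF d0 uH])
    ultimately show ?thesis using that by argo
  qed
  have vdiff: "hn 3 (J (uu x) - J (uu y)) \<le> 2 * a * norm (x - y)" for x y
  proof -
    have "hn 3 (J (uu x) - J (uu y)) = hn 3 (J (J (x - y)))" using udiff by (simp flip: Jlin)
    also have "\<dots> \<le> hn 3 (J (x - y))" unfolding J_def by (rule Kn_hn[OF d0]) (rule Kn_H0[OF d0], use N in simp)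
    also have "\<dots> \<le> 2 * hn N (J (x - y))" by (rule hn_mono[OF JH[OF N(2)] N(1)])
    finally show ?thesis using a(2)[of "x - y"] by simp
  qed
  obtain B where B: "B \<ge> 0" "\<And>v. v \<in> H 3 ==> hn 3 v \<le> 2 * (A + 1) ==> hn 0 (F v) \<le> B"
    using F_bound[of 0 "2 * (A + 1)"] by auto
  obtain C where C: "C \<ge> 0" "\<And>v w. v \<in> H 3 ==> w \<in> H 3 ==> hn 0 (F v - F w) \<le> C * (1 + hn 3 v + hn 3 w) * hn 3 (v - w)"
    using F_lipschitz[of 0] by auto
  define b where "b = C * (1 + 4 * (A + 1)) * (2 * a)"
  have b0: "b \<ge> 0" using C(1) A a(1) by (simp add: b_def)
  have Flip: "norm (Fv x - Fv y) \<le> b * norm (x - y)" if "S x \<le> A + 1" "S y \<le> A + 1" for x y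
  proof -
    have "norm (Fv x - Fv y) \<le> hn 0 (Fv x - Fv y)" by (rule norm_le_hn)
    also have "\<dots> \<le> C * (1 + hn 3 (J (uu x)) + hn 3 (J (uu y))) * hn 3 (J (uu x) - J (uu y))" unfolding Fv_def by (rule C(2)[OF vH3 vH3])
    also have "\<dots> \<le> C * (1 + 4 * (A + 1)) * (2 * a * norm (x - y))"
      using v3[OF that(1)] v3[OF that(2)] C(1) A vdiff by (intro mult_mono mult_left_mono) auto
    finally show ?thesis by (simp add: b_def algebra_simps)
  qed
  have Fbd: "norm (Fv x) \<le> B" if "S x \<le> A + 1" for x
    using B(2)[OF vH3 v3[OF that]] norm_le_hn[of "Fv x" 0] by (simp add: Fv_def)
  define g where "g y = cutoff A (S y) *\<^sub>R Fv y" for y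
  have "norm (g x - g y) \<le> (a * B + b) * norm (x - y)" for x y
    unfolding g_def by (rule cutoff_product_lipschitz[OF Slip Fbd Flip a(1) b0 B(1)])
  from ode_lipschitz_solution[OF this T, of 0]
  obtain y where y: "y 0 = 0" "\<And>t. t \<in> {-T..T} ==> (y has_vector_derivative g (y t)) (at t within {-T..T})" by blast
  have "reg_sol r n N A T (\<lambda>t. uu (y t))"
    unfolding reg_sol_def
  proof (intro conjI allI impI ballI)
    show "uu (y t) \<in> H N" for t by (rule uH)
    fix k t assume k: "k \<le> N" and t: "t \<in> {-T..T}"
    have k2: "k \<le> 2 * n" using k N by simp
    obtain c where c: "c \<ge> 0" "\<And>f. norm ((D ^^ k) (J f)) \<le> c * norm f" using Kn_smoothing[OF r k2] unfolding J_def by blast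
    have bl: "bounded_linear (\<lambda>f. (D ^^ k) (J f))"
      by (rule bounded_linear_intro[where K = c])
        (use c in \<open>auto simp: Jlin Dp_add[OF JH[OF k2] JH[OF k2]] Dp_scale[OF JH[OF k2]] mult.commute\<close>)
    have "((\<lambda>t. (D ^^ k) u0 + (D ^^ k) (J (y t))) has_vector_derivative (0 + (D ^^ k) (J (g (y t))))) (at t within {-T..T})"
      by (intro has_vector_derivative_add has_vector_derivative_const bounded_linear.has_vector_derivative[OF bl y(2)[OF t]])
    moreover have "(D ^^ k) (uu x) = (D ^^ k) u0 + (D ^^ k) (J x)" for x
      unfolding uu_def by (rule Dp_add[OF u0 JH[OF N(2)] k])
    moreover have "(D ^^ k) (J (g (y t))) = cutoff A (S (y t)) *\<^sub>R J ((D ^^ k) (Fv (y t)))"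
    proof -
      have "J (uu (y t)) \<in> H (k + 3)" 
        using Kn_H[OF d0 uH, of n "y t"] H_mono[of _ "N + 2 * n" "k + 3"] k N unfolding J_def by simp
      then have "Fv (y t) \<in> H k" unfolding Fv_def by (rule F_H)
      then have "(D ^^ k) (J (Fv (y t))) = J ((D ^^ k) (Fv (y t)))" unfolding J_def by (rule Kn_Dp[OF d0]) simp
      then show ?thesis unfolding g_def by (simp add: Jlin Dp_scale[OF JH[OF k2] order_refl])
    qed
    ultimately show "((\<lambda>t. (D ^^ k) (uu (y t))) has_vector_derivative
        cutoff A (hn N (uu (y t))) *\<^sub>R (K r ^^ n) ((D ^^ k) (F ((K r ^^ n) (uu (y t)))))) (at t within {-T..T})"
      by (simp add: S_def J_def Fv_def)
  qed
  moreover have "uu (y 0) = u0" using y(1) linear_0[OF bounded_linear.linear[OF Jl]] by (simp add: uu_def)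
  ultimately show ?thesis by (intro exI[of _ "\<lambda>t. uu (y t)"]) auto
qed

text \<open>One J is moved to the other factor, so the right-hand side is the energy rate of the
  original equation at v = J u, and the estimates for \<open>F\<close> apply without a constant
  depending on the smoothing.\<close>

lemma reg_sol_energy:
  assumes r: "r > 0" and sol: "reg_sol r n N A T u" and k: "k \<le> N" and N: "N \<ge> 3" "2 * n \<ge> N" and t: "t \<in> {-T..T}"
  shows "((\<lambda>t. (norm ((D ^^ k) (u t)))\<^sup>2) has_real_derivative
     2 * (cutoff A (hn N (u t)) * inner ((D ^^ k) (F ((K r ^^ n) (u t)))) ((D ^^ k) ((K r ^^ n) (u t))))) (at t within {-T..T})"
proof -
  have d0: "r \<noteq> 0" using r by simp
  have uH: "u t \<in> H N" using sol by (simp add: reg_sol_def)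
  have "inner ((D ^^ k) (u t)) ((K r ^^ n) ((D ^^ k) (F ((K r ^^ n) (u t)))))
      = inner ((D ^^ k) (F ((K r ^^ n) (u t)))) ((D ^^ k) ((K r ^^ n) (u t)))"
    using Kn_adj[OF d0, of n "(D ^^ k) (u t)"] Kn_Dp[OF d0 uH k, of n] by (metis inner_commute)
  then show ?thesis
    using norm_sq_has_real_derivative[of "\<lambda>t. (D ^^ k) (u t)"] sol k t unfolding reg_sol_def by fastforce
qed

lemma reg_sol_smooth:
  assumes r: "r > 0" and sol: "reg_sol r n N A T u" and N: "N \<ge> 3" "2 * n \<ge> N"
  shows "(K r ^^ n) (u t) \<in> H (N + 3)" "hn N ((K r ^^ n) (u t)) \<le> hn N (u t)"
    "k \<le> N ==> hn k ((K r ^^ n) (u t)) \<le> hn k (u t)"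
    "k \<le> N ==> (K r ^^ n) ((K r ^^ n) (F ((K r ^^ n) (u t)))) \<in> H N"
    "k \<le> N ==> t \<in> {-T..T} ==> ((\<lambda>t. (D ^^ k) ((K r ^^ n) (u t))) has_vector_derivative
       (D ^^ k) (cutoff A (hn N (u t)) *\<^sub>R (K r ^^ n) ((K r ^^ n) (F ((K r ^^ n) (u t)))))) (at t within {-T..T})"
proof -
  define J where "J = K r ^^ n"
  have d0: "r \<noteq> 0" using r by simp
  have uH: "u t \<in> H N" for t using sol by (simp add: reg_sol_def)
  \<comment> \<open>J gains 2 n \<ge> N \<ge> 3 derivatives, so F (J u) lies in \<open>H N\<close>
    again.\<close>
  show v: "(K r ^^ n) (u t) \<in> H (N + 3)" for t
    using H_mono[OF Kn_H[OF d0 uH, of n t], of "N + 3"] N by simp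
  show h: "hn k ((K r ^^ n) (u t)) \<le> hn k (u t)" if "k \<le> N" for k
    by (rule Kn_hn[OF d0 H_mono[OF uH that]])
  show "hn N ((K r ^^ n) (u t)) \<le> hn N (u t)" by (rule h) simp
  have FN: "F ((K r ^^ n) (u t)) \<in> H N" for t by (rule F_H[OF v])
  then show JJ: "(K r ^^ n) ((K r ^^ n) (F ((K r ^^ n) (u t)))) \<in> H N" for t by (intro Kn_H'[OF d0])
  assume k: "k \<le> N" and t: "t \<in> {-T..T}"
  have "((\<lambda>t. (D ^^ k) (u t)) has_vector_derivative
       cutoff A (hn N (u t)) *\<^sub>R J ((D ^^ k) (F (J (u t))))) (at t within {-T..T})"
    using sol k t unfolding reg_sol_def J_def by blast
  from bounded_linear.has_vector_derivative[OF Kn_lin[OF d0, of n] this]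
  have "((\<lambda>t. J ((D ^^ k) (u t))) has_vector_derivative
      J (cutoff A (hn N (u t)) *\<^sub>R J ((D ^^ k) (F (J (u t)))))) (at t within {-T..T})"
    unfolding J_def .
  moreover have "J ((D ^^ k) (u t)) = (D ^^ k) (J (u t))" for t unfolding J_def by (rule Kn_Dp[OF d0 uH k, symmetric])
  moreover have "J (c *\<^sub>R J ((D ^^ k) (F (J (u t))))) = (D ^^ k) (c *\<^sub>R J (J (F (J (u t)))))" for c
  proof -
    have "(D ^^ k) (c *\<^sub>R J (J (F (J (u t))))) = c *\<^sub>R (D ^^ k) (J (J (F (J (u t)))))"
      unfolding J_def by (rule Dp_scale[OF JJ k])
    also have "(D ^^ k) (J (J (F (J (u t))))) = J (J ((D ^^ k) (F (J (u t)))))"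
      unfolding J_def using Kn_Dp[OF d0 FN k, of n] Kn_Dp[OF d0 Kn_H'[OF d0 FN] k, of n n] by simp
    finally show ?thesis using bounded_linear.linear[OF Kn_lin[OF d0, of n]] by (simp add: linear_scale J_def)
  qed
  ultimately show "((\<lambda>t. (D ^^ k) ((K r ^^ n) (u t))) has_vector_derivative
       (D ^^ k) (cutoff A (hn N (u t)) *\<^sub>R (K r ^^ n) ((K r ^^ n) (F ((K r ^^ n) (u t)))))) (at t within {-T..T})"
    by (simp add: J_def)
qed


section \<open>A priori bounds uniform in the regularisation\<close>

lemma reg_L2_bound:
  assumes T: "T > 0"
  shows "\<exists>C\<ge>1. \<forall>d n N A u t. d > 0 --> reg_sol d n N A T u --> N \<ge> 3 --> 2 * n \<ge> N --> t \<in> {-T..T} -->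
     1 + (norm (u t))\<^sup>2 \<le> C * (1 + (norm (u 0))\<^sup>2)"
proof -
  obtain C where C: "C \<ge> 0" "\<And>v. v \<in> H 3 ==> \<bar>inner v (F v)\<bar> \<le> C * (1 + (norm v)\<^sup>2)" using L2_estimate by blast
  show ?thesis
  proof (intro exI[of _ "exp (2 * C * T)"] conjI allI impI)
    show "1 \<le> exp (2 * C * T)" using C(1) T by simp
    fix d n N A u t
    assume d: "d > 0" and sol: "reg_sol d n N A T u" and N: "N \<ge> 3" "2 * n \<ge> N" and t: "t \<in> {-T..T}"
    have "1 + (norm (u t))\<^sup>2 \<le> (1 + (norm (u 0))\<^sup>2) * exp (2 * C * \<bar>t\<bar>)"
    proof (rule gronwall_two_sided[OF _ _ t])
      fix s assume s: "s \<in> {-T..T}"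
      let ?v = "(K d ^^ n) (u s)"
      show "((\<lambda>t. 1 + (norm (u t))\<^sup>2) has_real_derivative 2 * (cutoff A (hn N (u s)) * inner (F ?v) ?v)) (at s within {-T..T})"
        using DERIV_add[OF DERIV_const[of 1] reg_sol_energy[OF d sol _ N s, of 0]] by simp
      have v: "?v \<in> H 3" using H_mono[OF reg_sol_smooth(1)[OF d sol N]] by simp
      have "\<bar>inner (F ?v) ?v\<bar> \<le> C * (1 + (norm ?v)\<^sup>2)" using C(2)[OF v] by (simp add: inner_commute)
      also have "\<dots> \<le> C * (1 + (norm (u s))\<^sup>2)"
        using Kn_norm[of d n "u s"] d C(1) by (intro mult_left_mono add_mono power_mono) auto
      finally have "\<bar>cutoff A (hn N (u s)) * inner (F ?v) ?v\<bar> \<le> 1 * (C * (1 + (norm (u s))\<^sup>2))"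
        unfolding abs_mult using cutoff_bounds by (intro mult_mono) auto
      then show "\<bar>2 * (cutoff A (hn N (u s)) * inner (F ?v) ?v)\<bar> \<le> 2 * C * (1 + (norm (u s))\<^sup>2)" by simp
    qed
    also have "\<dots> \<le> (1 + (norm (u 0))\<^sup>2) * exp (2 * C * T)"
      using t C(1) by (intro mult_left_mono) (auto simp: mult_left_mono)
    finally show "1 + (norm (u t))\<^sup>2 \<le> exp (2 * C * T) * (1 + (norm (u 0))\<^sup>2)" by (simp add: mult.commute)
  qed
qed

text \<open>\<open>E1\<close> is evaluated at J u, because only there the exact cancellation of
  \<open>E1_drift\<close> holds; the bound is accordingly one for J u. It needs no smallness of
  r.\<close>

lemma reg_H1_bound:
  assumes T: "T > 0"
  shows "\<exists>M\<ge>0. \<forall>r n N A u t. r > 0 --> reg_sol r n N A T u --> N \<ge> 3 --> 2 * n \<ge> N --> hn 1 (u 0) \<le> R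
     --> t \<in> {-T..T} --> hn 1 ((K r ^^ n) (u t)) \<le> M"
proof -
  obtain C where C: "C \<ge> 1" "\<And>r n N A u t. r > 0 ==> reg_sol r n N A T u ==> N \<ge> 3 ==> 2 * n \<ge> N ==> t \<in> {-T..T} ==>
     1 + (norm (u t))\<^sup>2 \<le> C * (1 + (norm (u 0))\<^sup>2)" using reg_L2_bound[OF T] by blast
  define Q where "Q = sqrt (C * (1 + R\<^sup>2))"
  have Q0: "Q \<ge> 0" using C(1) by (simp add: Q_def)
  obtain Cc where Cc: "Cc \<ge> 0" "\<And>v. v \<in> dom ==> norm v \<le> Q ==> \<bar>E1 v - (norm (D v))\<^sup>2 / 2\<bar> \<le> (norm (D v))\<^sup>2 / 4 + Cc"
    using E1_coercive[of Q] by blast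
  obtain Cm where Cm: "Cm \<ge> 0" "\<And>f. norm (m 0 f) \<le> Cm * norm f" using m_bound by blast
  define B where "B = hn 2 h * Q + 6 * (Cm * Q) * norm h + 6 * hn 2 h * Q\<^sup>2"
  have B0: "B \<ge> 0" using Q0 Cm(1) by (simp add: B_def)
  \<comment> \<open>||D v||^2 / 4 is at most E1 v + Cc, the energy drifts by at most B T, and
    initially it is at most 3/4 R^2 + Cc.\<close>
  define P where "P = 4 * (B * T + 3/4 * R\<^sup>2 + 2 * Cc)"
  show ?thesis
  proof (intro exI[of _ "Q + sqrt P"] conjI allI impI)
    show "0 \<le> Q + sqrt P" using Q0 B0 T Cc(1) by (simp add: P_def)
    fix r n N A u t
    assume r: "r > 0" and sol: "reg_sol r n N A T u" and N: "N \<ge> 3" "2 * n \<ge> N" and R: "hn 1 (u 0) \<le> R" and t: "t \<in> {-T..T}"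
    define v where "v s = (K r ^^ n) (u s)" for s
    have d0: "r \<noteq> 0" using r by simp
    have R0: "0 \<le> R" using R hn_nonneg[of 1 "u 0"] by linarith
    have vN: "v s \<in> H (N + 3)" for s unfolding v_def by (rule reg_sol_smooth(1)[OF r sol N])
    have v3: "v s \<in> H 3" "v s \<in> H 2" "v s \<in> dom" for s
      using H_mono[OF vN[of s], of 3] H_mono[OF vN[of s], of 2] by (auto simp: H_2)
    have vQ: "norm (v s) \<le> Q" if "s \<in> {-T..T}" for s
    proof -
      have "norm (u 0) \<le> R" using R norm_le_hn[of "u 0" 1] by linarith
      then have "C * (1 + (norm (u 0))\<^sup>2) \<le> C * (1 + R\<^sup>2)" using C(1) by (intro mult_left_mono add_mono power_mono) auto
      then have "(norm (u s))\<^sup>2 \<le> C * (1 + R\<^sup>2)" using C(2)[OF r sol N that] by linarith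
      then have "norm (u s) \<le> Q" unfolding Q_def by (rule real_le_rsqrt)
      then show ?thesis using Kn_norm[OF d0, of n "u s"] by (simp add: v_def)
    qed
    define v' where "v' s = cutoff A (hn N (u s)) *\<^sub>R (K r ^^ n) ((K r ^^ n) (F (v s)))" for s
    have dv: "((\<lambda>t. (D ^^ k) (v t)) has_vector_derivative (D ^^ k) (v' s)) (at s within {-T..T})" if "k \<le> N" "s \<in> {-T..T}" for k s
      using reg_sol_smooth(5)[OF r sol N that] by (simp add: v_def v'_def)
    have v'd: "v' s \<in> dom" for s
      using reg_sol_smooth(4)[OF r sol N, of 0 s] H_dom[of _ N] N by (auto simp: v'_def v_def intro!: dom_scale)
    have E1': "((\<lambda>t. E1 (v t)) has_real_derivative inner (X (v s)) (v' s)) (at s within {-T..T})" if "s \<in> {-T..T}" for s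
      using dv[OF _ that, of 0] dv[OF _ that, of 1] N by (intro E1_derivative v3 v'd) auto
    have E1'b: "\<bar>inner (X (v s)) (v' s)\<bar> \<le> B" if s: "s \<in> {-T..T}" for s
    proof -
      have "\<bar>inner (X (v s)) ((K r ^^ n) ((K r ^^ n) (F (v s))))\<bar> \<le> hn 2 h * norm (v s) + 6 * norm (m 0 (v s)) * norm h + 6 * hn 2 h * (norm (v s))\<^sup>2"
        using E1_drift[OF r v3(2)[of s], of n] v3(1)[of s] by simp
      also have "\<dots> \<le> B"
      proof -
        have "norm (m 0 (v s)) \<le> Cm * Q" using Cm vQ[OF s] by (meson mult_left_mono order_trans)
        then show ?thesis unfolding B_def using vQ[OF s] by (intro add_mono mult_left_mono mult_right_mono power_mono) auto
      qed
      finally have "cutoff A (hn N (u s)) * \<bar>inner (X (v s)) ((K r ^^ n) ((K r ^^ n) (F (v s))))\<bar> \<le> 1 * B"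
        using cutoff_bounds by (intro mult_mono) auto
      then show ?thesis using cutoff_bounds by (simp add: v'_def abs_mult)
    qed
    have "norm (E1 (v t) - E1 (v 0)) \<le> B * norm (t - 0)"
      using T t by (intro field_differentiable_bound[of "{-T..T}" "\<lambda>t. E1 (v t)" "\<lambda>s. inner (X (v s)) (v' s)"] E1') (auto intro: E1'b)
    also have "\<dots> \<le> B * T" using t B0 by (intro mult_left_mono) auto
    finally have diff: "\<bar>E1 (v t) - E1 (v 0)\<bar> \<le> B * T" by simp
    have z: "0 \<in> {-T..T}" using T by simp
    have "hn 1 (v 0) \<le> R" using reg_sol_smooth(3)[OF r sol N, of 1 0] R N by (simp add: v_def)
    then have "norm (D (v 0)) \<le> R" using norm_D_le_hn[of "v 0"] by linarith
    then have "(norm (D (v 0)))\<^sup>2 \<le> R\<^sup>2" by (intro power_mono) auto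
    then have "E1 (v 0) \<le> 3/4 * R\<^sup>2 + Cc" using Cc(2)[OF v3(3) vQ[OF z]] by linarith
    then have "(norm (D (v t)))\<^sup>2 \<le> P" using Cc(2)[OF v3(3) vQ[OF t]] diff unfolding P_def abs_le_iff by argo
    then have "norm (D (v t)) \<le> sqrt P" by (rule real_le_rsqrt)
    then show "hn 1 ((K r ^^ n) (u t)) \<le> Q + sqrt P" using vQ[OF t] by (simp add: v_def hn_def)
  qed
qed

lemma X_norm_le:
  assumes "6 *\<^sub>R m 0 v + 3 *\<^sub>R (v \<odot> v) = y"
  shows "norm (X v) \<le> norm (D (D v)) + norm y" "norm (D (D v)) \<le> norm (X v) + norm y"
proof -
  have "X v = y - D (D v)" "D (D v) = y - X v" using assms by (auto simp: X_def)
  then show "norm (X v) \<le> norm (D (D v)) + norm y" "norm (D (D v)) \<le> norm (X v) + norm y"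
    using norm_triangle_ineq4[of y "D (D v)"] norm_triangle_ineq4[of y "X v"] by simp_all
qed

text \<open>J J - 1 costs one derivative and gains a factor r. An H^2 bound of the error thus needs
  F v in \<open>H 3\<close>, hence v in \<open>H 6\<close>, which explains N \<ge> 6. Bounds of that
  order are known only where the cutoff is active, so B depends on A.\<close>

lemma reg_error:
  assumes A: "A \<ge> 0"
  shows "\<exists>B\<ge>0. \<forall>r n N T u t. r > 0 --> reg_sol r n N A T u --> N \<ge> 6 --> 2 * n \<ge> N --> hn N (u t) \<le> A + 1 -->
     hn 2 ((K r ^^ n) ((K r ^^ n) (F ((K r ^^ n) (u t)))) - F ((K r ^^ n) (u t))) \<le> n * r * B"
proof -
  obtain B where B: "B \<ge> 0" "\<And>v. v \<in> H 6 ==> hn 6 v \<le> 2 * (A + 1) ==> hn 3 (F v) \<le> B"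
    using F_bound[of 3 "2 * (A + 1)"] by auto
  show ?thesis
  proof (intro exI[of _ "4 * B"] conjI allI impI)
    fix r n N T u t
    assume r: "r > 0" and sol: "reg_sol r n N A T u" and N: "N \<ge> 6" "2 * n \<ge> N" and uA: "hn N (u t) \<le> A + 1"
    have N3: "N \<ge> 3" using N by simp
    have d0: "r \<noteq> 0" using r by simp
    define v where "v = (K r ^^ n) (u t)"
    have vN: "v \<in> H (N + 3)" unfolding v_def by (rule reg_sol_smooth(1)[OF r sol N3 N(2)])
    have v6: "v \<in> H 6" "v \<in> H N" using H_mono[OF vN] N by auto
    have "hn 6 v \<le> 2 * hn N v" by (rule hn_mono[OF v6(2) N(1)])
    moreover have "hn N v \<le> hn N (u t)" unfolding v_def by (rule reg_sol_smooth(2)[OF r sol N3 N(2)])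
    ultimately have h6: "hn 6 v \<le> 2 * (A + 1)" using uA by argo
    define f where "f = F v"
    have f3: "f \<in> H 3" unfolding f_def using F_H[of v 3] v6 by simp
    have fB: "hn 3 f \<le> B" unfolding f_def by (rule B(2)[OF v6(1) h6])
    have JJ: "(K r ^^ n) ((K r ^^ n) g) = (K r ^^ (n + n)) g" for g by (simp add: funpow_add)
    have fd: "f \<in> dom" "D (D f) \<in> dom" using f3 by (auto simp: H_Suc numeral_3_eq_3)
    have Df: "norm (D f) \<le> B" "norm (D (D (D f))) \<le> B"
      using interpolation[OF f3, of 1] interpolation[OF f3, of 3] fB by (auto simp: numeral_3_eq_3)
    have 1: "norm ((K r ^^ (n + n)) f - f) \<le> 2 * n * r * B"
    proof -
      have "norm ((K r ^^ (n + n)) f - f) \<le> real (n + n) * r * norm (D f)" by (rule Kn_near1[OF r fd(1)])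
      also have "\<dots> \<le> real (n + n) * r * B" using Df r by (intro mult_left_mono) auto
      finally show ?thesis by simp
    qed
    have 2: "norm ((D ^^ 2) ((K r ^^ (n + n)) f - f)) \<le> 2 * n * r * B"
    proof -
      have f2: "f \<in> H 2" using H_mono[OF f3] by simp
      have "(D ^^ 2) ((K r ^^ (n + n)) f - f) = (D ^^ 2) ((K r ^^ (n + n)) f) - (D ^^ 2) f"
        by (rule Dp_diff[OF Kn_H'[OF d0 f2] f2 order_refl])
      also have "\<dots> = (K r ^^ (n + n)) ((D ^^ 2) f) - (D ^^ 2) f" using Kn_Dp[OF d0 f2 order_refl] by simp
      also have "norm \<dots> \<le> real (n + n) * r * norm (D ((D ^^ 2) f))"
        by (rule Kn_near1[OF r]) (use fd in \<open>simp add: numeral_2_eq_2\<close>)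
      also have "\<dots> \<le> real (n + n) * r * B" using Df r by (intro mult_left_mono) (auto simp: numeral_2_eq_2)
      finally show ?thesis by simp
    qed
    show "hn 2 ((K r ^^ n) ((K r ^^ n) (F ((K r ^^ n) (u t)))) - F ((K r ^^ n) (u t))) \<le> n * r * (4 * B)"
      unfolding v_def[symmetric] f_def[symmetric] JJ hn_def[of 2] using 1 2 by linarith
  qed (use B in simp)
qed

text \<open>J J F v is split as D (X v) + h + e: the first part is controlled by the cancellation in
  \<open>G_DX\<close>, the others by \<open>G_bound\<close>. The error e is at most 1 once r is
  below a threshold depending on A, n and N, while M is fixed before them; this order of quantifiers
  later permits removing the cutoff.\<close>

lemma reg_H2_bound:
  assumes T: "T > 0"
  shows "\<exists>M\<ge>0. \<forall>A n N. A \<ge> 0 --> N \<ge> 6 --> 2 * n \<ge> N --> (\<exists>r0>0. \<forall>r u t. 0 < r --> r < r0 --> reg_sol r n N A T u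
     --> hn 2 (u 0) \<le> R --> t \<in> {-T..T} --> hn 2 ((K r ^^ n) (u t)) \<le> M)"
proof -
  obtain M where M: "M \<ge> 0" "\<And>r n N A u t. r > 0 ==> reg_sol r n N A T u ==> N \<ge> 3 ==> 2 * n \<ge> N ==> hn 1 (u 0) \<le> 2 * R
     ==> t \<in> {-T..T} ==> hn 1 ((K r ^^ n) (u t)) \<le> M" using reg_H1_bound[OF T, of "2 * R"] by blast
  obtain C1 where C1: "C1 \<ge> 0" "\<And>v. v \<in> H 5 ==> hn 1 v \<le> M ==> \<bar>G v (D (X v))\<bar> \<le> C1 * (1 + norm (X v))\<^sup>2"
    using G_DX_bound[of M] by blast
  obtain C2 where C2: "C2 \<ge> 0" "\<And>v z. v \<in> H 3 ==> z \<in> H 2 ==> hn 1 v \<le> M ==> \<bar>G v z\<bar> \<le> C2 * hn 2 z * (1 + norm (X v))"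
    using G_bound[of M] by blast
  obtain Y where Y: "Y \<ge> 0" "\<And>v. v \<in> dom ==> hn 1 v \<le> M ==> hn 1 (6 *\<^sub>R m 0 v + 3 *\<^sub>R (v \<odot> v)) \<le> Y"
    using lower_part_bound[of M] by blast
  define C3 where "C3 = C1 + C2 * (hn 2 h + 1)"
  have C30: "C3 \<ge> 0" using C1(1) C2(1) by (simp add: C3_def)
  define P where "P = 2 * (((\<bar>R\<bar> + Y)\<^sup>2 / 2 + 2 * M^3 + 1) * exp (4 * C3 * T))"
  have P0: "P \<ge> 0" using M(1) by (simp add: P_def)
  show ?thesis
  proof (rule exI[of _ "M + sqrt P + Y"], intro conjI allI impI)
    show "0 \<le> M + sqrt P + Y" using M(1) P0 Y(1) by simp
    fix A :: real and n N :: nat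
    assume A: "A \<ge> 0" and N: "N \<ge> 6" "2 * n \<ge> N"
    have N3: "N \<ge> 3" using N by simp
    obtain B :: real where B: "B \<ge> 0" "\<And>(r::real) u t. r > 0 ==> reg_sol r n N A T u ==> hn N (u t) \<le> A + 1 ==>
       hn 2 ((K r ^^ n) ((K r ^^ n) (F ((K r ^^ n) (u t)))) - F ((K r ^^ n) (u t))) \<le> n * r * B"
      using reg_error[OF A] N by (metis (no_types, lifting))
    \<comment> \<open>Chosen so that n r B \<le> 1 for r < r0; the summand 1 covers n B = 0.\<close>
    define r0 where "r0 = 1 / (n * B + 1)"
    have nB: "n * B \<ge> 0" using B(1) by simp
    show "\<exists>r0>0. \<forall>r u t. 0 < r --> r < r0 --> reg_sol r n N A T u
     --> hn 2 (u 0) \<le> R --> t \<in> {-T..T} --> hn 2 ((K r ^^ n) (u t)) \<le> M + sqrt P + Y"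
    proof (intro exI[of _ r0] conjI allI impI)
      show "r0 > 0" using nB by (simp add: r0_def)
      fix r u t
      assume r: "0 < r" "r < r0" and sol: "reg_sol r n N A T u" and R: "hn 2 (u 0) \<le> R" and t: "t \<in> {-T..T}"
      have d0: "r \<noteq> 0" using r by simp
      have small: "n * r * B \<le> 1"
      proof -
        have "(n * B) * r \<le> (n * B) * r0" using r nB by (intro mult_left_mono) auto
        also have "\<dots> \<le> 1" using nB by (simp add: r0_def)
        finally show ?thesis by (simp add: ac_simps)
      qed
      define v where "v s = (K r ^^ n) (u s)" for s
      have uN: "u s \<in> H N" for s using sol by (simp add: reg_sol_def)
      have R1: "hn 1 (u 0) \<le> 2 * R" using hn_mono[OF H_mono[OF uN, of 2], of 1 0] R N by simp
      have vN: "v s \<in> H (N + 3)" for s unfolding v_def by (rule reg_sol_smooth(1)[OF r(1) sol N3 N(2)])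
      have v6: "v s \<in> H 6" "v s \<in> H 5" "v s \<in> H 3" "v s \<in> H 2" "v s \<in> dom" "D (v s) \<in> dom" for s
        using H_mono[OF vN[of s], of 6] H_mono[OF vN[of s], of 5] H_mono[OF vN[of s], of 3] H_mono[OF vN[of s], of 2] N by (auto simp: H_2)
      have vM: "hn 1 (v s) \<le> M" if "s \<in> {-T..T}" for s unfolding v_def by (rule M(2)[OF r(1) sol N3 N(2) R1 that])
      define w where "w s = (K r ^^ n) ((K r ^^ n) (F (v s)))" for s
      have wN: "w s \<in> H N" for s
        using reg_sol_smooth(4)[OF r(1) sol N3 N(2), of 0 s] by (simp add: w_def v_def)
      have w2: "w s \<in> H 2" for s using H_mono[OF wN] N by simp
      have dv: "((\<lambda>t. (D ^^ k) (v t)) has_vector_derivative (D ^^ k) (cutoff A (hn N (u s)) *\<^sub>R w s)) (at s within {-T..T})" if "k \<le> N" "s \<in> {-T..T}" for k s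
        using reg_sol_smooth(5)[OF r(1) sol N3 N(2) that] by (simp add: v_def w_def)
      have E2': "((\<lambda>t. E2 (v t)) has_real_derivative cutoff A (hn N (u s)) * G (v s) (w s)) (at s within {-T..T})" if s: "s \<in> {-T..T}" for s
      proof -
        have "((\<lambda>t. E2 (v t)) has_real_derivative G (v s) (cutoff A (hn N (u s)) *\<^sub>R w s)) (at s within {-T..T})"
          using dv[OF _ s, of 0] dv[OF _ s, of 1] dv[OF _ s, of 2] N
          by (intro E2_derivative v6 H_scale w2) (auto simp: numeral_2_eq_2)
        then show ?thesis using G_linear(2)[OF v6(4) w2 w2] by simp
      qed
      define x where "x s = norm (X (v s))" for s
      have G: "\<bar>cutoff A (hn N (u s)) * G (v s) (w s)\<bar> \<le> C3 * (1 + x s)\<^sup>2" if s: "s \<in> {-T..T}" for s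
      proof (cases "hn N (u s) \<le> A + 1")
        case False
        then have "cutoff A (hn N (u s)) = 0" by (intro cutoff_eq_0) simp
        then show ?thesis using C30 by simp
      next
        case True
        define e where "e = w s - F (v s)"
        have FH: "F (v s) \<in> H 2" using F_H[of "v s" 2] v6(2)[of s] by simp
        have XH: "D (X (v s)) \<in> H 2" using D_H[of "X (v s)" 2] X_H[of "v s" 3] v6(2)[of s] by simp
        have eH: "e \<in> H 2" unfolding e_def by (rule H_diff[OF w2 FH])
        have e1: "hn 2 e \<le> 1" using B(2)[OF r(1) sol True] small by (simp add: e_def w_def v_def)
        have he: "h + e \<in> H 2" "hn 2 (h + e) \<le> hn 2 h + 1" using H_add[OF h_H eH] hn_add[OF h_H eH] e1 by auto
        have "w s = D (X (v s)) + (h + e)" by (simp add: e_def F_def)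
        then have "G (v s) (w s) = G (v s) (D (X (v s))) + G (v s) (h + e)" using G_linear(1)[OF v6(4) XH he(1)] by simp
        also have "\<bar>\<dots>\<bar> \<le> C1 * (1 + x s)\<^sup>2 + C2 * (hn 2 h + 1) * (1 + x s)\<^sup>2"
        proof -
          have 1: "\<bar>G (v s) (D (X (v s)))\<bar> \<le> C1 * (1 + x s)\<^sup>2" unfolding x_def by (rule C1(2)[OF v6(2) vM[OF s]])
          have "\<bar>G (v s) (h + e)\<bar> \<le> C2 * hn 2 (h + e) * (1 + x s)" unfolding x_def by (rule C2(2)[OF v6(3) he(1) vM[OF s]])
          also have "\<dots> \<le> C2 * (hn 2 h + 1) * (1 + x s)\<^sup>2"
          proof (intro mult_mono mult_left_mono he C2(1))
            have "0 \<le> x s" by (simp add: x_def)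
            then show "1 + x s \<le> (1 + x s)\<^sup>2" by (simp add: power2_sum)
          qed (auto simp: x_def C2(1))
          finally show ?thesis using 1 by linarith
        qed
        finally have "\<bar>G (v s) (w s)\<bar> \<le> C3 * (1 + x s)\<^sup>2" by (simp add: C3_def algebra_simps)
        then have "cutoff A (hn N (u s)) * \<bar>G (v s) (w s)\<bar> \<le> 1 * (C3 * (1 + x s)\<^sup>2)"
          using cutoff_bounds by (intro mult_mono) auto
        then show ?thesis using cutoff_bounds by (simp add: abs_mult)
      qed
      have co: "\<bar>E2 (v s) - (x s)\<^sup>2 / 2\<bar> \<le> M^3" if s: "s \<in> {-T..T}" for s
      proof -
        have Dv: "norm (D (v s)) \<le> M" using vM[OF s] norm_D_le_hn[of "v s"] by linarith
        have "norm (v s \<odot> D (v s)) \<le> M * M"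
          using norm_mul[OF v6(5), of s "D (v s)"] mult_mono[OF vM[OF s] Dv] M(1) by simp
        from abs_inner_le[OF this Dv] show ?thesis by (simp add: E2_def x_def power3_eq_cube)
      qed
      \<comment> \<open>\<open>E2\<close> equals x^2 / 2 up to M^3, so the shifted quantity is at
        least 1 + x^2 / 2, and four times it dominates (1 + x)^2.\<close>
      have "E2 (v t) + M^3 + 1 \<le> (E2 (v 0) + M^3 + 1) * exp (4 * C3 * \<bar>t\<bar>)"
      proof (rule gronwall_two_sided[OF _ _ t])
        fix s assume s: "s \<in> {-T..T}"
        show "((\<lambda>t. E2 (v t) + M^3 + 1) has_real_derivative cutoff A (hn N (u s)) * G (v s) (w s)) (at s within {-T..T})"
          using E2'[OF s] by (auto intro!: derivative_eq_intros)
        have "(1 + x s)\<^sup>2 \<le> 2 * (1 + (x s)\<^sup>2)" using zero_le_power2[of "1 - x s"] by (simp add: power2_sum power2_diff)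
        also have "\<dots> \<le> 4 * (E2 (v s) + M^3 + 1)" using co[OF s] unfolding abs_le_iff by argo
        finally have "C3 * (1 + x s)\<^sup>2 \<le> C3 * (4 * (E2 (v s) + M^3 + 1))" using C30 by (rule mult_left_mono)
        then show "\<bar>cutoff A (hn N (u s)) * G (v s) (w s)\<bar> \<le> 4 * C3 * (E2 (v s) + M^3 + 1)"
          using order_trans[OF G[OF s]] by (simp only: mult.assoc mult.left_commute[of 4])
      qed
      also have "\<dots> \<le> ((\<bar>R\<bar> + Y)\<^sup>2 / 2 + 2 * M^3 + 1) * exp (4 * C3 * T)"
      proof (rule mult_mono)
        have z: "0 \<in> {-T..T}" using T by simp
        have "hn 2 (v 0) \<le> R" using reg_sol_smooth(3)[OF r(1) sol N3 N(2), of 2 0] R N by (simp add: v_def)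
        then have "norm (D (D (v 0))) \<le> R" using norm_DD_le_hn[of "v 0"] by linarith
        then have "x 0 \<le> \<bar>R\<bar> + Y"
          using X_norm_le(1)[OF refl, of "v 0"] Y(2)[OF v6(5) vM[OF z]] norm_le_hn[of _ 1] unfolding x_def by (smt (verit))
        then have "(x 0)\<^sup>2 \<le> (\<bar>R\<bar> + Y)\<^sup>2" by (intro power_mono) (auto simp: x_def)
        then show "E2 (v 0) + M^3 + 1 \<le> (\<bar>R\<bar> + Y)\<^sup>2 / 2 + 2 * M^3 + 1" using co[OF z] by linarith
        show "exp (4 * C3 * \<bar>t\<bar>) \<le> exp (4 * C3 * T)" using t C30 by (auto intro!: mult_left_mono)
      qed (use M(1) in auto)
      finally have "(x t)\<^sup>2 \<le> P" unfolding P_def using co[OF t] by linarith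
      then have "x t \<le> sqrt P" by (rule real_le_rsqrt)
      then have "norm (D (D (v t))) \<le> sqrt P + Y"
        using X_norm_le(2)[OF refl, of "v t"] Y(2)[OF v6(5) vM[OF t]] norm_le_hn[of _ 1] unfolding x_def by (smt (verit))
      then show "hn 2 ((K r ^^ n) (u t)) \<le> M + sqrt P + Y"
        using vM[OF t] norm_le_hn[of "v t" 1] unfolding v_def[symmetric] hn_def[of 2] by (simp add: numeral_2_eq_2)
    qed
  qed
qed

text \<open>With order k - 1 bounded, 1 + ||u||^2 + ||D^k u||^2 satisfies a linear differential
  inequality. The hypothesis concerns J u and the conclusion u itself, so the bound can be fed back
  at the next order.\<close>

lemma reg_linear_bound:
  assumes T: "T > 0" and k: "k \<ge> 3" and B: "B \<ge> 0"
  shows "\<exists>C\<ge>0. \<forall>d n N A u t. d > 0 --> reg_sol d n N A T u --> k \<le> N --> 2 * n \<ge> N -->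
     (\<forall>s\<in>{-T..T}. hn (k - 1) ((K d ^^ n) (u s)) \<le> B) --> t \<in> {-T..T} --> hn k (u t) \<le> C * (1 + hn k (u 0))"
proof -
  obtain C0 where C0: "C0 \<ge> 0" "\<And>v. v \<in> H 3 ==> \<bar>inner v (F v)\<bar> \<le> C0 * (1 + (norm v)\<^sup>2)" using L2_estimate by blast
  obtain Ck where Ck: "Ck \<ge> 0" "\<And>v. v \<in> H (k + 3) ==> \<bar>inner ((D ^^ k) (F v)) ((D ^^ k) v)\<bar> \<le> Ck * (1 + hn (k - 1) v) * (1 + hn k v)\<^sup>2"
    using energy_estimate[OF k] by blast
  \<comment> \<open>Besides the factor 2 from differentiating squares, Ck carries the 3 of (1 + b +
    c)^2 \<le> 3 (1 + b^2 + c^2).\<close>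
  define a where "a = 2 * C0 + 6 * Ck * (1 + B)"
  have a0: "a \<ge> 0" using C0(1) Ck(1) B by (simp add: a_def)
  show ?thesis
  proof (intro exI[of _ "2 * exp (a * T)"] conjI allI impI)
    fix d n N A u t
    assume d: "d > 0" and sol: "reg_sol d n N A T u" and kN: "k \<le> N" and N: "2 * n \<ge> N"
      and vB: "\<forall>s\<in>{-T..T}. hn (k - 1) ((K d ^^ n) (u s)) \<le> B" and t: "t \<in> {-T..T}"
    have N3: "N \<ge> 3" using k kN by simp
    define y where "y s = 1 + (norm (u s))\<^sup>2 + (norm ((D ^^ k) (u s)))\<^sup>2" for s
    have yt: "y t \<le> y 0 * exp (a * \<bar>t\<bar>)"
    proof (rule gronwall_two_sided[OF _ _ t])
      fix s assume s: "s \<in> {-T..T}"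
      let ?v = "(K d ^^ n) (u s)" and ?c = "cutoff A (hn N (u s))"
      show "(y has_real_derivative 2 * (?c * inner (F ?v) ?v) + 2 * (?c * inner ((D ^^ k) (F ?v)) ((D ^^ k) ?v))) (at s within {-T..T})"
        unfolding y_def
        using DERIV_add[OF DERIV_add[OF DERIV_const[of 1] reg_sol_energy[OF d sol _ N3 N s, of 0]] reg_sol_energy[OF d sol kN N3 N s]] by simp
      have vN: "?v \<in> H (N + 3)" by (rule reg_sol_smooth(1)[OF d sol N3 N])
      have v: "?v \<in> H 3" "?v \<in> H (k + 3)" using H_mono[OF vN] kN by auto
      have "\<bar>inner (F ?v) ?v\<bar> \<le> C0 * (1 + (norm ?v)\<^sup>2)" using C0(2)[OF v(1)] by (simp add: inner_commute)
      also have "\<dots> \<le> C0 * (1 + (norm (u s))\<^sup>2)"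
        using Kn_norm[of d n "u s"] d C0(1) by (intro mult_left_mono add_mono power_mono) auto
      also have "\<dots> \<le> C0 * y s" unfolding y_def using C0(1) by (intro mult_left_mono) auto
      finally have 1: "\<bar>inner (F ?v) ?v\<bar> \<le> C0 * y s" .
      have "\<bar>inner ((D ^^ k) (F ?v)) ((D ^^ k) ?v)\<bar> \<le> Ck * (1 + hn (k - 1) ?v) * (1 + hn k ?v)\<^sup>2" by (rule Ck(2)[OF v(2)])
      also have "\<dots> \<le> Ck * (1 + B) * (3 * y s)"
      proof (intro mult_mono mult_left_mono add_mono order_refl Ck(1))
        show "hn (k - 1) ?v \<le> B" using vB s by blast
        have "(1 + hn k ?v)\<^sup>2 \<le> (1 + hn k (u s))\<^sup>2" using reg_sol_smooth(3)[OF d sol N3 N kN, of s] by (intro power_mono) auto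
        also have "\<dots> \<le> 3 * y s"
        proof -
          have "(1 + (b + c))\<^sup>2 \<le> 3 * (1 + b\<^sup>2 + c\<^sup>2)" for b c :: real
            using zero_le_power2[of "1 - b"] zero_le_power2[of "1 - c"] zero_le_power2[of "b - c"]
            by (simp add: power2_eq_square algebra_simps)
          then show ?thesis by (simp add: y_def hn_def)
        qed
        finally show "(1 + hn k ?v)\<^sup>2 \<le> 3 * y s" .
      qed (use B Ck(1) in auto)
      finally have 2: "\<bar>inner ((D ^^ k) (F ?v)) ((D ^^ k) ?v)\<bar> \<le> Ck * (1 + B) * (3 * y s)" .
      have c: "\<bar>?c * z\<bar> \<le> \<bar>z\<bar>" for z using cutoff_bounds[of A "hn N (u s)"] mult_right_mono[of ?c 1 "\<bar>z\<bar>"] by (simp add: abs_mult)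
      show "\<bar>2 * (?c * inner (F ?v) ?v) + 2 * (?c * inner ((D ^^ k) (F ?v)) ((D ^^ k) ?v))\<bar> \<le> a * y s"
        using 1 2 c[of "inner (F ?v) ?v"] c[of "inner ((D ^^ k) (F ?v)) ((D ^^ k) ?v)"]
        unfolding a_def by (simp add: algebra_simps)
    qed
    also have "\<dots> \<le> y 0 * exp (a * T)"
      using t a0 by (intro mult_left_mono) (auto simp: y_def mult_left_mono)
    also have "y 0 \<le> (1 + hn k (u 0))\<^sup>2"
    proof -
      have "1 + b\<^sup>2 + c\<^sup>2 \<le> (1 + (b + c))\<^sup>2" if "b \<ge> 0" "c \<ge> 0" for b c :: real
        using that by (simp add: power2_eq_square algebra_simps)
      then show ?thesis by (simp add: y_def hn_def)
    qed
    finally have yt: "y t \<le> (1 + hn k (u 0))\<^sup>2 * exp (a * T)" by simp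
    have "(hn k (u t))\<^sup>2 \<le> 2 * y t"
    proof -
      have "(b + c)\<^sup>2 \<le> 2 * (1 + b\<^sup>2 + c\<^sup>2)" for b c :: real
        using zero_le_power2[of "b - c"] by (simp add: power2_eq_square algebra_simps)
      then show ?thesis by (simp add: y_def hn_def)
    qed
    also have "\<dots> \<le> 4 * ((1 + hn k (u 0))\<^sup>2 * (exp (a * T) * exp (a * T)))"
    proof -
      have e: "exp (a * T) \<ge> 1" using a0 T by simp
      have "(1 + hn k (u 0))\<^sup>2 * exp (a * T) \<le> (1 + hn k (u 0))\<^sup>2 * (exp (a * T) * exp (a * T))"
        using e by (intro mult_left_mono) auto
      then show ?thesis using yt zero_le_power2[of "1 + hn k (u 0)"] 
        by (smt (verit) exp_gt_zero mult_nonneg_nonneg)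
    qed
    also have "\<dots> = (2 * exp (a * T) * (1 + hn k (u 0)))\<^sup>2" by (simp add: power2_eq_square algebra_simps)
    finally show "hn k (u t) \<le> 2 * exp (a * T) * (1 + hn k (u 0))" by (rule power2_le_imp_le) simp
  qed simp
qed

text \<open>Order 3 follows from the H^2 bound and each further order from the previous one, both
  through \<open>reg_linear_bound\<close>. R is doubled at each step because lower norms are
  dominated only up to the factor 2 in \<open>hn_mono\<close>. M is independent of A, and only the
  threshold for the smoothing scale depends on it.\<close>

lemma reg_apriori:
  assumes T: "T > 0" and k: "k \<ge> 3"
  shows "\<forall>R. \<exists>M\<ge>0. \<forall>A n N. A \<ge> 0 --> N \<ge> 6 --> k \<le> N --> 2 * n \<ge> N --> (\<exists>d0>0. \<forall>d u t. 0 < d --> d < d0 --> reg_sol d n N A T u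
     --> hn k (u 0) \<le> R --> t \<in> {-T..T} --> hn k (u t) \<le> M)" (is "\<forall>R. ?P R k")
  using k
proof (induction k rule: nat_induct_at_least)
  case base
  show ?case
  proof
  fix R
  obtain M where M0: "M \<ge> 0" and M1: "\<forall>A n N. A \<ge> 0 --> N \<ge> 6 --> 2 * n \<ge> N --> (\<exists>d0>0. \<forall>d u t. 0 < d --> d < d0 --> reg_sol d n N A T u
     --> hn 2 (u 0) \<le> 2 * R --> t \<in> {-T..T} --> hn 2 ((K d ^^ n) (u t)) \<le> M)"
    using reg_H2_bound[OF T, of "2 * R"] by (elim exE conjE) (rule that)
  note M = M0 M1[rule_format]
  obtain C where C0: "C \<ge> 0" and C1: "\<forall>d n N A u t. d > 0 --> reg_sol d n N A T u --> 3 \<le> N --> 2 * n \<ge> N -->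
     (\<forall>s\<in>{-T..T}. hn 2 ((K d ^^ n) (u s)) \<le> M) --> t \<in> {-T..T} --> hn 3 (u t) \<le> C * (1 + hn 3 (u 0))"
    using reg_linear_bound[OF T order_refl M(1)] by auto
  note C = C0 C1[rule_format]
  show "?P R 3"
  proof (rule exI[of _ "C * (1 + \<bar>R\<bar>)"], intro conjI allI impI)
    fix A :: real and n N :: nat assume A: "A \<ge> 0" and N: "N \<ge> 6" "3 \<le> N" "2 * n \<ge> N"
    obtain d0 where d0: "d0 > 0" "\<And>d u t. 0 < d ==> d < d0 ==> reg_sol d n N A T u
     ==> hn 2 (u 0) \<le> 2 * R ==> t \<in> {-T..T} ==> hn 2 ((K d ^^ n) (u t)) \<le> M" using M(2)[OF A N(1,3)] by blast
    show "\<exists>d0>0. \<forall>d u t. 0 < d --> d < d0 --> reg_sol d n N A T u --> hn 3 (u 0) \<le> R --> t \<in> {-T..T} --> hn 3 (u t) \<le> C * (1 + \<bar>R\<bar>)"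
    proof (intro exI[of _ d0] conjI allI impI d0(1))
      fix d u t assume d: "0 < d" "d < d0" and sol: "reg_sol d n N A T u" and R: "hn 3 (u 0) \<le> R" and t: "t \<in> {-T..T}"
      have "u 0 \<in> H 3" using sol H_mono N unfolding reg_sol_def by blast
      then have "hn 2 (u 0) \<le> 2 * R" using hn_mono[of "u 0" 3 2] R by simp
      then have "hn 3 (u t) \<le> C * (1 + hn 3 (u 0))" using d0(2)[OF d sol] by (intro C(2)[OF d(1) sol N(2,3) _ t])
      also have "\<dots> \<le> C * (1 + \<bar>R\<bar>)" using R C(1) by (intro mult_left_mono) auto
      finally show "hn 3 (u t) \<le> C * (1 + \<bar>R\<bar>)" .
    qed
  qed (use C in simp)
  qed
next
  case (Suc k)
  show ?case
  proof
  fix R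
  obtain M where M0: "M \<ge> 0" and M1: "\<forall>A n N. A \<ge> 0 --> N \<ge> 6 --> k \<le> N --> 2 * n \<ge> N --> (\<exists>d0>0. \<forall>d u t. 0 < d --> d < d0 --> reg_sol d n N A T u
     --> hn k (u 0) \<le> 2 * R --> t \<in> {-T..T} --> hn k (u t) \<le> M)"
    using Suc.IH[rule_format, of "2 * R"] by (elim exE conjE) (rule that)
  note M = M0 M1[rule_format]
  have k3: "Suc k \<ge> 3" using Suc.hyps by simp
  obtain C where C0: "C \<ge> 0" and C1: "\<forall>d n N A u t. d > 0 --> reg_sol d n N A T u --> Suc k \<le> N --> 2 * n \<ge> N -->
     (\<forall>s\<in>{-T..T}. hn k ((K d ^^ n) (u s)) \<le> M) --> t \<in> {-T..T} --> hn (Suc k) (u t) \<le> C * (1 + hn (Suc k) (u 0))"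
    using reg_linear_bound[OF T k3 M(1)] by auto
  note C = C0 C1[rule_format]
  show "?P R (Suc k)"
  proof (rule exI[of _ "C * (1 + \<bar>R\<bar>)"], intro conjI allI impI)
    fix A :: real and n N :: nat assume A: "A \<ge> 0" and N: "N \<ge> 6" "Suc k \<le> N" "2 * n \<ge> N"
    have kN: "k \<le> N" using N by simp
    have N3: "N \<ge> 3" using N by simp
    obtain d0 where d0: "d0 > 0" "\<And>d u t. 0 < d ==> d < d0 ==> reg_sol d n N A T u
     ==> hn k (u 0) \<le> 2 * R ==> t \<in> {-T..T} ==> hn k (u t) \<le> M" using M(2)[OF A N(1) kN N(3)] by blast
    show "\<exists>d0>0. \<forall>d u t. 0 < d --> d < d0 --> reg_sol d n N A T u --> hn (Suc k) (u 0) \<le> R --> t \<in> {-T..T} --> hn (Suc k) (u t) \<le> C * (1 + \<bar>R\<bar>)"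
    proof (intro exI[of _ d0] conjI allI impI d0(1))
      fix d u t assume d: "0 < d" "d < d0" and sol: "reg_sol d n N A T u" and R: "hn (Suc k) (u 0) \<le> R" and t: "t \<in> {-T..T}"
      have "u 0 \<in> H (Suc k)" using sol H_mono N unfolding reg_sol_def by blast
      then have R': "hn k (u 0) \<le> 2 * R" using hn_mono[of "u 0" "Suc k" k] R by simp
      have "hn k ((K d ^^ n) (u s)) \<le> M" if "s \<in> {-T..T}" for s
        using reg_sol_smooth(3)[OF d(1) sol N3 N(3) kN, of s] d0(2)[OF d sol R' that] by linarith
      then have "hn (Suc k) (u t) \<le> C * (1 + hn (Suc k) (u 0))" by (intro C(2)[OF d(1) sol N(2,3) _ t])
      also have "\<dots> \<le> C * (1 + \<bar>R\<bar>)" using R C(1) by (intro mult_left_mono) auto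
      finally show "hn (Suc k) (u t) \<le> C * (1 + \<bar>R\<bar>)" .
    qed
  qed (use C in simp)
  qed
qed


text \<open>The values lie three orders above the order in which the equation holds, matching the
  loss of \<open>F\<close>.\<close>

definition solution :: "nat => real => (real => 'a) => bool" where
  "solution k T q \<longleftrightarrow> (\<forall>t\<in>{-T..T}. q t \<in> H (k + 3)) \<and>
    (\<forall>j\<le>k. \<forall>t\<in>{-T..T}. ((\<lambda>t. (D ^^ j) (q t)) has_vector_derivative (D ^^ j) (F (q t))) (at t within {-T..T}))"

text \<open>Iterates ||D f||^2 \<le> ||f|| ||D (D f)||, with the higher factor bounded by B. Thus
  L^2 convergence plus an H^N bound gives convergence of all orders below N.\<close>

lemma small_interpolation:
  assumes "j < N" "\<epsilon> > 0"
  shows "\<exists>\<eta>>0. \<forall>f\<in>H N. hn N f \<le> B --> norm f < \<eta> --> norm ((D ^^ j) f) < \<epsilon>"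
  using assms
proof (induction j arbitrary: \<epsilon>)
  case 0 then show ?case by (intro exI[of _ \<epsilon>]) auto
next
  case (Suc j)
  define e where "e = \<epsilon>\<^sup>2 / (\<bar>B\<bar> + 1)"
  have e: "e > 0" using Suc.prems by (simp add: e_def)
  obtain \<eta> where \<eta>: "\<eta> > 0" "\<And>f. f \<in> H N ==> hn N f \<le> B ==> norm f < \<eta> ==> norm ((D ^^ j) f) < e"
    using Suc.IH[OF _ e] Suc.prems by auto
  have "norm ((D ^^ Suc j) f) < \<epsilon>" if f: "f \<in> H N" and B: "hn N f \<le> B" and s: "norm f < \<eta>" for f
  proof -
    have "(D ^^ j) f \<in> H 2" using Dp_H'[OF f, of j 2] Suc.prems by simp
    from norm_D_sq[OF this] have "(norm ((D ^^ Suc j) f))\<^sup>2 \<le> norm ((D ^^ j) f) * norm ((D ^^ (Suc (Suc j))) f)" by simp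
    also have "\<dots> \<le> norm ((D ^^ j) f) * B"
      using interpolation[OF f, of "Suc (Suc j)"] B Suc.prems by (intro mult_left_mono) auto
    also have "\<dots> \<le> norm ((D ^^ j) f) * (\<bar>B\<bar> + 1)" by (intro mult_left_mono) auto
    also have "\<dots> < e * (\<bar>B\<bar> + 1)" using \<eta>(2)[OF f B s] by (intro mult_strict_right_mono) auto
    also have "\<dots> = \<epsilon>\<^sup>2" by (simp add: e_def)
    finally show ?thesis using Suc.prems(2) by (simp add: power_less_imp_less_base)
  qed
  then show ?case using \<eta>(1) by blast
qed

lemma hn_limit_le:
  assumes "\<And>j. j \<le> k ==> (\<lambda>i. (D ^^ j) (v i)) \<longlonglongrightarrow> (D ^^ j) q" and "\<And>i. hn k (v i) \<le> M"
  shows "hn k q \<le> M"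
proof (rule tendsto_le[OF _ tendsto_const])
  show "(\<lambda>i. hn k (v i)) \<longlonglongrightarrow> hn k q"
    unfolding hn_def using assms(1)[of 0] assms(1)[of k] by (intro tendsto_intros) auto
qed (use assms(2) in auto)

section \<open>Solutions for smooth data\<close>

text \<open>Two approximations differ in L^2 by O(d i + d k), since \<open>F\<close> obeys the
  one-sided estimate \<open>difference_estimate0\<close>. With the uniform bound of order s + 4,
  interpolation upgrades this to uniform convergence up to order s + 3, which suffices to pass to
  the limit in \<open>F\<close> at order s.\<close>

lemma approximate_solutions_converge:
  assumes T: "T > 0" and A: "A \<ge> 0" and u0: "u0 \<in> dom"
    and vH: "\<And>i t. v i t \<in> H (s + 4)" and vA: "\<And>i t. t \<in> {-T..T} ==> hn (s + 4) (v i t) \<le> A"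
    and v0: "\<And>i. norm (v i 0 - u0) \<le> b * d i" and d: "d \<longlonglongrightarrow> 0" "\<And>i. d i > 0" and b: "b \<ge> 0"
    and vd: "\<And>i j t. j \<le> s ==> t \<in> {-T..T} ==> ((\<lambda>t. (D ^^ j) (v i t)) has_vector_derivative (D ^^ j) (w i t)) (at t within {-T..T})"
    and wH: "\<And>i t. w i t \<in> H s"
    and wF: "\<And>i j t. j \<le> s ==> t \<in> {-T..T} ==> norm ((D ^^ j) (w i t) - (D ^^ j) (F (v i t))) \<le> b * d i"
  shows "\<exists>q. solution s T q \<and> q 0 = u0 \<and> (\<forall>j\<le>s+3. \<forall>t\<in>{-T..T}. (\<lambda>i. (D ^^ j) (v i t)) \<longlonglongrightarrow> (D ^^ j) (q t))"
proof -
  define I where "I = {-T..T}"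
  have I0: "0 \<in> I" using T by (simp add: I_def)
  define N where "N = s + 4"
  have v3: "v i t \<in> H 3" for i t using H_mono[OF vH, of 3 i t] by simp
  have v3A: "hn 3 (v i t) \<le> 2 * A" if "t \<in> I" for i t
    using hn_mono[OF vH, of 3 i t] vA[of t i] that by (simp add: I_def)
  obtain C where Cnn: "C \<ge> 0" and Cb: "\<forall>p\<in>H 3. \<forall>q\<in>H 3. \<bar>inner (F p - F q) (p - q)\<bar> \<le> C * (1 + hn 3 p + hn 3 q) * (norm (p - q))\<^sup>2"
    using difference_estimate0 by (elim exE conjE) (rule that)
  note C = Cnn Cb[rule_format]
  \<comment> \<open>The summand 1 absorbs the cross term 2 ||z|| e \<le> ||z||^2 + e^2 caused by the
    defect.\<close>
  define a where "a = 2 * C * (1 + 4 * A) + 1"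
  have a0: "a \<ge> 0" using C(1) A by (simp add: a_def)
  have diffbound: "norm (v i t - v k t) \<le> 2 * b * exp (a * T) * (d i + d k)" if t: "t \<in> I" for i k t
  proof -
    \<comment> \<open>e bounds both the initial distance and the defect of the equation; adding e^2
      to ||z||^2 makes the Gronwall inequality homogeneous.\<close>
    define e where "e = b * (d i + d k)"
    have e0: "e \<ge> 0" using b d(2)[of i] d(2)[of k] by (simp add: e_def)
    define z where "z t = v i t - v k t" for t
    have "(norm (z t))\<^sup>2 + e\<^sup>2 \<le> ((norm (z 0))\<^sup>2 + e\<^sup>2) * exp (a * \<bar>t\<bar>)"
    proof (rule gronwall_two_sided[OF _ _ t[unfolded I_def]])
      fix r assume r: "r \<in> {-T..T}"
      have zd: "(z has_vector_derivative (w i r - w k r)) (at r within {-T..T})"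
        unfolding z_def using vd[of 0 r i] vd[of 0 r k] r by (intro has_vector_derivative_diff) auto
      show "((\<lambda>t. (norm (z t))\<^sup>2 + e\<^sup>2) has_real_derivative 2 * inner (z r) (w i r - w k r)) (at r within {-T..T})"
        using DERIV_add[OF norm_sq_has_real_derivative[OF zd] DERIV_const[of "e\<^sup>2"]] by simp
      have 1: "\<bar>inner (z r) (F (v i r) - F (v k r))\<bar> \<le> C * (1 + 4 * A) * (norm (z r))\<^sup>2"
      proof -
        have "\<bar>inner (z r) (F (v i r) - F (v k r))\<bar> \<le> C * (1 + hn 3 (v i r) + hn 3 (v k r)) * (norm (z r))\<^sup>2"
          using C(2)[OF v3 v3, of i r k r] by (simp add: z_def inner_commute)
        also have "\<dots> \<le> C * (1 + 4 * A) * (norm (z r))\<^sup>2"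
          using v3A[of r i] v3A[of r k] r C(1) by (intro mult_right_mono mult_left_mono) (auto simp: I_def)
        finally show ?thesis .
      qed
      have "norm ((w i r - F (v i r)) - (w k r - F (v k r))) \<le> e"
        using norm_triangle_ineq4[of "w i r - F (v i r)" "w k r - F (v k r)"] wF[of 0 r i] wF[of 0 r k] r
        by (simp add: e_def distrib_left)
      then have 2: "\<bar>inner (z r) ((w i r - F (v i r)) - (w k r - F (v k r)))\<bar> \<le> norm (z r) * e" by (intro abs_inner_le) auto
      have 3: "2 * (norm (z r) * e) \<le> (norm (z r))\<^sup>2 + e\<^sup>2" using sum_squares_bound[of "norm (z r)" e] by simp
      have "inner (z r) (w i r - w k r) = inner (z r) (F (v i r) - F (v k r)) + inner (z r) ((w i r - F (v i r)) - (w k r - F (v k r)))"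
        by (simp add: inner_diff_right)
      then have "\<bar>2 * inner (z r) (w i r - w k r)\<bar> \<le> 2 * (C * (1 + 4 * A) * (norm (z r))\<^sup>2) + ((norm (z r))\<^sup>2 + e\<^sup>2)"
        using 1 2 3 by linarith
      also have "\<dots> \<le> a * (norm (z r))\<^sup>2 + a * e\<^sup>2"
      proof -
        have "1 * e\<^sup>2 \<le> a * e\<^sup>2" using C(1) A by (intro mult_right_mono) (auto simp: a_def)
        then show ?thesis by (simp add: a_def algebra_simps)
      qed
      finally show "\<bar>2 * inner (z r) (w i r - w k r)\<bar> \<le> a * ((norm (z r))\<^sup>2 + e\<^sup>2)" by (simp add: distrib_left)
    qed
    also have "\<dots> \<le> (e\<^sup>2 + e\<^sup>2) * exp (a * T)"
    proof (intro mult_mono add_mono order_refl)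
      have "norm (z 0) \<le> norm (v i 0 - u0) + norm (v k 0 - u0)"
        using norm_triangle_ineq4[of "v i 0 - u0" "v k 0 - u0"] by (simp add: z_def)
      also have "\<dots> \<le> e" using v0[of i] v0[of k] by (simp add: e_def distrib_left)
      finally show "(norm (z 0))\<^sup>2 \<le> e\<^sup>2" by (intro power_mono) auto
      show "exp (a * \<bar>t\<bar>) \<le> exp (a * T)" using t a0 by (auto simp: I_def intro!: mult_left_mono)
    qed auto
    also have "\<dots> = 2 * e\<^sup>2 * exp (a * T)" by simp
    finally have "(norm (z t))\<^sup>2 \<le> 2 * e\<^sup>2 * exp (a * T)" using zero_le_power2[of e] by linarith
    also have "\<dots> \<le> 4 * e\<^sup>2 * (exp (a * T) * exp (a * T))"
      using a0 T by (intro mult_mono) (auto simp: mult_le_cancel_left1)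
    also have "\<dots> = (2 * e * exp (a * T))\<^sup>2" by (simp add: power2_eq_square)
    finally have "norm (z t) \<le> 2 * e * exp (a * T)" by (rule power2_le_imp_le) (use e0 in simp)
    then show ?thesis by (simp add: z_def e_def algebra_simps)
  qed
  have ucauchy: "uniformly_Cauchy_on I (\<lambda>i t. (D ^^ j) (v i t))" if j: "j \<le> s + 3" for j
    unfolding uniformly_Cauchy_on_def
  proof (intro allI impI)
    fix \<epsilon> :: real assume \<epsilon>: "\<epsilon> > 0"
    have jN: "j < s + 4" using j by simp
    obtain \<eta> where \<eta>: "\<eta> > 0" "\<And>f. f \<in> H (s + 4) ==> hn (s + 4) f \<le> 2 * A ==> norm f < \<eta> ==> norm ((D ^^ j) f) < \<epsilon>"
      using small_interpolation[OF jN \<epsilon>, of "2 * A"] by blast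
    define c where "c = 2 * b * exp (a * T)"
    have c0: "c \<ge> 0" using b by (simp add: c_def)
    have "\<eta> / (2 * c + 1) > 0" using \<eta>(1) c0 by simp
    then obtain M where M: "\<And>i. i \<ge> M ==> d i < \<eta> / (2 * c + 1)"
      using d unfolding LIMSEQ_iff by (metis abs_of_pos diff_zero real_norm_def)
    have "dist ((D ^^ j) (v i t)) ((D ^^ j) (v k t)) < \<epsilon>" if "t \<in> I" "i \<ge> M" "k \<ge> M" for i k t
    proof -
      have "norm (v i t - v k t) \<le> c * (d i + d k)" using diffbound[OF that(1)] by (simp add: c_def)
      also have "\<dots> \<le> c * (2 * (\<eta> / (2 * c + 1)))"
        using M[OF that(2)] M[OF that(3)] c0 by (intro mult_left_mono) auto
      also have "\<dots> = \<eta> * (2 * c / (2 * c + 1))" by simp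
      also have "\<dots> < \<eta> * 1" using \<eta>(1) c0 by (intro mult_strict_left_mono) auto
      finally have sm: "norm (v i t - v k t) < \<eta>" by simp
      have h: "hn (s + 4) (v i t - v k t) \<le> 2 * A"
        using hn_diff[OF vH vH, of i t k t] vA[of t i] vA[of t k] that(1) by (simp add: I_def)
      have "norm ((D ^^ j) (v i t - v k t)) < \<epsilon>" by (rule \<eta>(2)[OF H_diff[OF vH vH] h sm])
      then show ?thesis using Dp_diff[OF vH vH, of j i t k t] j by (simp add: dist_norm)
    qed
    then show "\<exists>M. \<forall>x\<in>I. \<forall>m\<ge>M. \<forall>n\<ge>M. dist ((D ^^ j) (v m x)) ((D ^^ j) (v n x)) < \<epsilon>" by blast
  qed
  have "\<forall>j. \<exists>g. j \<le> s + 3 --> uniform_limit I (\<lambda>i t. (D ^^ j) (v i t)) g sequentially"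
    using Cauchy_uniformly_convergent[OF ucauchy] unfolding uniformly_convergent_on_def by blast
  then obtain g where g: "\<And>j. j \<le> s + 3 ==> uniform_limit I (\<lambda>i t. (D ^^ j) (v i t)) (g j) sequentially" by metis
  define q where "q = g 0"
  have glim: "(\<lambda>i. (D ^^ j) (v i t)) \<longlonglongrightarrow> g j t" if "j \<le> s + 3" "t \<in> I" for j t
    using tendsto_uniform_limitI[OF g[OF that(1)] that(2)] .
  have qH: "q t \<in> H (s + 3)" "\<And>j. j \<le> s + 3 ==> (D ^^ j) (q t) = g j t" if t: "t \<in> I" for t
    using H_closed[of "\<lambda>i. v i t" "s + 3" "\<lambda>j. g j t"] H_mono[OF vH, of "s+3"] glim[OF _ t] by (auto simp: q_def)
  have qlim: "(\<lambda>i. (D ^^ j) (v i t)) \<longlonglongrightarrow> (D ^^ j) (q t)" if "j \<le> s + 3" "t \<in> I" for j t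
    using glim[OF that] qH(2)[OF that(2,1)] by simp
  have vs3: "v i t \<in> H (s + 3)" for i t using H_mono[OF vH] by simp
  have vs3A: "hn (s + 3) (v i t) \<le> 2 * A" if "t \<in> I" for i t using hn_mono[OF vH, of "s+3" i t] vA[of t i] that by (simp add: I_def)
  have qA: "hn (s + 3) (q t) \<le> 2 * A" if "t \<in> I" for t by (rule hn_limit_le[OF qlim[OF _ that] vs3A[OF that]])
  have q0: "q 0 = u0"
  proof (rule LIMSEQ_unique)
    show "(\<lambda>i. v i 0) \<longlonglongrightarrow> q 0" using qlim[of 0 0] I0 by simp
    have "(\<lambda>i. v i 0 - u0) \<longlonglongrightarrow> 0"
      by (rule Lim_null_comparison[where g = "\<lambda>i. b * d i"]) (use v0 tendsto_mult_right_zero[OF d(1)] in auto)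
    then show "(\<lambda>i. v i 0) \<longlonglongrightarrow> u0" by (simp add: LIM_zero_cancel)
  qed
  obtain CF where CF: "CF \<ge> 0" "\<And>p q. p \<in> H (s + 3) ==> q \<in> H (s + 3) ==> hn s (F p - F q) \<le> CF * (1 + hn (s + 3) p + hn (s + 3) q) * hn (s + 3) (p - q)"
    using F_lipschitz[of s] by blast
  define c where "c = CF * (1 + 4 * A)"
  have c0: "c \<ge> 0" using CF(1) A by (simp add: c_def)
  have wconv: "\<forall>\<^sub>F i in sequentially. \<forall>t\<in>I. norm ((D ^^ j) (w i t) - (D ^^ j) (F (q t))) < e" if j: "j \<le> s" and e: "e > 0" for j e
  proof -
    have e': "e / (4 * c + 4) > 0" using e c0 by simp
    have "\<forall>\<^sub>F i in sequentially. b * d i < e / 2"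
      using order_tendstoD(2)[OF tendsto_mult_right_zero[OF d(1)], of "e/2" b] e by simp
    moreover have "\<forall>\<^sub>F i in sequentially. \<forall>t\<in>I. dist (v i t) (q t) < e / (4 * c + 4)"
      using uniform_limitD[OF g[of 0] e'] by (simp add: q_def)
    moreover have "\<forall>\<^sub>F i in sequentially. \<forall>t\<in>I. dist ((D ^^ (s + 3)) (v i t)) (g (s + 3) t) < e / (4 * c + 4)"
      using uniform_limitD[OF g[of "s+3"] e'] by simp
    ultimately show ?thesis
    proof eventually_elim
      case (elim i)
      show ?case
      proof
        fix t assume t: "t \<in> I"
        have "norm (v i t - q t) < e / (4 * c + 4)" using elim(2) t by (simp add: dist_norm)
        moreover have "norm ((D ^^ (s + 3)) (v i t - q t)) < e / (4 * c + 4)"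
          using elim(3) t Dp_diff[OF vs3[of i t] qH(1)[OF t] order_refl] qH(2)[OF t order_refl] by (simp add: dist_norm)
        ultimately have h: "hn (s + 3) (v i t - q t) \<le> 2 * (e / (4 * c + 4))" unfolding hn_def by linarith
        have "hn s (F (v i t) - F (q t)) \<le> CF * (1 + hn (s + 3) (v i t) + hn (s + 3) (q t)) * hn (s + 3) (v i t - q t)"
          by (rule CF(2)[OF vs3 qH(1)[OF t]])
        also have "\<dots> \<le> c * (2 * (e / (4 * c + 4)))"
          unfolding c_def using vs3A[OF t, of i] qA[OF t] CF(1) A h by (intro mult_mono mult_left_mono) (auto simp: c_def)
        also have "\<dots> = (e / 2) * (4 * c / (4 * c + 4))" by simp
        also have "\<dots> \<le> (e / 2) * 1" using c0 e by (intro mult_left_mono) auto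
        finally have 1: "hn s (F (v i t) - F (q t)) \<le> e / 2" by simp
        have FH: "F (v i t) \<in> H s" "F (q t) \<in> H s" using F_H[OF vs3] F_H[OF qH(1)[OF t]] by auto
        have "norm ((D ^^ j) (F (v i t)) - (D ^^ j) (F (q t))) \<le> e / 2"
          using interpolation[OF H_diff[OF FH] j] 1 Dp_diff[OF FH j] by simp
        moreover have "norm ((D ^^ j) (w i t) - (D ^^ j) (F (v i t))) < e / 2"
          using wF[OF j, of t i] t elim(1) by (simp add: I_def)
        ultimately show "norm ((D ^^ j) (w i t) - (D ^^ j) (F (q t))) < e"
          using norm_triangle_ineq[of "(D ^^ j) (w i t) - (D ^^ j) (F (v i t))" "(D ^^ j) (F (v i t)) - (D ^^ j) (F (q t))"] by simp
      qed
    qed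
  qed
  have qd: "((\<lambda>t. (D ^^ j) (q t)) has_vector_derivative (D ^^ j) (F (q t))) (at t within I)" if j: "j \<le> s" and t: "t \<in> I" for j t
  proof (rule has_vector_derivative_uniform_limit[OF _ t])
    show "((\<lambda>t. (D ^^ j) (v i t)) has_vector_derivative (D ^^ j) (w i x)) (at x within I)" if "x \<in> I" for i x
      using vd[OF j] that unfolding I_def .
    show "uniform_limit I (\<lambda>i t. (D ^^ j) (w i t)) (\<lambda>t. (D ^^ j) (F (q t))) sequentially"
      by (rule uniform_limitI) (use wconv[OF j] in \<open>simp add: dist_norm\<close>)
  qed (use qlim j in \<open>auto simp: I_def\<close>)
  show ?thesis
    using qH(1) qd q0 qlim unfolding solution_def I_def by (intro exI[of _ q]) auto
qed

text \<open>M and C depend on the data only through the H^s bound R, whereas the auxiliary level A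
  may depend on the full norm of u0. The linear bound of order s + 1 is recorded because the
  Bona-Smith argument uses it.\<close>

lemma smooth_existence:
  assumes T: "T > 0" and s: "s \<ge> 3"
  shows "\<exists>M\<ge>0. \<exists>C\<ge>0. \<forall>u0\<in>H (s + 4). hn s u0 \<le> R -->
    (\<exists>q. solution s T q \<and> q 0 = u0 \<and> (\<forall>t\<in>{-T..T}. hn s (q t) \<le> M \<and> hn (Suc s) (q t) \<le> C * (1 + hn (Suc s) u0)))"
proof -
  obtain M where M0: "M \<ge> 0" and M1: "\<forall>A n N. A \<ge> 0 --> N \<ge> 6 --> s \<le> N --> 2 * n \<ge> N --> (\<exists>\<delta>0>0. \<forall>\<delta> u t. 0 < \<delta> --> \<delta> < \<delta>0 --> reg_sol \<delta> n N A T u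
     --> hn s (u 0) \<le> R --> t \<in> {-T..T} --> hn s (u t) \<le> M)"
    using reg_apriori[OF T s, THEN spec, of R] by (elim exE conjE) (rule that)
  obtain C where C0: "C \<ge> 0" and C1: "\<forall>\<delta> n N A u t. \<delta> > 0 --> reg_sol \<delta> n N A T u --> Suc s \<le> N --> 2 * n \<ge> N -->
     (\<forall>r\<in>{-T..T}. hn s ((K \<delta> ^^ n) (u r)) \<le> M) --> t \<in> {-T..T} --> hn (Suc s) (u t) \<le> C * (1 + hn (Suc s) (u 0))"
    using reg_linear_bound[OF T _ M0, of "Suc s"] s by auto
  have "\<exists>q. solution s T q \<and> q 0 = u0 \<and> (\<forall>t\<in>{-T..T}. hn s (q t) \<le> M \<and> hn (Suc s) (q t) \<le> C * (1 + hn (Suc s) u0))"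
    if u0: "u0 \<in> H (s + 4)" and R: "hn s u0 \<le> R" for u0
  proof -
    \<comment> \<open>Order s + 4 gives strong convergence up to order s + 3, and \<open>F\<close>
      maps that to order s.\<close>
    define N where "N = s + 4"
    have N: "N \<ge> 6" "s \<le> N" "N \<ge> 3" "2 * N \<ge> N" "Suc s \<le> N" using s by (auto simp: N_def)
    have N3: "3 \<le> N" using N by simp
    obtain A where A0: "A \<ge> 0" and A1: "\<forall>A' n N'. A' \<ge> 0 --> N' \<ge> 6 --> N \<le> N' --> 2 * n \<ge> N' --> (\<exists>\<delta>0>0. \<forall>\<delta> u t. 0 < \<delta> --> \<delta> < \<delta>0 --> reg_sol \<delta> n N' A' T u
     --> hn N (u 0) \<le> hn N u0 --> t \<in> {-T..T} --> hn N (u t) \<le> A)"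
      using reg_apriori[OF T N3, THEN spec, of "hn N u0"] by (elim exE conjE) (rule that)
    obtain d1 where d1: "d1 > 0" "\<And>\<delta> u t. 0 < \<delta> ==> \<delta> < d1 ==> reg_sol \<delta> N N A T u ==> hn s (u 0) \<le> R ==> t \<in> {-T..T} ==> hn s (u t) \<le> M"
      using M1[rule_format, OF A0 N(1,2,4)] by blast
    obtain d2 where d2: "d2 > 0" "\<And>\<delta> u t. 0 < \<delta> ==> \<delta> < d2 ==> reg_sol \<delta> N N A T u ==> hn N (u 0) \<le> hn N u0 ==> t \<in> {-T..T} ==> hn N (u t) \<le> A"
      using A1[rule_format, OF A0 N(1) order_refl N(4)] by blast
    define d where "d = min d1 d2"
    have d: "d > 0" "d \<le> d1" "d \<le> d2" using d1(1) d2(1) by (auto simp: d_def)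
    define \<delta> where "\<delta> i = d / (real i + 2)" for i :: nat
    have \<delta>pos: "\<delta> i > 0" for i using d by (simp add: \<delta>_def)
    have \<delta>lt: "\<delta> i < d1" "\<delta> i < d2" for i
    proof -
      have "0 < d + real i * d" using d(1) by (simp add: add_pos_nonneg)
      then have "\<delta> i < d" unfolding \<delta>_def by (simp add: field_simps)
      then show "\<delta> i < d1" "\<delta> i < d2" using d by auto
    qed
    have "(\<lambda>i. d / real (i + 2)) \<longlonglongrightarrow> 0"
      by (rule LIMSEQ_ignore_initial_segment) (rule lim_const_over_n)
    then have \<delta>lim: "\<delta> \<longlonglongrightarrow> 0" by (simp add: \<delta>_def[abs_def] add.commute)
    have "\<exists>u. u 0 = u0 \<and> reg_sol (\<delta> i) N N A T u" for i
      by (rule reg_sol_exists[OF \<delta>pos T A0 N(3,4)]) (use u0 in \<open>simp add: N_def\<close>)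
    then obtain u where u: "\<And>i. u i 0 = u0" "\<And>i. reg_sol (\<delta> i) N N A T (u i)" by metis
    have uM: "hn s (u i t) \<le> M" if "t \<in> {-T..T}" for i t
      using d1(2)[OF \<delta>pos \<delta>lt(1) u(2), of i t] u(1) R that by simp
    have uA: "hn N (u i t) \<le> A" if "t \<in> {-T..T}" for i t
      using d2(2)[OF \<delta>pos \<delta>lt(2) u(2), of i t] u(1) that by simp
    define v where "v i t = (K (\<delta> i) ^^ N) (u i t)" for i t
    have \<delta>n0: "\<delta> i \<noteq> 0" for i using \<delta>pos[of i] by simp
    have vH: "v i t \<in> H (N + 3)" for i t unfolding v_def by (rule reg_sol_smooth(1)[OF \<delta>pos u(2) N(3,4)])
    have vle: "hn k (v i t) \<le> hn k (u i t)" if "k \<le> N" for k i t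
      unfolding v_def by (rule reg_sol_smooth(3)[OF \<delta>pos u(2) N(3,4) that])
    have uS: "hn (Suc s) (u i t) \<le> C * (1 + hn (Suc s) u0)" if "t \<in> {-T..T}" for i t
    proof -
      have "\<forall>r\<in>{-T..T}. hn s ((K (\<delta> i) ^^ N) (u i r)) \<le> M"
        using vle[OF N(2), of i] uM[of _ i] unfolding v_def by (meson order_trans)
      then show ?thesis using C1[rule_format, OF \<delta>pos u(2) N(5,4) _ that, of i] u(1) by simp
    qed
    define w where "w i t = (K (\<delta> i) ^^ N) ((K (\<delta> i) ^^ N) (F (v i t)))" for i t
    have wH: "w i t \<in> H N" for i t
      using reg_sol_smooth(4)[OF \<delta>pos u(2) N(3,4), of 0] by (simp add: w_def v_def)
    \<comment> \<open>The cutoff is gone: A is the a priori bound of order N, so its value is 1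
      along the whole solution.\<close>
    have vd: "((\<lambda>t. (D ^^ j) (v i t)) has_vector_derivative (D ^^ j) (w i t)) (at t within {-T..T})" if "j \<le> s" "t \<in> {-T..T}" for i j t
      using reg_sol_smooth(5)[OF \<delta>pos u(2) N(3,4), of j t i] that uA[OF that(2), of i] N(2)
      by (simp add: w_def v_def cutoff_eq_1)
    obtain B where B: "B \<ge> 0" "\<And>f. f \<in> H (s + 1 + 3) ==> hn (s + 1 + 3) f \<le> A ==> hn (s + 1) (F f) \<le> B"
      using F_bound[of "s + 1" A] by blast
    define b where "b = 2 * N * B + N * norm (D u0)"
    have b0: "b \<ge> 0" using B(1) by (simp add: b_def)
    have wF: "norm ((D ^^ j) (w i t) - (D ^^ j) (F (v i t))) \<le> b * \<delta> i" if j: "j \<le> s" and t: "t \<in> {-T..T}" for i j t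
    proof -
      define f where "f = F (v i t)"
      have vs: "v i t \<in> H (s + 1 + 3)" using H_mono[OF vH] by (simp add: N_def)
      have hv: "hn (s + 1 + 3) (v i t) \<le> A" 
      proof -
        have "s + 1 + 3 = N" by (simp add: N_def)
        then show ?thesis using vle[of N i t] uA[OF t, of i] by simp
      qed
      have f: "f \<in> H (s + 1)" "hn (s + 1) f \<le> B" unfolding f_def using F_H[OF vs] B(2)[OF vs hv] by auto
      have JJ: "(K (\<delta> i) ^^ N) ((K (\<delta> i) ^^ N) g) = (K (\<delta> i) ^^ (N + N)) g" for g by (simp add: funpow_add)
      have "(D ^^ j) ((K (\<delta> i) ^^ (N + N)) f) = (K (\<delta> i) ^^ (N + N)) ((D ^^ j) f)" using j by (intro Kn_Dp[OF \<delta>n0 f(1)]) simp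
      moreover have "norm ((K (\<delta> i) ^^ (N + N)) ((D ^^ j) f) - (D ^^ j) f) \<le> real (N + N) * \<delta> i * norm (D ((D ^^ j) f))"
        by (rule Kn_near1[OF \<delta>pos]) (rule Dp_dom[OF f(1)], use j in simp)
      moreover have "real (N + N) * \<delta> i * norm (D ((D ^^ j) f)) \<le> real (N + N) * \<delta> i * B"
        using interpolation[OF f(1), of "Suc j"] f(2) j \<delta>pos[of i] by (intro mult_left_mono) auto
      moreover have "real (N + N) * \<delta> i * B \<le> b * \<delta> i" using \<delta>pos[of i] by (simp add: b_def algebra_simps)
      ultimately show ?thesis unfolding w_def f_def[symmetric] JJ by simp
    qed
    have "\<exists>q. solution s T q \<and> q 0 = u0 \<and> (\<forall>j\<le>s+3. \<forall>t\<in>{-T..T}. (\<lambda>i. (D ^^ j) (v i t)) \<longlonglongrightarrow> (D ^^ j) (q t))"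
    proof (rule approximate_solutions_converge[OF T A0 _ _ _ _ \<delta>lim \<delta>pos b0 vd _ wF])
      show u0d: "u0 \<in> dom" using H_dom[OF u0] by simp
      show "v i t \<in> H (s + 4)" for i t using H_mono[OF vH] by (simp add: N_def)
      show "hn (s + 4) (v i t) \<le> A" if "t \<in> {-T..T}" for i t using vle[of N i t] uA[OF that, of i] by (simp add: N_def)
      show "norm (v i 0 - u0) \<le> b * \<delta> i" for i
      proof -
        have "norm (v i 0 - u0) \<le> N * \<delta> i * norm (D u0)" unfolding v_def u(1) by (rule Kn_near1[OF \<delta>pos u0d])
        also have "\<dots> \<le> b * \<delta> i" using B(1) \<delta>pos[of i] by (simp add: b_def algebra_simps)
        finally show ?thesis .
      qed
      show "w i t \<in> H s" for i t using H_mono[OF wH N(2)] .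
    qed
    then obtain q where q: "solution s T q" "q 0 = u0" "\<And>j t. j \<le> s+3 ==> t \<in> {-T..T} ==> (\<lambda>i. (D ^^ j) (v i t)) \<longlonglongrightarrow> (D ^^ j) (q t)" by blast
    have "hn s (q t) \<le> M" "hn (Suc s) (q t) \<le> C * (1 + hn (Suc s) u0)" if t: "t \<in> {-T..T}" for t
    proof -
      show "hn s (q t) \<le> M"
        by (rule hn_limit_le[where v = "\<lambda>i. v i t"]) (auto intro!: q(3)[OF _ t] order_trans[OF vle[OF N(2)] uM[OF t]])
      show "hn (Suc s) (q t) \<le> C * (1 + hn (Suc s) u0)"
        by (rule hn_limit_le[where v = "\<lambda>i. v i t"]) (auto intro!: q(3)[OF _ t] order_trans[OF vle[OF N(5)] uS[OF t]])
    qed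
    then show ?thesis using q(1,2) by blast
  qed
  then show ?thesis using M0 C0 by blast
qed

section \<open>Stability in L^2 and in H^s\<close>

lemma L2_stability:
  assumes T: "T > 0" and B: "B \<ge> 0"
  shows "\<exists>C\<ge>0. \<forall>p q. (\<forall>t\<in>{-T..T}. p t \<in> H 3 \<and> hn 3 (p t) \<le> B \<and> (p has_vector_derivative F (p t)) (at t within {-T..T})) -->
     (\<forall>t\<in>{-T..T}. q t \<in> H 3 \<and> hn 3 (q t) \<le> B \<and> (q has_vector_derivative F (q t)) (at t within {-T..T})) -->
     (\<forall>t\<in>{-T..T}. norm (p t - q t) \<le> C * norm (p 0 - q 0))"
proof -
  obtain C where Cnn: "C \<ge> 0" and Cb: "\<forall>p\<in>H 3. \<forall>q\<in>H 3. \<bar>inner (F p - F q) (p - q)\<bar> \<le> C * (1 + hn 3 p + hn 3 q) * (norm (p - q))\<^sup>2"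
    using difference_estimate0 by (elim exE conjE) (rule that)
  note C = Cnn Cb[rule_format]
  define a where "a = 2 * C * (1 + 2 * B)"
  have a0: "a \<ge> 0" using C(1) B by (simp add: a_def)
  show ?thesis
  proof (intro exI[of _ "exp (a * T)"] conjI allI impI ballI)
    fix p q t
    assume p: "\<forall>t\<in>{-T..T}. p t \<in> H 3 \<and> hn 3 (p t) \<le> B \<and> (p has_vector_derivative F (p t)) (at t within {-T..T})"
      and q: "\<forall>t\<in>{-T..T}. q t \<in> H 3 \<and> hn 3 (q t) \<le> B \<and> (q has_vector_derivative F (q t)) (at t within {-T..T})"
      and t: "t \<in> {-T..T}"
    have "(norm (p t - q t))\<^sup>2 \<le> (norm (p 0 - q 0))\<^sup>2 * exp (a * \<bar>t\<bar>)"
    proof (rule gronwall_two_sided[OF _ _ t])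
      fix r assume r: "r \<in> {-T..T}"
      have d: "((\<lambda>t. p t - q t) has_vector_derivative (F (p r) - F (q r))) (at r within {-T..T})"
        using p q r by (intro has_vector_derivative_diff) auto
      show "((\<lambda>t. (norm (p t - q t))\<^sup>2) has_real_derivative 2 * inner (p r - q r) (F (p r) - F (q r))) (at r within {-T..T})"
        by (rule norm_sq_has_real_derivative[OF d])
      have "\<bar>inner (p r - q r) (F (p r) - F (q r))\<bar> \<le> C * (1 + hn 3 (p r) + hn 3 (q r)) * (norm (p r - q r))\<^sup>2"
        using C(2)[of "p r" "q r"] p q r by (metis inner_commute)
      also have "\<dots> \<le> C * (1 + 2 * B) * (norm (p r - q r))\<^sup>2"
        using bspec[OF p r] bspec[OF q r] C(1) by (intro mult_right_mono mult_left_mono) auto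
      finally show "\<bar>2 * inner (p r - q r) (F (p r) - F (q r))\<bar> \<le> a * (norm (p r - q r))\<^sup>2"
        unfolding a_def by (simp add: abs_mult)
    qed
    also have "\<dots> \<le> (norm (p 0 - q 0))\<^sup>2 * (exp (a * T) * exp (a * T))"
    proof (intro mult_left_mono)
      have "exp (a * \<bar>t\<bar>) \<le> exp (a * T)" using t a0 by (auto intro!: mult_left_mono)
      also have "\<dots> \<le> exp (a * T) * exp (a * T)" using a0 T by simp
      finally show "exp (a * \<bar>t\<bar>) \<le> exp (a * T) * exp (a * T)" .
    qed simp
    also have "\<dots> = (exp (a * T) * norm (p 0 - q 0))\<^sup>2" by (simp add: power2_eq_square)
    finally show "norm (p t - q t) \<le> exp (a * T) * norm (p 0 - q 0)" by (rule power2_le_imp_le) simp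
  qed simp
qed

lemma solution_L2:
  assumes "solution s T q" "t \<in> {-T..T}"
  shows "q t \<in> H 3" "(q has_vector_derivative F (q t)) (at t within {-T..T})" "q t \<in> H s"
proof -
  show "q t \<in> H 3" using assms H_mono[of "q t" "s + 3" 3] by (simp add: solution_def)
  show "q t \<in> H s" using assms H_mono[of "q t" "s + 3" s] by (simp add: solution_def)
  show "(q has_vector_derivative F (q t)) (at t within {-T..T})"
  proof -
    have "((\<lambda>t. (D ^^ 0) (q t)) has_vector_derivative (D ^^ 0) (F (q t))) (at t within {-T..T})"
      using assms unfolding solution_def by blast
    then show ?thesis by simp
  qed
qed

text \<open>The parameter \<open>\<eta>\<close> measures \<open>\<parallel>p 0 - q 0\<parallel>\<close>; the exponents come from
  \<open>\<parallel>w\<parallel>\<^sub>\<infinity>\<^sup>4 \<le> 4 \<parallel>w\<parallel>\<^sup>3 \<parallel>w''\<parallel>\<close>.\<close>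

lemma stability:
  assumes T: "T > 0" and s: "s \<ge> 3" and B: "B \<ge> 0"
  shows "\<exists>C\<ge>0. \<forall>p q. solution s T p --> solution s T q --> (\<forall>t\<in>{-T..T}. hn s (p t) \<le> B \<and> hn s (q t) \<le> B) -->
    (\<forall>\<eta> Q. \<eta> \<ge> 0 --> norm (p 0 - q 0) \<le> \<eta>^4 --> (\<forall>t\<in>{-T..T}. hn (Suc s) (q t) \<le> Q) -->
      (\<forall>t\<in>{-T..T}. hn s (p t - q t) \<le> C * (hn s (p 0 - q 0) + \<eta>^3 * Q)))"
proof -
  obtain C0 where C0nn: "C0 \<ge> 0" and C0b: "\<forall>p\<in>H 3. \<forall>q\<in>H 3. \<bar>inner (F p - F q) (p - q)\<bar> \<le> C0 * (1 + hn 3 p + hn 3 q) * (norm (p - q))\<^sup>2"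
    using difference_estimate0 by (elim exE conjE) (rule that)
  note C0 = C0nn C0b[rule_format]
  obtain Cs where Cs: "Cs \<ge> 0" "\<And>p q. p \<in> H (s + 3) ==> q \<in> H (s + 3) ==> \<bar>inner ((D ^^ s) (F p - F q)) ((D ^^ s) (p - q))\<bar>
      \<le> Cs * (1 + hn s p + hn s q) * (hn s (p - q))\<^sup>2 + 6 * norm ((p - q) \<odot> (D ^^ Suc s) q) * hn s (p - q)"
    using difference_estimate[OF s] by blast
  have B2: "2 * B \<ge> 0" using B by simp
  obtain C1 where C1: "C1 \<ge> 0" and C1': "\<forall>p q. (\<forall>t\<in>{-T..T}. p t \<in> H 3 \<and> hn 3 (p t) \<le> 2 * B \<and> (p has_vector_derivative F (p t)) (at t within {-T..T})) -->
     (\<forall>t\<in>{-T..T}. q t \<in> H 3 \<and> hn 3 (q t) \<le> 2 * B \<and> (q has_vector_derivative F (q t)) (at t within {-T..T})) -->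
     (\<forall>t\<in>{-T..T}. norm (p t - q t) \<le> C1 * norm (p 0 - q 0))"
    using L2_stability[OF T B2] by (elim exE conjE) (rule that)
  \<comment> \<open>With x = ||w|| and y = ||D w|| one gets (2 x y)^2 \<le> 8 B C1^3 \<eta>^12. As c
    \<ge> 1, also c^4 \<ge> c \<ge> 8 B C1^3, and two square roots give the sup norm bound c
    \<eta>^3.\<close>
  define c where "c = 1 + 8 * B * C1^3"
  have c1: "c \<ge> 1" using B C1 by (simp add: c_def)
  define a where "a = 2 * C0 * (1 + 4 * B) + 4 * Cs * (1 + 2 * B) + 12"
  have a0: "a \<ge> 0" using C0(1) Cs(1) B by (simp add: a_def)
  define E where "E = exp (a * T)"
  have E1: "E \<ge> 1" using a0 T by (simp add: E_def)
  show ?thesis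
  proof (intro exI[of _ "2 * E * c"] conjI allI impI ballI)
    fix p q \<eta> Q t
    assume p: "solution s T p" and q: "solution s T q" and hB: "\<forall>t\<in>{-T..T}. hn s (p t) \<le> B \<and> hn s (q t) \<le> B"
      and \<eta>: "0 \<le> \<eta>" and w0: "norm (p 0 - q 0) \<le> \<eta>^4" and Q: "\<forall>t\<in>{-T..T}. hn (Suc s) (q t) \<le> Q" and t: "t \<in> {-T..T}"
    define w where "w t = p t - q t" for t
    have zI: "0 \<in> {-T..T}" using T by simp
    have Q0: "Q \<ge> 0" using bspec[OF Q zI] hn_nonneg[of "Suc s" "q 0"] by linarith
    have pH: "p r \<in> H (s + 3)" "q r \<in> H (s + 3)" if "r \<in> {-T..T}" for r using p q that by (auto simp: solution_def)
    have ps: "p r \<in> H s" "q r \<in> H s" if "r \<in> {-T..T}" for r using solution_L2(3)[OF p that] solution_L2(3)[OF q that] .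
    have h3: "hn 3 (p r) \<le> 2 * B" "hn 3 (q r) \<le> 2 * B" if "r \<in> {-T..T}" for r
      using hn_mono[OF ps(1)[OF that] s] hn_mono[OF ps(2)[OF that] s] bspec[OF hB that] by auto
    have w_small: "norm (w r) \<le> C1 * \<eta>^4" if r: "r \<in> {-T..T}" for r
    proof -
      have "norm (p r - q r) \<le> C1 * norm (p 0 - q 0)"
        using C1'[rule_format, of p q r] solution_L2[OF p] solution_L2[OF q] h3 r by blast
      also have "\<dots> \<le> C1 * \<eta>^4" by (rule mult_left_mono[OF w0 C1])
      finally show ?thesis by (simp add: w_def)
    qed
    have wH: "w r \<in> H (s + 3)" if "r \<in> {-T..T}" for r unfolding w_def by (rule H_diff[OF pH[OF that]])
    have ws: "w r \<in> H s" if "r \<in> {-T..T}" for r using H_mono[OF wH[OF that]] by simp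
    have wB: "hn s (w r) \<le> 2 * B" if "r \<in> {-T..T}" for r
      using hn_diff[OF ps[OF that]] bspec[OF hB that] by (simp add: w_def)
    define \<beta> where "\<beta> = c * \<eta>^3 * Q"
    have \<beta>0: "\<beta> \<ge> 0" using c1 \<eta> Q0 by (simp add: \<beta>_def)
    have bad: "norm (w r \<odot> (D ^^ Suc s) (q r)) \<le> \<beta>" if r: "r \<in> {-T..T}" for r
    proof -
      define x y where "x = norm (w r)" and "y = norm (D (w r))"
      have w2: "w r \<in> H 2" using H_mono[OF ws[OF r], of 2] s by simp
      then have wd: "w r \<in> dom" by (simp add: H_2)
      have x: "0 \<le> x" "x \<le> C1 * \<eta>^4" "0 \<le> y" using w_small[OF r] by (auto simp: x_def y_def)
      have "norm (D (D (w r))) \<le> 2 * B" using interpolation[OF ws[OF r], of 2] s wB[OF r] by (simp add: numeral_2_eq_2)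
      then have "norm (w r) * norm (D (D (w r))) \<le> x * (2 * B)" unfolding x_def by (intro mult_left_mono) auto
      then have y2: "y\<^sup>2 \<le> x * (2 * B)" using norm_D_sq[OF w2] unfolding x_def y_def by linarith
      have "(2 * x * y)\<^sup>2 = 4 * x\<^sup>2 * y\<^sup>2" by (simp add: power_mult_distrib)
      also have "\<dots> \<le> 4 * x\<^sup>2 * (x * (2 * B))" by (intro mult_left_mono y2) auto
      also have "\<dots> = 8 * B * x^3" by (simp add: power2_eq_square power3_eq_cube)
      also have "\<dots> \<le> 8 * B * (C1 * \<eta>^4)^3" using x B by (intro mult_left_mono power_mono) auto
      also have "\<dots> = (8 * B * C1^3) * \<eta>^12" by (simp add: power_mult_distrib flip: power_mult)
      also have "\<dots> \<le> c^4 * \<eta>^12"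
      proof (intro mult_right_mono)
        have "8 * B * C1^3 \<le> c" by (simp add: c_def)
        also have "c \<le> c^4" using c1 power_increasing[of 1 4 c] by simp
        finally show "8 * B * C1^3 \<le> c^4" .
      qed (use \<eta> in auto)
      also have "\<dots> = ((c * \<eta>^3)\<^sup>2)\<^sup>2" by (simp add: power_mult_distrib flip: power_mult)
      finally have "2 * x * y \<le> (c * \<eta>^3)\<^sup>2" by (rule power2_le_imp_le) simp
      then have "sqrt (2 * x * y) \<le> c * \<eta>^3" using c1 \<eta> by (intro real_le_lsqrt) auto
      then have "norm (w r \<odot> (D ^^ Suc s) (q r)) \<le> c * \<eta>^3 * norm ((D ^^ Suc s) (q r))"
        using norm_mul_sqrt[OF wd, of "(D ^^ Suc s) (q r)"] unfolding x_def y_def by (meson mult_right_mono norm_ge_zero order_trans)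
      also have "\<dots> \<le> c * \<eta>^3 * Q"
        using bspec[OF Q r] norm_Dp_le_hn[of "Suc s" "q r"] c1 \<eta> by (intro mult_left_mono) auto
      finally show ?thesis by (simp add: \<beta>_def)
    qed
    \<comment> \<open>\<beta> bounds the term that loses a derivative; adding its square makes the
      Gronwall inequality homogeneous.\<close>
    define z where "z r = (norm (w r))\<^sup>2 + (norm ((D ^^ s) (w r)))\<^sup>2 + \<beta>\<^sup>2" for r
    have hz: "(hn s (w r))\<^sup>2 \<le> 2 * z r - 2 * \<beta>\<^sup>2" for r
    proof -
      have "(x + y)\<^sup>2 \<le> 2 * (x\<^sup>2 + y\<^sup>2)" for x y :: real using zero_le_power2[of "x - y"] by (simp add: power2_eq_square algebra_simps)
      from this[of "norm (w r)" "norm ((D ^^ s) (w r))"] show ?thesis unfolding z_def hn_def by argo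
    qed
    have "z t \<le> z 0 * exp (a * \<bar>t\<bar>)"
    proof (rule gronwall_two_sided[OF _ _ t])
      fix r assume r: "r \<in> {-T..T}"
      have d0: "(w has_vector_derivative (F (p r) - F (q r))) (at r within {-T..T})"
        unfolding w_def using solution_L2(2)[OF p r] solution_L2(2)[OF q r] by (rule has_vector_derivative_diff)
      have FH: "F (p r) \<in> H s" "F (q r) \<in> H s" using F_H pH[OF r] by auto
      have ds: "((\<lambda>t. (D ^^ s) (w t)) has_vector_derivative ((D ^^ s) (F (p r) - F (q r)))) (at r within {-T..T})"
      proof (rule has_vector_derivative_transform[OF r])
        show "(D ^^ s) (w x) = (D ^^ s) (p x) - (D ^^ s) (q x)" if "x \<in> {-T..T}" for x
          unfolding w_def by (rule Dp_diff[OF ps[OF that] order_refl])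
        show "((\<lambda>t. (D ^^ s) (p t) - (D ^^ s) (q t)) has_vector_derivative (D ^^ s) (F (p r) - F (q r))) (at r within {-T..T})"
          unfolding Dp_diff[OF FH order_refl] using p q r unfolding solution_def by (intro has_vector_derivative_diff) auto
      qed
      show "(z has_real_derivative 2 * inner (w r) (F (p r) - F (q r)) + 2 * inner ((D ^^ s) (w r)) ((D ^^ s) (F (p r) - F (q r)))) (at r within {-T..T})"
        unfolding z_def using DERIV_add[OF DERIV_add[OF norm_sq_has_real_derivative[OF d0] norm_sq_has_real_derivative[OF ds]] DERIV_const[of "\<beta>\<^sup>2"]] by simp
      have zr: "(norm (w r))\<^sup>2 \<le> z r" by (simp add: z_def)
      have "\<bar>inner (w r) (F (p r) - F (q r))\<bar> \<le> C0 * (1 + hn 3 (p r) + hn 3 (q r)) * (norm (w r))\<^sup>2"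
        using C0(2)[OF solution_L2(1)[OF p r] solution_L2(1)[OF q r]] by (simp add: w_def inner_commute)
      also have "\<dots> \<le> C0 * (1 + 4 * B) * z r"
        using h3[OF r] C0(1) B zr by (intro mult_mono mult_left_mono) auto
      finally have 1: "\<bar>inner (w r) (F (p r) - F (q r))\<bar> \<le> C0 * (1 + 4 * B) * z r" .
      have "\<bar>inner ((D ^^ s) (w r)) ((D ^^ s) (F (p r) - F (q r)))\<bar>
        \<le> Cs * (1 + hn s (p r) + hn s (q r)) * (hn s (w r))\<^sup>2 + 6 * norm (w r \<odot> (D ^^ Suc s) (q r)) * hn s (w r)"
        using Cs(2)[OF pH[OF r]] unfolding w_def by (metis inner_commute)
      also have "\<dots> \<le> Cs * (1 + 2 * B) * (2 * z r) + 6 * \<beta> * hn s (w r)"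
      proof (rule add_mono)
        have "1 + hn s (p r) + hn s (q r) \<le> 1 + 2 * B" using bspec[OF hB r] by linarith
        moreover have "(hn s (w r))\<^sup>2 \<le> 2 * z r" using hz[of r] zero_le_power2[of \<beta>] by linarith
        ultimately show "Cs * (1 + hn s (p r) + hn s (q r)) * (hn s (w r))\<^sup>2 \<le> Cs * (1 + 2 * B) * (2 * z r)"
          using B Cs(1) by (intro mult_mono[OF mult_left_mono]) auto
        show "6 * norm (w r \<odot> (D ^^ Suc s) (q r)) * hn s (w r) \<le> 6 * \<beta> * hn s (w r)"
          using bad[OF r] by (intro mult_right_mono) auto
      qed
      also have "6 * \<beta> * hn s (w r) \<le> 6 * z r"
      proof -
        have "2 * \<beta> * hn s (w r) \<le> 2 * z r" using hz[of r] sum_squares_bound[of \<beta> "hn s (w r)"] zero_le_power2[of \<beta>] by linarith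
        then show ?thesis by simp
      qed
      finally have 2: "\<bar>inner ((D ^^ s) (w r)) ((D ^^ s) (F (p r) - F (q r)))\<bar> \<le> Cs * (1 + 2 * B) * (2 * z r) + 6 * z r" by simp
      have "a * z r = 2 * (C0 * (1 + 4 * B) * z r) + 2 * (Cs * (1 + 2 * B) * (2 * z r) + 6 * z r)"
        unfolding a_def by (simp add: algebra_simps)
      then show "\<bar>2 * inner (w r) (F (p r) - F (q r)) + 2 * inner ((D ^^ s) (w r)) ((D ^^ s) (F (p r) - F (q r)))\<bar> \<le> a * z r"
      proof -
        have tri: "\<bar>2 * x + 2 * y\<bar> \<le> 2 * x' + 2 * y'" if "\<bar>x\<bar> \<le> x'" "\<bar>y\<bar> \<le> y'" for x y x' y' :: real
          using that by linarith
        assume e: "a * z r = 2 * (C0 * (1 + 4 * B) * z r) + 2 * (Cs * (1 + 2 * B) * (2 * z r) + 6 * z r)"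
        show ?thesis unfolding e by (rule tri[OF 1 2])
      qed
    qed
    also have "\<dots> \<le> ((hn s (w 0))\<^sup>2 + \<beta>\<^sup>2) * E"
    proof (rule mult_mono)
      have "x\<^sup>2 + y\<^sup>2 \<le> (x + y)\<^sup>2" if "x \<ge> 0" "y \<ge> 0" for x y :: real using that by (simp add: power2_sum)
      then show "z 0 \<le> (hn s (w 0))\<^sup>2 + \<beta>\<^sup>2" by (simp add: z_def hn_def)
      show "exp (a * \<bar>t\<bar>) \<le> E" unfolding E_def using t a0 by (auto intro!: mult_left_mono)
    qed auto
    finally have "(hn s (w t))\<^sup>2 \<le> 2 * (((hn s (w 0))\<^sup>2 + \<beta>\<^sup>2) * E)" using hz[of t] zero_le_power2[of \<beta>] by linarith
    also have "\<dots> \<le> 4 * ((hn s (w 0) + \<beta>)\<^sup>2 * (E * E))"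
    proof -
      have "((hn s (w 0))\<^sup>2 + \<beta>\<^sup>2) * E \<le> (hn s (w 0) + \<beta>)\<^sup>2 * (E * E)"
        using E1 \<beta>0 by (intro mult_mono) (auto simp: power2_sum mult_le_cancel_left1)
      moreover have "0 \<le> (hn s (w 0) + \<beta>)\<^sup>2 * (E * E)" using E1 by simp
      ultimately show ?thesis by linarith
    qed
    also have "\<dots> = (2 * E * (hn s (w 0) + \<beta>))\<^sup>2" by (simp add: power2_eq_square algebra_simps)
    finally have "hn s (w t) \<le> 2 * E * (hn s (w 0) + \<beta>)" by (rule power2_le_imp_le) (use E1 \<beta>0 in simp)
    also have "\<dots> \<le> 2 * E * (c * (hn s (w 0) + \<eta>^3 * Q))"
    proof (intro mult_left_mono)
      have "1 * hn s (w 0) \<le> c * hn s (w 0)" using c1 by (intro mult_right_mono) auto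
      then show "hn s (w 0) + \<beta> \<le> c * (hn s (w 0) + \<eta>^3 * Q)" by (simp add: \<beta>_def algebra_simps)
    qed (use E1 in simp)
    finally show "hn s (p t - q t) \<le> 2 * E * c * (hn s (p 0 - q 0) + \<eta>^3 * Q)" by (simp add: w_def)
  qed (use E1 c1 in simp)
qed

end

context kdv_structure begin

text \<open>Stated for curves differentiable in L^2 with an H^3 bound, not for
  \<open>solution\<close>: a competitor that is merely continuous into H^s need not have the three
  extra orders that \<open>solution\<close> demands.\<close>

lemma uniqueness:
  assumes T: "T > 0"
    and p: "\<And>t. t \<in> {-T..T} ==> p t \<in> H 3 \<and> hn 3 (p t) \<le> B \<and> (p has_vector_derivative F (p t)) (at t within {-T..T})"
    and q: "\<And>t. t \<in> {-T..T} ==> q t \<in> H 3 \<and> hn 3 (q t) \<le> B \<and> (q has_vector_derivative F (q t)) (at t within {-T..T})"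
    and "p 0 = q 0" and t: "t \<in> {-T..T}"
  shows "p t = q t"
proof -
  have "0 \<in> {-T..T}" using T by simp
  then have B: "B \<ge> 0" using p[of 0] hn_nonneg[of 3 "p 0"] by linarith
  obtain C where "\<forall>p q. (\<forall>t\<in>{-T..T}. p t \<in> H 3 \<and> hn 3 (p t) \<le> B \<and> (p has_vector_derivative F (p t)) (at t within {-T..T})) -->
     (\<forall>t\<in>{-T..T}. q t \<in> H 3 \<and> hn 3 (q t) \<le> B \<and> (q has_vector_derivative F (q t)) (at t within {-T..T})) -->
     (\<forall>t\<in>{-T..T}. norm (p t - q t) \<le> C * norm (p 0 - q 0))"
    using L2_stability[OF T B] by (elim exE conjE) (rule that)
  from this[rule_format, of p q t] p q t have "norm (p t - q t) \<le> C * norm (p 0 - q 0)" by blast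
  then show ?thesis using \<open>p 0 = q 0\<close> by simp
qed

lemma solution_bounded:
  assumes "solution s T q"
  shows "\<exists>B\<ge>0. \<forall>t\<in>{-T..T}. hn s (q t) \<le> B"
proof -
  have c: "continuous_on {-T..T} (\<lambda>t. (D ^^ j) (q t))" if "j \<le> s" for j
    using assms that unfolding solution_def by (intro continuous_on_vector_derivative) blast
  have "continuous_on {-T..T} (\<lambda>t. hn s (q t))"
    unfolding hn_def using c[of 0] c[of s] by (intro continuous_intros) auto
  then have "bounded ((\<lambda>t. hn s (q t)) ` {-T..T})" by (intro compact_imp_bounded compact_continuous_image) auto
  then obtain B where "\<forall>t\<in>{-T..T}. hn s (q t) \<le> B" unfolding bounded_iff by auto
  then show ?thesis by (intro exI[of _ "\<bar>B\<bar>"]) force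
qed

lemma solution_restrict:
  assumes "solution s T q" "T' \<le> T" shows "solution s T' q"
  unfolding solution_def
proof (intro conjI ballI allI impI)
  fix t assume t: "t \<in> {-T'..T'}"
  then have tT: "t \<in> {-T..T}" using assms(2) by auto
  show "q t \<in> H (s + 3)" using assms(1) tT by (simp add: solution_def)
  fix j assume "j \<le> s"
  then have "((\<lambda>t. (D ^^ j) (q t)) has_vector_derivative (D ^^ j) (F (q t))) (at t within {-T..T})"
    using assms(1) tT by (simp add: solution_def)
  then show "((\<lambda>t. (D ^^ j) (q t)) has_vector_derivative (D ^^ j) (F (q t))) (at t within {-T'..T'})"
    by (rule has_vector_derivative_within_subset) (use assms(2) in auto)
qed

lemma solution_cong:
  assumes "solution s T q" "\<And>t. t \<in> {-T..T} ==> p t = q t" shows "solution s T p"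
  unfolding solution_def
proof (intro conjI ballI allI impI)
  fix t assume t: "t \<in> {-T..T}"
  show "p t \<in> H (s + 3)" using assms t by (simp add: solution_def)
  fix j assume "j \<le> s"
  then have "((\<lambda>t. (D ^^ j) (q t)) has_vector_derivative (D ^^ j) (F (p t))) (at t within {-T..T})"
    using assms t by (simp add: solution_def)
  then show "((\<lambda>t. (D ^^ j) (p t)) has_vector_derivative (D ^^ j) (F (p t))) (at t within {-T..T})"
    using assms by (intro has_vector_derivative_transform[OF t, of "\<lambda>t. (D ^^ j) (p t)"]) auto
qed

lemma solution_unique:
  assumes T: "T > 0" and s: "s \<ge> 3" and p: "solution s T p" and q: "solution s T q" and "p 0 = q 0" and t: "t \<in> {-T..T}"
  shows "p t = q t"
proof -
  obtain B where B: "\<And>t. t \<in> {-T..T} ==> hn s (p t) \<le> B" using solution_bounded[OF p] by blast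
  obtain B' where B': "\<And>t. t \<in> {-T..T} ==> hn s (q t) \<le> B'" using solution_bounded[OF q] by blast
  have 1: "p r \<in> H 3 \<and> hn 3 (p r) \<le> max (2 * B) (2 * B') \<and> (p has_vector_derivative F (p r)) (at r within {-T..T})" if "r \<in> {-T..T}" for r
    using solution_L2[OF p that] B[OF that] hn_mono[OF solution_L2(3)[OF p that] s] by auto
  have 2: "q r \<in> H 3 \<and> hn 3 (q r) \<le> max (2 * B) (2 * B') \<and> (q has_vector_derivative F (q r)) (at r within {-T..T})" if "r \<in> {-T..T}" for r
    using solution_L2[OF q that] B'[OF that] hn_mono[OF solution_L2(3)[OF q that] s] by auto
  show ?thesis by (rule uniqueness[OF T 1 2 \<open>p 0 = q 0\<close> t])
qed

definition flow :: "nat => 'a => real => 'a" where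
  "flow s u0 = (SOME q. q 0 = u0 \<and> (\<forall>T>0. solution s T q))"

text \<open>Local solutions are glued by reading the value at t from the solution on
  [-|t| - 1, |t| + 1]; uniqueness makes it agree with the solution on any larger or smaller interval
  containing t.\<close>

lemma flow:
  assumes s: "s \<ge> 3" and u0: "u0 \<in> H (s + 4)"
  shows "flow s u0 0 = u0" "T > 0 ==> solution s T (flow s u0)"
proof -
  have "\<exists>q. T > 0 --> solution s T q \<and> q 0 = u0" for T
  proof (cases "T > 0")
    case True
    obtain M C where "\<forall>f\<in>H (s + 4). hn s f \<le> hn s u0 -->
      (\<exists>q. solution s T q \<and> q 0 = f \<and> (\<forall>t\<in>{-T..T}. hn s (q t) \<le> M \<and> hn (Suc s) (q t) \<le> C * (1 + hn (Suc s) f)))"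
      using smooth_existence[OF True s, of "hn s u0"] by (elim exE conjE) (rule that)
    then show ?thesis using u0 by blast
  qed auto
  then obtain Q where Q: "\<And>T. T > 0 ==> solution s T (Q T)" "\<And>T. T > 0 ==> Q T 0 = u0" by metis
  define q where "q t = Q (\<bar>t\<bar> + 1) t" for t
  have eq: "q t = Q T t" if T: "T > 0" and t: "t \<in> {-T..T}" for T t
  proof (cases "t = 0")
    case True then show ?thesis using Q(2)[OF T] Q(2)[of 1] by (simp add: q_def)
  next
    case False
    have "solution s \<bar>t\<bar> (Q (\<bar>t\<bar> + 1))" by (rule solution_restrict[OF Q(1)]) auto
    moreover have "solution s \<bar>t\<bar> (Q T)" by (rule solution_restrict[OF Q(1)[OF T]]) (use t in auto)
    ultimately show ?thesis
      unfolding q_def by (rule solution_unique[rotated 2]) (use False s Q(2)[OF T] Q(2)[of "\<bar>t\<bar> + 1"] in auto)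
  qed
  have "solution s T q" if "T > 0" for T by (rule solution_cong[OF Q(1)[OF that] eq[OF that]])
  moreover have "q 0 = u0" using Q(2)[of 1] by (simp add: q_def)
  ultimately have "\<exists>q. q 0 = u0 \<and> (\<forall>T>0. solution s T q)" by blast
  then have "flow s u0 0 = u0 \<and> (\<forall>T>0. solution s T (flow s u0))" unfolding flow_def by (rule someI_ex)
  then show "flow s u0 0 = u0" "T > 0 ==> solution s T (flow s u0)" by auto
qed

text \<open>\<open>stability\<close> with the a priori bounds of \<open>smooth_existence\<close>
  inserted. Only g enters with its norm of order s + 1, so the smoother datum is put in the second
  place.\<close>

lemma flow_stability:
  assumes T: "T > 0" and s: "s \<ge> 3"
  shows "\<exists>C\<ge>0. \<forall>f\<in>H (s + 4). \<forall>g\<in>H (s + 4). hn s f \<le> R --> hn s g \<le> R --> (\<forall>\<eta>\<ge>0. norm (f - g) \<le> \<eta>^4 -->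
    (\<forall>t\<in>{-T..T}. hn s (flow s f t - flow s g t) \<le> C * (hn s (f - g) + \<eta>^3 * (1 + hn (Suc s) g))))"
proof -
  obtain M C where M0: "M \<ge> 0" and C0: "C \<ge> 0" and MC: "\<forall>f\<in>H (s + 4). hn s f \<le> R -->
      (\<exists>q. solution s T q \<and> q 0 = f \<and> (\<forall>t\<in>{-T..T}. hn s (q t) \<le> M \<and> hn (Suc s) (q t) \<le> C * (1 + hn (Suc s) f)))"
    using smooth_existence[OF T s, of R] by (elim exE conjE) (rule that)
  have bd: "hn s (flow s f t) \<le> M" "hn (Suc s) (flow s f t) \<le> C * (1 + hn (Suc s) f)"
    if f: "f \<in> H (s + 4)" "hn s f \<le> R" and t: "t \<in> {-T..T}" for f t
  proof -
    obtain q where q: "solution s T q" "q 0 = f" "\<forall>t\<in>{-T..T}. hn s (q t) \<le> M \<and> hn (Suc s) (q t) \<le> C * (1 + hn (Suc s) f)"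
      using MC f by blast
    have "flow s f t = q t"
      by (rule solution_unique[OF T s flow(2)[OF s f(1) T] q(1) _ t]) (simp add: flow(1)[OF s f(1)] q(2))
    then show "hn s (flow s f t) \<le> M" "hn (Suc s) (flow s f t) \<le> C * (1 + hn (Suc s) f)" using q(3) t by auto
  qed
  obtain C' where C'0: "C' \<ge> 0" and C': "\<forall>p q. solution s T p --> solution s T q --> (\<forall>t\<in>{-T..T}. hn s (p t) \<le> M \<and> hn s (q t) \<le> M) -->
    (\<forall>\<eta> Q. \<eta> \<ge> 0 --> norm (p 0 - q 0) \<le> \<eta>^4 --> (\<forall>t\<in>{-T..T}. hn (Suc s) (q t) \<le> Q) -->
      (\<forall>t\<in>{-T..T}. hn s (p t - q t) \<le> C' * (hn s (p 0 - q 0) + \<eta>^3 * Q)))"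
    using stability[OF T s M0] by (elim exE conjE) (rule that)
  show ?thesis
  proof (rule exI[of _ "C' * (1 + C)"], intro conjI ballI impI allI)
    fix f g \<eta> t assume f: "f \<in> H (s + 4)" "hn s f \<le> R" and g: "g \<in> H (s + 4)" "hn s g \<le> R"
      and \<eta>: "0 \<le> \<eta>" "norm (f - g) \<le> \<eta>^4" and t: "t \<in> {-T..T}"
    define Q where "Q = 1 + hn (Suc s) g"
    have Q0: "Q \<ge> 0" by (simp add: Q_def)
    have "norm (flow s f 0 - flow s g 0) \<le> \<eta>^4" using \<eta> flow(1)[OF s f(1)] flow(1)[OF s g(1)] by simp
    moreover have "\<forall>t\<in>{-T..T}. hn (Suc s) (flow s g t) \<le> C * Q" using bd(2)[OF g] by (simp add: Q_def)
    moreover have "\<forall>t\<in>{-T..T}. hn s (flow s f t) \<le> M \<and> hn s (flow s g t) \<le> M" using bd(1)[OF f] bd(1)[OF g] by blast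
    ultimately have "hn s (flow s f t - flow s g t) \<le> C' * (hn s (flow s f 0 - flow s g 0) + \<eta>^3 * (C * Q))"
      using C' flow(2)[OF s f(1) T] flow(2)[OF s g(1) T] \<eta>(1) t by blast
    also have "\<dots> = C' * (hn s (f - g) + \<eta>^3 * (C * Q))" using flow(1)[OF s f(1)] flow(1)[OF s g(1)] by simp
    also have "\<dots> \<le> C' * ((1 + C) * (hn s (f - g) + \<eta>^3 * Q))"
    proof (rule mult_left_mono[OF _ C'0])
      have "0 \<le> C * hn s (f - g)" "0 \<le> \<eta>^3 * Q" using C0 \<eta>(1) Q0 by auto
      then show "hn s (f - g) + \<eta>^3 * (C * Q) \<le> (1 + C) * (hn s (f - g) + \<eta>^3 * Q)" by (simp add: algebra_simps)
    qed
    finally show "hn s (flow s f t - flow s g t) \<le> C' * (1 + C) * (hn s (f - g) + \<eta>^3 * (1 + hn (Suc s) g))"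
      by (simp add: Q_def mult.assoc)
  qed (use C0 C'0 in simp)
qed

section \<open>Extension of the flow\<close>

text \<open>Two factors K lift \<open>H s\<close> to \<open>H (s + 4)\<close>, the regularity that
  \<open>flow\<close> requires of its data.\<close>

definition moll :: "nat => 'a => 'a" where "moll i = K (1 / Suc i) ^^ 2"

lemma moll:
  assumes "s \<ge> 3" "f \<in> H s"
  shows "moll i f \<in> H (s + 4)" and "hn s (moll i f) \<le> hn s f" "norm (moll i f - f) \<le> 2 * (1 / Suc i)\<^sup>2 * hn s f"
    "hn (Suc s) (moll i f) \<le> Suc i * hn s f" "(\<lambda>i. hn s (moll i f - f)) \<longlonglongrightarrow> 0"
    "\<And>g. g \<in> H s ==> moll i (f - g) = moll i f - moll i g"
proof -
  define \<delta> where "\<delta> = 1 / real (Suc i)"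
  have \<delta>: "\<delta> > 0" by (simp add: \<delta>_def)
  have \<delta>0: "\<delta> \<noteq> 0" using \<delta> by simp
  have m: "moll i = K \<delta> ^^ 2" by (simp add: moll_def \<delta>_def)
  show "moll i f \<in> H (s + 4)" unfolding m using Kn_H[OF \<delta>0 assms(2), of 2] by simp
  show "hn s (moll i f) \<le> hn s f" unfolding m by (rule Kn_hn[OF \<delta>0 assms(2)])
  have f2: "f \<in> H 2" using H_mono[OF assms(2), of 2] assms(1) by simp
  have "norm (moll i f - f) \<le> real 2 * \<delta>\<^sup>2 * norm (D (D f))" unfolding m by (rule Kn_near2[OF \<delta> f2])
  also have "\<dots> \<le> real 2 * \<delta>\<^sup>2 * hn s f"
    using interpolation[OF assms(2), of 2] assms(1) by (intro mult_left_mono) (auto simp: numeral_2_eq_2)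
  finally show "norm (moll i f - f) \<le> 2 * (1 / Suc i)\<^sup>2 * hn s f" by (simp add: \<delta>_def)
  have "(D ^^ Suc s) (moll i f) = D ((D ^^ s) (K \<delta> (K \<delta> f)))" by (simp add: m numeral_2_eq_2)
  also have "(D ^^ s) (K \<delta> (K \<delta> f)) = K \<delta> (K \<delta> ((D ^^ s) f))"
    using Kn_Dp[OF \<delta>0 assms(2) order_refl, of 2] by (simp add: numeral_2_eq_2)
  finally have "norm ((D ^^ Suc s) (moll i f)) \<le> 1 / \<delta> * norm (K \<delta> ((D ^^ s) f))" using K_norm_D[OF \<delta>] by simp
  also have "\<dots> \<le> 1 / \<delta> * norm ((D ^^ s) f)" using \<delta> K_norm[OF \<delta>0] by (intro mult_left_mono) auto
  finally have 1: "norm ((D ^^ Suc s) (moll i f)) \<le> Suc i * norm ((D ^^ s) f)" by (simp add: \<delta>_def)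
  have "norm (moll i f) \<le> norm f" unfolding m by (rule Kn_norm[OF \<delta>0])
  also have "\<dots> \<le> Suc i * norm f" by (simp add: mult_le_cancel_right1)
  finally show "hn (Suc s) (moll i f) \<le> Suc i * hn s f" using 1 by (simp add: hn_def algebra_simps)
  have Dm: "(D ^^ s) (moll i f - f) = moll i ((D ^^ s) f) - (D ^^ s) f" for i
  proof -
    have n: "1 / real (Suc i) \<noteq> 0" by simp
    show ?thesis unfolding moll_def using Dp_diff[OF Kn_H'[OF n assms(2)] assms(2) order_refl] Kn_Dp[OF n assms(2) order_refl] by simp
  qed
  have "(\<lambda>i. norm (moll i f - f) + norm (moll i ((D ^^ s) f) - (D ^^ s) f)) \<longlonglongrightarrow> 0 + 0"
    unfolding moll_def using Kn_tendsto[of 2 f] Kn_tendsto[of 2 "(D ^^ s) f"]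
    by (intro tendsto_add tendsto_norm_zero LIM_zero) auto
  then show "(\<lambda>i. hn s (moll i f - f)) \<longlonglongrightarrow> 0" unfolding hn_def Dm by simp
  show "\<And>g. g \<in> H s ==> moll i (f - g) = moll i f - moll i g"
    unfolding m using bounded_linear.linear[OF Kn_lin[OF \<delta>0]] by (simp add: linear_diff)
qed

text \<open>Bona--Smith: smoothing the data costs one power of the smoothing scale in \<open>H\<^sup>s\<^sup>+\<^sup>1\<close> and gains two in
  \<open>L\<^sup>2\<close>, so that the bad term of the stability estimate tends to zero.\<close>

lemma bona_smith:
  assumes T: "T > 0" and s: "s \<ge> 3" and R: "R \<ge> 0"
  shows "\<exists>C\<ge>0. \<forall>f\<in>H s. hn s f \<le> R --> (\<forall>i k. i \<le> k --> (\<forall>t\<in>{-T..T}.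
     hn s (flow s (moll k f) t - flow s (moll i f) t) \<le> C * (hn s (moll k f - moll i f) + sqrt (1 / Suc i))))"
proof -
  obtain C where C0: "C \<ge> 0" and C: "\<forall>f\<in>H (s + 4). \<forall>g\<in>H (s + 4). hn s f \<le> R --> hn s g \<le> R --> (\<forall>\<eta>\<ge>0. norm (f - g) \<le> \<eta>^4 -->
    (\<forall>t\<in>{-T..T}. hn s (flow s f t - flow s g t) \<le> C * (hn s (f - g) + \<eta>^3 * (1 + hn (Suc s) g))))"
    using flow_stability[OF T s, of R] by (elim exE conjE) (rule that)
  \<comment> \<open>Ensures c^4 \<ge> 4 R, so that c r can serve as the parameter \<eta> of the
    stability estimate.\<close>
  define c where "c = 1 + 4 * R"
  have c1: "c \<ge> 1" using R by (simp add: c_def)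
  define c' where "c' = c^3 * (1 + R)"
  have c'1: "c' \<ge> 1" using c1 R mult_mono[of 1 "c^3" 1 "1 + R"] by (simp add: c'_def)
  show ?thesis
  proof (rule exI[of _ "C * c'"], intro conjI ballI impI allI)
    fix f t and i k :: nat assume f: "f \<in> H s" "hn s f \<le> R" and ik: "i \<le> k" and t: "t \<in> {-T..T}"
    \<comment> \<open>r is the square root of the smoothing scale: the L^2 distance is of size r^4,
      the norm of order s + 1 of size r^(-2), so \<eta>^3 times the latter is of size r.\<close>
    define r where "r = sqrt (1 / real (Suc i))"
    have r: "0 < r" "r \<le> 1" "r\<^sup>2 = 1 / Suc i" by (auto simp: r_def)
    have r4: "r^4 = (1 / Suc i)\<^sup>2" using r(3) by (metis numeral_Bit0 power2_eq_square power_add)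
    have "norm (moll k f - moll i f) \<le> norm (moll k f - f) + norm (moll i f - f)"
      using norm_triangle_ineq4[of "moll k f - f" "moll i f - f"] by simp
    also have "\<dots> \<le> 2 * (1 / Suc k)\<^sup>2 * hn s f + 2 * (1 / Suc i)\<^sup>2 * hn s f" by (intro add_mono moll[OF s f(1)])
    also have "\<dots> \<le> 2 * (1 / Suc i)\<^sup>2 * hn s f + 2 * (1 / Suc i)\<^sup>2 * hn s f"
      using ik by (intro add_right_mono mult_right_mono mult_left_mono power_mono frac_le) auto
    also have "\<dots> = 4 * r^4 * hn s f" by (simp add: r4)
    also have "\<dots> \<le> 4 * r^4 * R" using f(2) r by (intro mult_left_mono) auto
    also have "\<dots> = (4 * R) * r^4" by simp
    also have "\<dots> \<le> c^4 * r^4"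
    proof (rule mult_right_mono)
      have "4 * R \<le> c" by (simp add: c_def)
      also have "c \<le> c^4" using c1 power_increasing[of 1 4 c] by simp
      finally show "4 * R \<le> c^4" .
    qed simp
    also have "\<dots> = (c * r)^4" by (simp add: power_mult_distrib)
    finally have d: "norm (moll k f - moll i f) \<le> (c * r)^4" .
    have cr: "0 \<le> c * r" using c1 r by simp
    have hR: "hn s (moll k f) \<le> R" "hn s (moll i f) \<le> R" using moll(2)[OF s f(1)] f(2) order_trans by blast+
    have "hn s (flow s (moll k f) t - flow s (moll i f) t) \<le> C * (hn s (moll k f - moll i f) + (c * r)^3 * (1 + hn (Suc s) (moll i f)))"
      using C moll(1)[OF s f(1)] hR cr d t by blast
    also have "\<dots> \<le> C * (c' * (hn s (moll k f - moll i f) + r))"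
    proof (rule mult_left_mono[OF _ C0])
      have "hn (Suc s) (moll i f) \<le> Suc i * hn s f" by (rule moll(4)[OF s f(1)])
      also have "\<dots> \<le> Suc i * R" using f(2) by (intro mult_left_mono) auto
      finally have "(c * r)^3 * (1 + hn (Suc s) (moll i f)) \<le> (c * r)^3 * (1 + Suc i * R)" using cr by (intro mult_left_mono) auto
      also have "\<dots> = c^3 * r * (r\<^sup>2 * (1 + Suc i * R))" by (simp add: power_mult_distrib power3_eq_cube power2_eq_square)
      also have "r\<^sup>2 * (1 + Suc i * R) = r\<^sup>2 + R" unfolding distrib_left r(3) by simp
      also have "c^3 * r * (r\<^sup>2 + R) \<le> c^3 * r * (1 + R)"
        using c1 r R power_le_one[of r 2] by (intro mult_left_mono add_right_mono) auto
      also have "\<dots> = c' * r" by (simp add: c'_def)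
      finally have "(c * r)^3 * (1 + hn (Suc s) (moll i f)) \<le> c' * r" .
      moreover have "1 * hn s (moll k f - moll i f) \<le> c' * hn s (moll k f - moll i f)" using c'1 by (intro mult_right_mono) auto
      ultimately show "hn s (moll k f - moll i f) + (c * r)^3 * (1 + hn (Suc s) (moll i f)) \<le> c' * (hn s (moll k f - moll i f) + r)"
        by (simp add: distrib_left)
    qed
    finally show "hn s (flow s (moll k f) t - flow s (moll i f) t) \<le> C * c' * (hn s (moll k f - moll i f) + sqrt (1 / Suc i))"
      by (simp add: r_def mult.assoc)
  qed (use C0 c'1 in simp)
qed

lemma sqrt_inverse_Suc_tendsto: "(\<lambda>i. sqrt (1 / real (Suc i))) \<longlonglongrightarrow> 0"
  using tendsto_real_sqrt[OF LIMSEQ_Suc[OF lim_1_over_n]] by simp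

definition ext_flow :: "nat => 'a => real => 'a" where
  "ext_flow s f t = lim (\<lambda>i. flow s (moll i f) t)"

lemma flow_H: "s \<ge> 3 ==> u0 \<in> H (s + 4) ==> flow s u0 t \<in> H s"
proof -
  assume s: "s \<ge> 3" and u0: "u0 \<in> H (s + 4)"
  have "\<bar>t\<bar> + 1 > 0" by simp
  moreover have "t \<in> {- (\<bar>t\<bar> + 1)..\<bar>t\<bar> + 1}" by (auto simp: abs_if)
  ultimately show ?thesis using solution_L2(3)[OF flow(2)[OF s u0]] by blast
qed

text \<open>The smooth flows are uniformly Cauchy in every order up to s by
  \<open>bona_smith\<close>, because moll i f tends to f in \<open>H s\<close>; the limits of the
  derivatives are derivatives of the limit by \<open>H_closed\<close>.\<close>

lemma ext_flow_limit:
  assumes T: "T > 0" and s: "s \<ge> 3" and f: "f \<in> H s" and j: "j \<le> s"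
  shows "uniform_limit {-T..T} (\<lambda>i t. (D ^^ j) (flow s (moll i f) t)) (\<lambda>t. (D ^^ j) (ext_flow s f t)) sequentially"
    "t \<in> {-T..T} ==> ext_flow s f t \<in> H s"
proof -
  define I where "I = {-T..T}"
  define u where "u i t = flow s (moll i f) t" for i t
  have uH: "u i t \<in> H s" for i t unfolding u_def by (rule flow_H[OF s moll(1)[OF s f]])
  obtain C where C0: "C \<ge> 0" and C: "\<forall>g\<in>H s. hn s g \<le> hn s f --> (\<forall>i k. i \<le> k --> (\<forall>t\<in>{-T..T}.
     hn s (flow s (moll k g) t - flow s (moll i g) t) \<le> C * (hn s (moll k g - moll i g) + sqrt (1 / Suc i))))"
    using bona_smith[OF T s hn_nonneg[of s f]] by (elim exE conjE) (rule that)
  have est: "hn s (u k t - u i t) \<le> C * (hn s (moll k f - moll i f) + sqrt (1 / Suc i))" if "i \<le> k" "t \<in> I" for i k t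
    using C f that unfolding u_def I_def by blast
  have mH: "moll i f \<in> H s" for i using H_mono[OF moll(1)[OF s f]] by simp
  have uc: "uniformly_Cauchy_on I (\<lambda>i t. (D ^^ l) (u i t))" if l: "l \<le> s" for l
  proof (rule uniformly_Cauchy_onI')
    fix \<epsilon> :: real assume \<epsilon>: "\<epsilon> > 0"
    define e where "e = \<epsilon> / (3 * C + 1)"
    have e: "e > 0" using \<epsilon> C0 by (simp add: e_def)
    have "\<forall>\<^sub>F i in sequentially. hn s (moll i f - f) < e \<and> sqrt (1 / real (Suc i)) < e"
      using order_tendstoD(2)[OF moll(5)[OF s f] e] order_tendstoD(2)[OF sqrt_inverse_Suc_tendsto e] by eventually_elim auto
    then obtain M where M: "\<And>i. i \<ge> M ==> hn s (moll i f - f) < e" "\<And>i. i \<ge> M ==> sqrt (1 / real (Suc i)) < e"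
      unfolding eventually_sequentially by blast
    have "dist ((D ^^ l) (u i t)) ((D ^^ l) (u k t)) < \<epsilon>" if "t \<in> I" "i \<ge> M" "k > i" for t i k
    proof -
      have "hn s (moll k f - moll i f) \<le> hn s (moll k f - f) + hn s (moll i f - f)"
        using hn_diff[OF H_diff[OF mH f] H_diff[OF mH f], of k i] by simp
      also have "\<dots> \<le> e + e" using M(1)[of i] M(1)[of k] that by simp
      finally have "hn s (u k t - u i t) \<le> C * (e + e + e)"
        using est[of i k t] M(2)[of i] that C0 mult_left_mono[of "hn s (moll k f - moll i f) + sqrt (1 / Suc i)" "e + e + e" C] by fastforce
      also have "\<dots> = \<epsilon> * (3 * C / (3 * C + 1))" by (simp add: e_def)
      also have "\<dots> < \<epsilon> * 1" using \<epsilon> C0 by (intro mult_strict_left_mono) auto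
      finally have "norm ((D ^^ l) (u k t - u i t)) < \<epsilon>" using interpolation[OF H_diff[OF uH uH, of k t i t] l] by linarith
      then show ?thesis using Dp_diff[OF uH uH l, of k t i t] by (simp add: dist_norm norm_minus_commute)
    qed
    then show "\<exists>M. \<forall>x\<in>I. \<forall>m\<ge>M. \<forall>n>m. dist ((D ^^ l) (u m x)) ((D ^^ l) (u n x)) < \<epsilon>" by blast
  qed
  have "\<forall>l. \<exists>g. l \<le> s --> uniform_limit I (\<lambda>i t. (D ^^ l) (u i t)) g sequentially"
    using Cauchy_uniformly_convergent[OF uc] unfolding uniformly_convergent_on_def by blast
  then obtain g where g: "\<And>l. l \<le> s ==> uniform_limit I (\<lambda>i t. (D ^^ l) (u i t)) (g l) sequentially" by metis
  have glim: "(\<lambda>i. (D ^^ l) (u i t)) \<longlonglongrightarrow> g l t" if "l \<le> s" "t \<in> I" for l t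
    using tendsto_uniform_limitI[OF g[OF that(1)] that(2)] .
  have e0: "ext_flow s f t = g 0 t" if "t \<in> I" for t
    unfolding ext_flow_def using limI[OF glim[of 0 t]] that by (simp add: u_def)
  have gH: "g 0 t \<in> H s \<and> (\<forall>l\<le>s. (D ^^ l) (g 0 t) = g l t)" if "t \<in> I" for t
    using H_closed[of "\<lambda>i. u i t" s "\<lambda>l. g l t"] uH glim[OF _ that] by blast
  show "t \<in> {-T..T} ==> ext_flow s f t \<in> H s" using e0 gH by (simp add: I_def)
  have "(D ^^ j) (ext_flow s f t) = g j t" if "t \<in> I" for t using e0[OF that] gH[OF that] j by simp
  then show "uniform_limit {-T..T} (\<lambda>i t. (D ^^ j) (flow s (moll i f) t)) (\<lambda>t. (D ^^ j) (ext_flow s f t)) sequentially"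
    using g[OF j] uniform_limit_cong'[of I "\<lambda>i t. (D ^^ j) (u i t)" "\<lambda>i t. (D ^^ j) (u i t)" "g j" "\<lambda>t. (D ^^ j) (ext_flow s f t)" sequentially]
    by (simp add: u_def I_def)
qed

lemma ext_flow_continuous:
  assumes T: "T > 0" and s: "s \<ge> 3" and f: "f \<in> H s" and j: "j \<le> s"
  shows "continuous_on {-T..T} (\<lambda>t. (D ^^ j) (ext_flow s f t))"
proof (rule uniform_limit_theorem[OF _ ext_flow_limit(1)[OF T s f j]])
  have "continuous_on {-T..T} (\<lambda>t. (D ^^ j) (flow s (moll i f) t))" for i
    using flow(2)[OF s moll(1)[OF s f] T, of i] j unfolding solution_def by (intro continuous_on_vector_derivative) blast
  then show "\<forall>\<^sub>F n in sequentially. continuous_on {-T..T} (\<lambda>t. (D ^^ j) (flow s (moll n f) t))" by simp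
qed simp

lemma ext_flow_0:
  assumes s: "s \<ge> 3" and f: "f \<in> H s" shows "ext_flow s f 0 = f"
proof -
  have "flow s (moll i f) 0 = moll i f" for i by (rule flow(1)[OF s moll(1)[OF s f]])
  then show ?thesis unfolding ext_flow_def moll_def using limI[OF Kn_tendsto[of 2 f]] by simp
qed

lemma ext_flow_bounded:
  assumes T: "T > 0" and s: "s \<ge> 3" and f: "f \<in> H s"
  shows "\<exists>B\<ge>0. \<forall>t\<in>{-T..T}. hn s (ext_flow s f t) \<le> B"
proof -
  have "continuous_on {-T..T} (\<lambda>t. hn s (ext_flow s f t))"
    unfolding hn_def using ext_flow_continuous[OF T s f, of 0] ext_flow_continuous[OF T s f, of s] by (intro continuous_intros) auto
  then have "bounded ((\<lambda>t. hn s (ext_flow s f t)) ` {-T..T})" by (intro compact_imp_bounded compact_continuous_image) auto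
  then obtain B where "\<forall>t\<in>{-T..T}. hn s (ext_flow s f t) \<le> B" unfolding bounded_iff by auto
  then show ?thesis by (intro exI[of _ "\<bar>B\<bar>"]) force
qed

text \<open>\<open>F\<close> is Lipschitz from bounded sets of \<open>H s\<close> to
  \<open>H (s - 3)\<close>, so the right-hand sides converge uniformly up to order s - 3 and the
  derivative passes to the limit.\<close>

lemma ext_flow_derivative:
  assumes T: "T > 0" and s: "s \<ge> 3" and f: "f \<in> H s" and j: "j \<le> s - 3" and t: "t \<in> {-T..T}"
  shows "((\<lambda>t. (D ^^ j) (ext_flow s f t)) has_vector_derivative (D ^^ j) (F (ext_flow s f t))) (at t within {-T..T})"
proof (rule has_vector_derivative_uniform_limit[OF _ t, where y = "\<lambda>i t. (D ^^ j) (flow s (moll i f) t)"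
      and y' = "\<lambda>i t. (D ^^ j) (F (flow s (moll i f) t))"])
  define q where "q = ext_flow s f"
  define u where "u i t = flow s (moll i f) t" for i t
  have uH: "u i t \<in> H s" for i t unfolding u_def by (rule flow_H[OF s moll(1)[OF s f]])
  have qH: "q t \<in> H s" if "t \<in> {-T..T}" for t unfolding q_def by (rule ext_flow_limit(2)[OF T s f order_refl that])
  have s3: "s - 3 + 3 = s" using s by simp
  obtain B where B: "B \<ge> 0" "\<And>t. t \<in> {-T..T} ==> hn s (q t) \<le> B" using ext_flow_bounded[OF T s f] unfolding q_def by blast
  obtain C where C0: "C \<ge> 0" and C: "\<forall>v\<in>H s. \<forall>w\<in>H s. hn (s - 3) (F v - F w) \<le> C * (1 + hn s v + hn s w) * hn s (v - w)"
    using F_lipschitz[of "s - 3"] unfolding s3 by (elim exE conjE) (rule that)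
  show "convex {-T..T}" by simp
  show "((\<lambda>t. (D ^^ j) (flow s (moll i f) t)) has_vector_derivative (D ^^ j) (F (flow s (moll i f) x))) (at x within {-T..T})" if "x \<in> {-T..T}" for i x
    using flow(2)[OF s moll(1)[OF s f] T, of i] that j unfolding solution_def by simp
  show "(\<lambda>i. (D ^^ j) (flow s (moll i f) x)) \<longlonglongrightarrow> (D ^^ j) (ext_flow s f x)" if "x \<in> {-T..T}" for x
    by (rule tendsto_uniform_limitI[OF ext_flow_limit(1)[OF T s f] that]) (use j in simp)
  show "uniform_limit {-T..T} (\<lambda>i t. (D ^^ j) (F (flow s (moll i f) t))) (\<lambda>t. (D ^^ j) (F (ext_flow s f t))) sequentially"
  proof (rule uniform_limitI)
    fix \<epsilon> :: real assume \<epsilon>: "\<epsilon> > 0"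
    define c where "c = C * (2 + 2 * B)"
    have c0: "c \<ge> 0" using C0 B by (simp add: c_def)
    \<comment> \<open>The bound 1/2 keeps the distance below 1, hence hn s of the approximation
      below B + 1; the other bound yields the final \<epsilon>.\<close>
    define e where "e = min (1/2) (\<epsilon> / (2 * c + 1) / 2)"
    have e: "e > 0" using \<epsilon> c0 by (simp add: e_def)
    have "\<forall>\<^sub>F i in sequentially. \<forall>t\<in>{-T..T}. dist (u i t) (q t) < e"
      using uniform_limitD[OF ext_flow_limit(1)[OF T s f, of 0] e] by (simp add: u_def q_def)
    moreover have "\<forall>\<^sub>F i in sequentially. \<forall>t\<in>{-T..T}. dist ((D ^^ s) (u i t)) ((D ^^ s) (q t)) < e"
      using uniform_limitD[OF ext_flow_limit(1)[OF T s f, of s] e] by (simp add: u_def q_def)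
    ultimately show "\<forall>\<^sub>F i in sequentially. \<forall>t\<in>{-T..T}. dist ((D ^^ j) (F (flow s (moll i f) t))) ((D ^^ j) (F (ext_flow s f t))) < \<epsilon>"
    proof eventually_elim
      case (elim i)
      show ?case
      proof
        fix t assume t: "t \<in> {-T..T}"
        have h: "hn s (u i t - q t) < 2 * e"
        proof -
          have "norm (u i t - q t) < e" "norm ((D ^^ s) (u i t) - (D ^^ s) (q t)) < e" using elim t by (auto simp: dist_norm)
          then show ?thesis unfolding hn_def Dp_diff[OF uH[of i t] qH[OF t] order_refl] by linarith
        qed
        have h1: "hn s (u i t) \<le> B + 1"
          using hn_triangle_abs[OF uH[of i t] qH[OF t]] h B(2)[OF t] e_def by (smt (verit) field_sum_of_halves)
        have FH: "F (u i t) \<in> H (s - 3)" "F (q t) \<in> H (s - 3)" using F_H[of _ "s - 3"] uH qH[OF t] s3 by auto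
        have "norm ((D ^^ j) (F (u i t) - F (q t))) \<le> hn (s - 3) (F (u i t) - F (q t))" by (rule interpolation[OF H_diff[OF FH] j])
        also have "\<dots> \<le> C * (1 + hn s (u i t) + hn s (q t)) * hn s (u i t - q t)" using C uH qH[OF t] by blast
        also have "\<dots> \<le> c * (2 * e)"
          unfolding c_def using h1 B(2)[OF t] B(1) C0 h by (intro mult_mono mult_left_mono) auto
        also have "\<dots> \<le> c * (\<epsilon> / (2 * c + 1))"
        proof (rule mult_left_mono[OF _ c0])
          define d where "d = \<epsilon> / (2 * c + 1)"
          have "e \<le> d / 2" by (simp add: e_def d_def)
          then show "2 * e \<le> \<epsilon> / (2 * c + 1)" unfolding d_def[symmetric] by linarith
        qed
        also have "\<dots> = \<epsilon> * (c / (2 * c + 1))" by simp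
        also have "\<dots> < \<epsilon> * 1" using \<epsilon> c0 by (intro mult_strict_left_mono) auto
        finally show "dist ((D ^^ j) (F (flow s (moll i f) t))) ((D ^^ j) (F (ext_flow s f t))) < \<epsilon>"
          using Dp_diff[OF FH j] by (simp add: u_def q_def dist_norm)
      qed
    qed
  qed
qed

text \<open>The limit k to infinity in \<open>bona_smith\<close>. C is uniform on the ball of radius
  R, which is what continuity in the data needs.\<close>

lemma ext_flow_near:
  assumes T: "T > 0" and s: "s \<ge> 3" and R: "R \<ge> 0"
  shows "\<exists>C\<ge>0. \<forall>f\<in>H s. hn s f \<le> R --> (\<forall>i. \<forall>t\<in>{-T..T}.
     hn s (ext_flow s f t - flow s (moll i f) t) \<le> C * (hn s (moll i f - f) + sqrt (1 / Suc i)))"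
proof -
  obtain C where C0: "C \<ge> 0" and C: "\<forall>f\<in>H s. hn s f \<le> R --> (\<forall>i k. i \<le> k --> (\<forall>t\<in>{-T..T}.
     hn s (flow s (moll k f) t - flow s (moll i f) t) \<le> C * (hn s (moll k f - moll i f) + sqrt (1 / Suc i))))"
    using bona_smith[OF T s R] by (elim exE conjE) (rule that)
  have "hn s (ext_flow s f t - flow s (moll i f) t) \<le> C * (hn s (moll i f - f) + sqrt (1 / Suc i))"
    if f: "f \<in> H s" "hn s f \<le> R" and t: "t \<in> {-T..T}" for f i t
  proof (rule tendsto_le)
    have uH: "flow s (moll k f) t \<in> H s" for k by (rule flow_H[OF s moll(1)[OF s f(1)]])
    have qH: "ext_flow s f t \<in> H s" by (rule ext_flow_limit(2)[OF T s f(1) order_refl t])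
    have l: "(\<lambda>k. (D ^^ j) (flow s (moll k f) t)) \<longlonglongrightarrow> (D ^^ j) (ext_flow s f t)" if "j \<le> s" for j
      by (rule tendsto_uniform_limitI[OF ext_flow_limit(1)[OF T s f(1) that] t])
    show "(\<lambda>k. hn s (flow s (moll k f) t - flow s (moll i f) t)) \<longlonglongrightarrow> hn s (ext_flow s f t - flow s (moll i f) t)"
      unfolding hn_def Dp_diff[OF uH uH order_refl] Dp_diff[OF qH uH order_refl]
      using l[of 0] l[of s] by (intro tendsto_intros) auto
    have mH: "moll k f \<in> H s" for k using H_mono[OF moll(1)[OF s f(1)]] by simp
    have "(\<lambda>k. hn s (moll k f - f)) \<longlonglongrightarrow> 0" by (rule moll(5)[OF s f(1)])
    then show "(\<lambda>k. C * (hn s (moll k f - f) + hn s (moll i f - f) + sqrt (1 / Suc i))) \<longlonglongrightarrow> C * (hn s (moll i f - f) + sqrt (1 / Suc i))"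
      by (auto intro!: tendsto_eq_intros)
    have "hn s (flow s (moll k f) t - flow s (moll i f) t) \<le> C * (hn s (moll k f - f) + hn s (moll i f - f) + sqrt (1 / Suc i))" if "k \<ge> i" for k
    proof -
      have "hn s (moll k f - moll i f) \<le> hn s (moll k f - f) + hn s (moll i f - f)"
        using hn_diff[OF H_diff[OF mH f(1)] H_diff[OF mH f(1)], of k i] by simp
      then have "C * (hn s (moll k f - moll i f) + sqrt (1 / Suc i)) \<le> C * (hn s (moll k f - f) + hn s (moll i f - f) + sqrt (1 / Suc i))"
        using C0 by (intro mult_left_mono) auto
      moreover have "hn s (flow s (moll k f) t - flow s (moll i f) t) \<le> C * (hn s (moll k f - moll i f) + sqrt (1 / Suc i))"
        using C f that t by blast
      ultimately show ?thesis by linarith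
    qed
    then show "\<forall>\<^sub>F k in sequentially. hn s (flow s (moll k f) t - flow s (moll i f) t) \<le> C * (hn s (moll k f - f) + hn s (moll i f - f) + sqrt (1 / Suc i))"
      unfolding eventually_sequentially by blast
  qed simp
  then show ?thesis using C0 by blast
qed

text \<open>The difference is split through the flows of moll i g and moll i f. First i is fixed in
  terms of f alone, then the radius in terms of i: the norm of order s + 1 of moll i f is large but
  fixed, so a small \<eta> compensates it.\<close>

lemma ext_flow_continuous_dependence:
  assumes T: "T > 0" and s: "s \<ge> 3" and f: "f \<in> H s" and \<epsilon>: "\<epsilon> > 0"
  shows "\<exists>r>0. \<forall>g\<in>H s. hn s (g - f) < r --> (\<forall>t\<in>{-T..T}. hn s (ext_flow s g t - ext_flow s f t) < \<epsilon>)"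
proof -
  define R where "R = hn s f + 1"
  have R: "R \<ge> 0" by (simp add: R_def)
  obtain C where C0: "C \<ge> 0" and C: "\<forall>f\<in>H s. hn s f \<le> R --> (\<forall>i. \<forall>t\<in>{-T..T}.
     hn s (ext_flow s f t - flow s (moll i f) t) \<le> C * (hn s (moll i f - f) + sqrt (1 / Suc i)))"
    using ext_flow_near[OF T s R] by (elim exE conjE) (rule that)
  obtain C' where C'0: "C' \<ge> 0" and C': "\<forall>f\<in>H (s + 4). \<forall>g\<in>H (s + 4). hn s f \<le> R --> hn s g \<le> R --> (\<forall>\<eta>\<ge>0. norm (f - g) \<le> \<eta>^4 -->
    (\<forall>t\<in>{-T..T}. hn s (flow s f t - flow s g t) \<le> C' * (hn s (f - g) + \<eta>^3 * (1 + hn (Suc s) g))))"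
    using flow_stability[OF T s, of R] by (elim exE conjE) (rule that)
  define e where "e = \<epsilon> / (8 * (C + 1))"
  have e: "e > 0" using \<epsilon> C0 by (simp add: e_def)
  have Ce: "C * e \<le> \<epsilon> / 8"
  proof -
    have "C * e = (\<epsilon> / 8) * (C / (C + 1))" by (simp add: e_def)
    also have "\<dots> \<le> (\<epsilon> / 8) * 1" using \<epsilon> C0 by (intro mult_left_mono) auto
    finally show ?thesis by simp
  qed
  have "\<forall>\<^sub>F i in sequentially. hn s (moll i f - f) < e \<and> sqrt (1 / real (Suc i)) < e"
    using order_tendstoD(2)[OF moll(5)[OF s f] e] order_tendstoD(2)[OF sqrt_inverse_Suc_tendsto e] by eventually_elim auto
  then obtain i where i: "hn s (moll i f - f) < e" "sqrt (1 / real (Suc i)) < e"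
    unfolding eventually_sequentially by blast
  define Q where "Q = 1 + hn (Suc s) (moll i f)"
  have Q: "Q \<ge> 1" by (simp add: Q_def)
  \<comment> \<open>Covers the two quantities still to be made small by \<eta>: C' (1 + Q) \<eta>
    from the stability estimate and 2 C \<eta> from smoothing g instead of f.\<close>
  define b where "b = C' * (1 + Q) + 2 * C + 1"
  have b: "b \<ge> 1" using C'0 C0 Q by (simp add: b_def)
  define \<eta> where "\<eta> = min 1 (\<epsilon> / (8 * b))"
  have \<eta>: "0 < \<eta>" "\<eta> \<le> 1" using \<epsilon> b by (auto simp: \<eta>_def)
  have "\<eta> * b \<le> \<epsilon> / (8 * b) * b" using b by (intro mult_right_mono) (auto simp: \<eta>_def)
  then have \<eta>b: "b * \<eta> \<le> \<epsilon> / 8" using b by (simp add: mult.commute)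
  have \<eta>4: "\<eta>^4 \<le> \<eta>" "\<eta>^3 \<le> \<eta>" "\<eta>^4 > 0" using \<eta> power_decreasing[of 1 4 \<eta>] power_decreasing[of 1 3 \<eta>] by auto
  show ?thesis
  proof (intro exI[of _ "\<eta>^4"] conjI ballI impI)
    fix g t assume g: "g \<in> H s" and gf: "hn s (g - f) < \<eta>^4" and t: "t \<in> {-T..T}"
    define d where "d = hn s (g - f)"
    have d: "0 \<le> d" "d \<le> \<eta>" "d \<le> \<eta>^4" using gf \<eta>4 by (auto simp: d_def)
    have fR: "hn s f \<le> R" by (simp add: R_def)
    have gR: "hn s g \<le> R" using hn_add[OF H_diff[OF g f] f] d \<eta> by (simp add: R_def d_def)
    have gfH: "g - f \<in> H s" by (rule H_diff[OF g f])
    \<comment> \<open>Linearity and contractivity of the smoothing bound ||moll i g - g|| by that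
      for f plus 2 ||g - f||, although i was chosen for f.\<close>
    have mlin: "moll i (g - f) = moll i g - moll i f" by (rule moll(6)[OF s g f])
    have mH: "moll i h \<in> H s" if "h \<in> H s" for h using H_mono[OF moll(1)[OF s that]] by simp
    have 1: "hn s (ext_flow s f t - flow s (moll i f) t) \<le> \<epsilon> / 4"
    proof -
      have "hn s (ext_flow s f t - flow s (moll i f) t) \<le> C * (hn s (moll i f - f) + sqrt (1 / Suc i))" using C f fR t by blast
      also have "\<dots> \<le> C * (e + e)" using i C0 by (intro mult_left_mono add_mono) auto
      finally show ?thesis using Ce by (simp add: distrib_left)
    qed
    have 2: "hn s (ext_flow s g t - flow s (moll i g) t) \<le> \<epsilon> / 4 + \<epsilon> / 8"
    proof -
      have "moll i g - g = (moll i (g - f) - (g - f)) + (moll i f - f)" by (simp add: mlin)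
      then have "hn s (moll i g - g) \<le> hn s (moll i (g - f) - (g - f)) + hn s (moll i f - f)"
        using hn_add[OF H_diff[OF mH[OF gfH] gfH] H_diff[OF mH[OF f] f]] by (simp only:)
      also have "\<dots> \<le> 2 * d + e"
        using hn_diff[OF mH[OF gfH] gfH] moll(2)[OF s gfH, of i] i(1) by (simp add: d_def)
      finally have m: "hn s (moll i g - g) \<le> 2 * d + e" .
      have "hn s (ext_flow s g t - flow s (moll i g) t) \<le> C * (hn s (moll i g - g) + sqrt (1 / Suc i))" using C g gR t by blast
      also have "\<dots> \<le> C * (2 * \<eta> + e + e)" using m i(2) d(2) C0 by (intro mult_left_mono) auto
      also have "\<dots> = 2 * C * \<eta> + 2 * (C * e)" by (simp add: algebra_simps)
      also have "2 * C * \<eta> \<le> b * \<eta>" using C'0 Q \<eta> by (intro mult_right_mono) (auto simp: b_def)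
      finally show ?thesis using \<eta>b Ce by linarith
    qed
    have 3: "hn s (flow s (moll i g) t - flow s (moll i f) t) \<le> \<epsilon> / 8"
    proof -
      have hm: "hn s (moll i g - moll i f) \<le> d" using moll(2)[OF s gfH, of i] by (simp add: mlin d_def)
      have nm: "norm (moll i g - moll i f) \<le> \<eta>^4" using hm d(3) norm_le_hn[of "moll i g - moll i f" s] by linarith
      have hR: "hn s (moll i g) \<le> R" "hn s (moll i f) \<le> R" using moll(2)[OF s g, of i] gR moll(2)[OF s f, of i] fR by auto
      have "hn s (flow s (moll i g) t - flow s (moll i f) t) \<le> C' * (hn s (moll i g - moll i f) + \<eta>^3 * Q)"
        unfolding Q_def using C' moll(1)[OF s g] moll(1)[OF s f] hR nm \<eta>(1) t by (meson less_imp_le)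
      also have "\<dots> \<le> C' * (\<eta> + \<eta> * Q)"
        using hm d(2) \<eta>4 Q C'0 by (intro mult_left_mono add_mono mult_right_mono) auto
      also have "\<dots> = C' * (1 + Q) * \<eta>" by (simp add: algebra_simps)
      also have "\<dots> \<le> b * \<eta>" using C0 \<eta> by (intro mult_right_mono) (auto simp: b_def)
      finally show ?thesis using \<eta>b by linarith
    qed
    have m: "ext_flow s g t \<in> H s" "ext_flow s f t \<in> H s" "flow s (moll i g) t \<in> H s" "flow s (moll i f) t \<in> H s"
      using ext_flow_limit(2)[OF T s g order_refl t] ext_flow_limit(2)[OF T s f order_refl t]
        flow_H[OF s moll(1)[OF s g]] flow_H[OF s moll(1)[OF s f]] by auto
    have "ext_flow s g t - ext_flow s f t = (ext_flow s g t - flow s (moll i g) t) + (flow s (moll i g) t - flow s (moll i f) t) - (ext_flow s f t - flow s (moll i f) t)"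
      by simp
    then have "hn s (ext_flow s g t - ext_flow s f t) \<le> hn s (ext_flow s g t - flow s (moll i g) t) + hn s (flow s (moll i g) t - flow s (moll i f) t)
       + hn s (ext_flow s f t - flow s (moll i f) t)"
      using hn_diff[OF H_add[OF H_diff[OF m(1,3)] H_diff[OF m(3,4)]] H_diff[OF m(2,4)]] hn_add[OF H_diff[OF m(1,3)] H_diff[OF m(3,4)]] by simp
    then show "hn s (ext_flow s g t - ext_flow s f t) < \<epsilon>" using 1 2 3 \<epsilon> by linarith
  qed (use \<eta>4 in simp)
qed

end

section \<open>Test functions\<close>

definition smooth :: "(real => real) => bool" where
  "smooth f \<longleftrightarrow> (\<forall>k. (deriv ^^ k) f differentiable_on UNIV)"

text \<open>A coinduction principle: a class in which each function has a derivative that is again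
  in the class consists of smooth functions. It replaces formulas for higher derivatives.\<close>

lemma smooth_coinduct:
  assumes "P f" and step: "\<And>g. P g ==> \<exists>g'. P g' \<and> (\<forall>x. (g has_real_derivative g' x) (at x))"
  shows "smooth f"
proof -
  have P: "P ((deriv ^^ k) f)" for k
  proof (induction k)
    case (Suc k)
    obtain g' where g': "P g'" "\<And>x. ((deriv ^^ k) f has_real_derivative g' x) (at x)" using step[OF Suc] by blast
    have "deriv ((deriv ^^ k) f) = g'" by (rule ext) (rule DERIV_imp_deriv[OF g'(2)])
    then show ?case using g'(1) by simp
  qed (simp add: assms)
  have "(deriv ^^ k) f differentiable_on UNIV" for k
    using step[OF P[of k]] by (auto simp: differentiable_on_eq_differentiable_at real_differentiable_def)
  then show ?thesis by (simp add: smooth_def)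
qed

lemma smooth_deriv: "smooth f ==> smooth (deriv f)"
  unfolding smooth_def by (auto simp: funpow_swap1 dest: spec[of _ "Suc _"])

lemma smooth_has_derivative: "smooth f ==> (f has_real_derivative deriv f x) (at x)"
  unfolding smooth_def DERIV_deriv_iff_real_differentiable
  by (auto simp: differentiable_on_eq_differentiable_at dest: spec[of _ 0])

lemma smooth_continuous: "smooth f ==> continuous_on A f"
  by (intro continuous_at_imp_continuous_on ballI DERIV_isCont[OF smooth_has_derivative])

lemma smoothI:
  assumes "\<And>x. (f has_real_derivative g x) (at x)" "smooth g" shows "smooth f"
proof -
  have d: "deriv f = g" by (rule ext) (rule DERIV_imp_deriv[OF assms(1)])
  have "(deriv ^^ k) f differentiable_on UNIV" for k
  proof (cases k)
    case 0 then show ?thesis using assms(1) by (auto simp: differentiable_on_eq_differentiable_at real_differentiable_def)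
  next
    case (Suc n) then show ?thesis using assms(2) d by (simp add: smooth_def funpow_swap1)
  qed
  then show ?thesis by (simp add: smooth_def)
qed

text \<open>The closure of the smooth functions under sums and products is stable under
  differentiation, so \<open>smooth_coinduct\<close> gives smoothness of products without a higher
  Leibniz rule.\<close>

inductive smooth_alg :: "(real => real) => bool" where
  base: "smooth f ==> smooth_alg f"
| add: "smooth_alg f ==> smooth_alg g ==> smooth_alg (\<lambda>x. f x + g x)"
| mult: "smooth_alg f ==> smooth_alg g ==> smooth_alg (\<lambda>x. f x * g x)"

lemma smooth_alg_derivative: "smooth_alg f ==> \<exists>f'. smooth_alg f' \<and> (\<forall>x. (f has_real_derivative f' x) (at x))"
proof (induction rule: smooth_alg.induct)
  case (base f) then show ?case using smooth_deriv smooth_has_derivative smooth_alg.base by blast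
next
  case (add f g)
  obtain f' g' where "smooth_alg f'" "smooth_alg g'" "\<forall>x. (f has_real_derivative f' x) (at x)" "\<forall>x. (g has_real_derivative g' x) (at x)"
    using add.IH by (elim exE conjE) (rule that)
  then show ?case by (intro exI[of _ "\<lambda>x. f' x + g' x"] conjI smooth_alg.add) (simp_all add: DERIV_add)
next
  case (mult f g)
  obtain f' g' where d: "smooth_alg f'" "smooth_alg g'" "\<forall>x. (f has_real_derivative f' x) (at x)" "\<forall>x. (g has_real_derivative g' x) (at x)"
    using mult.IH by (elim exE conjE) (rule that)
  have "((\<lambda>x. f x * g x) has_real_derivative f' x * g x + g' x * f x) (at x)" for x
    using d(3,4) by (intro DERIV_mult) auto
  then show ?case using d(1,2) mult.hyps
    by (intro exI[of _ "\<lambda>x. f' x * g x + g' x * f x"] conjI smooth_alg.add[OF smooth_alg.mult smooth_alg.mult]) auto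
qed

lemma smooth_algD: "smooth_alg f ==> smooth f"
  by (rule smooth_coinduct[of smooth_alg, OF _ smooth_alg_derivative])

lemma smooth_add: "smooth f ==> smooth g ==> smooth (\<lambda>x. f x + g x)"
  and smooth_mult: "smooth f ==> smooth g ==> smooth (\<lambda>x. f x * g x)"
  by (rule smooth_algD, rule smooth_alg.add; erule smooth_alg.base)
    (rule smooth_algD, rule smooth_alg.mult; erule smooth_alg.base)

lemma smooth_affine: assumes "smooth f" shows "smooth (\<lambda>x. a * f (c * x + d))"
proof (rule smooth_coinduct[of "\<lambda>h. \<exists>a f. smooth f \<and> h = (\<lambda>x. a * f (c * x + d))"])
  show "\<exists>a' f'. smooth f' \<and> (\<lambda>x. a * f (c * x + d)) = (\<lambda>x. a' * f' (c * x + d))" using assms by blast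
  fix g assume "\<exists>a f. smooth f \<and> g = (\<lambda>x. a * f (c * x + d))"
  then obtain a f where f: "smooth f" "g = (\<lambda>x. a * f (c * x + d))" by blast
  have "(g has_real_derivative (a * c) * deriv f (c * x + d)) (at x)" for x
    unfolding f(2) by (auto intro!: derivative_eq_intros DERIV_chain2[OF smooth_has_derivative[OF f(1)]])
  then show "\<exists>g'. (\<exists>a f. smooth f \<and> g' = (\<lambda>x. a * f (c * x + d))) \<and> (\<forall>x. (g has_real_derivative g' x) (at x))"
    using smooth_deriv[OF f(1)] by blast
qed

lemma smooth_diff: "smooth f ==> smooth g ==> smooth (\<lambda>x. f x - g x)"
  using smooth_add[of f "\<lambda>x. -1 * g (1 * x + 0)"] smooth_affine[of g "-1" 1 0] by simp

lemma poly_times_exp_minus_tendsto_0: "((\<lambda>y. poly p y * exp (- y)) \<longlongrightarrow> (0::real)) at_top"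
proof -
  have "((\<lambda>y. \<Sum>i\<le>degree p. coeff p i * (y ^ i / exp y)) \<longlongrightarrow> (\<Sum>i\<le>degree p. coeff p i * 0)) at_top"
    by (intro tendsto_intros tendsto_power_div_exp_0)
  then show ?thesis by (simp add: poly_altdef sum_distrib_right exp_minus divide_inverse mult.assoc)
qed

definition flat_exp :: "real poly => real => real" where
  "flat_exp p x = (if x > 0 then poly p (1 / x) * exp (- (1 / x)) else 0)"

text \<open>With y = 1/x, the derivative of p(y) exp(-y) is y^2 (p - p')(y) exp(-y), so the class is
  closed under differentiation. At 0 the exponential beats every polynomial in y.\<close>

lemma flat_exp_derivative: "(flat_exp p has_real_derivative flat_exp ([:0, 0, 1:] * (p - pderiv p)) x) (at x)"
proof -
  consider "x > 0" | "x < 0" | "x = 0" by linarith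
  then show ?thesis
  proof cases
    case 1
    have "((\<lambda>x. poly p (1 / x) * exp (- (1 / x))) has_real_derivative flat_exp ([:0, 0, 1:] * (p - pderiv p)) x) (at x)"
      using 1 by (auto intro!: derivative_eq_intros DERIV_chain2[OF poly_DERIV] simp: flat_exp_def field_simps power2_eq_square)
    then show ?thesis
      by (rule has_field_derivative_transform_within_open[where S = "{0<..}"]) (use 1 in \<open>auto simp: flat_exp_def\<close>)
  next
    case 2
    have "((\<lambda>x. 0) has_real_derivative flat_exp ([:0, 0, 1:] * (p - pderiv p)) x) (at x)"
      using 2 by (auto simp: flat_exp_def)
    then show ?thesis
      by (rule has_field_derivative_transform_within_open[where S = "{..<0}"]) (use 2 in \<open>auto simp: flat_exp_def\<close>)
  next
    case 3
    have "((\<lambda>h. flat_exp p h / h) \<longlongrightarrow> 0) (at_right 0)"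
    proof (rule Lim_transform_eventually)
      have "((\<lambda>h. poly (pCons 0 p) (inverse h) * exp (- inverse h)) \<longlongrightarrow> 0) (at_right (0::real))"
        by (rule filterlim_compose[OF poly_times_exp_minus_tendsto_0 filterlim_inverse_at_top_right])
      then show "((\<lambda>h. poly (pCons 0 p) (inverse h) * exp (- inverse h)) \<longlongrightarrow> 0) (at_right (0::real))" .
      show "\<forall>\<^sub>F h in at_right 0. poly (pCons 0 p) (inverse h) * exp (- inverse h) = flat_exp p h / h"
        using eventually_at_right_less[of 0] by eventually_elim (auto simp: flat_exp_def field_simps)
    qed
    moreover have "((\<lambda>h. flat_exp p h / h) \<longlongrightarrow> 0) (at_left 0)"
    proof (rule Lim_transform_eventually[OF tendsto_const])
      show "\<forall>\<^sub>F h in at_left 0. 0 = flat_exp p h / h"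
        using eventually_at_left_real[of "-1" 0] by (auto simp: flat_exp_def elim: eventually_mono)
    qed
    ultimately have "((\<lambda>h. flat_exp p h / h) \<longlongrightarrow> 0) (at 0)" by (rule filterlim_split_at[rotated])
    then show ?thesis using 3 by (simp add: DERIV_def flat_exp_def)
  qed
qed

lemma smooth_flat_exp: "smooth (flat_exp p)"
proof (rule smooth_coinduct[of "\<lambda>f. \<exists>p. f = flat_exp p"])
  show "\<exists>g'. (\<exists>p. g' = flat_exp p) \<and> (\<forall>x. (g has_real_derivative g' x) (at x))" if "\<exists>p. g = flat_exp p" for g
    using that flat_exp_derivative by auto
qed auto

lemma smooth_primitive:
  assumes "smooth \<psi>" "\<And>x. x \<le> a ==> \<psi> x = 0"
  shows "\<exists>\<Phi>. smooth \<Phi> \<and> (\<forall>x. (\<Phi> has_real_derivative \<psi> x) (at x)) \<and> (\<forall>x\<le>a. \<Phi> x = 0)"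
proof -
  define \<Phi> where "\<Phi> x = integral {a - 1..x} \<psi>" for x
  have z: "\<Phi> x = 0" if "x \<le> a" for x
    unfolding \<Phi>_def by (rule integral_unique, rule has_integral_is_0) (use that assms(2) in auto)
  have d: "(\<Phi> has_real_derivative \<psi> x) (at x)" for x
  proof (cases "x < a")
    case True
    have "((\<lambda>x. 0) has_real_derivative \<psi> x) (at x)" using assms(2)[of x] True by simp
    then show ?thesis
      by (rule has_field_derivative_transform_within_open[where S = "{..<a}"]) (use True z in auto)
  next
    case False
    have "(\<Phi> has_real_derivative \<psi> x) (at x within {a - 1..x + 1})"
      unfolding \<Phi>_def by (rule integral_has_real_derivative[OF smooth_continuous[OF assms(1)]]) (use False in auto)
    then show ?thesis using at_within_Icc_at[of "a - 1" x "x + 1"] False by simp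
  qed
  show ?thesis using smoothI[OF d assms(1)] d z by blast
qed

text \<open>The normalised primitive of a nonnegative bump that vanishes outside (0, 1); its total
  mass P 1 is positive because the bump is positive at 1/2.\<close>

lemma smooth_step:
  "\<exists>S. smooth S \<and> (\<forall>x\<le>0. S x = 0) \<and> (\<forall>x\<ge>1. S x = 1) \<and> (\<forall>x. 0 \<le> S x \<and> S x \<le> 1)"
proof -
  define \<rho> where "\<rho> x = flat_exp 1 x * flat_exp 1 (1 - x)" for x
  have sm: "smooth \<rho>"
    unfolding \<rho>_def using smooth_mult[OF smooth_flat_exp smooth_affine[OF smooth_flat_exp[of 1], of 1 "-1" 1], of 1] by simp
  have nn: "\<rho> x \<ge> 0" for x by (simp add: \<rho>_def flat_exp_def)
  have z: "\<rho> x = 0" if "x \<le> 0 \<or> x \<ge> 1" for x using that by (auto simp: \<rho>_def flat_exp_def)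
  obtain P where P: "smooth P" "\<And>x. (P has_real_derivative \<rho> x) (at x)" "\<And>x. x \<le> 0 ==> P x = 0"
    using smooth_primitive[OF sm, of 0] z by blast
  have mono: "P x \<le> P y" if "x \<le> y" for x y
    using DERIV_nonneg_imp_nondecreasing[OF that] P(2) nn by blast
  have "\<rho> (1/2) > 0" by (simp add: \<rho>_def flat_exp_def)
  from DERIV_pos_inc_right[OF P(2) this] obtain d where d: "d > 0" "\<And>h. h > 0 ==> h < d ==> P (1/2) < P (1/2 + h)" by blast
  have "P (1/2) < P (1/2 + min (d/2) (1/2))" using d by simp
  also have "\<dots> \<le> P 1" by (rule mono) simp
  finally have P1: "P 1 > 0" using mono[of 0 "1/2"] P(3)[of 0] by simp
  have c: "P x = P 1" if "x \<ge> 1" for x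
  proof (rule antisym)
    show "P x \<le> P 1" using DERIV_nonpos_imp_nonincreasing[OF that, of P] P(2) z by (metis order_refl)
  qed (use mono that in auto)
  define S where "S x = (1 / P 1) * P x" for x
  have "smooth S" unfolding S_def using smooth_affine[OF P(1), of "1 / P 1" 1 0] by simp
  moreover have "0 \<le> S x" "S x \<le> 1" for x
  proof -
    show "0 \<le> S x" using mono[of 0 x] P(3)[of x] P(3)[of 0] P1 by (cases "x \<le> 0") (auto simp: S_def)
    show "S x \<le> 1" using mono[of x 1] c[of x] P1 by (cases "x \<le> 1") (auto simp: S_def)
  qed
  moreover have "S x = 1" if "x \<ge> 1" for x using c[OF that] P1 by (simp add: S_def)
  moreover have "S x = 0" if "x \<le> 0" for x using P(3)[OF that] by (simp add: S_def)
  ultimately show ?thesis by blast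
qed

lemma test_funI:
  assumes "smooth \<phi>" "\<And>x. \<bar>x\<bar> > R ==> \<phi> x = 0" shows "test_fun \<phi>"
proof -
  have "{x. \<phi> x \<noteq> 0} \<subseteq> {-R..R}"
  proof
    fix x assume "x \<in> {x. \<phi> x \<noteq> 0}"
    then have "\<not> \<bar>x\<bar> > R" using assms(2)[of x] by auto
    then show "x \<in> {-R..R}" by auto
  qed
  then have "bounded {x. \<phi> x \<noteq> 0}" by (rule bounded_subset[rotated]) simp
  then show ?thesis using assms(1) by (simp add: test_fun_def smooth_def)
qed

lemma test_funD:
  assumes "test_fun \<phi>" shows "smooth \<phi>" "\<exists>R>0. \<forall>x. \<bar>x\<bar> \<ge> R --> \<phi> x = 0"
proof -
  show "smooth \<phi>" using assms by (simp add: test_fun_def smooth_def)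
  have "bounded {x. \<phi> x \<noteq> 0}" using assms by (simp add: test_fun_def)
  then obtain B where "\<forall>x\<in>{x. \<phi> x \<noteq> 0}. \<bar>x\<bar> \<le> B" unfolding bounded_iff by auto
  then have "\<forall>x. \<bar>x\<bar> \<ge> \<bar>B\<bar> + 1 --> \<phi> x = 0" by force
  then show "\<exists>R>0. \<forall>x. \<bar>x\<bar> \<ge> R --> \<phi> x = 0" by (intro exI[of _ "\<bar>B\<bar> + 1"]) auto
qed

lemma test_fun_deriv: assumes "test_fun \<phi>" shows "test_fun (deriv \<phi>)"
proof -
  obtain R where R: "\<forall>x. \<bar>x\<bar> \<ge> R --> \<phi> x = 0" using test_funD[OF assms] by blast
  have "deriv \<phi> x = 0" if "\<bar>x\<bar> > R" for x
  proof (rule DERIV_imp_deriv)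
    have "((\<lambda>x. 0) has_real_derivative 0) (at x)" by simp
    then show "(\<phi> has_real_derivative 0) (at x)"
      by (rule has_field_derivative_transform_within_open[where S = "{x. \<bar>x\<bar> > R}"])
        (use R that in \<open>auto intro!: open_Collect_less continuous_intros\<close>)
  qed
  then show ?thesis by (intro test_funI[of _ R] smooth_deriv test_funD[OF assms])
qed

lemma test_fun_deriv_pow: "test_fun \<phi> ==> test_fun ((deriv ^^ k) \<phi>)"
  by (induction k) (auto intro: test_fun_deriv)

section \<open>Local integrability and the lemma of du Bois-Reymond\<close>

lemma locally_int_interval: "locally_int g ==> integrable lborel (\<lambda>x. indicator {a..b} x * g x)"
  using compact_Icc[of a b] unfolding locally_int_def set_integrable_def by auto

lemma integrable_bounded_mult:
  fixes g \<phi> :: "real => real"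
  assumes g: "integrable lborel g" and \<phi>: "\<phi> \<in> borel_measurable lborel" "\<And>x. \<bar>\<phi> x\<bar> \<le> B"
  shows "integrable lborel (\<lambda>x. g x * \<phi> x)"
proof (rule Bochner_Integration.integrable_bound)
  show "integrable lborel (\<lambda>x. B * g x)" using g by simp
  show "(\<lambda>x. g x * \<phi> x) \<in> borel_measurable lborel" using g \<phi>(1) by (intro borel_measurable_times) auto
  have B: "\<bar>B\<bar> = B" using \<phi>(2)[of 0] by simp
  have "\<bar>g x * \<phi> x\<bar> \<le> \<bar>B * g x\<bar>" for x
    using mult_left_mono[OF \<phi>(2)[of x], of "\<bar>g x\<bar>"] by (simp add: abs_mult B mult.commute)
  then show "AE x in lborel. norm (g x * \<phi> x) \<le> norm (B * g x)" by simp
qed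

lemma abs_indicator_le_1: "\<bar>indicator A x :: real\<bar> \<le> 1" by (simp add: indicator_def)

lemma test_fun_bounded: assumes "test_fun \<phi>" shows "\<exists>B. \<forall>x. \<bar>\<phi> x\<bar> \<le> B"
proof -
  obtain R where R: "\<forall>x. \<bar>x\<bar> \<ge> R --> \<phi> x = 0" using test_funD[OF assms] by blast
  have "compact (\<phi> ` {-R..R})" by (intro compact_continuous_image smooth_continuous test_funD[OF assms]) auto
  then have "bounded (\<phi> ` {-R..R})" by (rule compact_imp_bounded)
  then obtain B where B: "\<forall>x\<in>{-R..R}. \<bar>\<phi> x\<bar> \<le> B" by (auto simp: bounded_iff)
  have "\<bar>\<phi> x\<bar> \<le> \<bar>B\<bar>" for x
  proof (cases "\<bar>x\<bar> \<ge> R")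
    case True then show ?thesis using R by simp
  next
    case False
    then have "x \<in> {-R..R}" by auto
    then show ?thesis using B by fastforce
  qed
  then show ?thesis by blast
qed

lemma test_fun_measurable: "test_fun \<phi> ==> \<phi> \<in> borel_measurable lborel"
  using borel_measurable_continuous_onI[OF smooth_continuous[OF test_funD(1)]] by simp

lemma locally_int_test_integrable:
  assumes "locally_int g" "test_fun \<phi>" shows "integrable lborel (\<lambda>x. g x * \<phi> x)"
proof -
  obtain R where R: "\<forall>x. \<bar>x\<bar> \<ge> R --> \<phi> x = 0" using test_funD[OF assms(2)] by blast
  obtain B where B: "\<forall>x. \<bar>\<phi> x\<bar> \<le> B" using test_fun_bounded[OF assms(2)] ..
  have "integrable lborel (\<lambda>x. (indicator {-R..R} x * g x) * \<phi> x)"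
    by (rule integrable_bounded_mult[OF locally_int_interval[OF assms(1)] test_fun_measurable[OF assms(2)] B[rule_format]])
  also have "(\<lambda>x. (indicator {-R..R} x * g x) * \<phi> x) = (\<lambda>x. g x * \<phi> x)"
  proof
    fix x show "indicator {-R..R} x * g x * \<phi> x = g x * \<phi> x"
      using R[rule_format, of x] by (cases "\<bar>x\<bar> \<ge> R") (auto simp: indicator_def)
  qed
  finally show ?thesis .
qed

text \<open>On each bounded interval the positive and the negative part of g are densities of two
  finite measures that agree on all half-lines, hence coincide; by uniqueness of densities the two
  parts agree almost everywhere.\<close>

lemma AE_zero_interval_integrals:
  fixes g :: "real => real"
  assumes g: "locally_int g" and z: "\<And>a b. a < b ==> (LINT x|lborel. indicator {a<..b} x * g x) = 0"
  shows "AE x in lborel. g x = 0"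
proof -
  have "AE x in lborel. indicator {- real n<..real n} x * g x = 0" for n
  proof -
    define G where "G x = indicator {- real n<..real n} x * g x" for x
    have "integrable lborel (\<lambda>x. (indicator {- real n..real n} x * g x) * indicator {- real n<..real n} x)"
      by (rule integrable_bounded_mult[OF locally_int_interval[OF g] _ abs_indicator_le_1]) simp
    also have "(\<lambda>x. (indicator {- real n..real n} x * g x) * indicator {- real n<..real n} x) = G"
      by (auto simp: G_def indicator_def)
    finally have G: "integrable lborel G" .
    have m: "G \<in> borel_measurable lborel" using G by simp
    have i1: "integrable lborel (\<lambda>x. max 0 (G x))" "integrable lborel (\<lambda>x. max 0 (- G x))" using G by auto
    have eq: "density lborel (\<lambda>x. ennreal (max 0 (G x))) = density lborel (\<lambda>x. ennreal (max 0 (- G x)))"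
    proof (rule measure_eqI_lessThan)
      fix c :: real
      have j: "integrable lborel (\<lambda>x. max 0 (K x) * indicator {c<..} x)" if "integrable lborel (\<lambda>x. max 0 (K x))" for K :: "real => real"
        by (rule integrable_bounded_mult[OF that _ abs_indicator_le_1]) simp
      have e: "emeasure (density lborel (\<lambda>x. ennreal (max 0 (K x)))) {c<..} = ennreal (LINT x|lborel. max 0 (K x) * indicator {c<..} x)"
        if K: "integrable lborel (\<lambda>x. max 0 (K x))" "K \<in> borel_measurable lborel" for K :: "real => real"
      proof -
        have "emeasure (density lborel (\<lambda>x. ennreal (max 0 (K x)))) {c<..} = (\<integral>\<^sup>+x. ennreal (max 0 (K x)) * indicator {c<..} x \<partial>lborel)"
          using K by (subst emeasure_density) auto
        also have "\<dots> = (\<integral>\<^sup>+x. ennreal (max 0 (K x) * indicator {c<..} x) \<partial>lborel)"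
          by (intro nn_integral_cong) (auto simp: indicator_def)
        also have "\<dots> = ennreal (LINT x|lborel. max 0 (K x) * indicator {c<..} x)"
          by (rule nn_integral_eq_integral[OF j[OF K(1)]]) auto
        finally show ?thesis .
      qed
      have m': "(\<lambda>x. - G x) \<in> borel_measurable lborel" using m by simp
      note j = j[of G, OF i1(1)] j[of "\<lambda>x. - G x", OF i1(2)] and e = e[of G, OF i1(1) m] e[of "\<lambda>x. - G x", OF i1(2) m']
      have "(LINT x|lborel. max 0 (G x) * indicator {c<..} x) - (LINT x|lborel. max 0 (- G x) * indicator {c<..} x)
          = (LINT x|lborel. max 0 (G x) * indicator {c<..} x - max 0 (- G x) * indicator {c<..} x)"
        by (rule Bochner_Integration.integral_diff[OF j, symmetric])
      also have "\<dots> = (LINT x|lborel. indicator {max c (- real n)<..real n} x * g x)"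
        by (rule Bochner_Integration.integral_cong) (auto simp: G_def indicator_def max_def)
      also have "\<dots> = 0"
      proof (cases "max c (- real n) < real n")
        case True then show ?thesis by (rule z)
      next
        case False
        then have e: "{max c (- real n)<..real n} = {}" by auto
        show ?thesis unfolding e by simp
      qed
      finally show "emeasure (density lborel (\<lambda>x. ennreal (max 0 (G x)))) {c<..} = emeasure (density lborel (\<lambda>x. ennreal (max 0 (- G x)))) {c<..}"
        unfolding e by simp
      show "emeasure (density lborel (\<lambda>x. ennreal (max 0 (G x)))) {c<..} < \<infinity>" unfolding e by simp
    qed simp_all
    have "AE x in lborel. ennreal (max 0 (G x)) = ennreal (max 0 (- G x))"
    proof (subst finite_density_unique[symmetric])
      show "(\<integral>\<^sup>+ x. ennreal (max 0 (G x)) \<partial>lborel) \<noteq> \<infinity>"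
        using nn_integral_eq_integral[OF i1(1)] by simp
    qed (use m eq in auto)
    then show ?thesis by eventually_elim (auto simp: G_def max_def split: if_splits)
  qed
  then have "AE x in lborel. \<forall>n. indicator {- real n<..real n} x * g x = 0" unfolding AE_all_countable by blast
  then show ?thesis
  proof eventually_elim
    case (elim x)
    obtain n :: nat where "\<bar>x\<bar> < n" using reals_Archimedean2 by blast
    then have "x \<in> {- real n<..real n}" by auto
    then show ?case using elim[rule_format, of n] by simp
  qed
qed

text \<open>Differences of two steepening smooth steps are test functions that are bounded by 1 and
  converge pointwise to an interval indicator; dominated convergence transfers the hypothesis to
  intervals.\<close>

lemma du_Bois_Reymond_0:
  assumes g: "locally_int g" and z: "\<And>\<phi>. test_fun \<phi> ==> (LINT x|lborel. g x * \<phi> x) = 0"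
  shows "AE x in lborel. g x = 0"
proof (rule AE_zero_interval_integrals[OF g])
  fix a b :: real assume ab: "a < b"
  obtain S :: "real => real" where S0: "smooth S" "\<forall>x\<le>0. S x = 0" "\<forall>x\<ge>1. S x = 1" "\<forall>x. 0 \<le> S x \<and> S x \<le> 1"
    using smooth_step by (elim exE conjE) (rule that)
  note S = S0(1) S0(2,3)[rule_format] conjunct1[OF S0(4)[rule_format]] conjunct2[OF S0(4)[rule_format]]
  \<comment> \<open>As n grows this tends to the indicator of {a<..b}: half-open, since S vanishes
    at 0 itself.\<close>
  define \<phi> where "\<phi> n x = S (real (Suc n) * (x - a)) - S (real (Suc n) * (x - b))" for n x
  have supp: "\<phi> n x = 0" if "x < a \<or> x > b + 1" for n x
  proof -
    have "real (Suc n) * (x - c) \<le> 0" if "x \<le> c" for c using that by (intro mult_nonneg_nonpos) auto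
    moreover have "real (Suc n) * (x - c) \<ge> 1" if "x \<ge> c + 1" for c
      using mult_mono[of 1 "real (Suc n)" 1 "x - c"] that by simp
    ultimately show ?thesis using that ab S(2)[of "real (Suc n) * (x - a)"] S(2)[of "real (Suc n) * (x - b)"]
        S(3)[of "real (Suc n) * (x - a)"] S(3)[of "real (Suc n) * (x - b)"] unfolding \<phi>_def by (elim disjE) simp_all
  qed
  have test: "test_fun (\<phi> n)" for n
  proof (rule test_funI)
    have "smooth (\<lambda>x. S (real (Suc n) * (x - c)))" for c
      using smooth_affine[OF S(1), of 1 "real (Suc n)" "- real (Suc n) * c"] by (simp add: algebra_simps)
    then show "smooth (\<phi> n)" unfolding \<phi>_def by (intro smooth_diff)
    show "\<phi> n x = 0" if "\<bar>x\<bar> > \<bar>a\<bar> + \<bar>b\<bar> + 1" for x using that by (intro supp) auto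
  qed
  have le1: "\<bar>\<phi> n x\<bar> \<le> 1" for n x
    using S(4,5)[of "real (Suc n) * (x - a)"] S(4,5)[of "real (Suc n) * (x - b)"] unfolding \<phi>_def by linarith
  have "(\<lambda>n. LINT x|lborel. g x * \<phi> n x) \<longlonglongrightarrow> (LINT x|lborel. indicator {a<..b} x * g x)"
  proof (rule integral_dominated_convergence)
    show "integrable lborel (\<lambda>x. \<bar>indicator {a..b + 1} x * g x\<bar>)" using locally_int_interval[OF g] by (rule integrable_abs)
    show "(\<lambda>x. g x * \<phi> n x) \<in> borel_measurable lborel" for n by (rule borel_measurable_integrable[OF locally_int_test_integrable[OF g test]])
    have "integrable lborel (\<lambda>x. (indicator {a..b} x * g x) * indicator {a<..b} x)"
      by (rule integrable_bounded_mult[OF locally_int_interval[OF g] _ abs_indicator_le_1]) simp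
    also have "(\<lambda>x. (indicator {a..b} x * g x) * indicator {a<..b} x) = (\<lambda>x. indicator {a<..b} x * g x)"
      by (auto simp: indicator_def)
    finally show "(\<lambda>x. indicator {a<..b} x * g x) \<in> borel_measurable lborel" by (rule borel_measurable_integrable)
    show "AE x in lborel. norm (g x * \<phi> n x) \<le> \<bar>indicator {a..b + 1} x * g x\<bar>" for n
    proof (rule AE_I2)
      fix x show "norm (g x * \<phi> n x) \<le> \<bar>indicator {a..b + 1} x * g x\<bar>"
        using supp[of x n] mult_left_mono[OF le1[of n x], of "\<bar>g x\<bar>"] 
        by (cases "x < a \<or> b + 1 < x") (simp_all add: abs_mult)
    qed
    show "AE x in lborel. (\<lambda>n. g x * \<phi> n x) \<longlonglongrightarrow> indicator {a<..b} x * g x"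
    proof (rule AE_I2)
      fix x
      have ev: "\<forall>\<^sub>F n in sequentially. S (real (Suc n) * (x - c)) = (if x > c then 1 else 0)" for c
      proof (cases "x > c")
        case True
        obtain N :: nat where N: "1 / (x - c) < N" using reals_Archimedean2 by blast
        have "real (Suc n) * (x - c) \<ge> 1" if "n \<ge> N" for n
        proof -
          have n: "1 / (x - c) \<le> real (Suc n)" using N that by simp
          have "0 < x - c" using True by simp
          from pos_divide_le_eq[OF this] n show ?thesis by blast
        qed
        then have "\<forall>n\<ge>N. S (real (Suc n) * (x - c)) = 1" using S(3) by blast
        then show ?thesis unfolding eventually_sequentially if_P[OF True] by blast
      next
        case False
        have "real (Suc n) * (x - c) \<le> 0" for n using False by (intro mult_nonneg_nonpos) auto
        then show ?thesis unfolding if_not_P[OF False] by (intro always_eventually allI S(2))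
      qed
      have "\<forall>\<^sub>F n in sequentially. indicator {a<..b} x * g x = g x * \<phi> n x"
        using ev[of a] ev[of b]
      proof eventually_elim
        case (elim n) then show ?case using ab by (auto simp: \<phi>_def indicator_def)
      qed
      then show "(\<lambda>n. g x * \<phi> n x) \<longlonglongrightarrow> indicator {a<..b} x * g x"
        by (rule Lim_transform_eventually[OF tendsto_const])
    qed
  qed
  moreover have "(LINT x|lborel. g x * \<phi> n x) = 0" for n by (rule z[OF test])
  ultimately show "(LINT x|lborel. indicator {a<..b} x * g x) = 0" using LIMSEQ_unique[OF _ tendsto_const] by simp
qed

text \<open>Prepares Fubini on the triangle: the inner integral of the absolute value is at most |A
  x| times the integral of |B|.\<close>

lemma integrable_mult_bounded_product:
  fixes A B :: "real => real"
  assumes "integrable lborel A" "integrable lborel B"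
  shows "integrable (lborel \<Otimes>\<^sub>M lborel) (\<lambda>(x, y). A x * B y * indicator {..x} y)"
proof (rule lborel_pair.Fubini_integrable)
  have m [measurable]: "A \<in> borel_measurable borel" "B \<in> borel_measurable borel"
    using borel_measurable_integrable[OF assms(1)] borel_measurable_integrable[OF assms(2)] by simp_all
  have "(\<lambda>(x, y). A x * B y * indicator {..x} y :: real) = (\<lambda>z. A (fst z) * B (snd z) * (if snd z \<le> fst z then 1 else 0))"
    by (auto simp: fun_eq_iff)
  moreover have "(\<lambda>z. A (fst z) * B (snd z) * (if snd z \<le> fst z then 1 else 0)) \<in> borel_measurable (lborel \<Otimes>\<^sub>M lborel)"
    by measurable
  ultimately show meas: "(\<lambda>(x, y). A x * B y * indicator {..x} y) \<in> borel_measurable (lborel \<Otimes>\<^sub>M lborel)" by simp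
  have i: "integrable lborel (\<lambda>y. B y * indicator {..x} y)" for x
    by (rule integrable_bounded_mult[OF assms(2) _ abs_indicator_le_1]) simp
  show "AE x in lborel. integrable lborel (\<lambda>y. (\<lambda>(x, y). A x * B y * indicator {..x} y) (x, y))"
    using i by (simp add: mult.assoc)
  show "integrable lborel (\<lambda>x. LINT y|lborel. norm ((\<lambda>(x, y). A x * B y * indicator {..x} y) (x, y)))"
  proof (rule Bochner_Integration.integrable_bound)
    show "integrable lborel (\<lambda>x. A x * (LINT y|lborel. \<bar>B y\<bar>))" using assms(1) by simp
    have "(\<lambda>z. norm (A (fst z) * B (snd z) * (if snd z \<le> fst z then 1 else 0))) \<in> borel_measurable (lborel \<Otimes>\<^sub>M lborel)"
      by measurable
    from lborel.borel_measurable_lebesgue_integral[of "\<lambda>x y. norm (A x * B y * (if y \<le> x then 1 else 0))" lborel] this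
    have "(\<lambda>x. LINT y|lborel. norm (A x * B y * (if y \<le> x then 1 else 0))) \<in> borel_measurable lborel"
      by (simp add: case_prod_beta')
    moreover have "(\<lambda>x. LINT y|lborel. norm ((\<lambda>(x, y). A x * B y * indicator {..x} y) (x, y)))
       = (\<lambda>x. LINT y|lborel. norm (A x * B y * (if y \<le> x then 1 else 0)))"
      by (intro ext Bochner_Integration.integral_cong) (auto simp: indicator_def)
    ultimately show "(\<lambda>x. LINT y|lborel. norm ((\<lambda>(x, y). A x * B y * indicator {..x} y) (x, y))) \<in> borel_measurable lborel"
      by simp
    have "norm (LINT y|lborel. norm (A x * B y * indicator {..x} y)) \<le> norm (A x * (LINT y|lborel. \<bar>B y\<bar>))" for x
    proof -
      have "(LINT y|lborel. norm (A x * B y * indicator {..x} y)) = (LINT y|lborel. \<bar>A x\<bar> * \<bar>B y * indicator {..x} y\<bar>)"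
        by (simp add: abs_mult mult.assoc)
      also have "\<dots> = \<bar>A x\<bar> * (LINT y|lborel. \<bar>B y * indicator {..x} y\<bar>)" by (rule Bochner_Integration.integral_mult_right_zero)
      finally have e: "(LINT y|lborel. norm (A x * B y * indicator {..x} y)) = \<bar>A x\<bar> * (LINT y|lborel. \<bar>B y * indicator {..x} y\<bar>)" .
      have l: "(LINT y|lborel. \<bar>B y * indicator {..x} y\<bar>) \<le> (LINT y|lborel. \<bar>B y\<bar>)"
        by (rule integral_mono) (use i assms(2) in \<open>auto simp: indicator_def\<close>)
      have p: "0 \<le> (LINT y|lborel. \<bar>B y * indicator {..x} y\<bar>)" by (rule integral_nonneg_AE) simp
      have "norm (\<bar>A x\<bar> * (LINT y|lborel. \<bar>B y * indicator {..x} y\<bar>)) = \<bar>A x\<bar> * (LINT y|lborel. \<bar>B y * indicator {..x} y\<bar>)"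
        unfolding real_norm_def by (rule abs_of_nonneg[OF mult_nonneg_nonneg[OF abs_ge_zero p]])
      also have "\<dots> \<le> \<bar>A x\<bar> * (LINT y|lborel. \<bar>B y\<bar>)" by (rule mult_left_mono[OF l abs_ge_zero])
      also have "\<dots> = norm (A x * (LINT y|lborel. \<bar>B y\<bar>))" by (simp add: abs_mult)
      finally show ?thesis unfolding e .
    qed
    then show "AE x in lborel. norm (LINT y|lborel. norm ((\<lambda>(x, y). A x * B y * indicator {..x} y) (x, y))) \<le> norm (A x * (LINT y|lborel. \<bar>B y\<bar>))"
      unfolding prod.case by (rule AE_I2)
  qed
qed

section \<open>Absolutely continuous functions\<close>

text \<open>\<open>abs_cont F g\<close>: \<open>F\<close> is a locally absolutely continuous function with derivative \<open>g\<close> almost everywhere.\<close>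

definition abs_cont :: "(real => real) => (real => real) => bool" where
  "abs_cont F g \<longleftrightarrow> (\<forall>a b. a \<le> b --> integrable lborel (\<lambda>x. indicator {a..b} x * g x) \<and>
      (LINT x|lborel. indicator {a..b} x * g x) = F b - F a)"

lemma abs_contD:
  assumes "abs_cont F g"
  shows "integrable lborel (\<lambda>x. indicator {a..b} x * g x)"
    and "a \<le> b ==> (LINT x|lborel. indicator {a..b} x * g x) = F b - F a"
  using assms unfolding abs_cont_def by (cases "a \<le> b"; auto)+

lemma locally_intI:
  assumes "\<And>a b. integrable lborel (\<lambda>x. indicator {a..b} x * g x :: real)" shows "locally_int g"
  unfolding locally_int_def set_integrable_def
proof (intro allI impI)
  fix K :: "real set" assume K: "compact K"
  then have "bounded K" by (rule compact_imp_bounded)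
  then obtain B where "\<forall>x\<in>K. norm x \<le> B" unfolding bounded_iff ..
  then have B: "x \<in> {-B..B}" if "x \<in> K" for x using that by (auto simp: abs_le_iff)
  have "K \<in> sets lborel" using K by (simp add: compact_imp_closed)
  then have "integrable lborel (\<lambda>x. (indicator {-B..B} x * g x) * indicator K x)"
    by (intro integrable_bounded_mult[OF assms _ abs_indicator_le_1]) simp
  also have "(\<lambda>x. (indicator {-B..B} x * g x) * indicator K x) = (\<lambda>x. indicator K x *\<^sub>R g x)"
    using B by (auto simp: fun_eq_iff indicator_def)
  finally show "integrable lborel (\<lambda>x. indicator K x *\<^sub>R g x)" .
qed

lemma abs_cont_locally_int: "abs_cont F g ==> locally_int g"
  by (rule locally_intI) (rule abs_contD)

lemma abs_cont_continuous:
  assumes "abs_cont F g" shows "continuous_on A F"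
proof -
  have "isCont F x" for x
  proof -
    let ?a = "x - 1" and ?b = "x + 1"
    have si: "set_integrable lborel {?a..y} g" for y using abs_contD(1)[OF assms] by (simp add: set_integrable_def)
    have "F y = F ?a + integral {?a..y} g" if "y \<in> {?a..?b}" for y
      using abs_contD(2)[OF assms, of ?a y] that set_borel_integral_eq_integral(2)[OF si] by (simp add: set_lebesgue_integral_def)
    moreover have "continuous_on {?a..?b} (\<lambda>y. F ?a + integral {?a..y} g)"
      by (intro continuous_intros indefinite_integral_continuous_1 set_borel_integral_eq_integral(1)[OF si])
    ultimately have "continuous_on {?a..?b} F" by (rule continuous_on_eq[rotated, OF sym])
    then show ?thesis by (rule continuous_on_interior) simp
  qed
  then show ?thesis by (simp add: continuous_at_imp_continuous_on)
qed

lemma abs_cont_measurable: "abs_cont F g ==> F \<in> borel_measurable lborel"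
  using borel_measurable_continuous_onI[OF abs_cont_continuous] by simp

lemma abs_cont_bounded_Icc:
  assumes "abs_cont F g" shows "\<exists>C. \<forall>x\<in>{a..b}. \<bar>F x\<bar> \<le> C"
proof -
  have "bounded (F ` {a..b})"
    by (intro compact_imp_bounded compact_continuous_image abs_cont_continuous[OF assms]) simp
  then show ?thesis by (auto simp: bounded_iff)
qed

lemma abs_cont_times_locally_int:
  assumes "abs_cont F g" "\<And>a b. integrable lborel (\<lambda>x. indicator {a..b} x * h x)"
  shows "integrable lborel (\<lambda>x. indicator {a..b} x * (h x * F x))"
proof -
  obtain C where C: "\<forall>x\<in>{a..b}. \<bar>F x\<bar> \<le> C" using abs_cont_bounded_Icc[OF assms(1)] ..
  have m: "(\<lambda>x. indicator {a..b} x * F x) \<in> borel_measurable lborel" using abs_cont_measurable[OF assms(1)] by simp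
  have b: "\<bar>indicator {a..b} x * F x\<bar> \<le> \<bar>C\<bar>" for x using C by (cases "x \<in> {a..b}") force+
  have "integrable lborel (\<lambda>x. (indicator {a..b} x * h x) * (indicator {a..b} x * F x))"
    by (rule integrable_bounded_mult[OF assms(2) m b])
  also have "(\<lambda>x. (indicator {a..b} x * h x) * (indicator {a..b} x * F x)) = (\<lambda>x. indicator {a..b} x * (h x * F x))"
    by (auto simp: fun_eq_iff indicator_def)
  finally show ?thesis .
qed

lemma abs_cont_cong:
  assumes "abs_cont F g" "AE x in lborel. g x = g' x" "g' \<in> borel_measurable lborel" shows "abs_cont F g'"
  unfolding abs_cont_def
proof (intro allI impI)
  fix a b :: real assume ab: "a \<le> b"
  have g: "integrable lborel (\<lambda>x. indicator {a..b} x * g x)" by (rule abs_contD[OF assms(1)])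
  have m: "(\<lambda>x. indicator {a..b} x * g' x) \<in> borel_measurable lborel" using assms(3) by simp
  have e: "AE x in lborel. indicator {a..b} x * g x = indicator {a..b} x * g' x" using assms(2) by eventually_elim simp
  show "integrable lborel (\<lambda>x. indicator {a..b} x * g' x) \<and> (LINT x|lborel. indicator {a..b} x * g' x) = F b - F a"
    using integrable_cong_AE_imp[OF g m] e integral_cong_AE[OF borel_measurable_integrable[OF g] m e] abs_contD(2)[OF assms(1) ab]
    by (auto elim: eventually_mono)
qed

lemma abs_cont_add_const: assumes "abs_cont F f" shows "abs_cont (\<lambda>x. F x + c) f"
  using assms unfolding abs_cont_def by simp

lemma abs_cont_C1:
  assumes "\<And>x. (F has_real_derivative f x) (at x)" "continuous_on UNIV f" shows "abs_cont F f"
  unfolding abs_cont_def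
proof (intro allI impI conjI)
  fix a b :: real assume ab: "a \<le> b"
  have c: "isCont f x" for x using assms(2) continuous_on_eq_continuous_at[OF open_UNIV] by blast
  have h: "has_bochner_integral lborel (\<lambda>x. f x * indicator {a..b} x) (F b - F a)"
    by (rule has_bochner_integral_FTC_Icc_real[OF ab assms(1) c])
  show "integrable lborel (\<lambda>x. indicator {a..b} x * f x)" "(LINT x|lborel. indicator {a..b} x * f x) = F b - F a"
    using h by (auto simp: has_bochner_integral_iff mult.commute)
qed

lemma abs_cont_smooth: "smooth F ==> abs_cont F (deriv F)"
  by (intro abs_cont_C1 smooth_has_derivative smooth_continuous smooth_deriv)

text \<open>Fubini for \<open>f(x) g(y)\<close> on the triangle \<open>y \<le> x\<close>.\<close>

lemma abs_cont_mult:
  assumes F: "abs_cont F f" and G: "abs_cont G g"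
  shows "abs_cont (\<lambda>x. F x * G x) (\<lambda>x. f x * G x + g x * F x)"
  unfolding abs_cont_def
proof (intro allI impI)
  fix a b :: real assume ab: "a \<le> b"
  note F1 = abs_contD[OF F] and G1 = abs_contD[OF G]
  define A where "A x = indicator {a..b} x * f x" for x
  define B where "B x = indicator {a..b} x * g x" for x
  have iA: "integrable lborel A" and iB: "integrable lborel B" unfolding A_def B_def by (rule F1 G1)+
  have fG: "integrable lborel (\<lambda>x. indicator {a..b} x * (f x * G x))"
    and gF: "integrable lborel (\<lambda>x. indicator {a..b} x * (g x * F x))"
    by (rule abs_cont_times_locally_int[OF G F1(1)], rule abs_cont_times_locally_int[OF F G1(1)])
  have sA: "(LINT x|lborel. A x) = F b - F a" and sB: "(LINT x|lborel. B x) = G b - G a"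
    unfolding A_def B_def using F1(2)[OF ab] G1(2)[OF ab] by simp_all
  \<comment> \<open>The inner integral in y is f(x) (G(x) - G(a)), the one in x is g(y) (F(b) -
    F(y)); equating the iterated integrals is integration by parts.\<close>
  have in1: "(LINT y|lborel. A x * B y * indicator {..x} y) = indicator {a..b} x * (f x * G x) - G a * A x" for x
  proof (cases "x \<in> {a..b}")
    case True
    have "(LINT y|lborel. A x * B y * indicator {..x} y) = (LINT y|lborel. A x * (indicator {a..x} y * g y))"
      by (rule Bochner_Integration.integral_cong) (use True in \<open>auto simp: B_def indicator_def\<close>)
    also have "\<dots> = A x * (LINT y|lborel. indicator {a..x} y * g y)" by (rule Bochner_Integration.integral_mult_right_zero)
    also have "(LINT y|lborel. indicator {a..x} y * g y) = G x - G a" by (rule G1(2)) (use True in simp)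
    finally show ?thesis using True by (simp add: A_def algebra_simps)
  qed (simp add: A_def)
  have in2: "(LINT x|lborel. A x * B y * indicator {..x} y) = F b * B y - indicator {a..b} y * (g y * F y)" for y
  proof (cases "y \<in> {a..b}")
    case True
    have "(LINT x|lborel. A x * B y * indicator {..x} y) = (LINT x|lborel. B y * (indicator {y..b} x * f x))"
      by (rule Bochner_Integration.integral_cong) (use True in \<open>auto simp: A_def indicator_def\<close>)
    also have "\<dots> = B y * (LINT x|lborel. indicator {y..b} x * f x)" by (rule Bochner_Integration.integral_mult_right_zero)
    also have "(LINT x|lborel. indicator {y..b} x * f x) = F b - F y" by (rule F1(2)) (use True in simp)
    finally show ?thesis using True by (simp add: B_def algebra_simps)
  qed (simp add: B_def)
  have "(LINT x|lborel. indicator {a..b} x * (f x * G x) - G a * A x) = (LINT y|lborel. F b * B y - indicator {a..b} y * (g y * F y))"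
    using lborel_pair.Fubini_integral[OF integrable_mult_bounded_product[OF iA iB]] unfolding in1 in2 by (rule sym)
  then have "(LINT x|lborel. indicator {a..b} x * (f x * G x)) - G a * (F b - F a)
     = F b * (G b - G a) - (LINT y|lborel. indicator {a..b} y * (g y * F y))"
    unfolding Bochner_Integration.integral_diff[OF fG integrable_mult_right[OF iA]]
      Bochner_Integration.integral_diff[OF integrable_mult_right[OF iB] gF] Bochner_Integration.integral_mult_right_zero sA sB .
  moreover have "(LINT x|lborel. indicator {a..b} x * (f x * G x + g x * F x))
     = (LINT x|lborel. indicator {a..b} x * (f x * G x)) + (LINT x|lborel. indicator {a..b} x * (g x * F x))"
    unfolding distrib_left by (rule Bochner_Integration.integral_add[OF fG gF])
  moreover have "integrable lborel (\<lambda>x. indicator {a..b} x * (f x * G x + g x * F x))"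
    unfolding distrib_left by (rule Bochner_Integration.integrable_add[OF fG gF])
  ultimately show "integrable lborel (\<lambda>x. indicator {a..b} x * (f x * G x + g x * F x)) \<and>
      (LINT x|lborel. indicator {a..b} x * (f x * G x + g x * F x)) = F b * G b - F a * G a"
    unfolding left_diff_distrib right_diff_distrib by argo
qed

lemma integrable_indicator_Icc: "integrable lborel (\<lambda>x. indicator {a..b::real} x :: real)"
  by (rule integrable_real_indicator) (simp_all add: emeasure_lborel_Icc_eq)

lemma abs_cont_self_locally_int: assumes "abs_cont F g" shows "locally_int F"
proof (rule locally_intI)
  show "integrable lborel (\<lambda>x. indicator {a..b} x * F x)" for a b
    using abs_cont_times_locally_int[OF assms, of "\<lambda>_. 1" a b] integrable_indicator_Icc by simp
qed

lemma abs_cont_integral_test: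
  assumes F: "abs_cont F g" and \<phi>: "test_fun \<phi>"
  shows "(LINT x|lborel. F x * deriv \<phi> x) = - (LINT x|lborel. g x * \<phi> x)"
proof -
  obtain R where R: "R > 0" "\<forall>x. \<bar>x\<bar> \<ge> R --> \<phi> x = 0" using test_funD(2)[OF \<phi>] by (elim exE conjE) (rule that)
  obtain R' where R': "R' > 0" "\<forall>x. \<bar>x\<bar> \<ge> R' --> deriv \<phi> x = 0"
    using test_funD(2)[OF test_fun_deriv[OF \<phi>]] by (elim exE conjE) (rule that)
  define a where "a = max R R'"
  have z: "\<phi> x = 0" "deriv \<phi> x = 0" if "x \<notin> {-a..a}" for x
  proof -
    have "R \<le> \<bar>x\<bar>" "R' \<le> \<bar>x\<bar>" using that unfolding a_def by auto
    then show "\<phi> x = 0" "deriv \<phi> x = 0" using R R' by auto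
  qed
  have za: "\<phi> a = 0" "\<phi> (-a) = 0" using R R' by (auto simp: a_def)
  have lF: "locally_int F" by (rule abs_cont_self_locally_int[OF F])
  have i: "integrable lborel (\<lambda>x. F x * deriv \<phi> x)" "integrable lborel (\<lambda>x. g x * \<phi> x)"
    by (intro locally_int_test_integrable[OF lF] locally_int_test_integrable[OF abs_cont_locally_int[OF F]] test_fun_deriv \<phi>)+
  have "(LINT x|lborel. indicator {-a..a} x * (g x * \<phi> x + deriv \<phi> x * F x)) = F a * \<phi> a - F (-a) * \<phi> (-a)"
    by (rule abs_contD(2)[OF abs_cont_mult[OF F abs_cont_smooth[OF test_funD(1)[OF \<phi>]]]]) (use R in \<open>simp add: a_def\<close>)
  also have "(\<lambda>x. indicator {-a..a} x * (g x * \<phi> x + deriv \<phi> x * F x)) = (\<lambda>x. g x * \<phi> x + F x * deriv \<phi> x)"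
    using z by (auto simp: fun_eq_iff indicator_def)
  finally show ?thesis using i za by simp
qed

text \<open>S' is a test function of integral 1, so psi minus J S', with J the integral of psi, is
  the derivative of a test function. Hence k minus its pairing c with S' annihilates every test
  function.\<close>

lemma du_Bois_Reymond_1:
  assumes k: "locally_int k" and z: "\<And>\<phi>. test_fun \<phi> ==> (LINT x|lborel. k x * deriv \<phi> x) = 0"
  shows "\<exists>c. AE x in lborel. k x = c"
proof -
  obtain S :: "real => real" where S: "smooth S" "\<forall>x\<le>0. S x = 0" "\<forall>x\<ge>1. S x = 1" "\<forall>x. 0 \<le> S x \<and> S x \<le> 1"
    using smooth_step by (elim exE conjE) (rule that)
  note S2 = S(2,3)[rule_format]
  define c where "c = (LINT x|lborel. k x * deriv S x)"
  have dS: "test_fun (deriv S)"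
  proof (rule test_funI[OF smooth_deriv[OF S(1)], of 1])
    fix x :: real assume "\<bar>x\<bar> > 1"
    then consider "x < 0" | "x > 1" by linarith
    then show "deriv S x = 0"
    proof cases
      case 1
      have "((\<lambda>x. 0) has_real_derivative 0) (at x)" by simp
      then have "(S has_real_derivative 0) (at x)"
        by (rule has_field_derivative_transform_within_open[where S = "{..<0}"]) (use S2 1 in auto)
      then show ?thesis by (rule DERIV_imp_deriv)
    next
      case 2
      have "((\<lambda>x. 1) has_real_derivative 0) (at x)" by simp
      then have "(S has_real_derivative 0) (at x)"
        by (rule has_field_derivative_transform_within_open[where S = "{1<..}"]) (use S2 2 in auto)
      then show ?thesis by (rule DERIV_imp_deriv)
    qed
  qed
  have "(LINT x|lborel. (k x - c) * \<psi> x) = 0" if \<psi>: "test_fun \<psi>" for \<psi>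
  proof -
    obtain R where R: "R > 0" "\<forall>x. \<bar>x\<bar> \<ge> R --> \<psi> x = 0" using test_funD(2)[OF \<psi>] by (elim exE conjE) (rule that)
    have sm: "smooth \<psi>" by (rule test_funD[OF \<psi>])
    obtain P where P: "smooth P" "\<forall>x. (P has_real_derivative \<psi> x) (at x)" "\<forall>x\<le>- R. P x = 0"
      using smooth_primitive[OF sm, of "- R"] R by (auto simp: abs_real_def)
    have dP: "deriv P = \<psi>" by (rule ext) (rule DERIV_imp_deriv[OF P(2)[rule_format]])
    define J where "J = P R"
    have PJ: "P x = J" if "x \<ge> R" for x
    proof (rule antisym)
      have "\<exists>l. (P has_real_derivative l) (at y) \<and> l \<le> 0" "\<exists>l. (P has_real_derivative l) (at y) \<and> l \<ge> 0" if "R \<le> y" for y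
        using P(2)[rule_format, of y] R that by (auto intro!: exI[of _ 0])
      then show "P x \<le> J" "J \<le> P x" unfolding J_def
        using DERIV_nonpos_imp_nonincreasing[OF that, of P] DERIV_nonneg_imp_nondecreasing[OF that, of P] by blast+
    qed
    \<comment> \<open>Left of the supports both primitives vanish, right of them both equal J, so
      the difference has compact support.\<close>
    have test: "test_fun (\<lambda>x. P x - J * S (1 * x + 0))"
    proof (rule test_funI[of _ "R + 1"])
      show "smooth (\<lambda>x. P x - J * S (1 * x + 0))" by (intro smooth_diff P smooth_affine S)
      show "P x - J * S (1 * x + 0) = 0" if "\<bar>x\<bar> > R + 1" for x
      proof (cases "x \<ge> 0")
        case True
        then have "x \<ge> R" "x \<ge> 1" using that R by auto
        then show ?thesis using PJ S2(2) by simp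
      next
        case False
        then have "x \<le> - R" "x \<le> 0" using that R by auto
        then show ?thesis using P(3) S2(1) by simp
      qed
    qed
    have "((\<lambda>x. P x - J * S (1 * x + 0)) has_real_derivative \<psi> x - J * deriv S x) (at x)" for x
      using P(2) smooth_has_derivative[OF S(1)] by (auto intro!: derivative_eq_intros)
    then have "deriv (\<lambda>x. P x - J * S (1 * x + 0)) = (\<lambda>x. \<psi> x - J * deriv S x)" by (intro ext DERIV_imp_deriv)
    then have "(LINT x|lborel. k x * (\<psi> x - J * deriv S x)) = 0" using z[OF test] by simp
    moreover have "(\<lambda>x. k x * (\<psi> x - J * deriv S x)) = (\<lambda>x. k x * \<psi> x - J * (k x * deriv S x))" by (auto simp: algebra_simps)
    moreover note i = locally_int_test_integrable[OF k \<psi>] locally_int_test_integrable[OF k dS]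
    ultimately have 1: "(LINT x|lborel. k x * \<psi> x) = J * c" using i by (simp add: c_def)
    have "(LINT x|lborel. indicator {-R..R} x * \<psi> x) = P R - P (-R)"
      using abs_contD(2)[OF abs_cont_smooth[OF P(1)], of "-R" R] R by (simp add: dP)
    moreover have "(\<lambda>x. indicator {-R..R} x * \<psi> x) = \<psi>"
    proof
      fix x show "indicator {-R..R} x * \<psi> x = \<psi> x" using R(2)[rule_format, of x] by (cases "\<bar>x\<bar> \<ge> R") (auto simp: indicator_def)
    qed
    ultimately have 2: "(LINT x|lborel. \<psi> x) = J" using P(3) by (simp add: J_def)
    have l1: "locally_int (\<lambda>x. 1)" by (rule locally_intI) (simp add: integrable_indicator_Icc)
    have "integrable lborel \<psi>" using locally_int_test_integrable[OF l1 \<psi>] by simp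
    then show ?thesis using i 1 2 by (simp add: left_diff_distrib)
  qed
  moreover have "locally_int (\<lambda>x. k x - c)"
    by (rule locally_intI) (simp add: right_diff_distrib locally_int_interval[OF k] integrable_indicator_Icc)
  ultimately have "AE x in lborel. k x - c = 0" by (rule du_Bois_Reymond_0[rotated])
  then show ?thesis by (auto elim: eventually_mono)
qed

lemma locally_int_primitive: assumes g: "locally_int g" shows "\<exists>F. abs_cont F g"
proof -
  note i = locally_int_interval[OF g]
  define F where "F x = (if 0 \<le> x then (LINT y|lborel. indicator {0..x} y * g y) else - (LINT y|lborel. indicator {x..0} y * g y))" for x
  have add: "(LINT y|lborel. indicator {a..c} y * g y) = (LINT y|lborel. indicator {a..b} y * g y) + (LINT y|lborel. indicator {b..c} y * g y)"
    if "a \<le> b" "b \<le> c" for a b c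
  proof -
    have "(LINT y|lborel. indicator {a..b} y * g y) + (LINT y|lborel. indicator {b..c} y * g y) = (LINT y|lborel. indicator {a..b} y * g y + indicator {b..c} y * g y)"
      by (rule Bochner_Integration.integral_add[OF i i, symmetric])
    also have "\<dots> = (LINT y|lborel. indicator {a..c} y * g y)"
    proof (rule integral_cong_AE)
      have "AE y in lborel. y \<noteq> b" by (rule AE_lborel_singleton)
      then show "AE y in lborel. indicator {a..b} y * g y + indicator {b..c} y * g y = indicator {a..c} y * g y"
        by eventually_elim (use that in \<open>auto simp: indicator_def\<close>)
    qed (rule borel_measurable_add borel_measurable_integrable i)+
    finally show ?thesis by simp
  qed
  have "(LINT y|lborel. indicator {a..b} y * g y) = F b - F a" if "a \<le> b" for a b
  proof -
    consider "0 \<le> a" | "a < 0" "0 \<le> b" | "b < 0" by linarith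
    then show ?thesis
    proof cases
      case 1 then show ?thesis using add[OF 1 that] that by (simp add: F_def)
    next
      case 2 then show ?thesis using add[of a 0 b] by (simp add: F_def)
    next
      case 3 then show ?thesis using add[of a b 0] that by (simp add: F_def)
    qed
  qed
  then show ?thesis using i unfolding abs_cont_def by blast
qed

lemma locally_int_cong:
  assumes "locally_int F" "AE x in lborel. f x = F x" "f \<in> borel_measurable lborel" shows "locally_int f"
proof (rule locally_intI)
  fix a b
  show "integrable lborel (\<lambda>x. indicator {a..b} x * f x)"
    by (rule integrable_cong_AE_imp[OF locally_int_interval[OF assms(1), of a b]])
      (use assms(2,3) in \<open>auto elim: eventually_mono\<close>)
qed

lemma integral_mult_cong:
  fixes f F \<phi> :: "real => real"
  assumes "AE x in lborel. f x = F x" "f \<in> borel_measurable lborel" "F \<in> borel_measurable lborel" "\<phi> \<in> borel_measurable lborel"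
  shows "(LINT x|lborel. f x * \<phi> x) = (LINT x|lborel. F x * \<phi> x)"
  by (rule integral_cong_AE[OF borel_measurable_times[OF assms(2,4)] borel_measurable_times[OF assms(3,4)]])
    (use assms(1) in \<open>auto elim: eventually_mono\<close>)

lemma locally_int_measurable: assumes "locally_int g" shows "g \<in> borel_measurable lborel"
proof (rule borel_measurable_LIMSEQ_real)
  show "(\<lambda>x. indicator {- real n..real n} x * g x) \<in> borel_measurable lborel" for n
    by (rule borel_measurable_integrable[OF locally_int_interval[OF assms]])
  fix x
  obtain N :: nat where N: "\<bar>x\<bar> < real N" using reals_Archimedean2[of "\<bar>x\<bar>"] ..
  have "\<forall>n\<ge>N. g x = indicator {- real n..real n} x * g x"
  proof (intro allI impI)
    fix n :: nat assume "n \<ge> N"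
    then have "x \<in> {- real n..real n}" using N by auto
    then show "g x = indicator {- real n..real n} x * g x" by simp
  qed
  then have "\<forall>\<^sub>F n in sequentially. g x = indicator {- real n..real n} x * g x" unfolding eventually_sequentially ..
  then show "(\<lambda>n. indicator {- real n..real n} x * g x) \<longlonglongrightarrow> g x"
    by (rule Lim_transform_eventually[OF tendsto_const])
qed

text \<open>Subtracting a primitive of g from f leaves a function with weak derivative 0, which is
  constant by \<open>du_Bois_Reymond_1\<close>. This reduces weak calculus to absolutely continuous
  representatives.\<close>

lemma weak_deriv_1_iff:
  assumes f: "f \<in> borel_measurable lborel"
  shows "weak_deriv 1 f g \<longleftrightarrow> (\<exists>F. abs_cont F g \<and> (AE x in lborel. f x = F x))"
proof
  assume w: "weak_deriv 1 f g"
  then have l: "locally_int f" "locally_int g" and i: "\<forall>\<phi>. test_fun \<phi> --> (LINT x|lborel. f x * deriv \<phi> x) = - (LINT x|lborel. g x * \<phi> x)"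
    by (auto simp: weak_deriv_def)
  obtain G where G: "abs_cont G g" using locally_int_primitive[OF l(2)] ..
  have lG: "locally_int G" by (rule abs_cont_self_locally_int[OF G])
  have z: "(LINT x|lborel. (f x - G x) * deriv \<phi> x) = 0" if \<phi>: "test_fun \<phi>" for \<phi>
    using i \<phi> abs_cont_integral_test[OF G \<phi>]
      locally_int_test_integrable[OF l(1) test_fun_deriv[OF \<phi>]] locally_int_test_integrable[OF lG test_fun_deriv[OF \<phi>]]
    by (simp add: left_diff_distrib)
  have li: "locally_int (\<lambda>x. f x - G x)"
    by (rule locally_intI) (use locally_int_interval[OF l(1)] locally_int_interval[OF lG] in \<open>simp add: right_diff_distrib\<close>)
  obtain c where c: "AE x in lborel. f x - G x = c" using du_Bois_Reymond_1[OF li z] ..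
  show "\<exists>F. abs_cont F g \<and> (AE x in lborel. f x = F x)"
    by (intro exI[of _ "\<lambda>x. G x + c"] conjI abs_cont_add_const[OF G]) (use c in \<open>auto elim!: eventually_mono\<close>)
next
  assume "\<exists>F. abs_cont F g \<and> (AE x in lborel. f x = F x)"
  then obtain F where F: "abs_cont F g" "AE x in lborel. f x = F x" by (elim exE conjE) (rule that)
  have lF: "locally_int F" by (rule abs_cont_self_locally_int[OF F(1)])
  have "(LINT x|lborel. f x * deriv \<phi> x) = - (LINT x|lborel. g x * \<phi> x)" if \<phi>: "test_fun \<phi>" for \<phi>
    using integral_mult_cong[OF F(2) f abs_cont_measurable[OF F(1)] test_fun_measurable[OF test_fun_deriv[OF \<phi>]]]
      abs_cont_integral_test[OF F(1) \<phi>] by simp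
  then show "weak_deriv 1 f g"
    using locally_int_cong[OF lF F(2) f] abs_cont_locally_int[OF F(1)] by (simp add: weak_deriv_def)
qed

text \<open>A half-line has infinite measure, so an integrable function cannot stay at or above
  \<epsilon> in absolute value on it. This stands in for decay at infinity.\<close>

lemma small_values_of_integrable:
  fixes P :: "real => real"
  assumes "integrable lborel P" "\<epsilon> > 0"
  shows "\<exists>b\<ge>N. \<bar>P b\<bar> < \<epsilon>" "\<exists>a\<le>N. \<bar>P a\<bar> < \<epsilon>"
proof -
  have big: "emeasure lborel A = \<infinity>" if sub: "\<And>n. \<exists>a. {a..a + real n} \<subseteq> A" and sets: "A \<in> sets lborel" for A :: "real set"
  proof (rule ccontr)
    assume "emeasure lborel A \<noteq> \<infinity>"
    then have "emeasure lborel A < top" by (simp add: top.not_eq_extremum)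
    then obtain n where n: "emeasure lborel A < of_nat n" by (rule exE[OF ennreal_Ex_less_of_nat])
    obtain a where "{a..a + real n} \<subseteq> A" using sub[of n] ..
    then have "emeasure lborel {a..a + real n} \<le> emeasure lborel A" by (rule emeasure_mono[OF _ sets])
    then show False using n by (simp add: ennreal_of_nat_eq_real_of_nat)
  qed
  have top1: "emeasure lborel {N..} = \<infinity>" by (rule big) (auto intro!: exI[of _ N])
  have top2: "emeasure lborel {..N} = \<infinity>"
  proof (rule big)
    show "\<exists>a. {a..a + real n} \<subseteq> {..N}" for n by (rule exI[of _ "N - real n"]) auto
  qed auto
  have bad: False if A: "A \<in> sets lborel" "emeasure lborel A = \<infinity>" "\<And>x. x \<in> A ==> \<epsilon> \<le> \<bar>P x\<bar>" for A
  proof -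
    have "integrable lborel (\<lambda>x. \<epsilon> * indicator A x)"
    proof (rule Bochner_Integration.integrable_bound[OF assms(1)])
      show "(\<lambda>x. \<epsilon> * indicator A x) \<in> borel_measurable lborel" using A(1) by simp
      show "AE x in lborel. norm (\<epsilon> * indicator A x) \<le> norm (P x)"
        using A(3) assms(2) by (intro AE_I2) (auto simp: indicator_def)
    qed
    then have "integrable lborel (indicator A :: real => real)" using assms(2) by simp
    then show False using A(1,2) by (simp add: integrable_indicator_iff)
  qed
  show "\<exists>b\<ge>N. \<bar>P b\<bar> < \<epsilon>"
  proof (rule ccontr)
    assume "\<not> (\<exists>b\<ge>N. \<bar>P b\<bar> < \<epsilon>)"
    then show False using top1 by (intro bad[of "{N..}"]) (auto simp: not_less)
  qed
  show "\<exists>a\<le>N. \<bar>P a\<bar> < \<epsilon>"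
  proof (rule ccontr)
    assume "\<not> (\<exists>a\<le>N. \<bar>P a\<bar> < \<epsilon>)"
    then show False using top2 by (intro bad[of "{..N}"]) (auto simp: not_less)
  qed
qed

text \<open>The integrals over [a n, b n] converge to the full integral, and the end points are
  chosen where P is small, so the boundary terms vanish in the limit.\<close>

lemma abs_cont_integral_eq_0:
  assumes P: "abs_cont P p" "integrable lborel P" "integrable lborel p"
  shows "(LINT x|lborel. p x) = 0"
proof -
  have "\<forall>n::nat. \<exists>b\<ge>real n. \<bar>P b\<bar> < inverse (Suc n)" "\<forall>n::nat. \<exists>a\<le>- real n. \<bar>P a\<bar> < inverse (Suc n)"
    by (intro allI small_values_of_integrable[OF P(2)]; simp)+
  then obtain a b where b: "\<forall>n. real n \<le> b n \<and> \<bar>P (b n)\<bar> < inverse (Suc n)" and a: "\<forall>n. a n \<le> - real n \<and> \<bar>P (a n)\<bar> < inverse (Suc n)"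
    by (auto dest!: choice)
  have "(\<lambda>n. LINT x|lborel. indicator {a n..b n} x * p x) \<longlonglongrightarrow> (LINT x|lborel. p x)"
  proof (rule integral_dominated_convergence)
    show "integrable lborel (\<lambda>x. \<bar>p x\<bar>)" using P(3) by (rule integrable_abs)
    show "p \<in> borel_measurable lborel" by (rule borel_measurable_integrable[OF P(3)])
    then show "(\<lambda>x. indicator {a n..b n} x * p x) \<in> borel_measurable lborel" for n by simp
    show "AE x in lborel. norm (indicator {a n..b n} x * p x) \<le> \<bar>p x\<bar>" for n
      by (rule AE_I2) (simp add: indicator_def)
    show "AE x in lborel. (\<lambda>n. indicator {a n..b n} x * p x) \<longlonglongrightarrow> p x"
    proof (rule AE_I2)
      fix x
      obtain N :: nat where N: "\<bar>x\<bar> < real N" using reals_Archimedean2[of "\<bar>x\<bar>"] ..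
      have "\<forall>n\<ge>N. p x = indicator {a n..b n} x * p x"
      proof (intro allI impI)
        fix n assume "n \<ge> N"
        then have "real N \<le> real n" by simp
        then have "x \<in> {a n..b n}" using N a[rule_format, of n] b[rule_format, of n] by auto
        then show "p x = indicator {a n..b n} x * p x" by simp
      qed
      then have "\<forall>\<^sub>F n in sequentially. p x = indicator {a n..b n} x * p x" unfolding eventually_sequentially ..
      then show "(\<lambda>n. indicator {a n..b n} x * p x) \<longlonglongrightarrow> p x" by (rule Lim_transform_eventually[OF tendsto_const])
    qed
  qed
  moreover have "(\<lambda>n. LINT x|lborel. indicator {a n..b n} x * p x) \<longlonglongrightarrow> 0"
  proof (rule Lim_null_comparison)
    show "\<forall>\<^sub>F n in sequentially. norm (LINT x|lborel. indicator {a n..b n} x * p x) \<le> inverse (real (Suc n)) + inverse (real (Suc n))"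
    proof (intro always_eventually allI)
      fix n
      have "a n \<le> b n" using a[rule_format, of n] b[rule_format, of n] by linarith
      then have "(LINT x|lborel. indicator {a n..b n} x * p x) = P (b n) - P (a n)" by (rule abs_contD(2)[OF P(1)])
      then show "norm (LINT x|lborel. indicator {a n..b n} x * p x) \<le> inverse (real (Suc n)) + inverse (real (Suc n))"
        using a[rule_format, of n] b[rule_format, of n] unfolding real_norm_def by linarith
    qed
    show "(\<lambda>n. inverse (real (Suc n)) + inverse (real (Suc n))) \<longlonglongrightarrow> 0"
      using tendsto_add[OF LIMSEQ_inverse_real_of_nat LIMSEQ_inverse_real_of_nat] by simp
  qed
  ultimately show ?thesis by (rule LIMSEQ_unique)
qed

text \<open>Integration of p from a point left of x where P is as small as desired; applied to
  squares it gives the sup norm bound.\<close>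

lemma abs_cont_le_integral:
  assumes P: "abs_cont P p" "integrable lborel P" "integrable lborel p"
  shows "P x \<le> (LINT x|lborel. \<bar>p x\<bar>)"
proof (rule ccontr)
  assume "\<not> P x \<le> (LINT x|lborel. \<bar>p x\<bar>)"
  then have e: "P x - (LINT x|lborel. \<bar>p x\<bar>) > 0" by simp
  obtain y where y: "y \<le> x" "\<bar>P y\<bar> < P x - (LINT x|lborel. \<bar>p x\<bar>)"
    using small_values_of_integrable(2)[OF P(2) e, of x] by (elim exE conjE) (rule that)
  have "P x - P y = (LINT z|lborel. indicator {y..x} z * p z)" by (rule abs_contD(2)[OF P(1) y(1), symmetric])
  also have "\<dots> \<le> (LINT x|lborel. \<bar>p x\<bar>)"
    by (rule integral_mono[OF abs_contD(1)[OF P(1)] integrable_abs[OF P(3)]]) (auto simp: indicator_def)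
  finally show False using y(2) by linarith
qed

section \<open>The Hilbert space of square integrable functions\<close>

lemma square_int_mult_integrable:
  assumes "square_int f" "square_int g" shows "integrable lborel (\<lambda>x. f x * g x)"
proof (rule Bochner_Integration.integrable_bound)
  show "integrable lborel (\<lambda>x. (f x)\<^sup>2 + (g x)\<^sup>2)" using assms by (simp add: square_int_def)
  show "(\<lambda>x. f x * g x) \<in> borel_measurable lborel" using assms by (intro borel_measurable_times) (simp_all add: square_int_def)
  have "\<bar>f x * g x\<bar> \<le> (f x)\<^sup>2 + (g x)\<^sup>2" for x
  proof -
    have "0 \<le> (\<bar>f x\<bar> - \<bar>g x\<bar>)\<^sup>2" by simp
    then have "2 * \<bar>f x * g x\<bar> \<le> (f x)\<^sup>2 + (g x)\<^sup>2" by (simp add: power2_diff abs_mult)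
    then show ?thesis using abs_ge_zero[of "f x * g x"] by linarith
  qed
  then show "AE x in lborel. norm (f x * g x) \<le> norm ((f x)\<^sup>2 + (g x)\<^sup>2)" by simp
qed

lemma square_intI: "f \<in> borel_measurable lborel ==> integrable lborel (\<lambda>x. f x * f x) ==> square_int f"
  by (simp add: square_int_def power2_eq_square)

lemma square_int_measurable: "square_int f ==> f \<in> borel_measurable lborel"
  by (simp add: square_int_def)

lemma square_int_0 [simp]: "square_int (\<lambda>x. 0)"
  by (simp add: square_int_def)

lemma square_int_add: assumes "square_int f" "square_int g" shows "square_int (\<lambda>x. f x + g x)"
proof (rule square_intI)
  have "integrable lborel (\<lambda>x. f x * f x + g x * g x + 2 * (f x * g x))"
    by (intro Bochner_Integration.integrable_add integrable_mult_right square_int_mult_integrable assms)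
  also have "(\<lambda>x. f x * f x + g x * g x + 2 * (f x * g x)) = (\<lambda>x. (f x + g x) * (f x + g x))" by (simp add: algebra_simps)
  finally show "integrable lborel (\<lambda>x. (f x + g x) * (f x + g x))" .
qed (intro borel_measurable_add square_int_measurable assms)

lemma square_int_bounded_mult:
  assumes "square_int f" "w \<in> borel_measurable lborel" "\<And>x. \<bar>w x\<bar> \<le> B" shows "square_int (\<lambda>x. w x * f x)"
proof (rule square_intI)
  have w: "\<bar>w x * w x\<bar> \<le> B * B" for x using mult_mono[OF assms(3,3)[of x]] by (simp add: abs_mult order_trans[OF abs_ge_zero assms(3)])
  have "integrable lborel (\<lambda>x. (f x * f x) * (w x * w x))"
    by (rule integrable_bounded_mult[OF square_int_mult_integrable[OF assms(1,1)] _ w]) (intro borel_measurable_times assms)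
  then show "integrable lborel (\<lambda>x. (w x * f x) * (w x * f x))" by (simp add: mult_ac)
qed (intro borel_measurable_times assms square_int_measurable)

lemma square_int_scale: "square_int f ==> square_int (\<lambda>x. c * f x)"
  by (rule square_int_bounded_mult[where B = "\<bar>c\<bar>"]) simp_all

lemma square_int_diff: "square_int f ==> square_int g ==> square_int (\<lambda>x. f x - g x)"
  using square_int_add[of f "\<lambda>x. -1 * g x"] square_int_scale[of g "-1"] by simp

lemma square_int_cong:
  assumes "square_int f" "AE x in lborel. g x = f x" "g \<in> borel_measurable lborel" shows "square_int g"
proof -
  have "integrable lborel (\<lambda>x. (g x)\<^sup>2)"
    by (rule integrable_cong_AE_imp[of _ "\<lambda>x. (f x)\<^sup>2"]) (use assms in \<open>auto simp: square_int_def elim: eventually_mono\<close>)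
  then show ?thesis using assms(3) by (simp add: square_int_def)
qed

lemma square_int_locally_int: assumes "square_int f" shows "locally_int f"
proof (rule locally_intI)
  fix a b :: real
  have "square_int (indicator {a..b} :: real => real)"
    by (rule square_intI) (simp_all add: integrable_indicator_Icc flip: indicator_inter_arith)
  then show "integrable lborel (\<lambda>x. indicator {a..b} x * f x)" by (rule square_int_mult_integrable[OF _ assms])
qed

text \<open>A choice of representative that depends only on the almost-everywhere class. The type
  \<open>l2\<close> below consists of the functions equal to their own representative, so it
  realises the quotient as a subset and equality is plain equality.\<close>

definition canonical_rep :: "(real => real) => real => real" where
  "canonical_rep f = (SOME g. square_int g \<and> (AE x in lborel. g x = f x))"

lemma canonical_rep:
  assumes "square_int f" shows "square_int (canonical_rep f)" "AE x in lborel. canonical_rep f x = f x"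
proof -
  have "square_int (canonical_rep f) \<and> (AE x in lborel. canonical_rep f x = f x)"
    unfolding canonical_rep_def by (rule someI[of _ f]) (simp add: assms)
  then show "square_int (canonical_rep f)" "AE x in lborel. canonical_rep f x = f x" by auto
qed

lemma AE_eq_iff:
  assumes "AE x in M. f x = g x" shows "(AE x in M. h x = f x) \<longleftrightarrow> (AE x in M. h x = g x)"
proof
  assume "AE x in M. h x = f x" then show "AE x in M. h x = g x" using assms by eventually_elim simp
next
  assume "AE x in M. h x = g x" then show "AE x in M. h x = f x" using assms by eventually_elim simp
qed

lemma canonical_rep_cong: "AE x in lborel. f x = g x ==> canonical_rep f = canonical_rep g"
  unfolding canonical_rep_def by (simp add: AE_eq_iff)

typedef l2 = "{f. square_int f \<and> canonical_rep f = f}" morphisms rep Abs_l2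
  by (rule exI[of _ "canonical_rep (\<lambda>x. 0)"]) (simp add: canonical_rep canonical_rep_cong)

definition cls :: "(real => real) => l2" where "cls f = Abs_l2 (canonical_rep f)"

lemma square_int_rep [simp]: "square_int (rep u)" using rep[of u] by simp

lemma rep_measurable [measurable, simp]: "rep u \<in> borel_measurable borel"
  using square_int_measurable[OF square_int_rep[of u]] by simp

lemma cls_rep [simp]: "cls (rep u) = u"
  using rep[of u] by (simp add: cls_def rep_inverse)

lemma rep_cls: assumes "square_int f" shows "AE x in lborel. rep (cls f) x = f x"
proof -
  have "rep (cls f) = canonical_rep f" unfolding cls_def
    by (rule Abs_l2_inverse) (simp add: canonical_rep[OF assms] canonical_rep_cong)
  then show ?thesis using canonical_rep(2)[OF assms] by simp
qed

lemma cls_cong: "AE x in lborel. f x = g x ==> cls f = cls g"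
  unfolding cls_def by (simp add: canonical_rep_cong)

lemma l2_eqI: "AE x in lborel. rep u x = rep v x ==> u = v"
  using cls_cong[of "rep u" "rep v"] by simp

lemma cls_eq_iff: assumes "square_int f" "square_int g" shows "cls f = cls g \<longleftrightarrow> (AE x in lborel. f x = g x)"
proof
  assume e: "cls f = cls g"
  show "AE x in lborel. f x = g x" using rep_cls[OF assms(1)] rep_cls[OF assms(2)] unfolding e by eventually_elim simp
qed (rule cls_cong)

lemma cls_eqI: assumes "square_int f" "AE x in lborel. f x = rep u x" shows "cls f = u"
  using cls_cong[OF assms(2)] by simp

instantiation l2 :: real_inner
begin

definition "(0 :: l2) = cls (\<lambda>x. 0)"
definition "u + v = cls (\<lambda>x. rep u x + rep v x)"
definition "u - v = cls (\<lambda>x. rep u x - rep v x)"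
definition "- u = cls (\<lambda>x. - rep u x)"
definition "c *\<^sub>R u = cls (\<lambda>x. c * rep u x)"
definition "inner u v = (LINT x|lborel. rep u x * rep v x)"
definition "norm (u :: l2) = sqrt (inner u u)"
definition "dist (u :: l2) v = norm (u - v)"
definition "sgn (u :: l2) = inverse (norm u) *\<^sub>R u"
definition "uniformity = (INF e\<in>{0<..}. principal {(u :: l2, v). dist u v < e})"
definition "open U \<longleftrightarrow> (\<forall>u\<in>U. eventually (\<lambda>(u', v). u' = u --> v \<in> U) (uniformity :: (l2 \<times> l2) filter))"

lemma rep_0: "AE x in lborel. rep 0 x = 0"
  unfolding zero_l2_def by (rule rep_cls) simp

lemma rep_add: "AE x in lborel. rep (u + v) x = rep u x + rep v x"
  unfolding plus_l2_def by (rule rep_cls) (intro square_int_add square_int_rep)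

lemma rep_diff: "AE x in lborel. rep (u - v) x = rep u x - rep v x"
  unfolding minus_l2_def by (rule rep_cls) (intro square_int_diff square_int_rep)

lemma rep_uminus: "AE x in lborel. rep (- u) x = - rep u x"
  unfolding uminus_l2_def by (rule rep_cls) (use square_int_scale[OF square_int_rep[of u], of "-1"] in simp)

lemma rep_scaleR: "AE x in lborel. rep (c *\<^sub>R u) x = c * rep u x"
  unfolding scaleR_l2_def by (rule rep_cls) (intro square_int_scale square_int_rep)

lemma rep_times_integrable: "integrable lborel (\<lambda>x. rep u x * rep v x)"
  by (intro square_int_mult_integrable square_int_rep)

lemma rep_inner_cong:
  assumes "AE x in lborel. rep u x = f x" "square_int f" shows "inner u v = (LINT x|lborel. f x * rep v x)"
  unfolding inner_l2_def
  by (rule integral_mult_cong[OF assms(1)]) (use square_int_measurable[OF assms(2)] in simp_all)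

instance
proof
  fix a b c :: l2 and r s :: real
  show "a + b + c = a + (b + c)"
    by (rule l2_eqI) (use rep_add[of "a + b" c] rep_add[of a b] rep_add[of a "b + c"] rep_add[of b c] in \<open>eventually_elim, simp\<close>)
  show "a + b = b + a" unfolding plus_l2_def by (simp add: add.commute)
  show "0 + a = a" by (rule l2_eqI) (use rep_add[of 0 a] rep_0 in \<open>eventually_elim, simp\<close>)
  show "- a + a = 0" by (rule l2_eqI) (use rep_add[of "- a" a] rep_uminus[of a] rep_0 in \<open>eventually_elim, simp\<close>)
  show "a - b = a + - b" by (rule l2_eqI) (use rep_add[of a "- b"] rep_uminus[of b] rep_diff[of a b] in \<open>eventually_elim, simp\<close>)
  show "r *\<^sub>R (a + b) = r *\<^sub>R a + r *\<^sub>R b"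
    by (rule l2_eqI) (use rep_scaleR[of r "a + b"] rep_add[of a b] rep_add[of "r *\<^sub>R a" "r *\<^sub>R b"] rep_scaleR[of r a] rep_scaleR[of r b]
      in \<open>eventually_elim, simp add: ring_distribs\<close>)
  show "(r + s) *\<^sub>R a = r *\<^sub>R a + s *\<^sub>R a"
    by (rule l2_eqI) (use rep_scaleR[of "r + s" a] rep_add[of "r *\<^sub>R a" "s *\<^sub>R a"] rep_scaleR[of r a] rep_scaleR[of s a]
      in \<open>eventually_elim, simp add: ring_distribs\<close>)
  show "r *\<^sub>R s *\<^sub>R a = (r * s) *\<^sub>R a"
    by (rule l2_eqI) (use rep_scaleR[of r "s *\<^sub>R a"] rep_scaleR[of s a] rep_scaleR[of "r * s" a] in \<open>eventually_elim, simp\<close>)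
  show "1 *\<^sub>R a = a" by (rule l2_eqI) (use rep_scaleR[of 1 a] in \<open>eventually_elim, simp\<close>)
  show "inner a b = inner b a" by (simp add: inner_l2_def mult.commute)
  have "inner (a + b) c = (LINT x|lborel. (rep a x + rep b x) * rep c x)"
    by (rule rep_inner_cong[OF rep_add]) (intro square_int_add square_int_rep)
  then show "inner (a + b) c = inner a c + inner b c"
    using rep_times_integrable[of a c] rep_times_integrable[of b c] by (simp add: inner_l2_def distrib_right)
  have "inner (r *\<^sub>R a) b = (LINT x|lborel. (r * rep a x) * rep b x)"
    by (rule rep_inner_cong[OF rep_scaleR]) (intro square_int_scale square_int_rep)
  then show "inner (r *\<^sub>R a) b = r * inner a b" by (simp add: inner_l2_def mult.assoc)
  show "0 \<le> inner a a" unfolding inner_l2_def by (rule integral_nonneg_AE) simp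
  have "(LINT x|lborel. rep a x * rep a x) = 0 \<longleftrightarrow> (AE x in lborel. rep a x * rep a x = 0)"
    by (rule integral_nonneg_eq_0_iff_AE[OF rep_times_integrable]) simp
  also have "\<dots> \<longleftrightarrow> (AE x in lborel. rep a x = rep 0 x)" using AE_eq_iff[OF rep_0, of "rep a"] by simp
  also have "\<dots> \<longleftrightarrow> a = 0" using l2_eqI[of a 0] by auto
  finally show "inner a a = 0 \<longleftrightarrow> a = 0" unfolding inner_l2_def .
qed (fact dist_l2_def sgn_l2_def uniformity_l2_def open_l2_def norm_l2_def)+

end

lemma inner_cls:
  assumes "square_int f" "square_int g" shows "inner (cls f) (cls g) = (LINT x|lborel. f x * g x)"
proof -
  have "inner (cls f) (cls g) = (LINT x|lborel. f x * rep (cls g) x)" by (rule rep_inner_cong[OF rep_cls[OF assms(1)] assms(1)])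
  also have "\<dots> = (LINT x|lborel. rep (cls g) x * f x)" by (simp add: mult.commute)
  also have "\<dots> = (LINT x|lborel. g x * f x)"
    by (rule integral_mult_cong[OF rep_cls[OF assms(2)]]) (use square_int_measurable assms in simp_all)
  finally show ?thesis by (simp add: mult.commute)
qed

lemma norm_cls_sqr: "square_int f ==> (norm (cls f))\<^sup>2 = (LINT x|lborel. (f x)\<^sup>2)"
  by (simp add: power2_norm_eq_inner inner_cls flip: power2_eq_square)

lemma cls_add: "square_int f ==> square_int g ==> cls f + cls g = cls (\<lambda>x. f x + g x)"
proof (rule l2_eqI)
  assume s: "square_int f" "square_int g"
  show "AE x in lborel. rep (cls f + cls g) x = rep (cls (\<lambda>x. f x + g x)) x"
    using rep_add[of "cls f" "cls g"] rep_cls[OF s(1)] rep_cls[OF s(2)] rep_cls[OF square_int_add[OF s]] by eventually_elim simp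
qed

lemma cls_diff: "square_int f ==> square_int g ==> cls f - cls g = cls (\<lambda>x. f x - g x)"
proof (rule l2_eqI)
  assume s: "square_int f" "square_int g"
  show "AE x in lborel. rep (cls f - cls g) x = rep (cls (\<lambda>x. f x - g x)) x"
    using rep_diff[of "cls f" "cls g"] rep_cls[OF s(1)] rep_cls[OF s(2)] rep_cls[OF square_int_diff[OF s]] by eventually_elim simp
qed

lemma cls_scaleR: "square_int f ==> c *\<^sub>R cls f = cls (\<lambda>x. c * f x)"
proof (rule l2_eqI)
  assume s: "square_int f"
  show "AE x in lborel. rep (c *\<^sub>R cls f) x = rep (cls (\<lambda>x. c * f x)) x"
    using rep_scaleR[of c "cls f"] rep_cls[OF s] rep_cls[OF square_int_scale[OF s, of c]] by eventually_elim simp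
qed

text \<open>Riesz--Fischer: a subsequence with \<open>\<Sum> 2\<^sup>k \<parallel>X\<^sub>k\<^sub>+\<^sub>1 - X\<^sub>k\<parallel>\<^sup>2 < \<infinity>\<close> converges almost everywhere, and Fatou's lemma
  identifies its limit as the limit in norm.\<close>

instance l2 :: banach
proof
  fix X :: "nat => l2" assume X: "Cauchy X"
  have "\<forall>k. \<exists>N. \<forall>m\<ge>N. \<forall>n\<ge>N. norm (X m - X n) < (1 / 2) ^ k"
    using X unfolding Cauchy_iff by simp
  then obtain N where N: "\<forall>k. \<forall>m\<ge>N k. \<forall>n\<ge>N k. norm (X m - X n) < (1 / 2) ^ k" by (auto dest!: choice)
  \<comment> \<open>A sum instead of a maximum: its terms are natural numbers, so r k dominates N j
    for every j \<le> k.\<close>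
  define r where "r k = sum N {..k}" for k
  have rN: "N j \<le> r k" if "j \<le> k" for j k unfolding r_def using that by (intro member_le_sum) auto
  have sq: "square_int (\<lambda>x. rep (X m) x - rep (X n) x)" for m n by (intro square_int_diff square_int_rep)
  have nn: "(\<integral>\<^sup>+x. ennreal ((rep (X m) x - rep (X n) x)\<^sup>2) \<partial>lborel) = ennreal ((norm (X m - X n))\<^sup>2)" for m n
  proof -
    have "(\<integral>\<^sup>+x. ennreal ((rep (X m) x - rep (X n) x)\<^sup>2) \<partial>lborel) = ennreal (LINT x|lborel. (rep (X m) x - rep (X n) x)\<^sup>2)"
      by (rule nn_integral_eq_integral) (use sq[of m n] in \<open>auto simp: square_int_def\<close>)
    then show ?thesis using norm_cls_sqr[OF sq[of m n]] cls_diff[of "rep (X m)" "rep (X n)"] by simp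
  qed
  define d where "d k x = rep (X (r (Suc k))) x - rep (X (r k)) x" for k x
  have dm [measurable]: "d k \<in> borel_measurable borel" for k unfolding d_def by measurable
  have "(\<integral>\<^sup>+x. (\<Sum>k. ennreal (2 ^ k * (d k x)\<^sup>2)) \<partial>lborel) = (\<Sum>k. \<integral>\<^sup>+x. ennreal (2 ^ k * (d k x)\<^sup>2) \<partial>lborel)"
    by (rule nn_integral_suminf) simp
  also have "\<dots> \<le> (\<Sum>k. ennreal ((1 / 2) ^ k))"
  proof (rule suminf_le)
    fix k
    have "norm (X (r (Suc k)) - X (r k)) < (1 / 2) ^ k" using N rN[of k k] rN[of k "Suc k"] by simp
    then have "(norm (X (r (Suc k)) - X (r k)))\<^sup>2 \<le> ((1 / 2) ^ k)\<^sup>2" by (intro power_mono) auto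
    then have "2 ^ k * (norm (X (r (Suc k)) - X (r k)))\<^sup>2 \<le> 2 ^ k * ((1 / 2) ^ k)\<^sup>2" by (intro mult_left_mono) auto
    also have "\<dots> = (1 / 2) ^ k" by (simp add: power2_eq_square power_divide)
    finally have le: "2 ^ k * (norm (X (r (Suc k)) - X (r k)))\<^sup>2 \<le> (1 / 2) ^ k" .
    have "(\<integral>\<^sup>+x. ennreal (2 ^ k * (d k x)\<^sup>2) \<partial>lborel) = (\<integral>\<^sup>+x. ennreal (2 ^ k) * ennreal ((d k x)\<^sup>2) \<partial>lborel)"
      by (simp add: ennreal_mult)
    also have "\<dots> = ennreal (2 ^ k) * (\<integral>\<^sup>+x. ennreal ((d k x)\<^sup>2) \<partial>lborel)" by (rule nn_integral_cmult) simp
    also have "\<dots> = ennreal (2 ^ k * (norm (X (r (Suc k)) - X (r k)))\<^sup>2)" unfolding d_def nn by (simp add: ennreal_mult)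
    finally show "(\<integral>\<^sup>+x. ennreal (2 ^ k * (d k x)\<^sup>2) \<partial>lborel) \<le> ennreal ((1 / 2) ^ k)" using le by (simp add: ennreal_leI)
  qed auto
  also have "\<dots> = ennreal (\<Sum>k. (1 / 2) ^ k)" by (rule suminf_ennreal2) (auto intro: summable_geometric)
  also have "\<dots> < \<infinity>" by simp
  finally have "AE x in lborel. (\<Sum>k. ennreal (2 ^ k * (d k x)\<^sup>2)) \<noteq> \<infinity>"
    by (intro nn_integral_PInf_AE) auto
  then have conv: "AE x in lborel. convergent (\<lambda>k. rep (X (r k)) x)"
  proof eventually_elim
    case (elim x)
    then have s1: "summable (\<lambda>k. 2 ^ k * (d k x)\<^sup>2)" by (intro summable_suminf_not_top) auto
    have s2: "summable (\<lambda>k. (1 / 2 :: real) ^ k)" by (rule summable_geometric) simp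
    have "summable (\<lambda>k. d k x)"
    proof (rule summable_comparison_test[OF _ summable_add[OF s1 s2]], intro exI allI impI)
      fix k
      \<comment> \<open>Applied to y = 2^k |d k x| and divided by 2^k this gives |d k x| \<le> 2^k
        (d k x)^2 + 2^(-k), both terms being summable.\<close>
      have "y \<le> y\<^sup>2 + 1" if "0 \<le> y" for y :: real
        using zero_le_power2[of "y - 1"] that unfolding power2_diff by simp
      then have "2 ^ k * \<bar>d k x\<bar> \<le> (2 ^ k * \<bar>d k x\<bar>)\<^sup>2 + 1" by simp
      then have "(1 / 2) ^ k * (2 ^ k * \<bar>d k x\<bar>) \<le> (1 / 2) ^ k * ((2 ^ k * \<bar>d k x\<bar>)\<^sup>2 + 1)" by (intro mult_left_mono) auto
      then show "norm (d k x) \<le> 2 ^ k * (d k x)\<^sup>2 + (1 / 2) ^ k"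
        by (simp add: power_divide power2_eq_square divide_simps) (simp add: algebra_simps)
    qed
    then have "convergent (\<lambda>k. \<Sum>j<k. d j x)" by (simp add: summable_iff_convergent)
    then have "convergent (\<lambda>k. rep (X (r 0)) x + (\<Sum>j<k. d j x))" by (intro convergent_add convergent_const)
    moreover have "rep (X (r 0)) x + (\<Sum>j<k. d j x) = rep (X (r k)) x" for k
      using sum_lessThan_telescope[of "\<lambda>j. rep (X (r j)) x" k] by (simp add: d_def)
    ultimately show ?case by simp
  qed
  define f where "f x = lim (\<lambda>k. rep (X (r k)) x)" for x
  have fm [measurable]: "f \<in> borel_measurable borel"
    unfolding f_def by (rule borel_measurable_lim_metric) simp
  \<comment> \<open>Fatou's lemma along the subsequence; it shows at once that f is square
    integrable up to a member of the sequence and that the full sequence converges to it.\<close>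
  have close: "square_int (\<lambda>x. f x - rep (X n) x) \<and> (LINT x|lborel. (f x - rep (X n) x)\<^sup>2) \<le> ((1 / 2) ^ j)\<^sup>2" if n: "n \<ge> N j" for n j
  proof -
    have "AE x in lborel. ennreal ((f x - rep (X n) x)\<^sup>2) = liminf (\<lambda>k. ennreal ((rep (X (r k)) x - rep (X n) x)\<^sup>2))"
      using conv
    proof eventually_elim
      case (elim x)
      then have "(\<lambda>k. rep (X (r k)) x) \<longlonglongrightarrow> f x" unfolding f_def by (simp add: convergent_LIMSEQ_iff)
      then have "(\<lambda>k. ennreal ((rep (X (r k)) x - rep (X n) x)\<^sup>2)) \<longlonglongrightarrow> ennreal ((f x - rep (X n) x)\<^sup>2)"
        by (intro tendsto_ennrealI tendsto_intros)
      then show ?case by (intro lim_imp_Liminf[symmetric]) auto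
    qed
    then have "(\<integral>\<^sup>+x. ennreal ((f x - rep (X n) x)\<^sup>2) \<partial>lborel) = (\<integral>\<^sup>+x. liminf (\<lambda>k. ennreal ((rep (X (r k)) x - rep (X n) x)\<^sup>2)) \<partial>lborel)"
      by (rule nn_integral_cong_AE)
    also have "\<dots> \<le> liminf (\<lambda>k. \<integral>\<^sup>+x. ennreal ((rep (X (r k)) x - rep (X n) x)\<^sup>2) \<partial>lborel)"
      by (rule nn_integral_liminf) simp
    also have "\<dots> \<le> limsup (\<lambda>k. \<integral>\<^sup>+x. ennreal ((rep (X (r k)) x - rep (X n) x)\<^sup>2) \<partial>lborel)"
      by (rule Liminf_le_Limsup) simp
    also have "\<dots> \<le> ennreal (((1 / 2) ^ j)\<^sup>2)"
    proof (rule Limsup_bounded)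
      show "\<forall>\<^sub>F k in sequentially. (\<integral>\<^sup>+x. ennreal ((rep (X (r k)) x - rep (X n) x)\<^sup>2) \<partial>lborel) \<le> ennreal (((1 / 2) ^ j)\<^sup>2)"
        using eventually_ge_at_top[of j]
      proof eventually_elim
        case (elim k)
        then have "norm (X (r k) - X n) < (1 / 2) ^ j" using N n rN[of j k] by simp
        then show ?case unfolding nn by (intro ennreal_leI power_mono) auto
      qed
    qed
    finally have le: "(\<integral>\<^sup>+x. ennreal ((f x - rep (X n) x)\<^sup>2) \<partial>lborel) \<le> ennreal (((1 / 2) ^ j)\<^sup>2)" .
    then have i: "integrable lborel (\<lambda>x. (f x - rep (X n) x)\<^sup>2)"
      by (intro integrableI_nonneg) (auto simp: le_less_trans)
    have "ennreal (LINT x|lborel. (f x - rep (X n) x)\<^sup>2) \<le> ennreal (((1 / 2) ^ j)\<^sup>2)"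
      using le nn_integral_eq_integral[OF i] by simp
    then have "(LINT x|lborel. (f x - rep (X n) x)\<^sup>2) \<le> ((1 / 2) ^ j)\<^sup>2" by (subst (asm) ennreal_le_iff) auto
    then show ?thesis using i by (simp add: square_int_def)
  qed
  have "square_int (\<lambda>x. (f x - rep (X (N 0)) x) + rep (X (N 0)) x)"
    by (intro square_int_add square_int_rep) (use close[of 0 "N 0"] in simp)
  then have f: "square_int f" by simp
  have "X \<longlonglongrightarrow> cls f"
  proof (rule LIMSEQ_I)
    fix e :: real assume "e > 0"
    then obtain j where j: "(1 / 2) ^ j < e" using real_arch_pow_inv[of e "1/2"] by auto
    have "norm (X n - cls f) < e" if "n \<ge> N j" for n
    proof -
      have "(norm (cls f - X n))\<^sup>2 = (LINT x|lborel. (f x - rep (X n) x)\<^sup>2)"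
        using norm_cls_sqr[OF conjunct1[OF close[OF that]]] cls_diff[OF f square_int_rep[of "X n"]] by simp
      then have "(norm (cls f - X n))\<^sup>2 \<le> ((1 / 2) ^ j)\<^sup>2" using close[OF that] by simp
      then have "norm (cls f - X n) \<le> (1 / 2) ^ j" by (rule power2_le_imp_le) simp
      then show ?thesis using j by (simp add: norm_minus_commute)
    qed
    then show "\<exists>no. \<forall>n\<ge>no. norm (X n - cls f) < e" by blast
  qed
  then show "convergent X" by (rule convergentI)
qed

section \<open>The weak derivative as an operator\<close>

lemma test_fun_square_int: assumes "test_fun \<phi>" shows "square_int \<phi>"
proof (rule square_intI)
  have "locally_int \<phi>" using abs_cont_self_locally_int[OF abs_cont_smooth[OF test_funD(1)[OF assms]]] .
  then show "integrable lborel (\<lambda>x. \<phi> x * \<phi> x)" by (rule locally_int_test_integrable[OF _ assms])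
qed (rule test_fun_measurable[OF assms])

lemma inner_test:
  assumes "test_fun \<phi>" shows "inner u (cls \<phi>) = (LINT x|lborel. rep u x * \<phi> x)"
  using inner_cls[OF square_int_rep test_fun_square_int[OF assms], of u] by simp

lemma l2_eq_0I: assumes "\<And>\<phi>. test_fun \<phi> ==> inner u (cls \<phi>) = 0" shows "u = 0"
proof (rule l2_eqI)
  have "AE x in lborel. rep u x = 0"
    by (rule du_Bois_Reymond_0[OF square_int_locally_int[OF square_int_rep]]) (use assms inner_test in simp)
  then show "AE x in lborel. rep u x = rep 0 x" using rep_0 by eventually_elim simp
qed

definition has_l2_deriv :: "l2 => l2 => bool" where
  "has_l2_deriv u v \<longleftrightarrow> weak_deriv 1 (rep u) (rep v)"

definition l2_dom :: "l2 set" where "l2_dom = {u. \<exists>v. has_l2_deriv u v}"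

definition l2_D :: "l2 => l2" where "l2_D u = (THE v. has_l2_deriv u v)"

text \<open>Pairing with test functions is continuous and linear in both u and v; uniqueness,
  linearity and closedness of the weak derivative follow directly from this form.\<close>

lemma has_l2_deriv_iff:
  "has_l2_deriv u v \<longleftrightarrow> (\<forall>\<phi>. test_fun \<phi> --> inner u (cls (deriv \<phi>)) = - inner v (cls \<phi>))"
  by (auto simp: has_l2_deriv_def weak_deriv_def inner_test test_fun_deriv square_int_locally_int)

lemma has_l2_derivD: "has_l2_deriv u v ==> test_fun \<phi> ==> inner u (cls (deriv \<phi>)) = - inner v (cls \<phi>)"
  by (simp add: has_l2_deriv_iff)

lemma has_l2_deriv_unique: assumes "has_l2_deriv u v" "has_l2_deriv u v'" shows "v = v'"
proof -
  have "v - v' = 0"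
    by (rule l2_eq_0I) (use has_l2_derivD[OF assms(1)] has_l2_derivD[OF assms(2)] in \<open>simp add: inner_diff_left\<close>)
  then show ?thesis by simp
qed

lemma has_l2_derivI: assumes "has_l2_deriv u v" shows "u \<in> l2_dom" "l2_D u = v"
  using assms has_l2_deriv_unique unfolding l2_dom_def l2_D_def by blast+

lemma l2_dom_deriv: "u \<in> l2_dom ==> has_l2_deriv u (l2_D u)"
  using has_l2_derivI unfolding l2_dom_def by blast

lemma has_l2_deriv_abs_cont:
  "has_l2_deriv u v \<longleftrightarrow> (\<exists>F. abs_cont F (rep v) \<and> (AE x in lborel. rep u x = F x))"
  unfolding has_l2_deriv_def by (rule weak_deriv_1_iff) simp

lemma cls_has_l2_deriv:
  assumes "abs_cont F g" "square_int F" "square_int g" shows "has_l2_deriv (cls F) (cls g)"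
  unfolding has_l2_deriv_abs_cont
proof (intro exI conjI)
  show "AE x in lborel. rep (cls F) x = F x" by (rule rep_cls[OF assms(2)])
  have "AE x in lborel. g x = rep (cls g) x" using rep_cls[OF assms(3)] by eventually_elim simp
  then show "abs_cont F (rep (cls g))" by (rule abs_cont_cong[OF assms(1)]) simp
qed

lemma l2_domE:
  assumes "u \<in> l2_dom"
  obtains F where "abs_cont F (rep (l2_D u))" "AE x in lborel. rep u x = F x" "square_int F" "cls F = u"
proof -
  obtain F where F: "abs_cont F (rep (l2_D u))" "AE x in lborel. rep u x = F x"
    using l2_dom_deriv[OF assms] unfolding has_l2_deriv_abs_cont by (elim exE conjE)
  have F2: "AE x in lborel. F x = rep u x" using F(2) by eventually_elim simp
  have "square_int F" by (rule square_int_cong[OF square_int_rep F2 abs_cont_measurable[OF F(1)]])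
  then show thesis using that[OF F] cls_eqI[OF _ F2] by blast
qed

lemma subspace_l2_dom: "subspace l2_dom"
  and l2_D_add: "u \<in> l2_dom ==> v \<in> l2_dom ==> l2_D (u + v) = l2_D u + l2_D v"
  and l2_D_scale: "u \<in> l2_dom ==> l2_D (c *\<^sub>R u) = c *\<^sub>R l2_D u"
proof -
  have a: "has_l2_deriv (u + v) (l2_D u + l2_D v)" if "u \<in> l2_dom" "v \<in> l2_dom" for u v
    unfolding has_l2_deriv_iff using has_l2_derivD[OF l2_dom_deriv[OF that(1)]] has_l2_derivD[OF l2_dom_deriv[OF that(2)]]
    by (simp add: inner_add_left)
  have s: "has_l2_deriv (c *\<^sub>R u) (c *\<^sub>R l2_D u)" if "u \<in> l2_dom" for u c
    unfolding has_l2_deriv_iff using has_l2_derivD[OF l2_dom_deriv[OF that]] by simp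
  have "has_l2_deriv 0 0" by (simp add: has_l2_deriv_iff)
  then show "subspace l2_dom" unfolding subspace_def using a s has_l2_derivI(1) by blast
  show "u \<in> l2_dom ==> v \<in> l2_dom ==> l2_D (u + v) = l2_D u + l2_D v" using a has_l2_derivI(2) by blast
  show "u \<in> l2_dom ==> l2_D (c *\<^sub>R u) = c *\<^sub>R l2_D u" using s has_l2_derivI(2) by blast
qed

lemma l2_D_closed:
  assumes "\<And>n. u n \<in> l2_dom" "u \<longlonglongrightarrow> f" "(\<lambda>n. l2_D (u n)) \<longlonglongrightarrow> g"
  shows "f \<in> l2_dom \<and> l2_D f = g"
proof -
  have "has_l2_deriv f g" unfolding has_l2_deriv_iff
  proof (intro allI impI)
    fix \<phi> assume \<phi>: "test_fun \<phi>"
    have "(\<lambda>n. inner (u n) (cls (deriv \<phi>))) \<longlonglongrightarrow> inner f (cls (deriv \<phi>))" by (intro tendsto_intros assms)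
    moreover have "(\<lambda>n. inner (u n) (cls (deriv \<phi>))) = (\<lambda>n. - inner (l2_D (u n)) (cls \<phi>))"
      using has_l2_derivD[OF l2_dom_deriv[OF assms(1)] \<phi>] by simp
    moreover have "(\<lambda>n. - inner (l2_D (u n)) (cls \<phi>)) \<longlonglongrightarrow> - inner g (cls \<phi>)" by (intro tendsto_intros assms)
    ultimately show "inner f (cls (deriv \<phi>)) = - inner g (cls \<phi>)" using LIMSEQ_unique by simp
  qed
  then show ?thesis using has_l2_derivI by blast
qed

text \<open>The product of the absolutely continuous representatives and its derivative are both
  integrable, so the integral of the derivative is 0.\<close>

lemma l2_D_skew:
  assumes "u \<in> l2_dom" "v \<in> l2_dom" shows "inner (l2_D u) v = - inner u (l2_D v)"
proof -
  obtain F where F: "abs_cont F (rep (l2_D u))" "square_int F" "cls F = u" using l2_domE[OF assms(1)] .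
  obtain G where G: "abs_cont G (rep (l2_D v))" "square_int G" "cls G = v" using l2_domE[OF assms(2)] .
  have i: "integrable lborel (\<lambda>x. rep (l2_D u) x * G x)" "integrable lborel (\<lambda>x. rep (l2_D v) x * F x)"
    by (intro square_int_mult_integrable square_int_rep F G)+
  have "(LINT x|lborel. rep (l2_D u) x * G x + rep (l2_D v) x * F x) = 0"
    by (rule abs_cont_integral_eq_0[OF abs_cont_mult[OF F(1) G(1)] square_int_mult_integrable[OF F(2) G(2)]])
      (rule Bochner_Integration.integrable_add[OF i])
  moreover have "inner (l2_D u) v = (LINT x|lborel. rep (l2_D u) x * G x)"
    using inner_cls[OF square_int_rep G(2), of "l2_D u"] G(3) by simp
  moreover have "inner (l2_D v) u = (LINT x|lborel. rep (l2_D v) x * F x)"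
    using inner_cls[OF square_int_rep F(2), of "l2_D v"] F(3) by simp
  ultimately show ?thesis using i by (simp add: inner_commute)
qed

lemma test_fun_l2_dom: assumes "test_fun \<phi>" shows "cls \<phi> \<in> l2_dom" "l2_D (cls \<phi>) = cls (deriv \<phi>)"
proof -
  have "has_l2_deriv (cls \<phi>) (cls (deriv \<phi>))"
    by (intro cls_has_l2_deriv abs_cont_smooth test_funD(1) test_fun_square_int test_fun_deriv assms)
  then show "cls \<phi> \<in> l2_dom" "l2_D (cls \<phi>) = cls (deriv \<phi>)" by (rule has_l2_derivI)+
qed

lemma subspace_closure:
  fixes S :: "'a::real_normed_vector set" assumes "subspace S" shows "subspace (closure S)"
  unfolding subspace_def
proof (intro conjI ballI allI)
  show "0 \<in> closure S" using subspace_0[OF assms] closure_subset by blast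
  fix x y c assume "x \<in> closure S" "y \<in> closure S"
  then obtain u v where uv: "\<forall>n. u n \<in> S" "u \<longlonglongrightarrow> x" "\<forall>n. v n \<in> S" "v \<longlonglongrightarrow> y"
    unfolding closure_sequential by (elim exE conjE) (rule that)
  show "x + y \<in> closure S" unfolding closure_sequential
    using uv by (intro exI[of _ "\<lambda>n. u n + v n"]) (auto intro: tendsto_add subspace_add[OF assms])
  show "c *\<^sub>R x \<in> closure S" unfolding closure_sequential
    using uv by (intro exI[of _ "\<lambda>n. c *\<^sub>R u n"]) (auto intro: tendsto_scaleR subspace_scale[OF assms])
qed

lemma l2_dom_dense: "closure l2_dom = UNIV"
proof (rule closed_subspace_eq_UNIV)
  show "subspace (closure l2_dom)" by (rule subspace_closure[OF subspace_l2_dom])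
  fix g assume g: "\<And>f. f \<in> closure l2_dom ==> inner f g = 0"
  have "cls \<phi> \<in> closure l2_dom" if "test_fun \<phi>" for \<phi> using test_fun_l2_dom(1)[OF that] closure_subset by blast
  then have "inner g (cls \<phi>) = 0" if "test_fun \<phi>" for \<phi> using g[of "cls \<phi>"] that by (simp add: inner_commute)
  then show "g = 0" by (rule l2_eq_0I)
qed simp

lemma l2_D_resolvent_norm:
  assumes "u \<in> l2_dom"
  shows "norm u \<le> norm (u - d *\<^sub>R l2_D u)" "\<bar>d\<bar> * norm (l2_D u) \<le> norm (u - d *\<^sub>R l2_D u)"
proof -
  have z: "inner u (l2_D u) = 0" using l2_D_skew[OF assms assms] by (simp add: inner_commute)
  have e: "(norm (u - d *\<^sub>R l2_D u))\<^sup>2 = (norm u)\<^sup>2 + (\<bar>d\<bar> * norm (l2_D u))\<^sup>2"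
    using z by (simp add: power2_norm_eq_inner inner_diff_left inner_diff_right inner_commute power_mult_distrib)
      (simp add: power2_eq_square)
  show "norm u \<le> norm (u - d *\<^sub>R l2_D u)" by (rule power2_le_imp_le) (simp_all add: e)
  show "\<bar>d\<bar> * norm (l2_D u) \<le> norm (u - d *\<^sub>R l2_D u)" by (rule power2_le_imp_le) (simp_all add: e)
qed

text \<open>The range of 1 - r D is closed, because its norm bounds u and D u from above, and its
  orthogonal complement is trivial, so it is everything.\<close>

lemma l2_D_range: assumes "r \<noteq> 0" shows "\<exists>u\<in>l2_dom. u - r *\<^sub>R l2_D u = f"
proof -
  define R where "R u = u - r *\<^sub>R l2_D u" for u
  have Radd: "R u + R v = R (u + v)" if "u \<in> l2_dom" "v \<in> l2_dom" for u v
    using that by (simp add: R_def l2_D_add algebra_simps)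
  have Rscale: "c *\<^sub>R R u = R (c *\<^sub>R u)" if "u \<in> l2_dom" for u c
    using that by (simp add: R_def l2_D_scale algebra_simps)
  have Rdiff: "R u - R v = R (u - v)" if "u \<in> l2_dom" "v \<in> l2_dom" for u v
    using Radd[OF that(1) subspace_scale[OF subspace_l2_dom that(2)], of "-1"] Rscale[OF that(2), of "-1"]
    by (metis add_uminus_conv_diff scaleR_minus1_left)
  note ddiff = subspace_diff[OF subspace_l2_dom]
  have Ddiff: "l2_D (u - v) = l2_D u - l2_D v" if "u \<in> l2_dom" "v \<in> l2_dom" for u v
    using l2_D_add[OF that(1) subspace_scale[OF subspace_l2_dom that(2)], of "-1"] l2_D_scale[OF that(2), of "-1"] by simp
  have "R ` l2_dom = UNIV"
  proof (rule closed_subspace_eq_UNIV)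
    show "subspace (R ` l2_dom)" unfolding subspace_def
    proof (intro conjI ballI allI)
      show "0 \<in> R ` l2_dom" using subspace_0[OF subspace_l2_dom] l2_D_scale[of 0 0] by (intro image_eqI[of _ _ 0]) (simp_all add: R_def)
      fix x y c assume "x \<in> R ` l2_dom" "y \<in> R ` l2_dom"
      then obtain u v where "u \<in> l2_dom" "v \<in> l2_dom" "x = R u" "y = R v" by (elim imageE)
      then show "x + y \<in> R ` l2_dom" "c *\<^sub>R x \<in> R ` l2_dom"
        by (simp_all add: Radd Rscale subspace_add[OF subspace_l2_dom] subspace_scale[OF subspace_l2_dom])
    qed
    show "closed (R ` l2_dom)" unfolding closed_sequential_limits
    proof (intro allI impI, elim conjE)
      fix x l assume x: "\<forall>n. x n \<in> R ` l2_dom" and lim: "x \<longlonglongrightarrow> l"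
      from x have "\<forall>n. \<exists>u. u \<in> l2_dom \<and> x n = R u" by blast
      then obtain u where u: "\<forall>n. u n \<in> l2_dom \<and> x n = R (u n)" by (rule choice[THEN exE])
      have C: "\<exists>N. \<forall>m\<ge>N. \<forall>n\<ge>N. norm (x m - x n) < e" if "0 < e" for e
        using LIMSEQ_imp_Cauchy[OF lim] that unfolding Cauchy_iff by blast
      have xd: "x m - x n = R (u m - u n)" for m n using u Rdiff by simp
      note b = l2_D_resolvent_norm[OF ddiff, of _ _ r, folded R_def]
      have "Cauchy u" unfolding Cauchy_iff
      proof (intro allI impI)
        fix e :: real assume "0 < e"
        then obtain N where N: "\<forall>m\<ge>N. \<forall>n\<ge>N. norm (x m - x n) < e" by (rule exE[OF C])
        have "norm (u m - u n) < e" if "m \<ge> N" "n \<ge> N" for m n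
          using le_less_trans[OF b(1)[of "u m" "u n"]] N u that xd by simp
        then show "\<exists>M. \<forall>m\<ge>M. \<forall>n\<ge>M. norm (u m - u n) < e" by blast
      qed
      moreover have "Cauchy (\<lambda>n. l2_D (u n))" unfolding Cauchy_iff
      proof (intro allI impI)
        fix e :: real assume "0 < e"
        then have "0 < \<bar>r\<bar> * e" using assms by simp
        then obtain N where N: "\<forall>m\<ge>N. \<forall>n\<ge>N. norm (x m - x n) < \<bar>r\<bar> * e" by (rule exE[OF C])
        have "norm (l2_D (u m) - l2_D (u n)) < e" if "m \<ge> N" "n \<ge> N" for m n
        proof -
          have "\<bar>r\<bar> * norm (l2_D (u m) - l2_D (u n)) < \<bar>r\<bar> * e"
            using le_less_trans[OF b(2)[of "u m" "u n"]] N u that xd Ddiff by simp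
          then show ?thesis by (rule mult_left_less_imp_less) simp
        qed
        then show "\<exists>M. \<forall>m\<ge>M. \<forall>n\<ge>M. norm (l2_D (u m) - l2_D (u n)) < e" by blast
      qed
      ultimately obtain a d where ad: "u \<longlonglongrightarrow> a" "(\<lambda>n. l2_D (u n)) \<longlonglongrightarrow> d"
        using Cauchy_convergent convergent_def by (metis (no_types))
      have ad': "a \<in> l2_dom \<and> l2_D a = d" by (rule l2_D_closed[OF _ ad]) (use u in blast)
      have "(\<lambda>n. R (u n)) \<longlonglongrightarrow> a - r *\<^sub>R d" unfolding R_def by (intro tendsto_intros ad)
      moreover have "(\<lambda>n. R (u n)) = x" using u by auto
      ultimately have "l = a - r *\<^sub>R d" using LIMSEQ_unique[OF lim] by simp
      then show "l \<in> R ` l2_dom" using ad' by (auto simp: R_def)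
    qed
    fix g assume g: "\<And>f. f \<in> R ` l2_dom ==> inner f g = 0"
    \<comment> \<open>Orthogonality to the images of test functions says g' = - g / r weakly. Then g
      itself is in the domain, and skewness gives g = 0.\<close>
    have "has_l2_deriv g (- (1 / r) *\<^sub>R g)" unfolding has_l2_deriv_iff
    proof (intro allI impI)
      fix \<phi> assume \<phi>: "test_fun \<phi>"
      have "inner (R (cls \<phi>)) g = 0" using test_fun_l2_dom(1)[OF \<phi>] by (intro g) simp
      then have "inner g (cls \<phi>) = r * inner g (cls (deriv \<phi>))"
        by (simp add: R_def test_fun_l2_dom[OF \<phi>] inner_diff_right inner_commute[of _ g])
      then show "inner g (cls (deriv \<phi>)) = - inner (- (1 / r) *\<^sub>R g) (cls \<phi>)" using assms by simp
    qed
    then have "g \<in> l2_dom" "l2_D g = - (1 / r) *\<^sub>R g" by (rule has_l2_derivI)+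
    then show "g = 0" using l2_D_skew[of g g] assms by simp
  qed
  then have "f \<in> R ` l2_dom" by simp
  then show ?thesis unfolding R_def by (elim imageE) auto
qed

text \<open>F^2 is absolutely continuous with derivative 2 F F'; integrate its absolute value and
  apply Cauchy-Schwarz to |F| and |F'|.\<close>

lemma l2_dom_bound:
  assumes F: "abs_cont F (rep (l2_D u))" "square_int F" "cls F = u"
  shows "(F x)\<^sup>2 \<le> 2 * norm u * norm (l2_D u)"
proof -
  let ?f = "rep (l2_D u)"
  have i: "integrable lborel (\<lambda>x. ?f x * F x)" by (intro square_int_mult_integrable square_int_rep F)
  have sa: "square_int (\<lambda>x. \<bar>f x\<bar>)" if "square_int f" for f
    using that by (auto simp: square_int_def)
  have na: "norm (cls (\<lambda>x. \<bar>f x\<bar>)) = norm (cls f)" if "square_int f" for f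
    by (rule power2_eq_imp_eq) (simp_all add: norm_cls_sqr that sa)
  have "F x * F x \<le> (LINT x|lborel. \<bar>?f x * F x + ?f x * F x\<bar>)"
    by (rule abs_cont_le_integral[OF abs_cont_mult[OF F(1,1)] square_int_mult_integrable[OF F(2,2)]])
      (rule Bochner_Integration.integrable_add[OF i i])
  also have "\<dots> = (LINT x|lborel. 2 * (\<bar>?f x\<bar> * \<bar>F x\<bar>))"
    by (rule Bochner_Integration.integral_cong) (simp_all flip: abs_mult mult_2)
  also have "\<dots> = 2 * inner (cls (\<lambda>x. \<bar>?f x\<bar>)) (cls (\<lambda>x. \<bar>F x\<bar>))" by (simp add: inner_cls sa F(2))
  also have "\<dots> \<le> 2 * (norm (cls (\<lambda>x. \<bar>?f x\<bar>)) * norm (cls (\<lambda>x. \<bar>F x\<bar>)))" by (intro mult_left_mono norm_cauchy_schwarz) simp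
  also have "\<dots> = 2 * norm u * norm (l2_D u)" by (simp add: na F(2,3))
  finally show ?thesis by (simp add: power2_eq_square)
qed

text \<open>Total, with the default 0 where the product is not square integrable; for a factor in
  \<open>l2_dom\<close> the default never occurs, by the sup norm bound.\<close>

definition l2_mul :: "l2 => l2 => l2" where
  "l2_mul u v = (if square_int (\<lambda>x. rep u x * rep v x) then cls (\<lambda>x. rep u x * rep v x) else 0)"

lemma dom_mul:
  assumes "u \<in> l2_dom"
  shows "square_int (\<lambda>x. rep u x * rep v x)" "l2_mul u v = cls (\<lambda>x. rep u x * rep v x)"
    "(norm (l2_mul u v))\<^sup>2 \<le> 2 * norm u * norm (l2_D u) * (norm v)\<^sup>2"
proof -
  obtain F where F: "abs_cont F (rep (l2_D u))" "AE x in lborel. rep u x = F x" "square_int F" "cls F = u" using l2_domE[OF assms] .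
  have b: "(F x)\<^sup>2 \<le> 2 * norm u * norm (l2_D u)" for x by (rule l2_dom_bound[OF F(1,3,4)])
  have b': "\<bar>F x\<bar> \<le> sqrt (2 * norm u * norm (l2_D u))" for x using real_sqrt_le_mono[OF b[of x]] by simp
  have s: "square_int (\<lambda>x. F x * rep v x)"
    by (rule square_int_bounded_mult[OF square_int_rep abs_cont_measurable[OF F(1)] b'])
  have e: "AE x in lborel. rep u x * rep v x = F x * rep v x" using F(2) by eventually_elim simp
  show sq: "square_int (\<lambda>x. rep u x * rep v x)" by (rule square_int_cong[OF s e]) simp
  then show m: "l2_mul u v = cls (\<lambda>x. rep u x * rep v x)" by (simp add: l2_mul_def)
  have "(norm (l2_mul u v))\<^sup>2 = (LINT x|lborel. (F x * rep v x)\<^sup>2)" unfolding m cls_cong[OF e] by (rule norm_cls_sqr[OF s])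
  also have "\<dots> \<le> (LINT x|lborel. 2 * norm u * norm (l2_D u) * (rep v x)\<^sup>2)"
  proof (rule integral_mono)
    show "integrable lborel (\<lambda>x. (F x * rep v x)\<^sup>2)" using s by (simp add: square_int_def)
    show "integrable lborel (\<lambda>x. 2 * norm u * norm (l2_D u) * (rep v x)\<^sup>2)" using square_int_rep[of v] by (simp add: square_int_def)
    show "(F x * rep v x)\<^sup>2 \<le> 2 * norm u * norm (l2_D u) * (rep v x)\<^sup>2" for x
      unfolding power_mult_distrib by (rule mult_right_mono[OF b]) simp
  qed
  also have "\<dots> = 2 * norm u * norm (l2_D u) * (norm v)\<^sup>2" using norm_cls_sqr[OF square_int_rep[of v]] by simp
  finally show "(norm (l2_mul u v))\<^sup>2 \<le> 2 * norm u * norm (l2_D u) * (norm v)\<^sup>2" .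
qed

lemma rep_mul: "u \<in> l2_dom ==> AE x in lborel. rep (l2_mul u v) x = rep u x * rep v x"
  unfolding dom_mul(2) by (rule rep_cls) (rule dom_mul(1))

lemma l2_mul_commute: "l2_mul u v = l2_mul v u"
  by (simp add: l2_mul_def mult.commute)

lemma l2_mul_add: assumes "u \<in> l2_dom" shows "l2_mul u (v + v') = l2_mul u v + l2_mul u v'"
  by (rule l2_eqI) (use rep_mul[OF assms, of "v + v'"] rep_mul[OF assms, of v] rep_mul[OF assms, of v']
      rep_add[of v v'] rep_add[of "l2_mul u v" "l2_mul u v'"]
    in \<open>eventually_elim, simp add: ring_distribs\<close>)

lemma l2_mul_scale: assumes "u \<in> l2_dom" shows "l2_mul u (c *\<^sub>R v) = c *\<^sub>R l2_mul u v"
  by (rule l2_eqI) (use rep_mul[OF assms, of "c *\<^sub>R v"] rep_mul[OF assms, of v] rep_scaleR[of c v] rep_scaleR[of c "l2_mul u v"]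
    in \<open>eventually_elim, simp\<close>)

lemma l2_mul_add_dom:
  assumes "u \<in> l2_dom" "u' \<in> l2_dom" shows "l2_mul (u + u') v = l2_mul u v + l2_mul u' v"
  by (rule l2_eqI) (use rep_mul[OF subspace_add[OF subspace_l2_dom assms], of v] rep_mul[OF assms(1), of v] rep_mul[OF assms(2), of v]
      rep_add[of u u'] rep_add[of "l2_mul u v" "l2_mul u' v"]
    in \<open>eventually_elim, simp add: ring_distribs\<close>)

lemma l2_mul_scale_dom:
  assumes "u \<in> l2_dom" shows "l2_mul (c *\<^sub>R u) v = c *\<^sub>R l2_mul u v"
  by (rule l2_eqI) (use rep_mul[OF subspace_scale[OF subspace_l2_dom assms], of c v] rep_mul[OF assms, of v]
      rep_scaleR[of c u] rep_scaleR[of c "l2_mul u v"]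
    in \<open>eventually_elim, simp\<close>)

lemma l2_mul_adj: assumes "u \<in> l2_dom" shows "inner (l2_mul u v) v' = inner v (l2_mul u v')"
proof -
  have "inner (l2_mul u v) v' = (LINT x|lborel. (rep u x * rep v x) * rep v' x)"
    by (rule rep_inner_cong[OF rep_mul[OF assms] dom_mul(1)[OF assms]])
  moreover have "inner (l2_mul u v') v = (LINT x|lborel. (rep u x * rep v' x) * rep v x)"
    by (rule rep_inner_cong[OF rep_mul[OF assms] dom_mul(1)[OF assms]])
  ultimately show ?thesis by (simp add: inner_commute mult_ac)
qed

lemma l2_mul_has_deriv:
  assumes "u \<in> l2_dom" "v \<in> l2_dom" shows "has_l2_deriv (l2_mul u v) (l2_mul (l2_D u) v + l2_mul u (l2_D v))"
proof -
  obtain F where F: "abs_cont F (rep (l2_D u))" "AE x in lborel. rep u x = F x" using l2_domE[OF assms(1)] .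
  obtain G where G: "abs_cont G (rep (l2_D v))" "AE x in lborel. rep v x = G x" using l2_domE[OF assms(2)] .
  show ?thesis unfolding has_l2_deriv_abs_cont
  proof (intro exI conjI)
    show "AE x in lborel. rep (l2_mul u v) x = F x * G x" using rep_mul[OF assms(1), of v] F(2) G(2) by eventually_elim simp
    have "AE x in lborel. rep (l2_D u) x * G x + rep (l2_D v) x * F x = rep (l2_mul (l2_D u) v + l2_mul u (l2_D v)) x"
      using rep_add[of "l2_mul (l2_D u) v" "l2_mul u (l2_D v)"] rep_mul[OF assms(2), of "l2_D u"] rep_mul[OF assms(1), of "l2_D v"] F(2) G(2)
      by eventually_elim (simp add: l2_mul_commute[of _ v] mult.commute)
    then show "abs_cont (\<lambda>x. F x * G x) (rep (l2_mul (l2_D u) v + l2_mul u (l2_D v)))"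
      by (rule abs_cont_cong[OF abs_cont_mult[OF F(1) G(1)]]) simp
  qed
qed

section \<open>Multiplication by a bounded background whose derivatives are square
  integrable\<close>

locale background =
  fixes w :: "nat => real => real"
  assumes w_deriv: "(w k has_real_derivative w (Suc k) x) (at x)"
    and w_bounded: "\<exists>B. \<forall>x. \<bar>w k x\<bar> \<le> B"
    and w_square_int: "square_int (w (Suc k))"
begin

definition W_mul :: "nat => l2 => l2" where "W_mul k u = cls (\<lambda>x. w k x * rep u x)"

text \<open>The background itself need not be square integrable, but each term here contains one of
  its derivatives, which is.\<close>

definition W_force :: l2 where "W_force = cls (\<lambda>x. - w 3 x + 6 * (w 0 x * w 1 x))"

lemma w_continuous: "continuous_on UNIV (w k)"
  by (intro continuous_at_imp_continuous_on ballI DERIV_isCont[OF w_deriv])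

lemma w_measurable [measurable]: "w k \<in> borel_measurable borel"
  by (rule borel_measurable_continuous_onI[OF w_continuous])

lemma w_abs_cont: "abs_cont (w k) (w (Suc k))"
  by (rule abs_cont_C1[OF w_deriv w_continuous])

lemma square_int_w_mult: "square_int f ==> square_int (\<lambda>x. w k x * f x)"
proof -
  assume f: "square_int f"
  obtain B where "\<forall>x. \<bar>w k x\<bar> \<le> B" using w_bounded ..
  then show ?thesis by (intro square_int_bounded_mult[OF f, of _ B]) auto
qed

lemma rep_W_mul: "AE x in lborel. rep (W_mul k u) x = w k x * rep u x"
  unfolding W_mul_def by (intro rep_cls square_int_w_mult square_int_rep)

lemma W_mul_cls: assumes "square_int f" shows "W_mul k (cls f) = cls (\<lambda>x. w k x * f x)"
  unfolding W_mul_def by (rule cls_cong) (use rep_cls[OF assms] in \<open>eventually_elim, simp\<close>)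

lemma W_mul_adj: "inner (W_mul k u) v = inner u (W_mul k v)"
proof -
  have "inner (W_mul k u) v = (LINT x|lborel. (w k x * rep u x) * rep v x)" for u v
    by (intro rep_inner_cong[OF rep_W_mul] square_int_w_mult square_int_rep)
  from this[of u v] this[of v u] show ?thesis by (simp add: inner_commute mult_ac)
qed

lemma W_mul_add: "W_mul k (u + v) = W_mul k u + W_mul k v"
  by (rule l2_eqI) (use rep_W_mul[of k "u + v"] rep_W_mul[of k u] rep_W_mul[of k v] rep_add[of u v] rep_add[of "W_mul k u" "W_mul k v"]
    in \<open>eventually_elim, simp add: ring_distribs\<close>)

lemma W_mul_linear: "bounded_linear (W_mul k)"
proof -
  obtain B where B: "\<forall>x. \<bar>w k x\<bar> \<le> B" using w_bounded ..
  show ?thesis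
  proof (rule bounded_linear_intro)
    show "W_mul k (c *\<^sub>R u) = c *\<^sub>R W_mul k u" for c u
      by (rule l2_eqI) (use rep_W_mul[of k "c *\<^sub>R u"] rep_W_mul[of k u] rep_scaleR[of c u] rep_scaleR[of c "W_mul k u"]
        in \<open>eventually_elim, simp\<close>)
    show "norm (W_mul k u) \<le> norm u * B" for u
    proof (rule power2_le_imp_le)
      have B0: "0 \<le> B" using B[rule_format, of 0] by linarith
      have "(norm (W_mul k u))\<^sup>2 = (LINT x|lborel. (w k x * rep u x)\<^sup>2)"
        unfolding W_mul_def by (intro norm_cls_sqr square_int_w_mult square_int_rep)
      also have "\<dots> \<le> (LINT x|lborel. B\<^sup>2 * (rep u x)\<^sup>2)"
      proof (rule integral_mono)
        show "integrable lborel (\<lambda>x. (w k x * rep u x)\<^sup>2)" using square_int_w_mult[OF square_int_rep] by (simp add: square_int_def)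
        show "integrable lborel (\<lambda>x. B\<^sup>2 * (rep u x)\<^sup>2)" using square_int_rep[of u] by (simp add: square_int_def)
        show "(w k x * rep u x)\<^sup>2 \<le> B\<^sup>2 * (rep u x)\<^sup>2" for x
          unfolding power_mult_distrib using B B0 by (intro mult_right_mono) (simp_all add: abs_le_square_iff[symmetric])
      qed
      also have "\<dots> = (norm u * B)\<^sup>2" using norm_cls_sqr[OF square_int_rep[of u]] by (simp add: power_mult_distrib)
      finally show "(norm (W_mul k u))\<^sup>2 \<le> (norm u * B)\<^sup>2" .
      show "0 \<le> norm u * B" using B0 by simp
    qed
  qed (rule W_mul_add)
qed

lemma W_mul_has_deriv: assumes "u \<in> l2_dom" shows "has_l2_deriv (W_mul k u) (W_mul (Suc k) u + W_mul k (l2_D u))"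
proof -
  obtain F where F: "abs_cont F (rep (l2_D u))" "AE x in lborel. rep u x = F x" using l2_domE[OF assms] .
  show ?thesis unfolding has_l2_deriv_abs_cont
  proof (intro exI conjI)
    show "AE x in lborel. rep (W_mul k u) x = w k x * F x" using rep_W_mul[of k u] F(2) by eventually_elim simp
    have "AE x in lborel. w (Suc k) x * F x + rep (l2_D u) x * w k x = rep (W_mul (Suc k) u + W_mul k (l2_D u)) x"
      using rep_add[of "W_mul (Suc k) u" "W_mul k (l2_D u)"] rep_W_mul[of "Suc k" u] rep_W_mul[of k "l2_D u"] F(2)
      by eventually_elim (simp add: mult.commute)
    then show "abs_cont (\<lambda>x. w k x * F x) (rep (W_mul (Suc k) u + W_mul k (l2_D u)))"
      by (rule abs_cont_cong[OF abs_cont_mult[OF w_abs_cont F(1)]]) simp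
  qed
qed

lemma W_force_eq: "W_force = - cls (w 3) + 6 *\<^sub>R W_mul 0 (cls (w 1))"
proof -
  have s: "square_int (w 3)" "square_int (w 1)" using w_square_int[of 2] w_square_int[of 0] by simp_all
  have 1: "- cls (w 3) = cls (\<lambda>x. - w 3 x)" using cls_scaleR[OF s(1), of "-1"] by simp
  have 2: "6 *\<^sub>R W_mul 0 (cls (w 1)) = cls (\<lambda>x. 6 * (w 0 x * w 1 x))"
    unfolding W_mul_cls[OF s(2)] by (rule cls_scaleR[OF square_int_w_mult[OF s(2)]])
  have "square_int (\<lambda>x. - w 3 x)" using square_int_scale[OF s(1), of "-1"] by simp
  then show ?thesis unfolding 1 2 W_force_def
    by (rule cls_add[OF _ square_int_scale[OF square_int_w_mult[OF s(2)]], symmetric])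
qed

text \<open>The span P of all w^(i+1) and all products w^(j) w^(i+1) lies in the domain, is mapped
  into itself by the derivative, and contains the forcing; so every iterated derivative stays in
  P.\<close>

lemma W_force_dom: "(l2_D ^^ k) W_force \<in> l2_dom"
proof -
  define P where "P = span (range (\<lambda>i. cls (w (Suc i))) \<union> range (\<lambda>(j, i). W_mul j (cls (w (Suc i)))))"
  have b1: "cls (w (Suc i)) \<in> P" and b2: "W_mul j (cls (w (Suc i))) \<in> P" for i j
    unfolding P_def by (rule span_base, force)+
  have h1: "has_l2_deriv (cls (w (Suc i))) (cls (w (Suc (Suc i))))" for i
    by (intro cls_has_l2_deriv w_abs_cont w_square_int)
  have step: "u \<in> l2_dom \<and> l2_D u \<in> P" if "u \<in> P" for u
    using that unfolding P_def
  proof (induction rule: span_induct_alt)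
    case base
    then show ?case using subspace_0[OF subspace_l2_dom] l2_D_scale[of 0 0] by (simp add: span_zero)
  next
    case (step c x y)
    have x: "x \<in> l2_dom \<and> l2_D x \<in> P"
      using step(1)
    proof
      assume "x \<in> range (\<lambda>i. cls (w (Suc i)))"
      then obtain i where "x = cls (w (Suc i))" ..
      then show ?thesis using has_l2_derivI[OF h1[of i]] b1 by simp
    next
      assume "x \<in> range (\<lambda>(j, i). W_mul j (cls (w (Suc i))))"
      then obtain j i where x: "x = W_mul j (cls (w (Suc i)))" by auto
      have d: "cls (w (Suc i)) \<in> l2_dom" "l2_D (cls (w (Suc i))) = cls (w (Suc (Suc i)))" by (rule has_l2_derivI[OF h1])+
      have "W_mul (Suc j) (cls (w (Suc i))) + W_mul j (cls (w (Suc (Suc i)))) \<in> P"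
        unfolding P_def by (rule span_add; fold P_def; rule b2)
      then show ?thesis using has_l2_derivI[OF W_mul_has_deriv[OF d(1), of j]] unfolding x d(2) by simp
    qed
    have y: "y \<in> l2_dom" "l2_D y \<in> P" using step.IH by (simp_all add: P_def)
    note cx = subspace_scale[OF subspace_l2_dom conjunct1[OF x], of c]
    have "c *\<^sub>R l2_D x + l2_D y \<in> P" using x y(2) unfolding P_def by (intro span_add span_scale) simp_all
    then show ?case using subspace_add[OF subspace_l2_dom cx y(1)] l2_D_add[OF cx y(1)] l2_D_scale[of x c] x by (simp add: P_def)
  qed
  have "W_force \<in> P" unfolding W_force_eq P_def
    using b1[of 2] b2[of 0 0] unfolding P_def by (intro span_add span_neg span_scale) simp_all
  then have "(l2_D ^^ k) W_force \<in> P" by (induction k) (simp_all add: step)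
  then show ?thesis using step by blast
qed

sublocale kdv_structure l2_dom l2_D l2_mul W_mul W_force
proof (rule kdv_structure.intro)
  show "f \<in> l2_dom ==> g \<in> l2_dom ==> l2_mul f g \<in> l2_dom" for f g by (intro has_l2_derivI(1)[OF l2_mul_has_deriv])
  show "f \<in> l2_dom ==> g \<in> l2_dom ==> l2_D (l2_mul f g) = l2_mul (l2_D f) g + l2_mul f (l2_D g)" for f g
    by (rule has_l2_derivI(2)[OF l2_mul_has_deriv])
  show "f \<in> l2_dom ==> W_mul k f \<in> l2_dom" for k f by (intro has_l2_derivI(1)[OF W_mul_has_deriv])
  show "f \<in> l2_dom ==> l2_D (W_mul k f) = W_mul (Suc k) f + W_mul k (l2_D f)" for k f
    by (rule has_l2_derivI(2)[OF W_mul_has_deriv])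
  show "f \<in> l2_dom \<and> l2_D f = g" if "\<And>n. u n \<in> l2_dom" "u \<longlonglongrightarrow> f" "(\<lambda>n. l2_D (u n)) \<longlonglongrightarrow> g" for u f g
    by (rule l2_D_closed[OF that])
qed (fact subspace_l2_dom l2_D_add l2_D_scale l2_D_skew l2_D_range l2_dom_dense l2_mul_commute l2_mul_add l2_mul_scale
    l2_mul_add_dom l2_mul_scale_dom dom_mul(3) l2_mul_adj W_mul_linear W_mul_adj W_force_dom)+

end

section \<open>Sobolev spaces\<close>

lemma weak_deriv_locally_int: "weak_deriv k f g ==> locally_int f" "weak_deriv k f g ==> locally_int g"
  by (simp_all add: weak_deriv_def)

lemma weak_derivD:
  "weak_deriv k f g ==> test_fun \<phi> ==> (LINT x|lborel. f x * (deriv ^^ k) \<phi> x) = (- 1) ^ k * (LINT x|lborel. g x * \<phi> x)"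
  by (simp add: weak_deriv_def)

lemma weak_deriv_unique:
  assumes w: "weak_deriv k f g" "weak_deriv k f' g'" and e: "AE x in lborel. f x = f' x"
  shows "AE x in lborel. g x = g' x"
proof -
  note l = weak_deriv_locally_int
  have "AE x in lborel. g x - g' x = 0"
  proof (rule du_Bois_Reymond_0)
    show "locally_int (\<lambda>x. g x - g' x)"
      by (rule locally_intI) (simp add: right_diff_distrib locally_int_interval l(2)[OF w(1)] l(2)[OF w(2)])
    fix \<phi> assume \<phi>: "test_fun \<phi>"
    have "(LINT x|lborel. f x * (deriv ^^ k) \<phi> x) = (LINT x|lborel. f' x * (deriv ^^ k) \<phi> x)"
      by (rule integral_mult_cong[OF e locally_int_measurable[OF l(1)[OF w(1)]] locally_int_measurable[OF l(1)[OF w(2)]]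
            test_fun_measurable[OF test_fun_deriv_pow[OF \<phi>]]])
    then have "(LINT x|lborel. g x * \<phi> x) = (LINT x|lborel. g' x * \<phi> x)"
      using weak_derivD[OF w(1) \<phi>] weak_derivD[OF w(2) \<phi>] by simp
    then show "(LINT x|lborel. (g x - g' x) * \<phi> x) = 0"
      using locally_int_test_integrable[OF l(2)[OF w(1)] \<phi>] locally_int_test_integrable[OF l(2)[OF w(2)] \<phi>]
      by (simp add: left_diff_distrib)
  qed
  then show ?thesis by eventually_elim simp
qed

lemma wderiv_eq: assumes "weak_deriv k f g" shows "AE x in lborel. wderiv k f x = g x" "weak_deriv k f (wderiv k f)"
proof -
  show w: "weak_deriv k f (wderiv k f)" unfolding wderiv_def by (rule someI[of "weak_deriv k f", OF assms])
  show "AE x in lborel. wderiv k f x = g x" by (rule weak_deriv_unique[OF w assms]) simp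
qed

lemma weak_deriv_cong:
  assumes w: "weak_deriv k f g" and e: "AE x in lborel. f' x = f x" and m: "f' \<in> borel_measurable lborel"
  shows "weak_deriv k f' g"
  using locally_int_cong[OF weak_deriv_locally_int(1)[OF w] e m] weak_deriv_locally_int(2)[OF w] weak_derivD[OF w]
    integral_mult_cong[OF e m locally_int_measurable[OF weak_deriv_locally_int(1)[OF w]] test_fun_measurable[OF test_fun_deriv_pow]]
  by (simp add: weak_deriv_def)

lemma weak_deriv_0: "locally_int f ==> weak_deriv 0 f f"
  by (simp add: weak_deriv_def)

lemma weak_deriv_Suc: assumes j: "weak_deriv j f g" and 1: "weak_deriv 1 g h" shows "weak_deriv (Suc j) f h"
  unfolding weak_deriv_def
proof (intro conjI allI impI)
  fix \<phi> assume \<phi>: "test_fun \<phi>"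
  show "(LINT x|lborel. f x * (deriv ^^ Suc j) \<phi> x) = (- 1) ^ Suc j * (LINT x|lborel. h x * \<phi> x)"
    using weak_derivD[OF j test_fun_deriv[OF \<phi>]] weak_derivD[OF 1 \<phi>] by (simp add: funpow_swap1)
qed (rule weak_deriv_locally_int[OF j] weak_deriv_locally_int[OF 1])+

text \<open>Testing the relation of order j with the derivative of a test function and comparing
  with order j + 1. It chains weak derivatives that are given order by order.\<close>

lemma weak_deriv_Suc_imp_1: assumes j: "weak_deriv j f g" and k: "weak_deriv (Suc j) f h" shows "weak_deriv 1 g h"
  unfolding weak_deriv_def
proof (intro conjI allI impI)
  fix \<phi> assume \<phi>: "test_fun \<phi>"
  show "(LINT x|lborel. g x * (deriv ^^ 1) \<phi> x) = (- 1) ^ 1 * (LINT x|lborel. h x * \<phi> x)"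
  proof -
    have "(- 1) ^ j * (LINT x|lborel. g x * deriv \<phi> x) = (- 1) ^ j * - (LINT x|lborel. h x * \<phi> x)"
      using weak_derivD[OF j test_fun_deriv[OF \<phi>]] weak_derivD[OF k \<phi>] by (simp add: funpow_swap1)
    then show ?thesis by (subst (asm) mult_left_cancel) simp_all
  qed
qed (rule weak_deriv_locally_int[OF j] weak_deriv_locally_int[OF k])+

lemma weak_deriv_add: assumes f: "weak_deriv k f f'" and g: "weak_deriv k g g'" shows "weak_deriv k (\<lambda>x. f x + g x) (\<lambda>x. f' x + g' x)"
proof -
  have l: "locally_int (\<lambda>x. u x + v x)" if "locally_int u" "locally_int v" for u v
    by (rule locally_intI) (simp add: distrib_left locally_int_interval that)
  note lf = weak_deriv_locally_int[OF f] and lg = weak_deriv_locally_int[OF g]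
  show ?thesis unfolding weak_deriv_def
  proof (intro conjI allI impI)
    fix \<phi> assume \<phi>: "test_fun \<phi>"
    note p = test_fun_deriv_pow[OF \<phi>, of k]
    show "(LINT x|lborel. (f x + g x) * (deriv ^^ k) \<phi> x) = (- 1) ^ k * (LINT x|lborel. (f' x + g' x) * \<phi> x)"
      using weak_derivD[OF f \<phi>] weak_derivD[OF g \<phi>] locally_int_test_integrable[OF lf(1) p] locally_int_test_integrable[OF lg(1) p]
        locally_int_test_integrable[OF lf(2) \<phi>] locally_int_test_integrable[OF lg(2) \<phi>]
      by (simp add: distrib_right distrib_left)
  qed (intro l lf lg)+
qed

text \<open>Links the difference quotients of \<open>has_time_deriv\<close> with derivatives in the
  Hilbert space; the value at \<tau> = t, where the quotient divides by 0, is invisible to the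
  filter.\<close>

lemma has_vector_derivative_iff_quotient:
  fixes f :: "real => 'a::real_normed_vector"
  shows "(f has_vector_derivative f') (at t within S) \<longleftrightarrow>
    ((\<lambda>\<tau>. norm ((1 / (\<tau> - t)) *\<^sub>R (f \<tau> - f t) - f')) \<longlongrightarrow> 0) (at t within S)"
proof -
  have e: "\<forall>\<^sub>F \<tau> in at t within S. norm ((1 / norm (\<tau> - t)) *\<^sub>R (f \<tau> - (f t + (\<tau> - t) *\<^sub>R f'))) = norm ((1 / (\<tau> - t)) *\<^sub>R (f \<tau> - f t) - f')"
    unfolding eventually_at_filter
  proof (intro always_eventually allI impI)
    fix \<tau> :: real assume "\<tau> \<noteq> t"
    then have "(1 / (\<tau> - t)) *\<^sub>R (f \<tau> - f t) - f' = (1 / (\<tau> - t)) *\<^sub>R (f \<tau> - (f t + (\<tau> - t) *\<^sub>R f'))"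
      by (simp add: scaleR_diff_right scaleR_add_right)
    then show "norm ((1 / norm (\<tau> - t)) *\<^sub>R (f \<tau> - (f t + (\<tau> - t) *\<^sub>R f'))) = norm ((1 / (\<tau> - t)) *\<^sub>R (f \<tau> - f t) - f')" by simp
  qed
  have "(f has_vector_derivative f') (at t within S) \<longleftrightarrow>
    ((\<lambda>\<tau>. (1 / norm (\<tau> - t)) *\<^sub>R (f \<tau> - (f t + (\<tau> - t) *\<^sub>R f'))) \<longlongrightarrow> 0) (at t within S)"
    unfolding has_vector_derivative_def has_derivative_within by (simp add: bounded_linear_scaleR_left)
  also have "\<dots> \<longleftrightarrow> ((\<lambda>\<tau>. norm ((1 / norm (\<tau> - t)) *\<^sub>R (f \<tau> - (f t + (\<tau> - t) *\<^sub>R f')))) \<longlongrightarrow> 0) (at t within S)"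
    by (rule tendsto_norm_zero_iff[symmetric])
  also have "\<dots> \<longleftrightarrow> ((\<lambda>\<tau>. norm ((1 / (\<tau> - t)) *\<^sub>R (f \<tau> - f t) - f')) \<longlongrightarrow> 0) (at t within S)"
    by (rule tendsto_cong[OF e])
  finally show ?thesis .
qed

context background begin

lemma H_weak_deriv: assumes "u \<in> H k" "j \<le> k" shows "weak_deriv j (rep u) (rep ((l2_D ^^ j) u))"
  using assms(2)
proof (induction j)
  case 0 show ?case by (simp add: weak_deriv_0 square_int_locally_int)
next
  case (Suc j)
  have "has_l2_deriv ((l2_D ^^ j) u) ((l2_D ^^ Suc j) u)" using l2_dom_deriv[OF Dp_dom[OF assms(1), of j]] Suc.prems by simp
  then show ?case using Suc weak_deriv_Suc unfolding has_l2_deriv_def by simp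
qed

lemma sobolev_weak_deriv:
  assumes "square_int f" "cls f \<in> H k" "j \<le> k" shows "weak_deriv j f (rep ((l2_D ^^ j) (cls f)))"
proof (rule weak_deriv_cong[OF H_weak_deriv[OF assms(2,3)]])
  show "AE x in lborel. f x = rep (cls f) x" using rep_cls[OF assms(1)] by eventually_elim simp
qed (rule square_int_measurable[OF assms(1)])

text \<open>\<open>sobolev\<close> asks for each weak derivative separately;
  \<open>weak_deriv_Suc_imp_1\<close> shows that consecutive ones are related by the first-order
  operator, which is what \<open>H k\<close> iterates.\<close>

lemma sobolev_iff: "f \<in> sobolev k \<longleftrightarrow> square_int f \<and> cls f \<in> H k"
proof
  assume f: "f \<in> sobolev k"
  then have sq: "square_int f" by (simp add: sobolev_def)
  have "\<forall>j. \<exists>g. j \<le> k --> weak_deriv j f g \<and> square_int g" using f by (auto simp: sobolev_def)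
  then obtain g where g: "\<forall>j. j \<le> k --> weak_deriv j f (g j) \<and> square_int (g j)" by (rule choice[THEN exE])
  have hd: "has_l2_deriv (cls (g j)) (cls (g (Suc j)))" if "Suc j \<le> k" for j
  proof -
    have w: "weak_deriv 1 (g j) (g (Suc j))" using g that by (intro weak_deriv_Suc_imp_1[of j f]) auto
    have s: "square_int (g j)" "square_int (g (Suc j))" using g that by auto
    obtain G where G: "abs_cont G (g (Suc j))" "AE x in lborel. g j x = G x"
      using w unfolding weak_deriv_1_iff[OF square_int_measurable[OF s(1)]] by (elim exE conjE)
    have G': "AE x in lborel. G x = g j x" using G(2) by eventually_elim simp
    have "square_int G" by (rule square_int_cong[OF s(1) G' abs_cont_measurable[OF G(1)]])
    then show ?thesis using cls_has_l2_deriv[OF G(1) _ s(2)] cls_cong[OF G(2)] by simp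
  qed
  have c: "(l2_D ^^ j) (cls f) = cls (g j)" if "j \<le> k" for j
    using that
  proof (induction j)
    case 0
    have "AE x in lborel. f x = g 0 x"
      by (rule weak_deriv_unique[OF weak_deriv_0[OF square_int_locally_int[OF sq]], of f]) (use g in auto)
    then show ?case using cls_cong by simp
  next
    case (Suc j) then show ?case using has_l2_derivI(2)[OF hd[of j]] by simp
  qed
  then have "cls f \<in> H k" unfolding H_iff using has_l2_derivI(1)[OF hd] by simp
  then show "square_int f \<and> cls f \<in> H k" using sq by simp
next
  assume "square_int f \<and> cls f \<in> H k"
  then show "f \<in> sobolev k" using sobolev_weak_deriv square_int_rep unfolding sobolev_def by blast
qed

lemma sobolev_norm_eq:
  assumes "f \<in> sobolev k" shows "sobolev_norm k f = L2_set (\<lambda>j. norm ((l2_D ^^ j) (cls f))) {..k}"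
proof -
  have f: "square_int f" "cls f \<in> H k" using assms by (auto simp: sobolev_iff)
  have "(LINT x|lborel. (wderiv j f x)\<^sup>2) = (norm ((l2_D ^^ j) (cls f)))\<^sup>2" if "j \<le> k" for j
  proof -
    note w = wderiv_eq[OF sobolev_weak_deriv[OF f that]]
    have "(LINT x|lborel. (wderiv j f x)\<^sup>2) = (LINT x|lborel. (rep ((l2_D ^^ j) (cls f)) x)\<^sup>2)"
      by (rule integral_cong_AE) (use w(1) locally_int_measurable[OF weak_deriv_locally_int(2)[OF w(2)]] in \<open>auto elim: eventually_mono\<close>)
    then show ?thesis using norm_cls_sqr[OF square_int_rep] by simp
  qed
  then show ?thesis by (simp add: sobolev_norm_def L2_set_def)
qed

lemma norm_Dp_le_sobolev_norm: "f \<in> sobolev k ==> j \<le> k ==> norm ((l2_D ^^ j) (cls f)) \<le> sobolev_norm k f"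
  unfolding sobolev_norm_eq by (rule member_le_L2_set) auto

lemma hn_le_sobolev_norm: "f \<in> sobolev k ==> hn k (cls f) \<le> 2 * sobolev_norm k f"
  using norm_Dp_le_sobolev_norm[of f k 0] norm_Dp_le_sobolev_norm[of f k k] by (simp add: hn_def)

lemma sobolev_norm_le_sum: "f \<in> sobolev k ==> sobolev_norm k f \<le> (\<Sum>j\<le>k. norm ((l2_D ^^ j) (cls f)))"
  unfolding sobolev_norm_eq by (rule L2_set_le_sum) simp

lemma sobolev_norm_le_hn: assumes "f \<in> sobolev k" shows "sobolev_norm k f \<le> (real k + 1) * hn k (cls f)"
proof -
  have "(\<Sum>j\<le>k. norm ((l2_D ^^ j) (cls f))) \<le> of_nat (card {..k}) * hn k (cls f)"
    by (rule sum_bounded_above) (use assms interpolation in \<open>auto simp: sobolev_iff\<close>)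
  then show ?thesis using sobolev_norm_le_sum[OF assms] by (simp add: add.commute)
qed

lemma sobolev_norm_nonneg: "0 \<le> sobolev_norm k f"
  by (simp add: sobolev_norm_def sum_nonneg)

lemma sobolev_diff:
  assumes "f \<in> sobolev k" "g \<in> sobolev k"
  shows "(\<lambda>x. f x - g x) \<in> sobolev k" "cls (\<lambda>x. f x - g x) = cls f - cls g"
proof -
  have s: "square_int f" "square_int g" "cls f \<in> H k" "cls g \<in> H k" using assms by (auto simp: sobolev_iff)
  show c: "cls (\<lambda>x. f x - g x) = cls f - cls g" by (rule cls_diff[OF s(1,2), symmetric])
  show "(\<lambda>x. f x - g x) \<in> sobolev k" unfolding sobolev_iff c by (intro conjI square_int_diff s H_diff)
qed

lemma sobolev_divide:
  assumes "f \<in> sobolev k" shows "(\<lambda>x. f x / c) \<in> sobolev k" "cls (\<lambda>x. f x / c) = (1 / c) *\<^sub>R cls f"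
proof -
  have s: "square_int f" "cls f \<in> H k" using assms by (auto simp: sobolev_iff)
  show c: "cls (\<lambda>x. f x / c) = (1 / c) *\<^sub>R cls f" using cls_scaleR[OF s(1), of "1 / c"] by simp
  show "(\<lambda>x. f x / c) \<in> sobolev k" unfolding sobolev_iff c
    using square_int_scale[OF s(1), of "1 / c"] H_scale[OF s(2)] by simp
qed

lemma rep_sobolev: "v \<in> H k ==> rep v \<in> sobolev k"
  by (simp add: sobolev_iff)

lemma sobolev_mono: "f \<in> sobolev k ==> j \<le> k ==> f \<in> sobolev j"
  using H_mono by (auto simp: sobolev_iff)

text \<open>The Sobolev norm of the quotient error tends to 0 exactly if each of its derivatives
  does, since it is the Euclidean norm of their L^2 norms; each order is then a statement in the
  Hilbert space.\<close>

lemma has_time_deriv_iff: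
  assumes q: "\<And>\<tau>. \<tau> \<in> J ==> q \<tau> \<in> sobolev r" and v: "v \<in> sobolev r" and t: "t \<in> J"
  shows "has_time_deriv r q v t J \<longleftrightarrow>
    (\<forall>j\<le>r. ((\<lambda>\<tau>. (l2_D ^^ j) (cls (q \<tau>))) has_vector_derivative (l2_D ^^ j) (cls v)) (at t within J))"
proof -
  have df: "(\<lambda>x. q \<tau> x - q t x) \<in> sobolev r" "cls (\<lambda>x. q \<tau> x - q t x) = cls (q \<tau>) - cls (q t)" if "\<tau> \<in> J" for \<tau>
    using sobolev_diff[OF q[OF that] q[OF t]] by auto
  define e where "e \<tau> x = (q \<tau> x - q t x) / (\<tau> - t) - v x" for \<tau> x
  have e: "e \<tau> \<in> sobolev r" "cls (e \<tau>) = (1 / (\<tau> - t)) *\<^sub>R (cls (q \<tau>) - cls (q t)) - cls v" if "\<tau> \<in> J" for \<tau>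
    using sobolev_diff[OF sobolev_divide(1)[OF df(1)[OF that], of "\<tau> - t"] v] sobolev_divide(2)[OF df(1)[OF that], of "\<tau> - t"] df(2)[OF that]
    unfolding e_def by auto
  have De: "(l2_D ^^ j) (cls (e \<tau>)) = (1 / (\<tau> - t)) *\<^sub>R ((l2_D ^^ j) (cls (q \<tau>)) - (l2_D ^^ j) (cls (q t))) - (l2_D ^^ j) (cls v)"
    if "\<tau> \<in> J" "j \<le> r" for \<tau> j
  proof -
    have H: "cls (q \<tau>) \<in> H r" "cls (q t) \<in> H r" "cls v \<in> H r" using q[OF that(1)] q[OF t] v by (auto simp: sobolev_iff)
    show ?thesis unfolding e(2)[OF that(1)]
      using Dp_diff[OF H_scale[OF H_diff[OF H(1,2)]] H(3) that(2), of "1 / (\<tau> - t)"] Dp_scale[OF H_diff[OF H(1,2)] that(2), of "1 / (\<tau> - t)"]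
        Dp_diff[OF H(1,2) that(2)] by simp
  qed
  have J: "\<forall>\<^sub>F \<tau> in at t within J. \<tau> \<in> J" by (simp add: eventually_at_filter)
  have "((\<lambda>\<tau>. sobolev_norm r (e \<tau>)) \<longlongrightarrow> 0) (at t within J) \<longleftrightarrow>
    (\<forall>j\<le>r. ((\<lambda>\<tau>. norm ((l2_D ^^ j) (cls (e \<tau>)))) \<longlongrightarrow> 0) (at t within J))"
  proof (intro iffI allI impI)
    fix j assume l: "((\<lambda>\<tau>. sobolev_norm r (e \<tau>)) \<longlongrightarrow> 0) (at t within J)" and j: "j \<le> r"
    show "((\<lambda>\<tau>. norm ((l2_D ^^ j) (cls (e \<tau>)))) \<longlongrightarrow> 0) (at t within J)"
    proof (rule Lim_null_comparison[OF _ l])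
      show "\<forall>\<^sub>F \<tau> in at t within J. norm (norm ((l2_D ^^ j) (cls (e \<tau>)))) \<le> sobolev_norm r (e \<tau>)"
        using J by eventually_elim (simp add: norm_Dp_le_sobolev_norm e(1) j)
    qed
  next
    assume l: "\<forall>j\<le>r. ((\<lambda>\<tau>. norm ((l2_D ^^ j) (cls (e \<tau>)))) \<longlongrightarrow> 0) (at t within J)"
    show "((\<lambda>\<tau>. sobolev_norm r (e \<tau>)) \<longlongrightarrow> 0) (at t within J)"
    proof (rule Lim_null_comparison)
      show "\<forall>\<^sub>F \<tau> in at t within J. norm (sobolev_norm r (e \<tau>)) \<le> (\<Sum>j\<le>r. norm ((l2_D ^^ j) (cls (e \<tau>))))"
        using J by eventually_elim (simp add: sobolev_norm_nonneg sobolev_norm_le_sum e(1))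
      show "((\<lambda>\<tau>. \<Sum>j\<le>r. norm ((l2_D ^^ j) (cls (e \<tau>)))) \<longlongrightarrow> 0) (at t within J)"
        using l by (intro tendsto_null_sum) auto
    qed
  qed
  also have "\<dots> \<longleftrightarrow> (\<forall>j\<le>r. ((\<lambda>\<tau>. (l2_D ^^ j) (cls (q \<tau>))) has_vector_derivative (l2_D ^^ j) (cls v)) (at t within J))"
  proof (intro all_cong1 imp_cong refl)
    fix j assume j: "j \<le> r"
    have "\<forall>\<^sub>F \<tau> in at t within J. norm ((l2_D ^^ j) (cls (e \<tau>)))
       = norm ((1 / (\<tau> - t)) *\<^sub>R ((l2_D ^^ j) (cls (q \<tau>)) - (l2_D ^^ j) (cls (q t))) - (l2_D ^^ j) (cls v))"
      using J by eventually_elim (simp add: De j)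
    then show "((\<lambda>\<tau>. norm ((l2_D ^^ j) (cls (e \<tau>)))) \<longlongrightarrow> 0) (at t within J) \<longleftrightarrow>
      ((\<lambda>\<tau>. (l2_D ^^ j) (cls (q \<tau>))) has_vector_derivative (l2_D ^^ j) (cls v)) (at t within J)"
      unfolding has_vector_derivative_iff_quotient by (rule tendsto_cong)
  qed
  finally show ?thesis using v df(1) by (simp add: has_time_deriv_def e_def[abs_def])
qed

lemma w_locally_int: "locally_int (w k)"
  by (rule abs_cont_self_locally_int[OF w_abs_cont])

lemma w_weak_deriv: "weak_deriv k (w 0) (w k)"
proof (induction k)
  case 0 show ?case by (rule weak_deriv_0[OF w_locally_int])
next
  case (Suc k)
  have "weak_deriv 1 (w k) (w (Suc k))"
    using w_abs_cont[of k] weak_deriv_1_iff[of "w k" "w (Suc k)"] by auto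
  then show ?case by (rule weak_deriv_Suc[OF Suc])
qed

text \<open>p + W need not be square integrable, so its weak derivatives are found in the locally
  integrable setting; the choice in \<open>wderiv\<close> is fixed up to null sets. Every term of
  the expansion is then square integrable, because W occurs only differentiated or times p or
  p'.\<close>

lemma kdv_rhs_eq:
  assumes "p \<in> sobolev 3"
  shows "square_int (kdv_rhs (\<lambda>x. p x + w 0 x))" "cls (kdv_rhs (\<lambda>x. p x + w 0 x)) = F (cls p)"
proof -
  have p: "square_int p" "cls p \<in> H 3" using assms by (auto simp: sobolev_iff)
  define v where "v = cls p"
  have v: "v \<in> l2_dom" "l2_D v \<in> l2_dom" "l2_D (l2_D v) \<in> l2_dom" using p(2) Dp_dom[of v 3 0] Dp_dom[of v 3 1] Dp_dom[of v 3 2]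
    by (auto simp: v_def eval_nat_numeral)
  have m: "p \<in> borel_measurable lborel" by (rule square_int_measurable[OF p(1)])
  note w3 = wderiv_eq[OF weak_deriv_add[OF sobolev_weak_deriv[OF p(1) p(2), of 3] w_weak_deriv[of 3]], OF order_refl]
  note w1 = wderiv_eq[OF weak_deriv_add[OF sobolev_weak_deriv[OF p(1) p(2), of 1] w_weak_deriv[of 1]]]
  have w1': "AE x in lborel. wderiv 1 (\<lambda>x. p x + w 0 x) x = rep (l2_D v) x + w 1 x"
    "weak_deriv 1 (\<lambda>x. p x + w 0 x) (wderiv 1 (\<lambda>x. p x + w 0 x))"
    using w1 by (simp_all add: v_def)
  have w3': "AE x in lborel. wderiv 3 (\<lambda>x. p x + w 0 x) x = rep (l2_D (l2_D (l2_D v))) x + w 3 x"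
    using w3(1) by (simp add: v_def eval_nat_numeral)
  have meas: "kdv_rhs (\<lambda>x. p x + w 0 x) \<in> borel_measurable lborel"
    unfolding kdv_rhs_def using m locally_int_measurable[OF weak_deriv_locally_int(2)[OF w3(2)]]
      locally_int_measurable[OF weak_deriv_locally_int(2)[OF w1'(2)]]
    by (intro borel_measurable_add borel_measurable_times borel_measurable_uminus) simp_all
  have force: "AE x in lborel. rep W_force x = - w 3 x + 6 * (w 0 x * w 1 x)"
  proof -
    have s: "square_int (w 3)" "square_int (w 1)" using w_square_int[of 2] w_square_int[of 0] by simp_all
    have "square_int (\<lambda>x. - 1 * w 3 x + 6 * (w 0 x * w 1 x))" by (intro square_int_add square_int_scale square_int_w_mult s)
    then show ?thesis unfolding W_force_def by (intro rep_cls) simp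
  qed
  have FX: "F v = - l2_D (l2_D (l2_D v)) + 6 *\<^sub>R (W_mul 1 v + W_mul 0 (l2_D v)) + 6 *\<^sub>R l2_mul v (l2_D v) + W_force"
    using DX[of v] p(2) D_m[OF v(1), of 0] by (simp add: F_def v_def)
  have e: "AE x in lborel. kdv_rhs (\<lambda>x. p x + w 0 x) x = rep (F v) x"
    unfolding FX
    using w3' w1'(1) force rep_cls[OF p(1)]
      rep_add[of "- l2_D (l2_D (l2_D v)) + 6 *\<^sub>R (W_mul 1 v + W_mul 0 (l2_D v)) + 6 *\<^sub>R l2_mul v (l2_D v)" W_force]
      rep_add[of "- l2_D (l2_D (l2_D v)) + 6 *\<^sub>R (W_mul 1 v + W_mul 0 (l2_D v))" "6 *\<^sub>R l2_mul v (l2_D v)"]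
      rep_add[of "- l2_D (l2_D (l2_D v))" "6 *\<^sub>R (W_mul 1 v + W_mul 0 (l2_D v))"]
      rep_uminus[of "l2_D (l2_D (l2_D v))"] rep_scaleR[of 6 "W_mul 1 v + W_mul 0 (l2_D v)"] rep_scaleR[of 6 "l2_mul v (l2_D v)"]
      rep_add[of "W_mul 1 v" "W_mul 0 (l2_D v)"] rep_W_mul[of 1 v] rep_W_mul[of 0 "l2_D v"] rep_mul[OF v(1), of "l2_D v"]
  proof eventually_elim
    case (elim x)
    have "rep v x = p x" using elim(4) by (simp add: v_def)
    then show ?case unfolding kdv_rhs_def elim by (simp add: algebra_simps)
  qed
  show "square_int (kdv_rhs (\<lambda>x. p x + w 0 x))" by (rule square_int_cong[OF square_int_rep e meas])
  then show "cls (kdv_rhs (\<lambda>x. p x + w 0 x)) = F (cls p)" using cls_eqI[OF _ e] by (simp add: v_def)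
qed

lemma C_sobolev_continuous:
  assumes "p \<in> C_sobolev T k" "j \<le> k" shows "continuous_on {-T..T} (\<lambda>t. (l2_D ^^ j) (cls (p t)))"
  unfolding continuous_on_def
proof
  fix t assume t: "t \<in> {-T..T}"
  have ps: "p \<tau> \<in> sobolev k" if "\<tau> \<in> {-T..T}" for \<tau> using assms(1) that by (simp add: C_sobolev_def)
  have lim: "((\<lambda>\<tau>. sobolev_norm k (\<lambda>x. p \<tau> x - p t x)) \<longlongrightarrow> 0) (at t within {-T..T})"
    using assms(1) t by (simp add: C_sobolev_def)
  have "((\<lambda>\<tau>. (l2_D ^^ j) (cls (p \<tau>)) - (l2_D ^^ j) (cls (p t))) \<longlongrightarrow> 0) (at t within {-T..T})"
  proof (rule Lim_null_comparison[OF _ lim])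
    have "\<forall>\<^sub>F \<tau> in at t within {-T..T}. \<tau> \<in> {-T..T}" by (simp add: eventually_at_filter)
    then show "\<forall>\<^sub>F \<tau> in at t within {-T..T}. norm ((l2_D ^^ j) (cls (p \<tau>)) - (l2_D ^^ j) (cls (p t))) \<le> sobolev_norm k (\<lambda>x. p \<tau> x - p t x)"
    proof eventually_elim
      case (elim \<tau>)
      have "cls (p \<tau>) \<in> H k" "cls (p t) \<in> H k" using ps[OF elim] ps[OF t] by (auto simp: sobolev_iff)
      then show ?case using norm_Dp_le_sobolev_norm[OF sobolev_diff(1)[OF ps[OF elim] ps[OF t]] assms(2)]
        by (simp add: sobolev_diff(2)[OF ps[OF elim] ps[OF t]] Dp_diff[OF _ _ assms(2)])
    qed
  qed
  then show "((\<lambda>\<tau>. (l2_D ^^ j) (cls (p \<tau>))) \<longlongrightarrow> (l2_D ^^ j) (cls (p t))) (at t within {-T..T})" by (rule Lim_null[THEN iffD2])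
qed

lemma C_sobolevI:
  assumes p: "\<And>t. t \<in> {-T..T} ==> p t \<in> sobolev k"
    and c: "\<And>j. j \<le> k ==> continuous_on {-T..T} (\<lambda>t. (l2_D ^^ j) (cls (p t)))"
  shows "p \<in> C_sobolev T k"
  unfolding C_sobolev_def
proof (intro CollectI conjI ballI p)
  fix t assume t: "t \<in> {-T..T}"
  show "((\<lambda>\<tau>. sobolev_norm k (\<lambda>x. p \<tau> x - p t x)) \<longlongrightarrow> 0) (at t within {-T..T})"
  proof (rule Lim_null_comparison)
    have "\<forall>\<^sub>F \<tau> in at t within {-T..T}. \<tau> \<in> {-T..T}" by (simp add: eventually_at_filter)
    then show "\<forall>\<^sub>F \<tau> in at t within {-T..T}. norm (sobolev_norm k (\<lambda>x. p \<tau> x - p t x)) \<le> (\<Sum>j\<le>k. norm ((l2_D ^^ j) (cls (p \<tau>)) - (l2_D ^^ j) (cls (p t))))"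
    proof eventually_elim
      case (elim \<tau>)
      have "cls (p \<tau>) \<in> H k" "cls (p t) \<in> H k" using p[OF elim] p[OF t] by (auto simp: sobolev_iff)
      then show ?case using sobolev_norm_le_sum[OF sobolev_diff(1)[OF p[OF elim] p[OF t]]]
        by (simp add: sobolev_diff(2)[OF p[OF elim] p[OF t]] Dp_diff sobolev_norm_nonneg)
    qed
    have "((\<lambda>\<tau>. norm ((l2_D ^^ j) (cls (p \<tau>)) - (l2_D ^^ j) (cls (p t)))) \<longlongrightarrow> 0) (at t within {-T..T})" if "j \<le> k" for j
      using c[OF that] t unfolding continuous_on_def by (intro tendsto_norm_zero Lim_null[THEN iffD1]) blast
    then show "((\<lambda>\<tau>. \<Sum>j\<le>k. norm ((l2_D ^^ j) (cls (p \<tau>)) - (l2_D ^^ j) (cls (p t)))) \<longlongrightarrow> 0) (at t within {-T..T})"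
      by (intro tendsto_null_sum) auto
  qed
qed

definition kdv_flow :: "nat => (real => real) => real => real => real" where
  "kdv_flow s p0 t = rep (ext_flow s (cls p0) t)"

lemma kdv_flow_sobolev: assumes "s \<ge> 3" "p0 \<in> sobolev s" shows "kdv_flow s p0 t \<in> sobolev s"
proof -
  have "ext_flow s (cls p0) t \<in> H s"
    by (rule ext_flow_limit(2)[of "\<bar>t\<bar> + 1", OF _ assms(1) _ order_refl]) (use assms(2) in \<open>auto simp: sobolev_iff\<close>)
  then show ?thesis unfolding kdv_flow_def by (rule rep_sobolev)
qed

lemma kdv_flow_0: assumes "s \<ge> 3" "p0 \<in> sobolev s" shows "AE x in lborel. kdv_flow s p0 0 x = p0 x"
proof -
  have "ext_flow s (cls p0) 0 = cls p0" using assms by (intro ext_flow_0) (auto simp: sobolev_iff)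
  then show ?thesis using assms(2) rep_cls[of p0] by (simp add: kdv_flow_def sobolev_iff)
qed

lemma kdv_flow_C_sobolev: assumes "T > 0" "s \<ge> 3" "p0 \<in> sobolev s" shows "kdv_flow s p0 \<in> C_sobolev T s"
proof (rule C_sobolevI[OF kdv_flow_sobolev[OF assms(2,3)]])
  show "continuous_on {-T..T} (\<lambda>t. (l2_D ^^ j) (cls (kdv_flow s p0 t)))" if "j \<le> s" for j
    using ext_flow_continuous[OF assms(1,2) _ that] assms(3) by (simp add: kdv_flow_def sobolev_iff)
qed

lemma kdv_rhs_sobolev: assumes "s \<ge> 3" "p \<in> sobolev s" shows "kdv_rhs (\<lambda>x. p x + w 0 x) \<in> sobolev (s - 3)"
proof -
  have "cls p \<in> H (s - 3 + 3)" using assms by (simp add: sobolev_iff)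
  then have "F (cls p) \<in> H (s - 3)" by (rule F_H)
  then show ?thesis using kdv_rhs_eq[OF sobolev_mono[OF assms(2,1)]] by (simp add: sobolev_iff)
qed

lemma kdv_flow_solves: assumes s: "s \<ge> 3" and p0: "p0 \<in> sobolev s" shows "solves_perturbed_kdv (w 0) s UNIV (kdv_flow s p0)"
  unfolding solves_perturbed_kdv_def
proof
  fix t
  note q = kdv_flow_sobolev[OF s p0]
  have f: "cls p0 \<in> H s" using p0 by (simp add: sobolev_iff)
  have q': "kdv_flow s p0 \<tau> \<in> sobolev (s - 3)" for \<tau> using sobolev_mono[OF q] by simp
  have "((\<lambda>\<tau>. (l2_D ^^ j) (cls (kdv_flow s p0 \<tau>))) has_vector_derivative
      (l2_D ^^ j) (cls (kdv_rhs (\<lambda>x. kdv_flow s p0 t x + w 0 x)))) (at t)" if "j \<le> s - 3" for j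
  proof -
    \<comment> \<open>t is interior to this interval, so the derivative within it is the two-sided
      one.\<close>
    let ?T = "\<bar>t\<bar> + 1"
    have T: "0 < ?T" and t: "t \<in> {- ?T..?T}" by auto
    have "((\<lambda>\<tau>. (l2_D ^^ j) (cls (kdv_flow s p0 \<tau>))) has_vector_derivative
      (l2_D ^^ j) (cls (kdv_rhs (\<lambda>x. kdv_flow s p0 t x + w 0 x)))) (at t within {- ?T..?T})"
      using ext_flow_derivative[OF T s f that t] unfolding kdv_rhs_eq(2)[OF sobolev_mono[OF q s]]
      by (simp add: kdv_flow_def)
    moreover have "at t within {- ?T..?T} = at t" by (rule at_within_interior) auto
    ultimately show ?thesis by simp
  qed
  then show "has_time_deriv (s - 3) (kdv_flow s p0) (kdv_rhs (\<lambda>x. kdv_flow s p0 t x + w 0 x)) t UNIV"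
    by (subst has_time_deriv_iff[OF q' kdv_rhs_sobolev[OF s q]]) auto
qed

text \<open>\<open>uniqueness\<close> asks for a common H^3 bound, which continuity into H^s on the
  compact time interval supplies for both curves.\<close>

lemma kdv_flow_unique:
  assumes T: "T > 0" and s: "s \<ge> 3" and p0: "p0 \<in> sobolev s" and p: "p \<in> C_sobolev T s"
    and sol: "solves_perturbed_kdv (w 0) s {-T..T} p" and init: "AE x in lborel. p 0 x = p0 x" and t: "t \<in> {-T..T}"
  shows "AE x in lborel. p t x = kdv_flow s p0 t x"
proof -
  note kf = kdv_flow_C_sobolev[OF T s p0]
  have bounded: "\<exists>B. \<forall>t\<in>{-T..T}. hn 3 (cls (q t)) \<le> B" if "q \<in> C_sobolev T s" for q
  proof -
    have "continuous_on {-T..T} (\<lambda>t. hn 3 (cls (q t)))" unfolding hn_def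
      using C_sobolev_continuous[OF that, of 0] C_sobolev_continuous[OF that, of 3] s by (intro continuous_intros) auto
    then have "bounded ((\<lambda>t. hn 3 (cls (q t))) ` {-T..T})" by (intro compact_imp_bounded compact_continuous_image) auto
    then obtain B where "\<forall>x\<in>(\<lambda>t. hn 3 (cls (q t))) ` {-T..T}. norm x \<le> B" unfolding bounded_iff ..
    then show ?thesis by (intro exI[of _ B]) auto
  qed
  obtain B1 where B1: "\<forall>t\<in>{-T..T}. hn 3 (cls (p t)) \<le> B1" using bounded[OF p] ..
  obtain B2 where B2: "\<forall>t\<in>{-T..T}. hn 3 (cls (kdv_flow s p0 t)) \<le> B2" using bounded[OF kf] ..
  have *: "cls (q t) \<in> H 3 \<and> hn 3 (cls (q t)) \<le> max B1 B2 \<and>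
      ((\<lambda>t. cls (q t)) has_vector_derivative F (cls (q t))) (at t within {-T..T})"
    if q: "q \<in> C_sobolev T s" "\<forall>t\<in>{-T..T}. has_time_deriv (s - 3) q (kdv_rhs (\<lambda>x. q t x + w 0 x)) t {-T..T}"
      and B: "\<forall>t\<in>{-T..T}. hn 3 (cls (q t)) \<le> max B1 B2" and t: "t \<in> {-T..T}" for q t
  proof -
    have qs: "q \<tau> \<in> sobolev s" if "\<tau> \<in> {-T..T}" for \<tau> using q(1) that by (simp add: C_sobolev_def)
    have qs': "q \<tau> \<in> sobolev (s - 3)" if "\<tau> \<in> {-T..T}" for \<tau> using sobolev_mono[OF qs[OF that]] by simp
    have q3: "q t \<in> sobolev 3" by (rule sobolev_mono[OF qs[OF t] s])
    have "((\<lambda>\<tau>. cls (q \<tau>)) has_vector_derivative F (cls (q t))) (at t within {-T..T})"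
      using has_time_deriv_iff[of "{-T..T}" q "s - 3", OF qs' kdv_rhs_sobolev[OF s qs[OF t]] t] q(2) t kdv_rhs_eq(2)[OF q3] by (auto dest: spec[of _ 0])
    then show ?thesis using q3 B t by (simp add: sobolev_iff)
  qed
  have B: "\<forall>t\<in>{-T..T}. hn 3 (cls (p t)) \<le> max B1 B2" "\<forall>t\<in>{-T..T}. hn 3 (cls (kdv_flow s p0 t)) \<le> max B1 B2"
    using B1 B2 by (auto simp: le_max_iff_disj)
  have sp: "\<forall>t\<in>{-T..T}. has_time_deriv (s - 3) p (kdv_rhs (\<lambda>x. p t x + w 0 x)) t {-T..T}"
    using sol by (simp add: solves_perturbed_kdv_def)
  have sk: "\<forall>t\<in>{-T..T}. has_time_deriv (s - 3) (kdv_flow s p0) (kdv_rhs (\<lambda>x. kdv_flow s p0 t x + w 0 x)) t {-T..T}"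
  proof
    fix t
    have "has_time_deriv (s - 3) (kdv_flow s p0) (kdv_rhs (\<lambda>x. kdv_flow s p0 t x + w 0 x)) t UNIV"
      using kdv_flow_solves[OF s p0] by (simp add: solves_perturbed_kdv_def)
    then show "has_time_deriv (s - 3) (kdv_flow s p0) (kdv_rhs (\<lambda>x. kdv_flow s p0 t x + w 0 x)) t {-T..T}"
      unfolding has_time_deriv_def by (auto intro: tendsto_within_subset)
  qed
  have z: "0 \<in> {-T..T}" using T by simp
  have "cls (p 0) = cls p0" by (rule cls_cong[OF init])
  also have "\<dots> = cls (kdv_flow s p0 0)" by (rule cls_cong[symmetric, OF kdv_flow_0[OF s p0]])
  finally have "cls (p t) = cls (kdv_flow s p0 t)"
    by (intro uniqueness[OF T *[OF p sp B(1)] *[OF kf sk B(2)] _ t])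
  moreover have "square_int (p t)" "square_int (kdv_flow s p0 t)"
    using p t kdv_flow_sobolev[OF s p0, of t] by (auto simp: C_sobolev_def sobolev_iff)
  ultimately show ?thesis using cls_eq_iff by blast
qed

lemma kdv_flow_continuous_dependence:
  assumes T: "T > 0" and s: "s \<ge> 3" and q0: "q0 \<in> sobolev s" and \<epsilon>: "\<epsilon> > 0"
  shows "\<exists>r>0. \<forall>p0\<in>sobolev s. sobolev_norm s (\<lambda>x. p0 x - q0 x) < r -->
        C_sobolev_norm T s (\<lambda>t x. kdv_flow s p0 t x - kdv_flow s q0 t x) < \<epsilon>"
proof -
  \<comment> \<open>s + 1 is the price of passing from hn to the full Sobolev norm; the factor 2
    remains because a supremum of values below a bound need only be at most that bound.\<close>
  define \<eta> where "\<eta> = \<epsilon> / (2 * (real s + 1))"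
  have \<eta>: "\<eta> > 0" "(real s + 1) * \<eta> = \<epsilon> / 2" using \<epsilon> by (simp_all add: \<eta>_def field_simps)
  have f: "cls q0 \<in> H s" using q0 by (simp add: sobolev_iff)
  obtain r where r: "r > 0" "\<forall>g\<in>H s. hn s (g - cls q0) < r --> (\<forall>t\<in>{-T..T}. hn s (ext_flow s g t - ext_flow s (cls q0) t) < \<eta>)"
    using ext_flow_continuous_dependence[OF T s f \<eta>(1)] by (elim exE conjE) (rule that)
  show ?thesis
  proof (intro exI[of _ "r / 2"] conjI ballI impI)
    show "r / 2 > 0" using r(1) by simp
    fix p0 assume p0: "p0 \<in> sobolev s" and near: "sobolev_norm s (\<lambda>x. p0 x - q0 x) < r / 2"
    have "hn s (cls p0 - cls q0) < r"
      using hn_le_sobolev_norm[OF sobolev_diff(1)[OF p0 q0]] near unfolding sobolev_diff(2)[OF p0 q0] by linarith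
    then have n: "\<forall>t\<in>{-T..T}. hn s (ext_flow s (cls p0) t - ext_flow s (cls q0) t) < \<eta>"
      using r(2) p0 by (simp add: sobolev_iff)
    have "C_sobolev_norm T s (\<lambda>t x. kdv_flow s p0 t x - kdv_flow s q0 t x) \<le> \<epsilon> / 2"
      unfolding C_sobolev_norm_def
    proof (rule cSUP_least)
      show "{-T..T} \<noteq> {}" using T by simp
      fix t assume t: "t \<in> {-T..T}"
      note d = sobolev_diff[OF kdv_flow_sobolev[OF s p0, of t] kdv_flow_sobolev[OF s q0, of t]]
      have "sobolev_norm s (\<lambda>x. kdv_flow s p0 t x - kdv_flow s q0 t x) \<le> (real s + 1) * hn s (ext_flow s (cls p0) t - ext_flow s (cls q0) t)"
        using sobolev_norm_le_hn[OF d(1)] unfolding d(2) by (simp add: kdv_flow_def)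
      also have "\<dots> \<le> (real s + 1) * \<eta>" using n t by (intro mult_left_mono) (auto simp: less_imp_le)
      finally show "sobolev_norm s (\<lambda>x. kdv_flow s p0 t x - kdv_flow s q0 t x) \<le> \<epsilon> / 2" unfolding \<eta>(2) .
    qed
    then show "C_sobolev_norm T s (\<lambda>t x. kdv_flow s p0 t x - kdv_flow s q0 t x) < \<epsilon>" using \<epsilon> by linarith
  qed
qed

end

section \<open>The background c1 tanh + c2\<close>

fun tanh_poly :: "real => real => nat => real poly" where
  "tanh_poly c1 c2 0 = [:c2, c1:]"
| "tanh_poly c1 c2 (Suc k) = pderiv (tanh_poly c1 c2 k) * [:1, 0, -1:]"

lemma poly_tanh_bounded: "\<exists>B. \<forall>x. \<bar>poly p (tanh x :: real)\<bar> \<le> B"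
proof -
  have "bounded (poly p ` {-1..1})" by (intro compact_imp_bounded compact_continuous_image continuous_intros) simp
  then obtain B where B: "\<forall>y\<in>poly p ` {-1..1}. norm y \<le> B" unfolding bounded_iff ..
  have "tanh x \<in> {-1..1}" for x :: real using tanh_real_bounds[of x] by simp
  then show ?thesis using B by (intro exI[of _ B]) auto
qed

lemma DERIV_tanh_real: "(tanh has_real_derivative 1 - (tanh x)\<^sup>2) (at x)"
  by (auto intro!: derivative_eq_intros simp: cosh_real_nonzero)

text \<open>1 - tanh^2 is the derivative of tanh, so its integral over [-n, n] is 2 tanh n, which
  tends to 2; monotone convergence gives integrability, and values at most 1 give square
  integrability.\<close>

lemma square_int_sech_sqr: "square_int (\<lambda>x. 1 - (tanh x)\<^sup>2)"
proof -
  have b: "(tanh x)\<^sup>2 \<le> 1" for x :: real using tanh_real_bounds[of x] by (auto simp: abs_square_le_1 abs_le_iff)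
  have c: "continuous_on UNIV (\<lambda>x::real. 1 - (tanh x)\<^sup>2)"
    by (intro continuous_intros continuous_at_imp_continuous_on ballI DERIV_isCont[OF DERIV_tanh_real])
  have ac: "abs_cont tanh (\<lambda>x. 1 - (tanh x)\<^sup>2)" by (rule abs_cont_C1[OF DERIV_tanh_real c])
  have m: "(\<lambda>x::real. 1 - (tanh x)\<^sup>2) \<in> borel_measurable lborel" using borel_measurable_continuous_onI[OF c] by simp
  have "integrable lborel (\<lambda>x::real. 1 - (tanh x)\<^sup>2)"
  proof (rule integrable_monotone_convergence)
    show "integrable lborel (\<lambda>x. indicator {- real n..real n} x * (1 - (tanh x)\<^sup>2))" for n by (rule abs_contD[OF ac])
    show "AE x in lborel. mono (\<lambda>n. indicator {- real n..real n} x * (1 - (tanh x :: real)\<^sup>2))"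
      using b by (intro AE_I2 monoI) (auto simp: indicator_def)
    show "AE x in lborel. (\<lambda>n. indicator {- real n..real n} x * (1 - (tanh x :: real)\<^sup>2)) \<longlonglongrightarrow> 1 - (tanh x)\<^sup>2"
    proof (rule AE_I2)
      fix x :: real
      obtain N :: nat where N: "\<bar>x\<bar> < real N" using reals_Archimedean2[of "\<bar>x\<bar>"] ..
      have "\<forall>n\<ge>N. 1 - (tanh x)\<^sup>2 = indicator {- real n..real n} x * (1 - (tanh x)\<^sup>2)"
        using N by (auto simp: indicator_def)
      then have "\<forall>\<^sub>F n in sequentially. 1 - (tanh x)\<^sup>2 = indicator {- real n..real n} x * (1 - (tanh x)\<^sup>2)"
        unfolding eventually_sequentially ..
      then show "(\<lambda>n. indicator {- real n..real n} x * (1 - (tanh x)\<^sup>2)) \<longlonglongrightarrow> 1 - (tanh x)\<^sup>2"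
        by (rule Lim_transform_eventually[OF tendsto_const])
    qed
    have "(LINT x|lborel. indicator {- real n..real n} x * (1 - (tanh x)\<^sup>2)) = 2 * tanh (real n)" for n
      using abs_contD(2)[OF ac, of "- real n" "real n"] by simp
    moreover have "(\<lambda>n. 2 * tanh (real n)) \<longlonglongrightarrow> 2 * 1"
      by (intro tendsto_mult_left filterlim_compose[OF tanh_real_at_top filterlim_real_sequentially])
    ultimately show "(\<lambda>n. LINT x|lborel. indicator {- real n..real n} x * (1 - (tanh x)\<^sup>2)) \<longlonglongrightarrow> 2" by simp
  qed (rule m)
  then have "integrable lborel (\<lambda>x::real. (1 - (tanh x)\<^sup>2) * (1 - (tanh x)\<^sup>2))"
    by (rule integrable_bounded_mult[OF _ m, of _ 1]) (use b in auto)
  then show ?thesis by (rule square_intI[OF m])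
qed

text \<open>All derivatives are polynomials in tanh, hence bounded. From order 1 on the polynomial
  has the factor 1 - X^2 from the chain rule, so the function is a bounded multiple of 1 -
  tanh^2.\<close>

lemma background_tanh: "background (\<lambda>k x. poly (tanh_poly c1 c2 k) (tanh x))"
proof
  fix k :: nat
  show "((\<lambda>x. poly (tanh_poly c1 c2 k) (tanh x)) has_real_derivative poly (tanh_poly c1 c2 (Suc k)) (tanh x)) (at x)" for x
    by (rule DERIV_cong[OF DERIV_chain2[OF poly_DERIV DERIV_tanh_real]]) (simp add: power2_eq_square algebra_simps)
  show "\<exists>B. \<forall>x. \<bar>poly (tanh_poly c1 c2 k) (tanh x)\<bar> \<le> B" by (rule poly_tanh_bounded)
  obtain B where B: "\<forall>x::real. \<bar>poly (pderiv (tanh_poly c1 c2 k)) (tanh x)\<bar> \<le> B" using poly_tanh_bounded ..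
  have "continuous_on UNIV (\<lambda>x::real. poly (pderiv (tanh_poly c1 c2 k)) (tanh x))"
    by (intro continuous_intros continuous_at_imp_continuous_on ballI DERIV_isCont[OF DERIV_tanh_real])
  then have "(\<lambda>x::real. poly (pderiv (tanh_poly c1 c2 k)) (tanh x)) \<in> borel_measurable lborel"
    using borel_measurable_continuous_onI by simp
  then have "square_int (\<lambda>x. poly (pderiv (tanh_poly c1 c2 k)) (tanh x) * (1 - (tanh x)\<^sup>2))"
    by (rule square_int_bounded_mult[OF square_int_sech_sqr _ B[rule_format]])
  then show "square_int (\<lambda>x. poly (tanh_poly c1 c2 (Suc k)) (tanh x))" by (simp add: power2_eq_square algebra_simps)
qed

theorem theorem1p1:
  fixes c1 c2 :: real and s :: nat and W :: "real \<Rightarrow> real"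
  assumes s: "s \<ge> 3"
    and W: "W = (\<lambda>x. c1 * tanh x + c2)"
  shows "\<exists>\<Phi> :: (real \<Rightarrow> real) \<Rightarrow> real \<Rightarrow> real \<Rightarrow> real.
    (\<forall>u0 q u. (\<lambda>x. u0 x - W x) \<in> sobolev s
        \<and> q = \<Phi> (\<lambda>x. u0 x - W x) \<and> u = (\<lambda>t x. W x + q t x) \<longrightarrow>
      (AE x in lborel. u 0 x = u0 x) \<and>
      solves_kdv s UNIV u \<and>
      (AE x in lborel. q 0 x = u0 x - W x) \<and>
      solves_perturbed_kdv W s UNIV q \<and>
      (\<forall>T>0. q \<in> C_sobolev T s \<and>
        (\<forall>p\<in>C_sobolev T s.
            solves_perturbed_kdv W s {-T..T} p \<and> (AE x in lborel. p 0 x = u0 x - W x) \<longrightarrow>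
            (\<forall>t\<in>{-T..T}. AE x in lborel. p t x = q t x)))) \<and>
    (\<forall>T>0. \<forall>q0\<in>sobolev s. \<forall>\<epsilon>>0. \<exists>\<delta>>0. \<forall>p0\<in>sobolev s.
        sobolev_norm s (\<lambda>x. p0 x - q0 x) < \<delta> \<longrightarrow>
        C_sobolev_norm T s (\<lambda>t x. \<Phi> p0 t x - \<Phi> q0 t x) < \<epsilon>)"
proof -
  interpret background "\<lambda>k x. poly (tanh_poly c1 c2 k) (tanh x)" by (rule background_tanh)
  have W0: "(\<lambda>x. poly (tanh_poly c1 c2 0) (tanh x)) = W" by (simp add: W fun_eq_iff mult.commute)
  note flow_solves = kdv_flow_solves[OF s, unfolded W0] and flow_unique = kdv_flow_unique[OF _ s, unfolded W0]
  \<comment> \<open>W cancels in the time increments of W + q, and the right-hand side is evaluated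
    at W + q in both equations.\<close>
  have u: "solves_kdv s UNIV (\<lambda>t x. W x + q t x) \<longleftrightarrow> solves_perturbed_kdv W s UNIV q" for q
    by (simp add: solves_kdv_def solves_perturbed_kdv_def has_time_deriv_def add.commute)
  show ?thesis
  proof (rule exI[of _ "kdv_flow s"], intro conjI allI impI ballI; (elim conjE)?)
    fix u0 q u assume p0: "(\<lambda>x. u0 x - W x) \<in> sobolev s" and q: "q = kdv_flow s (\<lambda>x. u0 x - W x)" and u': "u = (\<lambda>t x. W x + q t x)"
    show init: "AE x in lborel. q 0 x = u0 x - W x" unfolding q by (rule kdv_flow_0[OF s p0])
    then show "AE x in lborel. u 0 x = u0 x" unfolding u' by eventually_elim simp
    show sol: "solves_perturbed_kdv W s UNIV q" unfolding q by (rule flow_solves[OF p0])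
    then show "solves_kdv s UNIV u" unfolding u' u .
    fix T :: real assume T: "T > 0"
    show "q \<in> C_sobolev T s" unfolding q by (rule kdv_flow_C_sobolev[OF T s p0])
    fix p t assume "p \<in> C_sobolev T s" "solves_perturbed_kdv W s {-T..T} p" "AE x in lborel. p 0 x = u0 x - W x" "t \<in> {-T..T}"
    then show "AE x in lborel. p t x = q t x" unfolding q by (rule flow_unique[OF T p0])
  next
    fix T \<epsilon> :: real and q0 assume "0 < T" "q0 \<in> sobolev s" "0 < \<epsilon>"
    then show "\<exists>\<delta>>0. \<forall>p0\<in>sobolev s. sobolev_norm s (\<lambda>x. p0 x - q0 x) < \<delta> \<longrightarrow>
        C_sobolev_norm T s (\<lambda>t x. kdv_flow s p0 t x - kdv_flow s q0 t x) < \<epsilon>"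
      by (intro kdv_flow_continuous_dependence s)
  qed
qed

end
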